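(* Let $D$ be a signed composition of $n$. Then: (a) $\tilde\theta_D$ is an extension of $\theta_D$ to $\mathcal Q_D$; (b) $\ker\tilde\theta_D=\mathcal Q_D^\perp$; (c) if $x,y\in\mathcal Q_D$, then $\tau_D(xy)=\langle\tilde\theta_D(x),\tilde\theta_D(y)\rangle_D$; (d) $\deg_D\circ\tilde\theta_D=\mathrm{aug}_D$ on $\mathcal Q_D$; (e) if $x\in\mathcal Q_D$, then $$\tilde\theta_D(x)=|W_D|\sum_{\lambda\in\mathrm{Bip}(D)}\frac{\tau_D(xE_\lambda^D)}{|\mathcal C_\lambda^D|}f_\lambda^D.$$
   Context: Groups. Let $I_n=\{\pm1,\dots,\pm n\}$, $W_n=\{w\in\mathfrak S(I_n): w(-i)=-w(i)\}$ the hyperoctahedral group, a Coxeter group of type $C_n$ with generators $t=(-1\ 1)$, $s_i=(i\ \ i{+}1)(-i\ \ -(i{+}1))$ ($1\le i\le n-1$), length function $\ell$; $t_i=(i\ -i)$ ($1\le i\le n$). A signed composition of $n$ is a sequence $C=(c_1,\dots,c_r)$ of nonzero integers with $\sum|c_i|=n$. Put $I_{C,+}^{(i)}=[|c_1|+\dots+|c_{i-1}|+1,|c_1|+\dots+|c_i|]$, $I_C^{(i)}=I_{C,+}^{(i)}$ if $c_i<0$ and $I_{C,+}^{(i)}\cup(-I_{C,+}^{(i)})$ if $c_i>0$; $W_C=\{w\in W_n: w(I_C^{(i)})=I_C^{(i)}\ \forall i\}$, a Coxeter group with generating set $S_C$ consisting of the $s_p$ with $p,p+1$ in a common $I_{C,+}^{(i)}$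 and the $t_p$ with $p=\min I_{C,+}^{(j)}$, $c_j>0$. $C\subset D$ means $W_C\subset W_D$. $X_C=\{x\in W_n:\ell(xw)\ge\ell(x)\ \forall w\in W_C\}$, $X_C^D=X_C\cap W_D$, $x_C^D=\sum_{w\in X_C^D}w$, $\Sigma'(W_D)=\bigoplus_{C\subset D}\mathbb Zx_C^D$ (a subalgebra of $\mathbb ZW_D$), and $\theta_D:\Sigma'(W_D)\to\mathbb Z\,\mathrm{Irr}\,W_D$ is the (surjective ring morphism) $\mathbb Z$-linear map $x_C^D\mapsto\mathrm{Ind}_{W_C}^{W_D}1$, where $\mathbb Z\,\mathrm{Irr}\,W_D$ is the ring of virtual characters. $\mathbb Q\Sigma'(W_D)=\mathbb Q\otimes\Sigma'(W_D)$, and $\theta_D$ is also extended $\mathbb Q$-linearly. Robinson–Schensted. Write $D=(d_1,\dots,d_r)$. $\mathrm{SBT}(D)$ is the set of $r$-tuples $T=(T_1,\dots,T_r)$ of pairs $T_i=(T_i^+,T_i^-)$ of tableaux of partition shape, with entries of $T_i^+,T_i^-$ together being exactly the elements of $I_{D,+}^{(i)}$, each once, rows and columns increasing, and $T_i^-=\emptyset$ if $d_i<0$. A bipartition is a pair $(\lambda^+,\lambda^-)$ of partitions, of size $|\lambda^+|+|\lambda^-|$. The shape $\mathrm{sh}\,T$ is the $r$-tuple of bipartitions $(\mathrm{sh}\,T_i^+,\mathrm{sh}\,T_i^-)$. $\mathrm{Bip}(D)$ is the set of $r$-tuples $(\lambda_{(1)},\dots,\lambda_{(r)})$ of bipartitions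 $\lambda_{(i)}=(\lambda_{(i)}^+,\lambda_{(i)}^-)$ with $|\lambda_{(i)}|=|d_i|$ and $\lambda_{(i)}^-=\emptyset$ if $d_i<0$. The generalized Robinson–Schensted bijection $w\mapsto(\mathbf P_D(w),\mathbf Q_D(w))$ from $W_D$ onto pairs in $\mathrm{SBT}(D)^2$ with the same shape is as follows: for each $i$, read the letters $w(p)$ for $p\in I_{D,+}^{(i)}$ in increasing order of $p$; row-insert the positive letters into $P_i^+$, recording the position $p$ in $Q_i^+$, and row-insert the absolute values of the negative letters into $P_i^-$, recording $p$ in $Q_i^-$. For $Q\in\mathrm{SBT}(D)$ let $Z_Q^D=\{w\in W_D:\mathbf Q_D(w)=Q\}$ and $z_Q^D=\sum_{w\in Z_Q^D}w$. Coplactic space. $\mathcal Q_D=\bigoplus_{Q\in\mathrm{SBT}(D)}\mathbb Zz_Q^D\subset\mathbb ZW_D$, and $\mathcal Q_D^\perp$ is the $\mathbb Z$-span of all $z_Q^D-z_{Q'}^D$ with $\mathrm{sh}\,Q=\mathrm{sh}\,Q'$. One has $\Sigma'(W_D)\subset\mathcal Q_D=\Sigma'(W_D)+\mathcal Q_D^\perp$ and $\Sigma'(W_D)\cap\mathcal Q_D^\perp=\ker\theta_D$, so $\tilde\theta_D:\mathcal Q_D\to\mathbb Z\,\mathrm{Irr}\,W_D$ is well-defined by $\tilde\theta_D(a+b)=\theta_D(a)$ for $a\in\Sigma'(W_D)$, $b\in\mathcal Q_D^\perp$. Other notation. $\tau_D:\mathbb ZW_D\to\mathbb Z$ is the linear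 form with $\tau_D(1)=1$, $\tau_D(w)=0$ for $w\ne1$ (extended $\mathbb Q$-linearly); $\langle\cdot,\cdot\rangle_D$ is the scalar product on $\mathbb Z\,\mathrm{Irr}\,W_D$ with $\mathrm{Irr}\,W_D$ orthonormal; $\deg_D$ is the linear map sending an irreducible character to its degree; $\mathrm{aug}_D:\mathbb ZW_D\to\mathbb Z$ is the augmentation. For $\lambda\in\mathrm{Bip}(D)$, $\hat\lambda$ is the signed composition of $n$ obtained by concatenating, for $i=1,\dots,r$, the parts of $\lambda_{(i)}^+$ followed by the negatives of the parts of $\lambda_{(i)}^-$ if $d_i>0$, and the negatives of the parts of $\lambda_{(i)}^+$ if $d_i<0$. $\mathcal C_\lambda^D$ is the conjugacy class in $W_D$ of a Coxeter element of $(W_{\hat\lambda},S_{\hat\lambda})$, and $f_\lambda^D$ is its characteristic function, viewed in $\mathbb Q\,\mathrm{Irr}\,W_D$ (the algebra of $\mathbb Q$-valued class functions on $W_D$). $(E_\lambda^D)_{\lambda\in\mathrm{Bip}(D)}$ is a fixed family of idempotents of $\mathbb Q\Sigma'(W_D)$ with $\theta_D(E_\lambda^D)=f_\lambda^D$, $E_\lambda^DE_\mu^D=0$ for $\lambda\ne\mu$, and $\sum_\lambda E_\lambda^D=1$. *)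

theory Defs
  imports
    "Jordan_Normal_Form.VS_Connect"
    "HOL-Library.Function_Algebras"
    "HOL-Library.Indicator_Function"
    "HOL-Combinatorics.Permutations"
    "HOL-Algebra.Group"
begin

section \<open>Linear structure on function spaces\<close>

text \<open>
  Elements of a group algebra and class functions are functions on the group, vanishing outside
  its carrier; they are added pointwise. The group algebra is taken over the rationals, and the
  integral objects are additive subgroups of it.
\<close>

definition zscale :: "int \<Rightarrow> ('a \<Rightarrow> 'b) \<Rightarrow> 'a \<Rightarrow> 'b::comm_ring_1" where
  "zscale c f = (\<lambda>x. of_int c * f x)"

definition qscale :: "rat \<Rightarrow> ('a \<Rightarrow> 'b) \<Rightarrow> 'a \<Rightarrow> 'b::field_char_0" where
  "qscale c f = (\<lambda>x. of_rat c * f x)"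

interpretation ZM: Modules.module zscale
  by unfold_locales (auto simp: zscale_def fun_eq_iff algebra_simps)

interpretation QM: Vector_Spaces.vector_space qscale
  by unfold_locales (auto simp: qscale_def fun_eq_iff algebra_simps of_rat_add of_rat_mult)

section \<open>Characters of a finite group\<close>

definition matrix_rep :: "('g, 'b) monoid_scheme \<Rightarrow> nat \<Rightarrow> ('g \<Rightarrow> complex mat) \<Rightarrow> bool" where
  "matrix_rep G m \<rho> \<longleftrightarrow> \<rho> \<in> hom G (units_of (ring_mat TYPE(complex) m ()))"

definition irreducible_rep :: "('g, 'b) monoid_scheme \<Rightarrow> nat \<Rightarrow> ('g \<Rightarrow> complex mat) \<Rightarrow> bool" where
  "irreducible_rep G m \<rho> \<longleftrightarrow> matrix_rep G m \<rho> \<and> m > 0 \<and>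
     (\<forall>U. VectorSpace.subspace class_ring U (module_vec TYPE(complex) m) \<and>
          (\<forall>g\<in>carrier G. \<forall>u\<in>U. \<rho> g *\<^sub>v u \<in> U) \<longrightarrow> U = {0\<^sub>v m} \<or> U = carrier_vec m)"

definition character :: "('g, 'b) monoid_scheme \<Rightarrow> nat \<Rightarrow> ('g \<Rightarrow> complex mat) \<Rightarrow> 'g \<Rightarrow> complex" where
  "character G m \<rho> = (\<lambda>g. if g \<in> carrier G then \<Sum>i<m. \<rho> g $$ (i, i) else 0)"

definition irr_chars :: "('g, 'b) monoid_scheme \<Rightarrow> ('g \<Rightarrow> complex) set" where
  "irr_chars G = {character G m \<rho> | m \<rho>. irreducible_rep G m \<rho>}"

definition virtual_chars :: "('g, 'b) monoid_scheme \<Rightarrow> ('g \<Rightarrow> complex) set" where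
  "virtual_chars G = ZM.span (irr_chars G)"

text \<open>
  \<open>QM.representation (irr_chars G) \<phi> \<chi>\<close> is the (rational) coefficient of \<open>\<chi>\<close> in the expansion of
  \<open>\<phi>\<close> on the irreducible characters. The next two definitions are thus the bilinear form that makes
  the irreducible characters orthonormal, and the linear extension of \<open>\<chi> \<mapsto> \<chi>(1)\<close>.
\<close>

definition char_inner :: "('g, 'b) monoid_scheme \<Rightarrow> ('g \<Rightarrow> complex) \<Rightarrow> ('g \<Rightarrow> complex) \<Rightarrow> rat" where
  "char_inner G \<phi> \<psi> =
     (\<Sum>\<chi>\<in>irr_chars G. QM.representation (irr_chars G) \<phi> \<chi> * QM.representation (irr_chars G) \<psi> \<chi>)"

definition char_deg :: "('g, 'b) monoid_scheme \<Rightarrow> ('g \<Rightarrow> complex) \<Rightarrow> complex" where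
  "char_deg G \<phi> = (\<Sum>\<chi>\<in>irr_chars G. of_rat (QM.representation (irr_chars G) \<phi> \<chi>) * \<chi> \<one>\<^bsub>G\<^esub>)"

definition induced :: "('g, 'b) monoid_scheme \<Rightarrow> 'g set \<Rightarrow> ('g \<Rightarrow> complex) \<Rightarrow> 'g \<Rightarrow> complex" where
  "induced G H \<phi> = (\<lambda>g. if g \<in> carrier G
     then (\<Sum>x | x \<in> carrier G \<and> inv\<^bsub>G\<^esub> x \<otimes>\<^bsub>G\<^esub> g \<otimes>\<^bsub>G\<^esub> x \<in> H. \<phi> (inv\<^bsub>G\<^esub> x \<otimes>\<^bsub>G\<^esub> g \<otimes>\<^bsub>G\<^esub> x))
            / of_nat (card H)
     else 0)"

section \<open>The hyperoctahedral group and its generalized parabolic subgroups\<close>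

text \<open>
  Signed permutations are functions on all integers that fix everything outside
  \<open>{\<plusminus>1, \<dots>, \<plusminus>n}\<close>; the product is composition, \<open>(v w)(i) = v (w i)\<close>.
\<close>

definition I_set :: "nat \<Rightarrow> int set" where
  "I_set n = {i. i \<noteq> 0 \<and> \<bar>i\<bar> \<le> int n}"

definition hyperoct :: "nat \<Rightarrow> (int \<Rightarrow> int) set" where
  "hyperoct n = {w. w permutes I_set n \<and> (\<forall>i\<in>I_set n. w (- i) = - w i)}"

definition t_gen :: "int \<Rightarrow> int \<Rightarrow> int" where
  "t_gen p = Transposition.transpose p (- p)"

definition s_gen :: "int \<Rightarrow> int \<Rightarrow> int" where
  "s_gen p = Transposition.transpose p (p + 1) \<circ> Transposition.transpose (- p) (- (p + 1))"

definition gens :: "nat \<Rightarrow> (int \<Rightarrow> int) set" where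
  "gens n = (if n = 0 then {} else {t_gen 1}) \<union> {s_gen p | p. 1 \<le> p \<and> p < int n}"

definition word_prod :: "('a \<Rightarrow> 'a) list \<Rightarrow> 'a \<Rightarrow> 'a" where
  "word_prod us = foldr (\<circ>) us id"

definition len :: "nat \<Rightarrow> (int \<Rightarrow> int) \<Rightarrow> nat" where
  "len n w = (LEAST k. \<exists>us. length us = k \<and> set us \<subseteq> gens n \<and> word_prod us = w)"

definition comp_size :: "int list \<Rightarrow> nat" where
  "comp_size C = (\<Sum>c\<leftarrow>C. nat \<bar>c\<bar>)"

definition signed_composition :: "nat \<Rightarrow> int list \<Rightarrow> bool" where
  "signed_composition n C \<longleftrightarrow> 0 \<notin> set C \<and> comp_size C = n"

text \<open>Blocks are indexed from 0, like list entries.\<close>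

definition block_pos :: "int list \<Rightarrow> nat \<Rightarrow> int set" where
  "block_pos C i = {(\<Sum>j<i. \<bar>C ! j\<bar>) + 1 .. (\<Sum>j<Suc i. \<bar>C ! j\<bar>)}"

definition block :: "int list \<Rightarrow> nat \<Rightarrow> int set" where
  "block C i = (if C ! i < 0 then block_pos C i else block_pos C i \<union> uminus ` block_pos C i)"

definition W :: "int list \<Rightarrow> (int \<Rightarrow> int) set" where
  "W C = {w \<in> hyperoct (comp_size C). \<forall>i<length C. w ` block C i = block C i}"

definition W_group :: "int list \<Rightarrow> (int \<Rightarrow> int) monoid" where
  "W_group C = \<lparr>carrier = W C, monoid.mult = (\<circ>), one = id\<rparr>"

definition S_gens :: "int list \<Rightarrow> (int \<Rightarrow> int) set" where
  "S_gens C = {s_gen p | p. \<exists>i<length C. p \<in> block_pos C i \<and> p + 1 \<in> block_pos C i}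
            \<union> {t_gen (Min (block_pos C j)) | j. j < length C \<and> C ! j > 0}"

definition sub_comps :: "int list \<Rightarrow> int list set" where
  "sub_comps D = {C. signed_composition (comp_size D) C \<and> W C \<subseteq> W D}"

definition X :: "int list \<Rightarrow> (int \<Rightarrow> int) set" where
  "X C = {x \<in> hyperoct (comp_size C). \<forall>w\<in>W C. len (comp_size C) (x \<circ> w) \<ge> len (comp_size C) x}"

section \<open>Group algebra and generalized descent algebra\<close>

text \<open>
  A group algebra element is its coefficient function, so \<open>indicator A\<close> is the sum of the
  elements of \<open>A\<close> and \<open>indicator {id}\<close> is the unit.
\<close>

definition alg_mult ::
  "int list \<Rightarrow> ((int \<Rightarrow> int) \<Rightarrow> rat) \<Rightarrow> ((int \<Rightarrow> int) \<Rightarrow> rat) \<Rightarrow> (int \<Rightarrow> int) \<Rightarrow> rat" where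
  "alg_mult D x y = (\<lambda>g. \<Sum>u\<in>W D. \<Sum>v\<in>W D. if u \<circ> v = g then x u * y v else 0)"

definition tau :: "((int \<Rightarrow> int) \<Rightarrow> rat) \<Rightarrow> rat" where
  "tau x = x id"

definition aug :: "int list \<Rightarrow> ((int \<Rightarrow> int) \<Rightarrow> rat) \<Rightarrow> rat" where
  "aug D x = (\<Sum>w\<in>W D. x w)"

definition x_elt :: "int list \<Rightarrow> int list \<Rightarrow> (int \<Rightarrow> int) \<Rightarrow> rat" where
  "x_elt D C = indicator (X C \<inter> W D)"

definition Sigma' :: "int list \<Rightarrow> ((int \<Rightarrow> int) \<Rightarrow> rat) set" where
  "Sigma' D = ZM.span (x_elt D ` sub_comps D)"

definition QSigma' :: "int list \<Rightarrow> ((int \<Rightarrow> int) \<Rightarrow> rat) set" where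
  "QSigma' D = QM.span (x_elt D ` sub_comps D)"

text \<open>
  The rational extension of \<open>\<theta>\<^sub>D\<close>, read off from coordinates in the basis \<open>x_elt D C\<close>; on
  \<open>Sigma' D\<close> these coordinates are integers.
\<close>

definition theta :: "int list \<Rightarrow> ((int \<Rightarrow> int) \<Rightarrow> rat) \<Rightarrow> (int \<Rightarrow> int) \<Rightarrow> complex" where
  "theta D x = (THE \<phi>. \<exists>a. x = (\<Sum>C\<in>sub_comps D. qscale (a C) (x_elt D C)) \<and>
     \<phi> = (\<Sum>C\<in>sub_comps D. qscale (a C) (induced (W_group D) (W C) (\<lambda>_. 1))))"

section \<open>Robinson--Schensted\<close>

text \<open>A tableau is its list of rows.\<close>

type_synonym tableau = "int list list"
type_synonym bipartition = "nat list \<times> nat list"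

definition int_partition :: "nat list \<Rightarrow> bool" where
  "int_partition p \<longleftrightarrow> sorted_wrt (\<ge>) p \<and> 0 \<notin> set p"

definition tableau :: "tableau \<Rightarrow> bool" where
  "tableau T \<longleftrightarrow> int_partition (map length T) \<and> (\<forall>r\<in>set T. sorted_wrt (<) r) \<and>
     (\<forall>i j k. i < j \<and> j < length T \<and> k < length (T ! j) \<longrightarrow> T ! i ! k < T ! j ! k)"

definition SBT :: "int list \<Rightarrow> (tableau \<times> tableau) list set" where
  "SBT D = {T. length T = length D \<and> (\<forall>i<length D.
     tableau (fst (T ! i)) \<and> tableau (snd (T ! i)) \<and>
     distinct (concat (fst (T ! i)) @ concat (snd (T ! i))) \<and>
     set (concat (fst (T ! i)) @ concat (snd (T ! i))) = block_pos D i \<and>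
     (D ! i < 0 \<longrightarrow> snd (T ! i) = []))}"

definition sh :: "(tableau \<times> tableau) list \<Rightarrow> bipartition list" where
  "sh = map (map_prod (map length) (map length))"

definition Bip :: "int list \<Rightarrow> bipartition list set" where
  "Bip D = {L. length L = length D \<and> (\<forall>i<length D.
     int_partition (fst (L ! i)) \<and> int_partition (snd (L ! i)) \<and>
     sum_list (fst (L ! i)) + sum_list (snd (L ! i)) = nat \<bar>D ! i\<bar> \<and>
     (D ! i < 0 \<longrightarrow> snd (L ! i) = []))}"

text \<open>Row insertion; the second component is the bumped letter, if any.\<close>

fun insert_row :: "int \<Rightarrow> int list \<Rightarrow> int list \<times> int option" where
  "insert_row x [] = ([x], None)"
| "insert_row x (y # ys) =
     (if x < y then (x # ys, Some y)
      else case insert_row x ys of (r, b) \<Rightarrow> (y # r, b))"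

text \<open>
  \<open>rs_insert x p P Q\<close> inserts \<open>x\<close> into \<open>P\<close> and records \<open>p\<close> in the row of \<open>Q\<close> where \<open>P\<close> grew. As
  \<open>P\<close> and \<open>Q\<close> always have the same shape, the case of nonempty \<open>P\<close> and empty \<open>Q\<close> is not needed.
\<close>

fun rs_insert :: "int \<Rightarrow> int \<Rightarrow> tableau \<Rightarrow> tableau \<Rightarrow> tableau \<times> tableau" where
  "rs_insert x p [] Q = ([[x]], [[p]])"
| "rs_insert x p (r # P) (q # Q) = (case insert_row x r of
      (r', None) \<Rightarrow> (r' # P, (q @ [p]) # Q)
    | (r', Some y) \<Rightarrow> (case rs_insert y p P Q of (P', Q') \<Rightarrow> (r' # P', q # Q')))"

definition rs :: "(int \<times> int) list \<Rightarrow> tableau \<times> tableau" where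
  "rs u = fold (\<lambda>(x, p) (P, Q). rs_insert x p P Q) u ([], [])"

definition rs_Q :: "int list \<Rightarrow> (int \<Rightarrow> int) \<Rightarrow> (tableau \<times> tableau) list" where
  "rs_Q D w = map (\<lambda>i. let ps = sorted_list_of_set (block_pos D i) in
     (snd (rs (map (\<lambda>p. (w p, p)) (filter (\<lambda>p. w p > 0) ps))),
      snd (rs (map (\<lambda>p. (\<bar>w p\<bar>, p)) (filter (\<lambda>p. w p < 0) ps))))) [0..<length D]"

section \<open>The coplactic space\<close>

definition z_elt :: "int list \<Rightarrow> (tableau \<times> tableau) list \<Rightarrow> (int \<Rightarrow> int) \<Rightarrow> rat" where
  "z_elt D T = indicator {w \<in> W D. rs_Q D w = T}"

definition coplactic :: "int list \<Rightarrow> ((int \<Rightarrow> int) \<Rightarrow> rat) set" where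
  "coplactic D = ZM.span (z_elt D ` SBT D)"

definition coplactic_perp :: "int list \<Rightarrow> ((int \<Rightarrow> int) \<Rightarrow> rat) set" where
  "coplactic_perp D =
     ZM.span {z_elt D T - z_elt D T' | T T'. T \<in> SBT D \<and> T' \<in> SBT D \<and> sh T = sh T'}"

definition theta_ext :: "int list \<Rightarrow> ((int \<Rightarrow> int) \<Rightarrow> rat) \<Rightarrow> (int \<Rightarrow> int) \<Rightarrow> complex" where
  "theta_ext D x = (THE \<phi>. \<exists>a\<in>Sigma' D. \<exists>b\<in>coplactic_perp D. x = a + b \<and> \<phi> = theta D a)"

section \<open>Conjugacy classes and idempotents\<close>

definition hat :: "int list \<Rightarrow> bipartition list \<Rightarrow> int list" where
  "hat D L = concat (map (\<lambda>(d, p, q).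
     if d > 0 then map int p @ map (\<lambda>k. - int k) q else map (\<lambda>k. - int k) p) (zip D L))"

text \<open>A Coxeter element is a product of all generators, each taken once, in some order.\<close>

definition coxeter_element :: "int list \<Rightarrow> (int \<Rightarrow> int) \<Rightarrow> bool" where
  "coxeter_element C c \<longleftrightarrow> (\<exists>us. distinct us \<and> set us = S_gens C \<and> c = word_prod us)"

text \<open>All Coxeter elements of a finite Coxeter group are conjugate, so this is a single class.\<close>

definition conj_class :: "int list \<Rightarrow> bipartition list \<Rightarrow> (int \<Rightarrow> int) set" where
  "conj_class D L = {h \<circ> c \<circ> inv\<^bsub>W_group D\<^esub> h | h c. h \<in> W D \<and> coxeter_element (hat D L) c}"

definition class_fun :: "int list \<Rightarrow> bipartition list \<Rightarrow> (int \<Rightarrow> int) \<Rightarrow> complex" where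
  "class_fun D L = indicator (conj_class D L)"

definition idempotent_family ::
  "int list \<Rightarrow> (bipartition list \<Rightarrow> (int \<Rightarrow> int) \<Rightarrow> rat) \<Rightarrow> bool" where
  "idempotent_family D E \<longleftrightarrow>
     (\<forall>L\<in>Bip D. E L \<in> QSigma' D \<and> alg_mult D (E L) (E L) = E L \<and> theta D (E L) = class_fun D L) \<and>
     (\<forall>L\<in>Bip D. \<forall>M\<in>Bip D. L \<noteq> M \<longrightarrow> alg_mult D (E L) (E M) = 0) \<and>
     (\<Sum>L\<in>Bip D. E L) = indicator {id}"

end

theory Submission
  imports Defs "Jordan_Normal_Form.Spectral_Radius"
begin

text \<open>
  Everything rests on the bilinear form \<open>(x, y) \<mapsto> \<tau>(x y) = (\<Sum>u. x(u) y(u\<inverse>))\<close> on the group algebra of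
  \<open>W D\<close>, which is computed twice.

  On the coplactic space: \<open>w \<mapsto> (P(w), Q(w))\<close> is a bijection onto pairs of tableaux of the same shape,
  and passing from \<open>w\<close> to its inverse exchanges \<open>P\<close> and \<open>Q\<close>. So exactly one \<open>w\<close> has \<open>Q(w) = Q\<close> and
  \<open>Q(w\<inverse>) = Q'\<close> if \<open>Q\<close> and \<open>Q'\<close> have the same shape, and none otherwise (\<open>card_rs_Q_pair\<close>). The value of
  the form on \<open>z_elt D Q\<close> and \<open>z_elt D Q'\<close> is therefore \<open>1\<close> or \<open>0\<close>, and the radical of the form on the
  coplactic space is \<open>coplactic_perp D\<close>.

  On the descent algebra: the value on \<open>x_elt D C\<close> and \<open>x_elt D C'\<close> is the number of \<open>r\<close> in \<open>X C\<close> with inverse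
  in \<open>X C'\<close>. Every double coset of \<open>W C'\<close> and \<open>W C\<close> contains exactly one such \<open>r\<close>, so by orbit counting this
  is the scalar product of the two induced trivial characters (\<open>tau_form_x_elt\<close>). Hence \<open>theta\<close> is an isometry.
  As the scalar product of characters is positive definite, \<open>theta\<close> is well defined, and whatever lies
  both in the descent algebra and in the radical is mapped to \<open>0\<close>.

  The two spaces are tied together by triangularity. Whether \<open>w\<close> belongs to \<open>X C\<close> depends on its
  descents, hence only on \<open>Q(w)\<close>; so \<open>x_elt D C\<close> is a sum of elements \<open>z_elt D Q\<close>
  (\<open>x_elt_eq_sum_z_elt\<close>). For every shape there is a composition \<open>C\<close> for which this sum contains one
  ``superstandard'' tableau of that shape, all other tableaux in it having a shape of smaller total weight
  (\<open>compatible_weight\<close>). Induction on the weight gives \<open>coplactic D = Sigma' D + coplactic_perp D\<close>.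

  The extension of \<open>theta\<close>, its kernel and the formula for \<open>\<tau>(x y)\<close> follow at once. The statement on degrees
  follows because the augmentation also vanishes on the radical. For the last formula, the functions
  \<open>class_fun D L = theta D (E L)\<close> are pairwise orthogonal since \<open>E L E M = 0\<close>, they are nonzero, and there are as
  many of them as shapes. The rational span of the image of \<open>theta_ext\<close> is spanned by one element for each
  shape, so they form a basis of it, and the coefficients in this basis are scalar products.

  The scalar product of \<open>char_inner\<close> is defined by coordinates on the irreducible characters. The first
  sections identify it with an average over the group (\<open>char_inner_eq_avg_form\<close>), which needs Schur's lemma, the
  orthogonality relations and the fact that induced trivial characters are integral combinations of irreducible ones.
\<close>

section \<open>Matrix representations and Schur's lemma\<close>

lemma matrix_repD:
  assumes "matrix_rep G m \<rho>"
  shows "g \<in> carrier G \<Longrightarrow> \<rho> g \<in> carrier_mat m m"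
    and "g \<in> carrier G \<Longrightarrow> h \<in> carrier G \<Longrightarrow> \<rho> (g \<otimes>\<^bsub>G\<^esub> h) = \<rho> g * \<rho> h"
  using assms unfolding matrix_rep_def hom_def
  by (auto simp: units_of_def Units_def ring_mat_simps)

text \<open>An idempotent matrix that is invertible is the identity.\<close>

lemma matrix_rep_one:
  assumes G: "group G" and "matrix_rep G m \<rho>"
  shows "\<rho> \<one>\<^bsub>G\<^esub> = 1\<^sub>m m"
proof -
  interpret G: group G by fact
  have c: "\<rho> \<one>\<^bsub>G\<^esub> \<in> carrier_mat m m" using matrix_repD[OF assms(2)] by auto
  have idem: "\<rho> \<one>\<^bsub>G\<^esub> * \<rho> \<one>\<^bsub>G\<^esub> = \<rho> \<one>\<^bsub>G\<^esub>" using matrix_repD(2)[OF assms(2), of "\<one>\<^bsub>G\<^esub>" "\<one>\<^bsub>G\<^esub>"] by simp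
  have "\<rho> \<one>\<^bsub>G\<^esub> \<in> Units (ring_mat TYPE(complex) m ())"
    using assms(2) unfolding matrix_rep_def hom_def units_of_def by auto
  then obtain S where S: "S \<in> carrier_mat m m" "S * \<rho> \<one>\<^bsub>G\<^esub> = 1\<^sub>m m"
    unfolding Units_def by (auto simp: ring_mat_simps)
  have "1\<^sub>m m = S * (\<rho> \<one>\<^bsub>G\<^esub> * \<rho> \<one>\<^bsub>G\<^esub>)" using S idem by simp
  also have "\<dots> = (S * \<rho> \<one>\<^bsub>G\<^esub>) * \<rho> \<one>\<^bsub>G\<^esub>" using S c by (intro assoc_mult_mat[symmetric]) auto
  also have "\<dots> = \<rho> \<one>\<^bsub>G\<^esub>" using S c by simp
  finally show ?thesis by simp
qed

lemma matrix_repI: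
  assumes G: "group G" and c: "\<And>g. g \<in> carrier G \<Longrightarrow> \<rho> g \<in> carrier_mat m m"
    and m: "\<And>g h. g \<in> carrier G \<Longrightarrow> h \<in> carrier G \<Longrightarrow> \<rho> (g \<otimes>\<^bsub>G\<^esub> h) = \<rho> g * \<rho> h"
    and one: "\<rho> \<one>\<^bsub>G\<^esub> = 1\<^sub>m m"
  shows "matrix_rep G m \<rho>"
proof -
  interpret G: group G by fact
  have "\<rho> g \<in> Units (ring_mat TYPE(complex) m ())" if g: "g \<in> carrier G" for g
    unfolding Units_def ring_mat_simps
    using c[OF g] c[of "inv\<^bsub>G\<^esub> g"] m[of g "inv\<^bsub>G\<^esub> g"] m[of "inv\<^bsub>G\<^esub> g" g] g one
    by (auto intro!: bexI[of _ "\<rho> (inv\<^bsub>G\<^esub> g)"])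
  then show ?thesis using m unfolding matrix_rep_def hom_def units_of_def by (auto simp: ring_mat_simps)
qed

lemma trace_mult_commute:
  assumes A: "A \<in> carrier_mat m k" and B: "B \<in> carrier_mat k m"
  shows "(\<Sum>i<m. (A * B) $$ (i, i)) = (\<Sum>i<k. (B * A) $$ (i, i) :: complex)"
proof -
  have "(\<Sum>i<m. (A * B) $$ (i, i)) = (\<Sum>i<m. \<Sum>j<k. A $$ (i, j) * B $$ (j, i))"
    using A B by (intro sum.cong) (auto simp: scalar_prod_def atLeast0LessThan)
  also have "\<dots> = (\<Sum>j<k. \<Sum>i<m. B $$ (j, i) * A $$ (i, j))"
    by (subst sum.swap) (simp add: mult.commute)
  also have "\<dots> = (\<Sum>i<k. (B * A) $$ (i, i))"
    using A B by (intro sum.cong) (auto simp: scalar_prod_def atLeast0LessThan)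
  finally show ?thesis .
qed

lemma subspace_vecI:
  assumes "U \<subseteq> carrier_vec m" "0\<^sub>v m \<in> U" "\<And>u v. u \<in> U \<Longrightarrow> v \<in> U \<Longrightarrow> u + v \<in> U"
    "\<And>c u. u \<in> U \<Longrightarrow> c \<cdot>\<^sub>v u \<in> U"
  shows "VectorSpace.subspace class_ring U (module_vec TYPE(complex) m)"
proof -
  interpret vec_space "TYPE(complex)" m .
  show ?thesis
    by (intro subspace.intro submodule.intro vec_vs vec_module)
      (use assms in \<open>auto simp: module_vec_simps\<close>)
qed

text \<open>
  A basis of \<open>U\<close> is extended to a basis of the whole space by the exchange lemma; \<open>P\<close> has these vectors as
  columns, those of \<open>U\<close> first. In the new coordinates a representation that leaves \<open>U\<close> invariant is block
  upper triangular.
\<close>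

lemma adapted_basis:
  assumes U: "VectorSpace.subspace class_ring U (module_vec TYPE(complex) m)"
  obtains k P R where "k \<le> m" "P \<in> carrier_mat m m" "R \<in> carrier_mat m m" "P * R = 1\<^sub>m m" "R * P = 1\<^sub>m m"
    "U = {P *\<^sub>v x | x. x \<in> carrier_vec m \<and> (\<forall>i<m. k \<le> i \<longrightarrow> x $ i = 0)}"
proof -
  interpret vec_space "TYPE(complex)" m .
  have sub: "submodule class_ring U V" using U by (simp add: subspace_def)
  have Uc: "U \<subseteq> carrier_vec m" using submodule.subset[OF sub] by (simp add: module_vec_simps)
  have lib: "\<And>A. A \<subseteq> U \<and> lin_indpt A \<Longrightarrow> finite A \<and> card A \<le> m"
    using li_le_dim[OF fin_dim] Uc dim_is_n by auto
  have "lin_indpt {}" by (auto simp: lin_dep_def)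
  then obtain A where finA: "finite A" and maxA: "maximal A (\<lambda>A. A \<subseteq> U \<and> lin_indpt A)"
    using maximal_exists[of "\<lambda>A. A \<subseteq> U \<and> lin_indpt A" m "{}"] lib by auto
  have AU: "A \<subseteq> U" and liA: "lin_indpt A" using maxA by (auto simp: maximal_def)
  have Ac: "A \<subseteq> carrier_vec m" using AU Uc by auto
  have spA: "span A = U"
  proof
    show "span A \<subseteq> U" using span_is_subset[OF AU sub] .
    show "U \<subseteq> span A"
    proof
      fix v assume v: "v \<in> U"
      show "v \<in> span A"
      proof (rule ccontr)
        assume n: "v \<notin> span A"
        have vA: "v \<notin> A" using n in_own_span[of A] Ac by auto
        have "lin_indpt (A \<union> {v})"
          using lin_dep_iff_in_span[of A v] Ac liA v Uc vA n by auto
        then have "A \<union> {v} = A" using maxA v AU unfolding maximal_def by blast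
        then show False using vA by auto
      qed
    qed
  qed
  have uv: "span (set (unit_vecs m)) = carrier_vec m" by (rule span_unit_vecs_is_carrier)
  have A_sub: "A \<subseteq> span (set (unit_vecs m))" using Ac unfolding uv .
  have finu: "finite (set (unit_vecs m))" by simp
  have uc: "set (unit_vecs m) \<subseteq> carrier_vec m" by (rule unit_vecs_carrier)
  obtain C where C: "finite C" "C \<subseteq> carrier_vec m" "C \<inter> A = {}"
    "int (card C) \<le> int (card (set (unit_vecs m :: complex vec list))) - int (card A)"
    "span (A \<union> C) = span (set (unit_vecs m))"
    using replacement[OF finA finu uc liA A_sub] by blast
  note C(5)[unfolded uv, simp]
  have cu: "card (set (unit_vecs m :: complex vec list)) = m" using unit_vecs_distinct distinct_card by fastforce
  have cAC: "card (A \<union> C) \<le> m"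
    using C(4) card_Un_le[of A C] cu by linarith
  have ACc: "A \<union> C \<subseteq> carrier_vec m" using Ac C(2) by simp
  have bas: "basis (A \<union> C)"
    using dim_gen_is_basis[of "A \<union> C"] finA C ACc cAC dim_is_n by simp
  have cm: "card (A \<union> C) = m" using dim_basis[OF _ bas] finA C dim_is_n by simp
  obtain as where as: "set as = A" "distinct as" using finite_distinct_list[OF finA] by blast
  obtain cs where cs: "set cs = C" "distinct cs" using finite_distinct_list[OF C(1)] by blast
  define ws where "ws = as @ cs"
  have ws: "set ws = A \<union> C" "distinct ws" using as cs C(3) by (auto simp: ws_def)
  have lw: "length ws = m" using distinct_card[OF ws(2)] ws cm by simp
  define k where "k = length as"
  define P where "P = mat_of_cols m ws"
  have P: "P \<in> carrier_mat m m" using lw by (auto simp: P_def)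
  have dimw: "\<forall>w\<in>set ws. dim_vec w = m" using ws ACc by auto
  have onto: "\<exists>x\<in>carrier_vec m. P *\<^sub>v x = v" if "v \<in> carrier_vec m" for v
  proof -
    have "v \<in> span_list ws" using span_list_as_span[of ws] ws ACc C(5) that by auto
    then obtain c where "v = lincomb_list c ws" by (auto simp: span_list_def)
    then show ?thesis using lincomb_list_as_mat_mult[OF dimw, of c] lw
      by (intro bexI[of _ "vec m c"]) (auto simp: P_def)
  qed
  define R where "R = mat_of_cols m (map (\<lambda>i. SOME x. x \<in> carrier_vec m \<and> P *\<^sub>v x = unit_vec m i) [0..<m])"
  have R: "R \<in> carrier_mat m m" by (auto simp: R_def)
  have colR: "P *\<^sub>v col R i = unit_vec m i" "col R i \<in> carrier_vec m" if i: "i < m" for i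
  proof -
    let ?x = "SOME x. x \<in> carrier_vec m \<and> P *\<^sub>v x = unit_vec m i"
    have x: "?x \<in> carrier_vec m \<and> P *\<^sub>v ?x = unit_vec m i"
      by (rule someI_ex) (use onto[of "unit_vec m i"] in auto)
    have "col R i = ?x" unfolding R_def using i x
      by (subst col_mat_of_cols) auto
    with x show "P *\<^sub>v col R i = unit_vec m i" "col R i \<in> carrier_vec m" by auto
  qed
  have PR: "P * R = 1\<^sub>m m"
  proof (rule mat_col_eqI)
    fix i assume "i < dim_col (1\<^sub>m m :: complex mat)"
    then have i: "i < m" by simp
    show "col (P * R) i = col (1\<^sub>m m) i" using col_mult2[OF P R i] colR(1)[OF i] i by simp
  qed (use P R in auto)
  have RP: "R * P = 1\<^sub>m m" by (rule mat_mult_left_right_inverse[OF P R PR])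
  have "U = {P *\<^sub>v x | x. x \<in> carrier_vec m \<and> (\<forall>i<m. k \<le> i \<longrightarrow> x $ i = 0)}" (is "_ = ?S")
  proof -
    have dima: "\<forall>w\<in>set as. dim_vec w = m" using as Ac by auto
    have ext: "mat_of_cols m as *\<^sub>v y = P *\<^sub>v vec m (\<lambda>i. if i < k then y $ i else 0)"
      if y: "y \<in> carrier_vec k" for y :: "complex vec"
    proof (intro eq_vecI)
      fix i assume "i < dim_vec (P *\<^sub>v vec m (\<lambda>i. if i < k then y $ i else 0))"
      then have i: "i < m" using P by auto
      have km: "k \<le> m" using lw by (simp add: k_def ws_def)
      have "(P *\<^sub>v vec m (\<lambda>i. if i < k then y $ i else 0)) $ i
          = (\<Sum>j<m. P $$ (i,j) * (if j < k then y $ j else 0))"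
        using i P by (auto simp: scalar_prod_def atLeast0LessThan intro!: sum.cong)
      also have "\<dots> = (\<Sum>j<k. P $$ (i,j) * y $ j)"
        using km by (intro sum.mono_neutral_cong_right) auto
      also have "\<dots> = (\<Sum>j<k. mat_of_cols m as $$ (i,j) * y $ j)"
        using i km by (intro sum.cong) (auto simp: P_def mat_of_cols_def ws_def k_def nth_append)
      also have "\<dots> = (mat_of_cols m as *\<^sub>v y) $ i"
        using i y by (auto simp: scalar_prod_def atLeast0LessThan k_def intro!: sum.cong)
      finally show "(mat_of_cols m as *\<^sub>v y) $ i = (P *\<^sub>v vec m (\<lambda>i. if i < k then y $ i else 0)) $ i" by simp
    qed (use P in auto)
    have "U = span_list as" using span_list_as_span[of as] as Ac spA by simp
    also have "\<dots> = {mat_of_cols m as *\<^sub>v y | y. y \<in> carrier_vec k}"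
    proof -
      have "y = vec (length as) (\<lambda>i. y $ i)" if "y \<in> carrier_vec (length as)" for y :: "complex vec"
        using that by auto
      then show ?thesis
        unfolding span_list_def lincomb_list_as_mat_mult[OF dima] k_def
        by (metis (no_types, lifting) vec_carrier)
    qed
    also have "\<dots> = ?S"
    proof (intro equalityI subsetI)
      fix u assume "u \<in> {mat_of_cols m as *\<^sub>v y | y. y \<in> carrier_vec k}"
      then show "u \<in> ?S" using ext by force
    next
      fix u assume "u \<in> ?S"
      then obtain x where x: "x \<in> carrier_vec m" "\<forall>i<m. k \<le> i \<longrightarrow> x $ i = 0" "u = P *\<^sub>v x" by auto
      have km: "k \<le> m" using lw by (simp add: k_def ws_def)
      have e: "vec m (\<lambda>i. if i < k then vec k (\<lambda>i. x $ i) $ i else 0) = x"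
        using x by (intro eq_vecI) auto
      have "u = mat_of_cols m as *\<^sub>v vec k (\<lambda>i. x $ i)"
        using ext[of "vec k (\<lambda>i. x $ i)"] x(3) unfolding e by simp
      then show "u \<in> {mat_of_cols m as *\<^sub>v y | y. y \<in> carrier_vec k}" by auto
    qed
    finally show ?thesis .
  qed
  moreover have "k \<le> m" using lw by (simp add: k_def ws_def)
  ultimately show ?thesis using that P R PR RP by blast
qed


text \<open>
  Schur's lemma: the kernel and the image of \<open>T\<close> are invariant, hence zero or everything.
\<close>

lemma intertwiner_invertible_or_zero:
  assumes G: "group G" and \<rho>: "irreducible_rep G m \<rho>" and \<sigma>: "irreducible_rep G k \<sigma>"
    and T: "T \<in> carrier_mat m k" and comm: "\<And>g. g \<in> carrier G \<Longrightarrow> \<rho> g * T = T * \<sigma> g"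
  shows "T = 0\<^sub>m m k \<or> (\<exists>S\<in>carrier_mat k m. T * S = 1\<^sub>m m \<and> S * T = 1\<^sub>m k)"
proof -
  have r: "matrix_rep G m \<rho>" and s: "matrix_rep G k \<sigma>" using \<rho> \<sigma> by (auto simp: irreducible_rep_def)
  note rc = matrix_repD(1)[OF r] and sc = matrix_repD(1)[OF s]
  define K where "K = {v \<in> carrier_vec k. T *\<^sub>v v = 0\<^sub>v m}"
  define I where "I = {T *\<^sub>v v | v. v \<in> carrier_vec k}"
  have "VectorSpace.subspace class_ring K (module_vec TYPE(complex) k)"
    using T by (intro subspace_vecI) (auto simp: K_def mult_add_distrib_mat_vec mult_mat_vec)
  moreover have "\<forall>g\<in>carrier G. \<forall>u\<in>K. \<sigma> g *\<^sub>v u \<in> K"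
  proof (intro ballI)
    fix g u assume g: "g \<in> carrier G" and u: "u \<in> K"
    have "T *\<^sub>v (\<sigma> g *\<^sub>v u) = (T * \<sigma> g) *\<^sub>v u"
      using T sc[OF g] u by (intro assoc_mult_mat_vec[symmetric]) (auto simp: K_def)
    also have "\<dots> = \<rho> g *\<^sub>v (T *\<^sub>v u)"
      using T rc[OF g] u by (subst comm[OF g, symmetric], intro assoc_mult_mat_vec) (auto simp: K_def)
    also have "\<dots> = 0\<^sub>v m" using u rc[OF g] by (auto simp: K_def)
    finally show "\<sigma> g *\<^sub>v u \<in> K" using sc[OF g] u by (auto simp: K_def)
  qed
  ultimately have K: "K = {0\<^sub>v k} \<or> K = carrier_vec k"
    using \<sigma> by (auto simp: irreducible_rep_def)
  have "VectorSpace.subspace class_ring I (module_vec TYPE(complex) m)"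
  proof (intro subspace_vecI)
    show "I \<subseteq> carrier_vec m" using T by (auto simp: I_def)
    show "0\<^sub>v m \<in> I" using T by (auto simp: I_def intro!: exI[of _ "0\<^sub>v k"])
    show "u + v \<in> I" if "u \<in> I" "v \<in> I" for u v
    proof -
      obtain a b where "u = T *\<^sub>v a" "v = T *\<^sub>v b" "a \<in> carrier_vec k" "b \<in> carrier_vec k"
        using \<open>u \<in> I\<close> \<open>v \<in> I\<close> by (auto simp: I_def)
      then show ?thesis using T
        by (auto simp: I_def mult_add_distrib_mat_vec[symmetric] intro!: exI[of _ "a + b"])
    qed
    show "c \<cdot>\<^sub>v u \<in> I" if "u \<in> I" for c u
    proof -
      obtain a where "u = T *\<^sub>v a" "a \<in> carrier_vec k" using \<open>u \<in> I\<close> by (auto simp: I_def)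
      then show ?thesis using T
        by (auto simp: I_def mult_mat_vec[symmetric] intro!: exI[of _ "c \<cdot>\<^sub>v a"])
    qed
  qed
  moreover have "\<forall>g\<in>carrier G. \<forall>u\<in>I. \<rho> g *\<^sub>v u \<in> I"
  proof (intro ballI)
    fix g u assume g: "g \<in> carrier G" and u: "u \<in> I"
    then obtain a where a: "u = T *\<^sub>v a" "a \<in> carrier_vec k" by (auto simp: I_def)
    have "\<rho> g *\<^sub>v u = (\<rho> g * T) *\<^sub>v a"
      using T rc[OF g] a by (auto intro!: assoc_mult_mat_vec[symmetric])
    also have "\<dots> = T *\<^sub>v (\<sigma> g *\<^sub>v a)"
      using T sc[OF g] a unfolding comm[OF g] by (intro assoc_mult_mat_vec) auto
    finally show "\<rho> g *\<^sub>v u \<in> I" using sc[OF g] a by (auto simp: I_def)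
  qed
  ultimately have I: "I = {0\<^sub>v m} \<or> I = carrier_vec m"
    using \<rho> by (auto simp: irreducible_rep_def)
  have zeroI: "T = 0\<^sub>m m k" if z: "\<And>v. v \<in> carrier_vec k \<Longrightarrow> T *\<^sub>v v = 0\<^sub>v m"
  proof (rule mat_col_eqI)
    fix j assume "j < dim_col (0\<^sub>m m k :: complex mat)"
    then have j: "j < k" by simp
    have "col T j = T *\<^sub>v unit_vec k j" using T j by (intro eq_vecI) auto
    then show "col T j = col (0\<^sub>m m k) j" using z[of "unit_vec k j"] j by simp
  qed (use T in auto)
  show ?thesis
  proof (cases "T = 0\<^sub>m m k")
    case False
    have "K \<noteq> carrier_vec k" using zeroI False by (auto simp: K_def)
    with K have K0: "K = {0\<^sub>v k}" by auto
    have "I \<noteq> {0\<^sub>v m}" using zeroI False by (auto simp: I_def)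
    with I have I1: "I = carrier_vec m" by auto
    define S where "S = mat_of_cols k (map (\<lambda>i. SOME x. x \<in> carrier_vec k \<and> T *\<^sub>v x = unit_vec m i) [0..<m])"
    have S: "S \<in> carrier_mat k m" by (auto simp: S_def)
    have colS: "T *\<^sub>v col S i = unit_vec m i" if i: "i < m" for i
    proof -
      let ?x = "SOME x. x \<in> carrier_vec k \<and> T *\<^sub>v x = unit_vec m i"
      have "unit_vec m i \<in> I" unfolding I1 by simp
      then have x: "?x \<in> carrier_vec k \<and> T *\<^sub>v ?x = unit_vec m i"
        by (intro someI_ex[of "\<lambda>x. x \<in> carrier_vec k \<and> T *\<^sub>v x = unit_vec m i"]) (auto simp: I_def)
      have "col S i = ?x" unfolding S_def using i x by (subst col_mat_of_cols) auto
      with x show ?thesis by auto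
    qed
    have TS: "T * S = 1\<^sub>m m"
    proof (rule mat_col_eqI)
      fix i assume "i < dim_col (1\<^sub>m m :: complex mat)"
      then have i: "i < m" by simp
      show "col (T * S) i = col (1\<^sub>m m) i" using col_mult2[OF T S i] colS[OF i] i by simp
    qed (use T S in auto)
    have ST: "S * T = 1\<^sub>m k"
    proof (rule mat_col_eqI)
      fix i assume "i < dim_col (1\<^sub>m k :: complex mat)"
      then have i: "i < k" by simp
      define v where "v = col (S * T) i - unit_vec k i"
      have v: "v \<in> carrier_vec k" using S T i by (auto simp: v_def)
      have "T *\<^sub>v v = T *\<^sub>v col (S * T) i - T *\<^sub>v unit_vec k i"
        unfolding v_def using S T i by (intro mult_minus_distrib_mat_vec) auto
      also have "T *\<^sub>v col (S * T) i = T *\<^sub>v (S *\<^sub>v col T i)" using S T i by (subst col_mult2) auto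
      also have "\<dots> = (T * S) *\<^sub>v col T i" using S T i by (intro assoc_mult_mat_vec[symmetric]) auto
      also have "\<dots> = col T i" unfolding TS using T i by auto
      also have "T *\<^sub>v unit_vec k i = col T i" using T i by (intro eq_vecI) auto
      finally have "T *\<^sub>v v = 0\<^sub>v m" using T by auto
      then have "v \<in> K" using v by (simp add: K_def)
      then have v0: "v = 0\<^sub>v k" using K0 by simp
      show "col (S * T) i = col (1\<^sub>m k) i"
      proof (intro eq_vecI)
        fix j assume "j < dim_vec (col (1\<^sub>m k :: complex mat) i)"
        then have j: "j < k" by simp
        have "v $ j = 0" using v0 j by simp
        then show "col (S * T) i $ j = col (1\<^sub>m k) i $ j" using i j S T by (auto simp: v_def)
      qed (use S in auto)
    qed (use T S in auto)
    show ?thesis using S TS ST by auto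
  qed simp
qed

text \<open>\<open>T\<close> minus an eigenvalue is an intertwiner that is not invertible, hence zero.\<close>

lemma intertwiner_scalar:
  assumes G: "group G" and \<rho>: "irreducible_rep G m \<rho>"
    and T: "T \<in> carrier_mat m m" and comm: "\<And>g. g \<in> carrier G \<Longrightarrow> \<rho> g * T = T * \<rho> g"
  shows "\<exists>c. T = c \<cdot>\<^sub>m 1\<^sub>m m"
proof -
  have r: "matrix_rep G m \<rho>" and m: "m > 0" using \<rho> by (auto simp: irreducible_rep_def)
  obtain c where "c \<in> spectrum T" using spectrum_non_empty[OF T m] by auto
  then obtain v where v: "v \<in> carrier_vec m" "v \<noteq> 0\<^sub>v m" "T *\<^sub>v v = c \<cdot>\<^sub>v v"
    using T by (auto simp: spectrum_def eigenvalue_def eigenvector_def)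
  define U where "U = T - c \<cdot>\<^sub>m 1\<^sub>m m"
  have U: "U \<in> carrier_mat m m" using T by (auto simp: U_def)
  have "\<rho> g * U = U * \<rho> g" if g: "g \<in> carrier G" for g
  proof -
    note rg = matrix_repD(1)[OF r g]
    have "\<rho> g * U = \<rho> g * T - \<rho> g * (c \<cdot>\<^sub>m 1\<^sub>m m)"
      unfolding U_def using rg T by (intro mult_minus_distrib_mat) auto
    also have "\<dots> = T * \<rho> g - (c \<cdot>\<^sub>m 1\<^sub>m m) * \<rho> g"
      using rg comm[OF g] by (simp add: mult_smult_distrib[OF rg one_carrier_mat] mult_smult_assoc_mat[OF one_carrier_mat rg])
    also have "\<dots> = U * \<rho> g"
      unfolding U_def using rg T by (intro minus_mult_distrib_mat[symmetric]) auto
    finally show ?thesis .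
  qed
  then consider "U = 0\<^sub>m m m" | S where "S \<in> carrier_mat m m" "S * U = 1\<^sub>m m"
    using intertwiner_invertible_or_zero[OF G \<rho> \<rho> U] by auto
  then show ?thesis
  proof cases
    case 1
    have "T = c \<cdot>\<^sub>m 1\<^sub>m m"
    proof (rule eq_matI)
      fix i j assume ij: "i < dim_row (c \<cdot>\<^sub>m 1\<^sub>m m :: complex mat)" "j < dim_col (c \<cdot>\<^sub>m 1\<^sub>m m :: complex mat)"
      have "U $$ (i,j) = 0" using 1 ij by simp
      then show "T $$ (i,j) = (c \<cdot>\<^sub>m 1\<^sub>m m) $$ (i,j)" using ij T by (auto simp: U_def)
    qed (use T in auto)
    then show ?thesis by blast
  next
    case 2
    have "U *\<^sub>v v = T *\<^sub>v v - (c \<cdot>\<^sub>m 1\<^sub>m m) *\<^sub>v v"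
      unfolding U_def using T v by (intro minus_mult_distrib_mat_vec) auto
    also have "(c \<cdot>\<^sub>m 1\<^sub>m m) *\<^sub>v v = c \<cdot>\<^sub>v v" using v by (intro eq_vecI) auto
    finally have "U *\<^sub>v v = 0\<^sub>v m" using v by auto
    moreover have "v = (S * U) *\<^sub>v v" using 2 v by auto
    moreover have "\<dots> = S *\<^sub>v (U *\<^sub>v v)" using 2 v U by (intro assoc_mult_mat_vec) auto
    ultimately have "v = 0\<^sub>v m" using 2 by auto
    with v show ?thesis by simp
  qed
qed

section \<open>Orthogonality of irreducible characters\<close>

text \<open>
  The scalar product of characters, with the inverse in place of complex conjugation. In this form it is
  bilinear and can be compared with \<open>\<tau>(x y)\<close>.
\<close>

definition avg_form :: "('g, 'b) monoid_scheme \<Rightarrow> ('g \<Rightarrow> complex) \<Rightarrow> ('g \<Rightarrow> complex) \<Rightarrow> complex" where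
  "avg_form G \<phi> \<psi> = (\<Sum>g\<in>carrier G. \<phi> g * \<psi> (inv\<^bsub>G\<^esub> g)) / of_nat (card (carrier G))"

lemma sum_group_shift:
  assumes "group G" "h \<in> carrier G"
  shows "(\<Sum>g\<in>carrier G. f (h \<otimes>\<^bsub>G\<^esub> g)) = (\<Sum>g\<in>carrier G. f g :: complex)"
proof -
  interpret group G by fact
  show ?thesis using assms(2)
    by (intro sum.reindex_bij_witness[of _ "\<lambda>g. inv\<^bsub>G\<^esub> h \<otimes>\<^bsub>G\<^esub> g" "\<lambda>g. h \<otimes>\<^bsub>G\<^esub> g"])
      (auto simp: m_assoc[symmetric])
qed

lemma sum_mat_mult_entry:
  assumes "A \<in> carrier_mat m k" "B \<in> carrier_mat k l" "i < m" "j < l"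
  shows "(A * B) $$ (i, j) = (\<Sum>t<k. A $$ (i, t) * B $$ (t, j))"
  using assms by (auto simp: scalar_prod_def atLeast0LessThan)

text \<open>
  \<open>T\<close> is the average (up to a factor) of \<open>\<rho> g E \<sigma>(g\<inverse>)\<close> for an elementary matrix \<open>E\<close>; averaging turns any
  matrix into an intertwiner.
\<close>

lemma matrix_coefficients_intertwine:
  fixes \<rho> \<sigma> p q m k
  assumes G: "group G" and r: "matrix_rep G m \<rho>" and s: "matrix_rep G k \<sigma>"
    and p: "p < m" and q: "q < k" and h: "h \<in> carrier G"
  defines "T \<equiv> mat m k (\<lambda>(i,j). \<Sum>g\<in>carrier G. \<rho> g $$ (i,p) * \<sigma> (inv\<^bsub>G\<^esub> g) $$ (q,j))"
  shows "\<rho> h * T = T * \<sigma> h"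
proof (rule eq_matI)
  interpret group G by fact
  note rc = matrix_repD(1)[OF r] and sc = matrix_repD(1)[OF s]
  have T: "T \<in> carrier_mat m k" by (simp add: T_def)
  fix i j assume "i < dim_row (T * \<sigma> h)" "j < dim_col (T * \<sigma> h)"
  then have i: "i < m" and j: "j < k" using T sc[OF h] by auto
  have "(\<rho> h * T) $$ (i,j) = (\<Sum>l<m. \<Sum>g\<in>carrier G. \<rho> h $$ (i,l) * \<rho> g $$ (l,p) * \<sigma> (inv\<^bsub>G\<^esub> g) $$ (q,j))"
    unfolding sum_mat_mult_entry[OF rc[OF h] T i j]
    using j by (auto simp: T_def sum_distrib_left mult.assoc intro!: sum.cong)
  also have "\<dots> = (\<Sum>g\<in>carrier G. (\<rho> h * \<rho> g) $$ (i,p) * \<sigma> (inv\<^bsub>G\<^esub> g) $$ (q,j))"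
    by (subst sum.swap) (auto simp: sum_mat_mult_entry[OF rc[OF h] rc i p] sum_distrib_right intro!: sum.cong)
  also have "\<dots> = (\<Sum>g\<in>carrier G. \<rho> (h \<otimes>\<^bsub>G\<^esub> g) $$ (i,p) * (\<sigma> (inv\<^bsub>G\<^esub> (h \<otimes>\<^bsub>G\<^esub> g)) * \<sigma> h) $$ (q,j))"
  proof (intro sum.cong refl)
    fix g assume g: "g \<in> carrier G"
    have "\<sigma> (inv\<^bsub>G\<^esub> (h \<otimes>\<^bsub>G\<^esub> g)) * \<sigma> h = \<sigma> (inv\<^bsub>G\<^esub> (h \<otimes>\<^bsub>G\<^esub> g) \<otimes>\<^bsub>G\<^esub> h)"
      using g h by (intro matrix_repD(2)[OF s, symmetric]) auto
    also have "inv\<^bsub>G\<^esub> (h \<otimes>\<^bsub>G\<^esub> g) \<otimes>\<^bsub>G\<^esub> h = inv\<^bsub>G\<^esub> g"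
      using g h by (simp add: inv_mult_group m_assoc)
    finally show "(\<rho> h * \<rho> g) $$ (i,p) * \<sigma> (inv\<^bsub>G\<^esub> g) $$ (q,j) =
        \<rho> (h \<otimes>\<^bsub>G\<^esub> g) $$ (i,p) * (\<sigma> (inv\<^bsub>G\<^esub> (h \<otimes>\<^bsub>G\<^esub> g)) * \<sigma> h) $$ (q,j)"
      using matrix_repD(2)[OF r h g] by simp
  qed
  also have "\<dots> = (\<Sum>g\<in>carrier G. \<rho> g $$ (i,p) * (\<sigma> (inv\<^bsub>G\<^esub> g) * \<sigma> h) $$ (q,j))"
    by (rule sum_group_shift[OF G h, of "\<lambda>g. \<rho> g $$ (i,p) * (\<sigma> (inv\<^bsub>G\<^esub> g) * \<sigma> h) $$ (q,j)"])
  also have "\<dots> = (\<Sum>g\<in>carrier G. \<Sum>l<k. \<rho> g $$ (i,p) * \<sigma> (inv\<^bsub>G\<^esub> g) $$ (q,l) * \<sigma> h $$ (l,j))"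
    by (auto simp: sum_mat_mult_entry[OF sc sc[OF h] q j] sum_distrib_left mult.assoc intro!: sum.cong)
  also have "\<dots> = (T * \<sigma> h) $$ (i,j)"
    unfolding sum_mat_mult_entry[OF T sc[OF h] i j]
    using i by (subst sum.swap) (auto simp: T_def sum_distrib_right intro!: sum.cong)
  finally show "(\<rho> h * T) $$ (i,j) = (T * \<sigma> h) $$ (i,j)" .
qed (use matrix_repD(1)[OF r h] matrix_repD(1)[OF s h] in \<open>auto simp: T_def\<close>)

lemma character_sum_coefficients:
  assumes G: "group G"
  shows "(\<Sum>g\<in>carrier G. character G m \<rho> g * character G k \<sigma> (inv\<^bsub>G\<^esub> g))
     = (\<Sum>i<m. \<Sum>j<k. \<Sum>g\<in>carrier G. \<rho> g $$ (i,i) * \<sigma> (inv\<^bsub>G\<^esub> g) $$ (j,j))"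
proof -
  interpret group G by fact
  have "(\<Sum>g\<in>carrier G. character G m \<rho> g * character G k \<sigma> (inv\<^bsub>G\<^esub> g))
      = (\<Sum>g\<in>carrier G. \<Sum>i<m. \<Sum>j<k. \<rho> g $$ (i,i) * \<sigma> (inv\<^bsub>G\<^esub> g) $$ (j,j))"
    by (auto simp: character_def sum_product intro!: sum.cong)
  also have "\<dots> = (\<Sum>i<m. \<Sum>g\<in>carrier G. \<Sum>j<k. \<rho> g $$ (i,i) * \<sigma> (inv\<^bsub>G\<^esub> g) $$ (j,j))"
    by (rule sum.swap)
  also have "\<dots> = (\<Sum>i<m. \<Sum>j<k. \<Sum>g\<in>carrier G. \<rho> g $$ (i,i) * \<sigma> (inv\<^bsub>G\<^esub> g) $$ (j,j))"
    by (intro sum.cong refl sum.swap)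
  finally show ?thesis .
qed

text \<open>
  If the characters differ, all averaged matrices vanish, because an invertible intertwiner would make the
  traces equal. For one representation they are scalar, and the scalar is found by taking the trace.
\<close>

lemma irr_chars_orthonormal:
  assumes G: "group G" and fin: "finite (carrier G)"
    and \<chi>: "\<chi> \<in> irr_chars G" and \<psi>: "\<psi> \<in> irr_chars G"
  shows "avg_form G \<chi> \<psi> = (if \<chi> = \<psi> then 1 else 0)"
proof -
  interpret group G by fact
  have card0: "card (carrier G) \<noteq> 0" using fin by auto
  obtain m \<rho> where \<rho>: "irreducible_rep G m \<rho>" "\<chi> = character G m \<rho>"
    using \<chi> by (auto simp: irr_chars_def)
  have r: "matrix_rep G m \<rho>" and m: "m > 0" using \<rho> by (auto simp: irreducible_rep_def)
  note rc = matrix_repD(1)[OF r]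
  show ?thesis
  proof (cases "\<chi> = \<psi>")
    case True
    have coeff: "(\<Sum>g\<in>carrier G. \<rho> g $$ (i,i) * \<rho> (inv\<^bsub>G\<^esub> g) $$ (j,j))
        = (if i = j then of_nat (card (carrier G)) / of_nat m else 0)" if i: "i < m" and j: "j < m" for i j
    proof -
      define T where "T = mat m m (\<lambda>(a,b). \<Sum>g\<in>carrier G. \<rho> g $$ (a,i) * \<rho> (inv\<^bsub>G\<^esub> g) $$ (j,b))"
      have "\<exists>c. T = c \<cdot>\<^sub>m 1\<^sub>m m"
        unfolding T_def
        by (rule intertwiner_scalar[OF G \<rho>(1)])
           (use matrix_coefficients_intertwine[OF G r r i j] in auto)
      then obtain c where c: "T = c \<cdot>\<^sub>m 1\<^sub>m m" ..
      have "of_nat m * c = (\<Sum>a<m. T $$ (a,a))" unfolding c by simp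
      also have "\<dots> = (\<Sum>g\<in>carrier G. \<Sum>a<m. \<rho> (inv\<^bsub>G\<^esub> g) $$ (j,a) * \<rho> g $$ (a,i))"
        by (subst sum.swap) (simp add: T_def mult.commute)
      also have "\<dots> = (\<Sum>g\<in>carrier G. (if i = j then 1 else 0))"
      proof (intro sum.cong refl)
        fix g assume g: "g \<in> carrier G"
        have "(\<Sum>a<m. \<rho> (inv\<^bsub>G\<^esub> g) $$ (j,a) * \<rho> g $$ (a,i)) = (\<rho> (inv\<^bsub>G\<^esub> g) * \<rho> g) $$ (j,i)"
          using sum_mat_mult_entry[OF rc rc j i] g by simp
        also have "\<rho> (inv\<^bsub>G\<^esub> g) * \<rho> g = \<rho> \<one>\<^bsub>G\<^esub>"
          using matrix_repD(2)[OF r, of "inv\<^bsub>G\<^esub> g" g] g by simp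
        finally show "(\<Sum>a<m. \<rho> (inv\<^bsub>G\<^esub> g) $$ (j,a) * \<rho> g $$ (a,i)) = (if i = j then 1 else 0)"
          using matrix_rep_one[OF G r] i j by auto
      qed
      finally have c': "of_nat m * c = (if i = j then of_nat (card (carrier G)) else 0)" by simp
      have "(\<Sum>g\<in>carrier G. \<rho> g $$ (i,i) * \<rho> (inv\<^bsub>G\<^esub> g) $$ (j,j)) = T $$ (i,j)"
        using i j by (simp add: T_def)
      also have "\<dots> = (if i = j then c else 0)" unfolding c using i j by simp
      finally show ?thesis using c' m by (auto simp: field_simps)
    qed
    have "(\<Sum>g\<in>carrier G. \<chi> g * \<chi> (inv\<^bsub>G\<^esub> g)) = (\<Sum>i<m. \<Sum>j<m. if i = j then of_nat (card (carrier G)) / of_nat m else 0)"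
      unfolding \<rho>(2) character_sum_coefficients[OF G] by (intro sum.cong refl) (simp add: coeff)
    also have "\<dots> = of_nat (card (carrier G))" using m by simp
    finally show ?thesis using True card0 by (simp add: avg_form_def)
  next
    case False
    obtain k \<sigma> where \<sigma>: "irreducible_rep G k \<sigma>" "\<psi> = character G k \<sigma>"
      using \<psi> by (auto simp: irr_chars_def)
    have s: "matrix_rep G k \<sigma>" using \<sigma> by (auto simp: irreducible_rep_def)
    note sc = matrix_repD(1)[OF s]
    have coeff: "(\<Sum>g\<in>carrier G. \<rho> g $$ (i,i) * \<sigma> (inv\<^bsub>G\<^esub> g) $$ (j,j)) = 0" if i: "i < m" and j: "j < k" for i j
    proof -
      define T where "T = mat m k (\<lambda>(a,b). \<Sum>g\<in>carrier G. \<rho> g $$ (a,i) * \<sigma> (inv\<^bsub>G\<^esub> g) $$ (j,b))"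
      have T: "T \<in> carrier_mat m k" by (simp add: T_def)
      have comm: "\<rho> g * T = T * \<sigma> g" if "g \<in> carrier G" for g
        unfolding T_def using matrix_coefficients_intertwine[OF G r s i j that] .
      have "\<not> (\<exists>S\<in>carrier_mat k m. T * S = 1\<^sub>m m \<and> S * T = 1\<^sub>m k)"
      proof
        assume "\<exists>S\<in>carrier_mat k m. T * S = 1\<^sub>m m \<and> S * T = 1\<^sub>m k"
        then obtain S where S: "S \<in> carrier_mat k m" "T * S = 1\<^sub>m m" "S * T = 1\<^sub>m k" by blast
        have "\<chi> g = \<psi> g" for g
        proof (cases "g \<in> carrier G")
          case g: True
          have "\<rho> g = \<rho> g * (T * S)" using S rc[OF g] by simp
          also have "\<dots> = (\<rho> g * T) * S" using S T rc[OF g] by (intro assoc_mult_mat[symmetric]) auto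
          also have "\<dots> = T * (\<sigma> g * S)" unfolding comm[OF g] using S T sc[OF g] by (intro assoc_mult_mat) auto
          finally have "(\<Sum>i<m. \<rho> g $$ (i,i)) = (\<Sum>i<m. (T * (\<sigma> g * S)) $$ (i,i))" by simp
          also have "\<dots> = (\<Sum>i<k. ((\<sigma> g * S) * T) $$ (i,i))"
            using S T sc[OF g] by (intro trace_mult_commute) auto
          also have "(\<sigma> g * S) * T = \<sigma> g * (S * T)"
            using S T sc[OF g] by (intro assoc_mult_mat) auto
          also have "\<dots> = \<sigma> g" using S sc[OF g] by simp
          finally show ?thesis using g by (simp add: \<rho> \<sigma> character_def)
        qed (simp add: \<rho> \<sigma> character_def)
        with False show False by auto
      qed
      with intertwiner_invertible_or_zero[OF G \<rho>(1) \<sigma>(1) T comm] have "T = 0\<^sub>m m k" by auto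
      then have "T $$ (i,j) = 0" using i j by simp
      then show ?thesis using i j by (simp add: T_def)
    qed
    have "(\<Sum>g\<in>carrier G. \<chi> g * \<psi> (inv\<^bsub>G\<^esub> g)) = 0"
      unfolding \<rho>(2) \<sigma>(2) character_sum_coefficients[OF G] by (simp add: coeff)
    then show ?thesis using False by (simp add: avg_form_def)
  qed
qed

section \<open>Permutation characters as virtual characters\<close>

text \<open>
  Induction on the degree: in a basis adapted to an invariant subspace, both diagonal blocks of the block
  triangular matrices are again representations, and their characters add up to the given one.
\<close>

lemma character_in_span_irr:
  assumes G: "group G"
  shows "matrix_rep G m \<rho> \<Longrightarrow> character G m \<rho> \<in> ZM.span (irr_chars G)"
proof (induction m arbitrary: \<rho> rule: less_induct)
  case (less m)
  note r = less.prems
  note rc = matrix_repD(1)[OF r]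
  consider "m = 0" | "irreducible_rep G m \<rho>"
    | U where "VectorSpace.subspace class_ring U (module_vec TYPE(complex) m)"
       "\<forall>g\<in>carrier G. \<forall>u\<in>U. \<rho> g *\<^sub>v u \<in> U" "U \<noteq> {0\<^sub>v m}" "U \<noteq> carrier_vec m"
  proof (cases "m = 0 \<or> irreducible_rep G m \<rho>")
    case False
    then have "\<not> (\<forall>U. VectorSpace.subspace class_ring U (module_vec TYPE(complex) m) \<and>
      (\<forall>g\<in>carrier G. \<forall>u\<in>U. \<rho> g *\<^sub>v u \<in> U) \<longrightarrow> U = {0\<^sub>v m} \<or> U = carrier_vec m)"
      using r by (auto simp: irreducible_rep_def)
    then obtain U where "VectorSpace.subspace class_ring U (module_vec TYPE(complex) m)"
       "\<forall>g\<in>carrier G. \<forall>u\<in>U. \<rho> g *\<^sub>v u \<in> U" "U \<noteq> {0\<^sub>v m}" "U \<noteq> carrier_vec m"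
      by blast
    then show ?thesis by (rule that(3))
  next
    case True
    then show ?thesis using that(1,2) by (elim disjE)
  qed
  then show ?case
  proof cases
    case 1
    then have "character G m \<rho> = 0" by (auto simp: character_def fun_eq_iff)
    then show ?thesis using ZM.span_zero by metis
  next
    case 2
    then show ?thesis by (intro ZM.span_base) (auto simp: irr_chars_def)
  next
    case 3
    obtain k P R where km: "k \<le> m"
      and P: "P \<in> carrier_mat m m" and R: "R \<in> carrier_mat m m" and PR: "P * R = 1\<^sub>m m" and RP: "R * P = 1\<^sub>m m"
      and U: "U = {P *\<^sub>v x | x. x \<in> carrier_vec m \<and> (\<forall>i<m. k \<le> i \<longrightarrow> x $ i = 0)}"
      by (rule adapted_basis[OF 3(1)])
    have k0: "k \<noteq> 0"
    proof
      assume k: "k = 0"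
      have "U \<subseteq> {0\<^sub>v m}"
      proof
        fix u assume "u \<in> U"
        then obtain x where x: "u = P *\<^sub>v x" "x \<in> carrier_vec m" "\<forall>i<m. x $ i = 0"
          unfolding U k by auto
        have "x = 0\<^sub>v m" using x(2,3) by (intro eq_vecI) auto
        then show "u \<in> {0\<^sub>v m}" using x(1) P by auto
      qed
      moreover have "0\<^sub>v m \<in> U" unfolding U using P by (intro CollectI exI[of _ "0\<^sub>v m"]) auto
      ultimately show False using 3(3) by (metis empty_iff subset_singletonD)
    qed
    have kneq: "k \<noteq> m"
    proof
      assume k: "k = m"
      have U': "U = {P *\<^sub>v x | x. x \<in> carrier_vec m}" unfolding U k by simp
      have "v \<in> U" if "v \<in> carrier_vec m" for v
      proof -
        have "v = (P * R) *\<^sub>v v" using PR that by simp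
        also have "\<dots> = P *\<^sub>v (R *\<^sub>v v)" using P R that by (intro assoc_mult_mat_vec) auto
        finally show ?thesis unfolding U' using R that by auto
      qed
      moreover have "U \<subseteq> carrier_vec m" unfolding U' using P by auto
      ultimately show False using 3(4) by auto
    qed
    define l where "l = m - k"
    have mkl: "m = k + l" using km by (simp add: l_def)
    have lm: "l < m" and km': "k < m" using k0 kneq km by (auto simp: l_def)
    define A where "A g = R * \<rho> g * P" for g
    have A: "A g \<in> carrier_mat m m" if "g \<in> carrier G" for g using R P rc[OF that] by (simp add: A_def)
    have Amult: "A (g \<otimes>\<^bsub>G\<^esub> h) = A g * A h" if g: "g \<in> carrier G" and h: "h \<in> carrier G" for g h
    proof -
      have "A g * A h = (R * \<rho> g) * P * (R * (\<rho> h * P))"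
        unfolding A_def using R P rc[OF g] rc[OF h] by (simp add: assoc_mult_mat[of _ m m _ m _ m])
      also have "\<dots> = (R * \<rho> g) * (P * R) * (\<rho> h * P)"
        using R P rc[OF g] rc[OF h] by (simp add: assoc_mult_mat[of _ m m _ m _ m])
      also have "\<dots> = R * (\<rho> g * \<rho> h) * P"
        using R P rc[OF g] rc[OF h] PR by (simp add: assoc_mult_mat[of _ m m _ m _ m])
      finally show ?thesis using matrix_repD(2)[OF r g h] by (simp add: A_def)
    qed
    have Aone: "A \<one>\<^bsub>G\<^esub> = 1\<^sub>m m"
      using matrix_rep_one[OF G r] R P RP by (simp add: A_def)
    \<comment> \<open>\<open>U\<close> is invariant, so the lower left block vanishes\<close>
    have lower: "A g $$ (i,j) = 0" if g: "g \<in> carrier G" and i: "k \<le> i" "i < m" and j: "j < k" for g i j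
    proof -
      have jm: "j < m" using j km by simp
      have "P *\<^sub>v unit_vec m j \<in> U" unfolding U using j by auto
      then have "\<rho> g *\<^sub>v (P *\<^sub>v unit_vec m j) \<in> U" using 3(2) g by blast
      then obtain x where x: "x \<in> carrier_vec m" "\<forall>i<m. k \<le> i \<longrightarrow> x $ i = 0" "\<rho> g *\<^sub>v (P *\<^sub>v unit_vec m j) = P *\<^sub>v x"
        unfolding U by auto
      have "A g *\<^sub>v unit_vec m j = (R * \<rho> g) *\<^sub>v (P *\<^sub>v unit_vec m j)"
        unfolding A_def using R P rc[OF g] by (intro assoc_mult_mat_vec) auto
      also have "\<dots> = R *\<^sub>v (\<rho> g *\<^sub>v (P *\<^sub>v unit_vec m j))"
        using R P rc[OF g] by (intro assoc_mult_mat_vec) auto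
      also have "\<dots> = (R * P) *\<^sub>v x" unfolding x(3) using R P x by (intro assoc_mult_mat_vec[symmetric]) auto
      also have "\<dots> = x" using RP x by simp
      finally have "(A g *\<^sub>v unit_vec m j) $ i = 0" using x i by simp
      moreover have "(A g *\<^sub>v unit_vec m j) $ i = A g $$ (i,j)"
        using A[OF g] i jm by auto
      ultimately show ?thesis by simp
    qed
    have split: "(\<Sum>t<m. f t) = (\<Sum>t<k. f t) + (\<Sum>t<l. f (k + t))" for f :: "nat \<Rightarrow> complex"
      unfolding mkl by (induction l) (simp_all add: add.assoc)
    define \<rho>1 where "\<rho>1 g = mat k k (\<lambda>(i,j). A g $$ (i,j))" for g
    define \<rho>2 where "\<rho>2 g = mat l l (\<lambda>(i,j). A g $$ (k + i,k + j))" for g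
    have "matrix_rep G k \<rho>1"
    proof (intro matrix_repI[OF G])
      fix g h assume g: "g \<in> carrier G" and h: "h \<in> carrier G"
      show "\<rho>1 (g \<otimes>\<^bsub>G\<^esub> h) = \<rho>1 g * \<rho>1 h"
      proof (rule eq_matI)
        fix i j assume "i < dim_row (\<rho>1 g * \<rho>1 h)" "j < dim_col (\<rho>1 g * \<rho>1 h)"
        then have i: "i < k" and j: "j < k" by (auto simp: \<rho>1_def)
        have "\<rho>1 (g \<otimes>\<^bsub>G\<^esub> h) $$ (i,j) = (A g * A h) $$ (i,j)"
          using i j by (simp add: \<rho>1_def Amult[OF g h])
        also have "\<dots> = (\<Sum>t<m. A g $$ (i,t) * A h $$ (t,j))"
          using i j km' by (intro sum_mat_mult_entry[OF A[OF g] A[OF h]]) auto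
        also have "\<dots> = (\<Sum>t<k. A g $$ (i,t) * A h $$ (t,j))"
          unfolding split using lower[OF h] j by (simp add: mkl)
        also have "\<dots> = (\<rho>1 g * \<rho>1 h) $$ (i,j)"
          by (subst sum_mat_mult_entry[of _ k k _ k]) (use i j in \<open>auto simp: \<rho>1_def\<close>)
        finally show "\<rho>1 (g \<otimes>\<^bsub>G\<^esub> h) $$ (i,j) = (\<rho>1 g * \<rho>1 h) $$ (i,j)" .
      qed (auto simp: \<rho>1_def)
    qed (use km' in \<open>auto simp: \<rho>1_def Aone intro!: eq_matI\<close>)
    then have s1: "character G k \<rho>1 \<in> ZM.span (irr_chars G)" using less.IH[OF km'] by blast
    have "matrix_rep G l \<rho>2"
    proof (intro matrix_repI[OF G])
      fix g h assume g: "g \<in> carrier G" and h: "h \<in> carrier G"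
      show "\<rho>2 (g \<otimes>\<^bsub>G\<^esub> h) = \<rho>2 g * \<rho>2 h"
      proof (rule eq_matI)
        fix i j assume "i < dim_row (\<rho>2 g * \<rho>2 h)" "j < dim_col (\<rho>2 g * \<rho>2 h)"
        then have i: "i < l" and j: "j < l" by (auto simp: \<rho>2_def)
        have "\<rho>2 (g \<otimes>\<^bsub>G\<^esub> h) $$ (i,j) = (A g * A h) $$ (k+i,k+j)"
          using i j by (simp add: \<rho>2_def Amult[OF g h])
        also have "\<dots> = (\<Sum>t<m. A g $$ (k+i,t) * A h $$ (t,k+j))"
          using i j mkl by (intro sum_mat_mult_entry[OF A[OF g] A[OF h]]) auto
        also have "\<dots> = (\<Sum>t<l. A g $$ (k+i,k+t) * A h $$ (k+t,k+j))"
          unfolding split using lower[OF g] i by (simp add: mkl)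
        also have "\<dots> = (\<rho>2 g * \<rho>2 h) $$ (i,j)"
          by (subst sum_mat_mult_entry[of _ l l _ l]) (use i j in \<open>auto simp: \<rho>2_def\<close>)
        finally show "\<rho>2 (g \<otimes>\<^bsub>G\<^esub> h) $$ (i,j) = (\<rho>2 g * \<rho>2 h) $$ (i,j)" .
      qed (auto simp: \<rho>2_def)
    qed (use mkl in \<open>auto simp: \<rho>2_def Aone intro!: eq_matI\<close>)
    then have s2: "character G l \<rho>2 \<in> ZM.span (irr_chars G)" using less.IH[OF lm] by blast
    have "character G m \<rho> = character G k \<rho>1 + character G l \<rho>2"
    proof
      fix g
      show "character G m \<rho> g = (character G k \<rho>1 + character G l \<rho>2) g"
      proof (cases "g \<in> carrier G")
        case g: True
        have "(\<Sum>i<m. \<rho> g $$ (i,i)) = (\<Sum>i<m. (\<rho> g * P * R) $$ (i,i))"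
          using P R rc[OF g] PR by (simp add: assoc_mult_mat[of _ m m _ m _ m])
        also have "\<dots> = (\<Sum>i<m. (R * (\<rho> g * P)) $$ (i,i))"
          using P R rc[OF g] by (intro trace_mult_commute) auto
        also have "R * (\<rho> g * P) = A g"
          unfolding A_def using P R rc[OF g] by (intro assoc_mult_mat[symmetric]) auto
        finally show ?thesis
          using g split[of "\<lambda>i. A g $$ (i,i)"] by (simp add: character_def \<rho>1_def \<rho>2_def)
      qed (simp add: character_def)
    qed
    then show ?thesis using ZM.span_add[OF s1 s2] by metis
  qed
qed

text \<open>The trace of a permutation matrix counts fixed points.\<close>

lemma permutation_character_in_span_irr:
  assumes G: "group G" and fin: "finite \<Omega>"
    and act: "\<And>g \<omega>. g \<in> carrier G \<Longrightarrow> \<omega> \<in> \<Omega> \<Longrightarrow> \<alpha> g \<omega> \<in> \<Omega>"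
    and mult: "\<And>g h \<omega>. g \<in> carrier G \<Longrightarrow> h \<in> carrier G \<Longrightarrow> \<omega> \<in> \<Omega> \<Longrightarrow> \<alpha> (g \<otimes>\<^bsub>G\<^esub> h) \<omega> = \<alpha> g (\<alpha> h \<omega>)"
    and one: "\<And>\<omega>. \<omega> \<in> \<Omega> \<Longrightarrow> \<alpha> \<one>\<^bsub>G\<^esub> \<omega> = \<omega>"
  shows "(\<lambda>g. if g \<in> carrier G then of_nat (card {\<omega> \<in> \<Omega>. \<alpha> g \<omega> = \<omega>}) else 0) \<in> ZM.span (irr_chars G)"
proof -
  define m where "m = card \<Omega>"
  obtain e where e: "bij_betw e {..<m} \<Omega>"
    using ex_bij_betw_nat_finite[OF fin] by (auto simp: m_def atLeast0LessThan)
  have eO: "e i \<in> \<Omega>" if "i < m" for i using e that by (auto simp: bij_betw_def)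
  have einj: "e i = e j \<longleftrightarrow> i = j" if "i < m" "j < m" for i j
    using e that by (auto simp: bij_betw_def inj_on_def)
  have surj: "\<exists>i<m. e i = \<omega>" if "\<omega> \<in> \<Omega>" for \<omega> using e that by (auto simp: bij_betw_def)
  define \<rho> where "\<rho> g = mat m m (\<lambda>(i,j). if \<alpha> g (e j) = e i then 1 else (0::complex))" for g
  have "matrix_rep G m \<rho>"
  proof (intro matrix_repI[OF G])
    fix g h assume g: "g \<in> carrier G" and h: "h \<in> carrier G"
    show "\<rho> (g \<otimes>\<^bsub>G\<^esub> h) = \<rho> g * \<rho> h"
    proof (rule eq_matI)
      fix i j assume "i < dim_row (\<rho> g * \<rho> h)" "j < dim_col (\<rho> g * \<rho> h)"
      then have i: "i < m" and j: "j < m" by (auto simp: \<rho>_def)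
      obtain t where t: "t < m" "e t = \<alpha> h (e j)" using surj act[OF h eO[OF j]] by metis
      have "(\<rho> g * \<rho> h) $$ (i,j) = (\<Sum>s<m. \<rho> g $$ (i,s) * \<rho> h $$ (s,j))"
        by (rule sum_mat_mult_entry[of _ m m _ m]) (use i j in \<open>auto simp: \<rho>_def\<close>)
      also have "\<dots> = (\<Sum>s<m. if s = t then \<rho> g $$ (i,t) else 0)"
        using j t by (intro sum.cong refl) (auto simp: \<rho>_def einj)
      also have "\<dots> = \<rho> g $$ (i,t)" using t by simp
      also have "\<dots> = \<rho> (g \<otimes>\<^bsub>G\<^esub> h) $$ (i,j)"
        using i j t mult[OF g h eO[OF j]] by (simp add: \<rho>_def)
      finally show "\<rho> (g \<otimes>\<^bsub>G\<^esub> h) $$ (i,j) = (\<rho> g * \<rho> h) $$ (i,j)" by simp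
    qed (auto simp: \<rho>_def)
  qed (use one eO einj in \<open>auto simp: \<rho>_def intro!: eq_matI\<close>)
  then have "character G m \<rho> \<in> ZM.span (irr_chars G)" by (rule character_in_span_irr[OF G])
  also have "character G m \<rho> = (\<lambda>g. if g \<in> carrier G then of_nat (card {\<omega> \<in> \<Omega>. \<alpha> g \<omega> = \<omega>}) else 0)"
  proof
    fix g
    have "(\<Sum>i<m. \<rho> g $$ (i,i)) = (\<Sum>i<m. if \<alpha> g (e i) = e i then 1 else 0)"
      by (intro sum.cong refl) (simp add: \<rho>_def)
    also have "\<dots> = of_nat (card {i\<in>{..<m}. \<alpha> g (e i) = e i})" by (simp flip: sum.inter_filter)
    also have "card {i\<in>{..<m}. \<alpha> g (e i) = e i} = card {\<omega> \<in> \<Omega>. \<alpha> g \<omega> = \<omega>}"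
      by (rule bij_betw_same_card[of e]) (use e surj in \<open>auto simp: bij_betw_def inj_on_def image_iff\<close>)
    finally show "character G m \<rho> g = (if g \<in> carrier G then of_nat (card {\<omega> \<in> \<Omega>. \<alpha> g \<omega> = \<omega>}) else 0)"
      by (simp add: character_def)
  qed
  finally show ?thesis .
qed

text \<open>
  \<open>g\<close> fixes the coset \<open>x H\<close> if and only if \<open>x\<inverse> g x \<in> H\<close>, and each coset has \<open>|H|\<close> representatives.
\<close>

lemma induced_trivial_eq_fixed_cosets:
  fixes G (structure)
  assumes G: "group G" and fin: "finite (carrier G)" and H: "subgroup H G"
  shows "induced G H (\<lambda>_. 1) = (\<lambda>g. if g \<in> carrier G then
     of_nat (card {\<omega> \<in> (\<lambda>x. (\<otimes>) x ` H) ` carrier G. (\<otimes>) g ` \<omega> = \<omega>}) else 0)"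
proof
  interpret group G by fact
  have HG: "H \<subseteq> carrier G" using H by (rule subgroup.subset)
  have finH: "finite H" using HG fin by (rule finite_subset)
  have cH: "card H \<noteq> 0" using finH subgroup.one_closed[OF H] by auto
  define co where "co x = (\<otimes>) x ` H" for x
  have self: "x \<in> co x" if "x \<in> carrier G" for x
    using that subgroup.one_closed[OF H] unfolding co_def by (intro image_eqI[of _ _ \<one>]) auto
  have coG: "co x \<subseteq> carrier G" if "x \<in> carrier G" for x
    using that HG by (auto simp: co_def)
  have mem: "y \<in> co x \<longleftrightarrow> inv x \<otimes> y \<in> H" if "x \<in> carrier G" "y \<in> carrier G" for x y
  proof
    assume "y \<in> co x"
    then obtain h where h: "h \<in> H" "y = x \<otimes> h" by (auto simp: co_def)
    then have "inv x \<otimes> y = h" using that HG by (auto simp: m_assoc[symmetric])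
    with h show "inv x \<otimes> y \<in> H" by simp
  next
    assume "inv x \<otimes> y \<in> H"
    moreover have "y = x \<otimes> (inv x \<otimes> y)" using that by (simp add: m_assoc[symmetric])
    ultimately show "y \<in> co x" unfolding co_def by blast
  qed
  have eqI: "co y = co x" if x: "x \<in> carrier G" and y: "y \<in> co x" for x y
  proof -
    have yG: "y \<in> carrier G" using coG[OF x] y by auto
    have xy: "inv x \<otimes> y \<in> H" using mem[OF x yG] y by simp
    have yx: "inv y \<otimes> x \<in> H"
      using subgroup.m_inv_closed[OF H xy] x yG by (simp add: inv_mult_group)
    have "z \<in> co y \<longleftrightarrow> z \<in> co x" if z: "z \<in> carrier G" for z
    proof -
      have "y \<otimes> (inv y \<otimes> z) = z" "x \<otimes> (inv x \<otimes> z) = z" using x yG z by (simp_all add: m_assoc[symmetric])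
      then have 1: "(inv x \<otimes> y) \<otimes> (inv y \<otimes> z) = inv x \<otimes> z" and 2: "(inv y \<otimes> x) \<otimes> (inv x \<otimes> z) = inv y \<otimes> z"
        using x yG z by (simp_all add: m_assoc)
      show ?thesis unfolding mem[OF yG z] mem[OF x z]
        using subgroup.m_closed[OF H xy, of "inv y \<otimes> z"] subgroup.m_closed[OF H yx, of "inv x \<otimes> z"]
        unfolding 1 2 by blast
    qed
    then show ?thesis using coG[OF x] coG[OF yG] by blast
  qed
  have card_co: "card (co x) = card H" if "x \<in> carrier G" for x
    unfolding co_def using that HG by (intro card_image) (auto simp: inj_on_def subset_iff)
  fix g
  show "induced G H (\<lambda>_. 1) g = (if g \<in> carrier G then
     of_nat (card {\<omega> \<in> (\<lambda>x. (\<otimes>) x ` H) ` carrier G. (\<otimes>) g ` \<omega> = \<omega>}) else 0)"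
  proof (cases "g \<in> carrier G")
    case g: True
    define F where "F = {\<omega> \<in> co ` carrier G. (\<otimes>) g ` \<omega> = \<omega>}"
    have act: "(\<otimes>) g ` co x = co (g \<otimes> x)" if x: "x \<in> carrier G" for x
    proof -
      have "(\<otimes>) g ` co x = (\<lambda>h. g \<otimes> (x \<otimes> h)) ` H" by (simp add: co_def image_image)
      also have "\<dots> = co (g \<otimes> x)" unfolding co_def
        using g x HG by (intro image_cong refl) (auto simp: m_assoc)
      finally show ?thesis .
    qed
    have fixiff: "inv x \<otimes> g \<otimes> x \<in> H \<longleftrightarrow> co (g \<otimes> x) = co x" if x: "x \<in> carrier G" for x
      using mem[OF x, of "g \<otimes> x"] eqI[OF x, of "g \<otimes> x"] self[of "g \<otimes> x"] x g
      by (auto simp: m_assoc)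
    have "{x \<in> carrier G. inv x \<otimes> g \<otimes> x \<in> H} = \<Union>F"
    proof (intro equalityI subsetI)
      fix x assume "x \<in> {x \<in> carrier G. inv x \<otimes> g \<otimes> x \<in> H}"
      then have x: "x \<in> carrier G" "co (g \<otimes> x) = co x" using fixiff by auto
      then have "co x \<in> F" unfolding F_def using act by auto
      then show "x \<in> \<Union>F" using self x by blast
    next
      fix x assume "x \<in> \<Union>F"
      then obtain y where y: "y \<in> carrier G" "(\<otimes>) g ` co y = co y" "x \<in> co y" by (auto simp: F_def)
      then have x: "x \<in> carrier G" "co x = co y" using coG[OF y(1)] eqI[OF y(1,3)] by auto
      then show "x \<in> {x \<in> carrier G. inv x \<otimes> g \<otimes> x \<in> H}"
        using y(2) act[OF x(1)] fixiff[OF x(1)] by simp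
    qed
    moreover have "card (\<Union>F) = card H * card F"
    proof -
      have "card (\<Union>F) = (\<Sum>\<omega>\<in>F. card \<omega>)"
      proof (rule card_Union_disjoint)
        show "pairwise disjnt F"
        proof (rule pairwiseI)
          fix A B assume AB: "A \<in> F" "B \<in> F" "A \<noteq> B"
          then obtain a b where ab: "a \<in> carrier G" "b \<in> carrier G" "A = co a" "B = co b" by (auto simp: F_def)
          show "disjnt A B"
          proof (rule ccontr)
            assume "\<not> disjnt A B"
            then obtain z where "z \<in> co a" "z \<in> co b" unfolding disjnt_def ab by blast
            then have "co a = co b" using eqI[OF ab(1), of z] eqI[OF ab(2), of z] by simp
            with AB(3) ab(3,4) show False by simp
          qed
        qed
        show "finite A" if "A \<in> F" for A using that finH by (auto simp: F_def co_def)
      qed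
      also have "\<dots> = (\<Sum>\<omega>\<in>F. card H)" by (intro sum.cong refl) (auto simp: F_def card_co)
      finally show ?thesis by simp
    qed
    ultimately have "card {x \<in> carrier G. inv x \<otimes> g \<otimes> x \<in> H} = card H * card F" by simp
    then show ?thesis using g cH by (simp add: induced_def F_def co_def)
  qed (simp add: induced_def)
qed

lemma induced_trivial_in_span_irr:
  fixes G (structure)
  assumes G: "group G" and fin: "finite (carrier G)" and H: "subgroup H G"
  shows "induced G H (\<lambda>_. 1) \<in> ZM.span (irr_chars G)"
proof -
  interpret group G by fact
  have HG: "H \<subseteq> carrier G" using H by (rule subgroup.subset)
  have act: "(\<otimes>) g ` ((\<otimes>) x ` H) = (\<otimes>) (g \<otimes> x) ` H" if "x \<in> carrier G" "g \<in> carrier G" for x g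
    unfolding image_image using that HG by (intro image_cong refl) (auto simp: m_assoc)
  show ?thesis unfolding induced_trivial_eq_fixed_cosets[OF assms]
  proof (rule permutation_character_in_span_irr[OF G])
    show "finite ((\<lambda>x. (\<otimes>) x ` H) ` carrier G)" using fin by simp
    show "(\<otimes>) g ` \<omega> \<in> (\<lambda>x. (\<otimes>) x ` H) ` carrier G"
      if "g \<in> carrier G" "\<omega> \<in> (\<lambda>x. (\<otimes>) x ` H) ` carrier G" for g \<omega>
    proof -
      obtain x where "x \<in> carrier G" "\<omega> = (\<otimes>) x ` H" using \<open>\<omega> \<in> _\<close> by (rule imageE)
      then show ?thesis using act[of x g] that(1) by (intro image_eqI[of _ _ "g \<otimes> x"]) simp_all
    qed
    show "(\<otimes>) (g \<otimes> h) ` \<omega> = (\<otimes>) g ` (\<otimes>) h ` \<omega>"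
      if "g \<in> carrier G" "h \<in> carrier G" "\<omega> \<in> (\<lambda>x. (\<otimes>) x ` H) ` carrier G" for g h \<omega>
      unfolding image_image using that HG by (intro image_cong refl) (auto simp: m_assoc)
    show "(\<otimes>) \<one> ` \<omega> = \<omega>" if "\<omega> \<in> (\<lambda>x. (\<otimes>) x ` H) ` carrier G" for \<omega>
    proof -
      have "\<omega> \<subseteq> carrier G" using that HG by auto
      then have "(\<otimes>) \<one> ` \<omega> = id ` \<omega>" by (intro image_cong refl) auto
      then show ?thesis by simp
    qed
  qed
qed

lemma sum_fun_apply: "(\<Sum>a\<in>A. f a) x = (\<Sum>a\<in>A. f a x)"
  by (induction A rule: infinite_finite_induct) auto

section \<open>The scalar product of characters as an average\<close>

text \<open>
  The regular character is a finite combination of irreducible ones. Its scalar product with an irreducible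
  character is the degree of the latter, which is not zero, so by orthogonality every irreducible character occurs in it.
\<close>

lemma finite_irr_chars:
  fixes G (structure)
  assumes G: "group G" and fin: "finite (carrier G)"
  shows "finite (irr_chars G)"
proof -
  interpret group G by fact
  define reg :: "'a \<Rightarrow> complex" where
    "reg = (\<lambda>g. if g \<in> carrier G then of_nat (card {x \<in> carrier G. g \<otimes> x = x}) else 0)"
  have "reg \<in> ZM.span (irr_chars G)"
    unfolding reg_def using fin
    by (intro permutation_character_in_span_irr[OF G]) (auto simp: m_assoc)
  then obtain t r where t: "finite t" "t \<subseteq> irr_chars G" "reg = (\<Sum>a\<in>t. zscale (r a) a)"
    unfolding ZM.span_explicit by blast
  have reg: "reg g = (if g = \<one> then of_nat (card (carrier G)) else 0)" for g
  proof (cases "g = \<one> \<or> g \<notin> carrier G")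
    case True
    have "{x \<in> carrier G. \<one> \<otimes> x = x} = carrier G" by auto
    then show ?thesis using True by (auto simp: reg_def)
  next
    case False
    then have none: "{x \<in> carrier G. g \<otimes> x = x} = {}" by auto
    show ?thesis unfolding reg_def none using False by simp
  qed
  have "irr_chars G \<subseteq> t"
  proof
    fix \<chi> assume \<chi>: "\<chi> \<in> irr_chars G"
    then obtain m \<rho> where \<rho>: "irreducible_rep G m \<rho>" "\<chi> = character G m \<rho>" by (auto simp: irr_chars_def)
    have r: "matrix_rep G m \<rho>" and m: "m > 0" using \<rho> by (auto simp: irreducible_rep_def)
    have "\<chi> \<one> = of_nat m" using matrix_rep_one[OF G r] by (simp add: \<rho> character_def)
    moreover have "avg_form G \<chi> reg = (\<Sum>g\<in>carrier G. if g = \<one> then \<chi> \<one> * of_nat (card (carrier G)) else 0) / of_nat (card (carrier G))"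
      unfolding avg_form_def reg by (intro arg_cong2[of _ _ _ _ "(/)"] sum.cong refl) auto
    moreover have "\<dots> = \<chi> \<one>" using fin by auto
    ultimately have ne: "avg_form G \<chi> reg \<noteq> 0" using m by simp
    have "avg_form G \<chi> reg = (\<Sum>a\<in>t. of_int (r a) * avg_form G \<chi> a)"
    proof -
      have "avg_form G \<chi> reg = (\<Sum>g\<in>carrier G. \<Sum>a\<in>t. of_int (r a) * (\<chi> g * a (inv g))) / of_nat (card (carrier G))"
        unfolding avg_form_def t(3)
        by (simp add: sum_fun_apply zscale_def sum_distrib_left mult.left_commute)
      also have "\<dots> = (\<Sum>a\<in>t. of_int (r a) * avg_form G \<chi> a)"
        by (subst sum.swap) (simp add: avg_form_def sum_distrib_left sum_divide_distrib)
      finally show ?thesis .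
    qed
    then obtain a where "a \<in> t" "avg_form G \<chi> a \<noteq> 0"
      using ne by (metis (no_types, lifting) mult_zero_right sum.neutral)
    then show "\<chi> \<in> t" using irr_chars_orthonormal[OF G fin \<chi>, of a] t(2) by (auto split: if_splits)
  qed
  then show ?thesis using t(1) finite_subset by blast
qed

lemma avg_form_sum_left:
  "avg_form G (\<Sum>a\<in>A. qscale (r a) (f a)) \<psi> = (\<Sum>a\<in>A. of_rat (r a) * avg_form G (f a) \<psi>)"
proof -
  have "avg_form G (\<Sum>a\<in>A. qscale (r a) (f a)) \<psi>
      = (\<Sum>g\<in>carrier G. \<Sum>a\<in>A. of_rat (r a) * (f a g * \<psi> (inv\<^bsub>G\<^esub> g))) / of_nat (card (carrier G))"
    unfolding avg_form_def by (simp add: sum_fun_apply qscale_def sum_distrib_right mult.assoc)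
  also have "\<dots> = (\<Sum>a\<in>A. of_rat (r a) * avg_form G (f a) \<psi>)"
    by (subst sum.swap) (simp add: avg_form_def sum_distrib_left sum_divide_distrib)
  finally show ?thesis .
qed

lemma avg_form_sum_right:
  "avg_form G \<psi> (\<Sum>a\<in>A. qscale (r a) (f a)) = (\<Sum>a\<in>A. of_rat (r a) * avg_form G \<psi> (f a))"
proof -
  have "avg_form G \<psi> (\<Sum>a\<in>A. qscale (r a) (f a))
      = (\<Sum>g\<in>carrier G. \<Sum>a\<in>A. of_rat (r a) * (\<psi> g * f a (inv\<^bsub>G\<^esub> g))) / of_nat (card (carrier G))"
    unfolding avg_form_def by (simp add: sum_fun_apply qscale_def sum_distrib_left mult.left_commute)
  also have "\<dots> = (\<Sum>a\<in>A. of_rat (r a) * avg_form G \<psi> (f a))"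
    by (subst sum.swap) (simp add: avg_form_def sum_distrib_left sum_divide_distrib)
  finally show ?thesis .
qed

lemma independent_irr_chars:
  assumes G: "group G" and fin: "finite (carrier G)"
  shows "QM.independent (irr_chars G)"
proof -
  note finI = finite_irr_chars[OF assms]
  have "u \<chi> = 0" if u: "(\<Sum>v\<in>irr_chars G. qscale (u v) v) = 0" and \<chi>: "\<chi> \<in> irr_chars G" for u \<chi>
  proof -
    have "(0::complex) = avg_form G 0 \<chi>" by (simp add: avg_form_def)
    also have "\<dots> = (\<Sum>v\<in>irr_chars G. of_rat (u v) * avg_form G v \<chi>)"
      unfolding u[symmetric] avg_form_sum_left ..
    also have "\<dots> = (\<Sum>v\<in>irr_chars G. if v = \<chi> then of_rat (u \<chi>) else 0)"
      by (intro sum.cong refl) (simp add: irr_chars_orthonormal[OF assms _ \<chi>])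
    also have "\<dots> = of_rat (u \<chi>)" using finI \<chi> by simp
    finally show ?thesis by simp
  qed
  then show ?thesis unfolding QM.dependent_finite[OF finI] by blast
qed

lemma span_irr_expand:
  assumes "group G" "finite (carrier G)" "\<phi> \<in> QM.span (irr_chars G)"
  shows "(\<Sum>\<chi>\<in>irr_chars G. qscale (QM.representation (irr_chars G) \<phi> \<chi>) \<chi>) = \<phi>"
  by (rule QM.sum_representation_eq)
     (use independent_irr_chars[OF assms(1,2)] finite_irr_chars[OF assms(1,2)] assms(3) in auto)

lemma char_inner_eq_avg_form:
  assumes G: "group G" "finite (carrier G)" and \<phi>: "\<phi> \<in> QM.span (irr_chars G)" and \<psi>: "\<psi> \<in> QM.span (irr_chars G)"
  shows "of_rat (char_inner G \<phi> \<psi>) = avg_form G \<phi> \<psi>"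
proof -
  let ?I = "irr_chars G" and ?r = "QM.representation (irr_chars G)"
  note finI = finite_irr_chars[OF G]
  have "avg_form G \<phi> \<psi> = avg_form G (\<Sum>\<chi>\<in>?I. qscale (?r \<phi> \<chi>) \<chi>) (\<Sum>\<chi>\<in>?I. qscale (?r \<psi> \<chi>) \<chi>)"
    using span_irr_expand[OF G] \<phi> \<psi> by simp
  also have "\<dots> = (\<Sum>\<chi>\<in>?I. of_rat (?r \<phi> \<chi>) * (\<Sum>\<eta>\<in>?I. of_rat (?r \<psi> \<eta>) * avg_form G \<chi> \<eta>))"
    by (subst avg_form_sum_left, subst avg_form_sum_right) (rule refl)
  also have "\<dots> = (\<Sum>\<chi>\<in>?I. of_rat (?r \<phi> \<chi>) * (\<Sum>\<eta>\<in>?I. if \<eta> = \<chi> then of_rat (?r \<psi> \<chi>) else 0))"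
    by (intro sum.cong refl arg_cong2[of _ _ _ _ "(*)"]) (auto simp: irr_chars_orthonormal[OF G])
  also have "\<dots> = of_rat (char_inner G \<phi> \<psi>)"
    using finI by (simp add: char_inner_def of_rat_sum of_rat_mult)
  finally show ?thesis by simp
qed

lemma char_deg_eq_value_at_one:
  assumes G: "group G" "finite (carrier G)" and \<phi>: "\<phi> \<in> QM.span (irr_chars G)"
  shows "char_deg G \<phi> = \<phi> \<one>\<^bsub>G\<^esub>"
proof -
  have "\<phi> \<one>\<^bsub>G\<^esub> = (\<Sum>\<chi>\<in>irr_chars G. qscale (QM.representation (irr_chars G) \<phi> \<chi>) \<chi>) \<one>\<^bsub>G\<^esub>"
    using span_irr_expand[OF assms] by simp
  also have "\<dots> = char_deg G \<phi>" by (simp add: char_deg_def sum_fun_apply qscale_def)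
  finally show ?thesis by simp
qed

lemma ZM_span_subset_QM_span: "ZM.span S \<subseteq> QM.span S"
proof
  fix x assume "x \<in> ZM.span S"
  then obtain t r where t: "finite t" "t \<subseteq> S" "x = (\<Sum>a\<in>t. zscale (r a) a)"
    unfolding ZM.span_explicit by blast
  have "zscale c f = qscale (of_int c) f" for c :: int and f :: "'a \<Rightarrow> 'b"
    by (simp add: zscale_def qscale_def)
  with t have "x = (\<Sum>a\<in>t. qscale (of_int (r a)) a)" by simp
  then show "x \<in> QM.span S" using t(2)
    by (auto intro!: QM.span_sum QM.span_scale intro: QM.span_base)
qed

text \<open>
  The sum over \<open>g\<close>, \<open>x\<close>, \<open>y\<close> of \<open>[x\<inverse> g x \<in> H] [y\<inverse> g\<inverse> y \<in> K]\<close> depends on \<open>x\<close> and \<open>y\<close> only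
  through \<open>w = y\<inverse> x\<close>, after the substitution \<open>b = x\<inverse> g x\<close>; the second condition then says
  that some \<open>a\<close> in \<open>K\<close> satisfies \<open>a w b = w\<close>. The right hand side is the orbit counting expression for
  the action of \<open>K \<times> H\<close> on the group.
\<close>

lemma avg_form_induced_trivial:
  fixes G (structure)
  assumes G: "group G" and fin: "finite (carrier G)" and H: "subgroup H G" and K: "subgroup K G"
  shows "avg_form G (induced G H (\<lambda>_. 1)) (induced G K (\<lambda>_. 1)) =
    of_nat (\<Sum>w\<in>carrier G. card {(a, b) \<in> K \<times> H. a \<otimes> w \<otimes> b = w}) / (of_nat (card H) * of_nat (card K))"
proof -
  interpret group G by fact
  have HG: "H \<subseteq> carrier G" and KG: "K \<subseteq> carrier G" using H K by (auto dest: subgroup.subset)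
  have finH: "finite H" and finK: "finite K" using HG KG fin finite_subset by blast+
  have cancel: "inv x \<otimes> (x \<otimes> z) = z" "x \<otimes> (inv x \<otimes> z) = z" if "x \<in> carrier G" "z \<in> carrier G" for x z
    using that by (simp_all add: m_assoc[symmetric])
  define F where "F w = (\<Sum>b\<in>carrier G. of_bool (b \<in> H) * of_bool (w \<otimes> inv b \<otimes> inv w \<in> K) :: complex)" for w
  have ind: "induced G L (\<lambda>_. 1) g = (\<Sum>x\<in>carrier G. of_bool (inv x \<otimes> g \<otimes> x \<in> L)) / of_nat (card L)"
    if g: "g \<in> carrier G" for L g
  proof -
    have "of_nat (card {x \<in> carrier G. inv x \<otimes> g \<otimes> x \<in> L}) = (\<Sum>x\<in>{x \<in> carrier G. inv x \<otimes> g \<otimes> x \<in> L}. 1 :: complex)" by simp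
    also have "\<dots> = (\<Sum>x\<in>carrier G. if inv x \<otimes> g \<otimes> x \<in> L then 1 else 0)" by (rule sum.inter_filter[OF fin])
    also have "\<dots> = (\<Sum>x\<in>carrier G. of_bool (inv x \<otimes> g \<otimes> x \<in> L))" by (rule sum.cong) auto
    finally show ?thesis using g by (simp add: induced_def)
  qed
  have inner: "(\<Sum>g\<in>carrier G. of_bool (inv x \<otimes> g \<otimes> x \<in> H) * of_bool (inv y \<otimes> inv g \<otimes> y \<in> K)) = F (inv y \<otimes> x)"
    if x: "x \<in> carrier G" and y: "y \<in> carrier G" for x y
    unfolding F_def
  proof (rule sum.reindex_bij_witness[of _ "\<lambda>b. x \<otimes> b \<otimes> inv x" "\<lambda>g. inv x \<otimes> g \<otimes> x"])
    fix g assume g: "g \<in> carrier G"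
    show "x \<otimes> (inv x \<otimes> g \<otimes> x) \<otimes> inv x = g" using x g by (simp add: m_assoc inv_solve_left' r_inv) (simp add: m_assoc[symmetric])
    show "inv x \<otimes> g \<otimes> x \<in> carrier G" using x g by simp
    have "inv y \<otimes> x \<otimes> inv (inv x \<otimes> g \<otimes> x) \<otimes> inv (inv y \<otimes> x) = inv y \<otimes> (x \<otimes> inv x) \<otimes> inv g \<otimes> (x \<otimes> inv x) \<otimes> y"
      using x y g by (simp add: inv_mult_group m_assoc cancel)
    also have "\<dots> = inv y \<otimes> inv g \<otimes> y" using x y g by simp
    finally show "of_bool (inv x \<otimes> g \<otimes> x \<in> H) * of_bool (inv y \<otimes> x \<otimes> inv (inv x \<otimes> g \<otimes> x) \<otimes> inv (inv y \<otimes> x) \<in> K) =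
      of_bool (inv x \<otimes> g \<otimes> x \<in> H) * (of_bool (inv y \<otimes> inv g \<otimes> y \<in> K) :: complex)" by simp
  next
    fix b assume b: "b \<in> carrier G"
    have "inv x \<otimes> (x \<otimes> b \<otimes> inv x) \<otimes> x = (inv x \<otimes> x) \<otimes> b \<otimes> (inv x \<otimes> x)" using x b by (simp add: m_assoc cancel)
    then show "inv x \<otimes> (x \<otimes> b \<otimes> inv x) \<otimes> x = b" using x b by simp
    show "x \<otimes> b \<otimes> inv x \<in> carrier G" using x b by simp
  qed
  have Fcard: "F w = of_nat (card {(a, b) \<in> K \<times> H. a \<otimes> w \<otimes> b = w})" if w: "w \<in> carrier G" for w
  proof -
    have "F w = (\<Sum>b\<in>carrier G. if b \<in> H \<and> w \<otimes> inv b \<otimes> inv w \<in> K then 1 else 0)"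
      unfolding F_def by (rule sum.cong) auto
    also have "\<dots> = of_nat (card {b \<in> carrier G. b \<in> H \<and> w \<otimes> inv b \<otimes> inv w \<in> K})"
      using fin by (simp flip: sum.inter_filter)
    also have "card {b \<in> carrier G. b \<in> H \<and> w \<otimes> inv b \<otimes> inv w \<in> K} = card {(a, b) \<in> K \<times> H. a \<otimes> w \<otimes> b = w}"
    proof (rule bij_betw_same_card[of "\<lambda>b. (w \<otimes> inv b \<otimes> inv w, b)"])
      show "bij_betw (\<lambda>b. (w \<otimes> inv b \<otimes> inv w, b)) {b \<in> carrier G. b \<in> H \<and> w \<otimes> inv b \<otimes> inv w \<in> K} {(a, b) \<in> K \<times> H. a \<otimes> w \<otimes> b = w}"
      proof (rule bij_betw_imageI)
        show "inj_on (\<lambda>b. (w \<otimes> inv b \<otimes> inv w, b)) {b \<in> carrier G. b \<in> H \<and> w \<otimes> inv b \<otimes> inv w \<in> K}"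
          by (rule inj_onI) simp
        show "(\<lambda>b. (w \<otimes> inv b \<otimes> inv w, b)) ` {b \<in> carrier G. b \<in> H \<and> w \<otimes> inv b \<otimes> inv w \<in> K} = {(a, b) \<in> K \<times> H. a \<otimes> w \<otimes> b = w}"
        proof (intro equalityI subsetI)
          fix z assume "z \<in> (\<lambda>b. (w \<otimes> inv b \<otimes> inv w, b)) ` {b \<in> carrier G. b \<in> H \<and> w \<otimes> inv b \<otimes> inv w \<in> K}"
          then obtain b where b: "b \<in> carrier G" "b \<in> H" "w \<otimes> inv b \<otimes> inv w \<in> K" "z = (w \<otimes> inv b \<otimes> inv w, b)" by auto
          have "w \<otimes> inv b \<otimes> inv w \<otimes> w \<otimes> b = w \<otimes> inv b \<otimes> (inv w \<otimes> w) \<otimes> b" using w b(1) by (simp add: m_assoc)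
          also have "\<dots> = w" using w b(1) by (simp add: m_assoc)
          finally show "z \<in> {(a, b) \<in> K \<times> H. a \<otimes> w \<otimes> b = w}" using b by simp
        next
          fix z assume "z \<in> {(a, b) \<in> K \<times> H. a \<otimes> w \<otimes> b = w}"
          then obtain a b where z: "z = (a, b)" "a \<in> K" "b \<in> H" "a \<otimes> w \<otimes> b = w" by auto
          have ab: "a \<in> carrier G" "b \<in> carrier G" using z HG KG by auto
          have "w \<otimes> inv b \<otimes> inv w = (a \<otimes> w \<otimes> b) \<otimes> inv b \<otimes> inv w" using z(4) by simp
          also have "\<dots> = a \<otimes> (w \<otimes> (b \<otimes> inv b) \<otimes> inv w)" using ab w by (simp only: m_assoc m_closed inv_closed)
          also have "\<dots> = a" using ab w by simp
          finally have "w \<otimes> inv b \<otimes> inv w = a" .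
          then show "z \<in> (\<lambda>b. (w \<otimes> inv b \<otimes> inv w, b)) ` {b \<in> carrier G. b \<in> H \<and> w \<otimes> inv b \<otimes> inv w \<in> K}"
            using z ab by (intro image_eqI[of _ _ b]) auto
        qed
      qed
    qed
    finally show ?thesis .
  qed
  let ?h = "of_nat (card H) :: complex" and ?k = "of_nat (card K) :: complex" and ?g = "of_nat (card (carrier G)) :: complex"
  have "(\<Sum>g\<in>carrier G. induced G H (\<lambda>_. 1) g * induced G K (\<lambda>_. 1) (inv g))
     = (\<Sum>g\<in>carrier G. (\<Sum>x\<in>carrier G. \<Sum>y\<in>carrier G. of_bool (inv x \<otimes> g \<otimes> x \<in> H) * of_bool (inv y \<otimes> inv g \<otimes> y \<in> K))) / (?h * ?k)"
    by (simp add: ind sum_product sum_divide_distrib)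
  also have "(\<Sum>g\<in>carrier G. (\<Sum>x\<in>carrier G. \<Sum>y\<in>carrier G. of_bool (inv x \<otimes> g \<otimes> x \<in> H) * of_bool (inv y \<otimes> inv g \<otimes> y \<in> K)))
     = (\<Sum>x\<in>carrier G. \<Sum>g\<in>carrier G. \<Sum>y\<in>carrier G. of_bool (inv x \<otimes> g \<otimes> x \<in> H) * (of_bool (inv y \<otimes> inv g \<otimes> y \<in> K) :: complex))"
    by (rule sum.swap)
  also have "\<dots> = (\<Sum>x\<in>carrier G. \<Sum>y\<in>carrier G. \<Sum>g\<in>carrier G. of_bool (inv x \<otimes> g \<otimes> x \<in> H) * of_bool (inv y \<otimes> inv g \<otimes> y \<in> K))"
    by (intro sum.cong refl sum.swap)
  also have "\<dots> = (\<Sum>x\<in>carrier G. \<Sum>y\<in>carrier G. F (inv y \<otimes> x))"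
    by (intro sum.cong refl inner)
  also have "\<dots> = (\<Sum>y\<in>carrier G. \<Sum>x\<in>carrier G. F (inv y \<otimes> x))" by (rule sum.swap)
  also have "\<dots> = (\<Sum>y\<in>carrier G. \<Sum>w\<in>carrier G. F w)"
    by (intro sum.cong refl sum_group_shift[OF G]) simp
  also have "\<dots> = ?g * of_nat (\<Sum>w\<in>carrier G. card {(a, b) \<in> K \<times> H. a \<otimes> w \<otimes> b = w})"
    by (simp add: Fcard)
  finally have e: "(\<Sum>g\<in>carrier G. induced G H (\<lambda>_. 1) g * induced G K (\<lambda>_. 1) (inv g))
     = ?g * of_nat (\<Sum>w\<in>carrier G. card {(a, b) \<in> K \<times> H. a \<otimes> w \<otimes> b = w}) / (?h * ?k)" .
  have "?g \<noteq> 0" using fin by auto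
  then show ?thesis unfolding avg_form_def e by simp
qed

section \<open>Row insertion\<close>

definition ins_pos :: "int \<Rightarrow> int list \<Rightarrow> nat" where
  "ins_pos x r = length (takeWhile (\<lambda>y. \<not> x < y) r)"

lemma insert_row_eq:
  "insert_row x r = (if ins_pos x r < length r then (r[ins_pos x r := x], Some (r ! ins_pos x r)) else (r @ [x], None))"
  by (induction r) (auto simp: ins_pos_def)

lemma ins_pos_le: "ins_pos x r \<le> length r"
  unfolding ins_pos_def by (rule length_takeWhile_le)

lemma ins_pos_less: "j < ins_pos x r \<Longrightarrow> r ! j \<le> x"
  using set_takeWhileD[of "r ! j" "\<lambda>y. \<not> x < y" r]
  unfolding ins_pos_def by (metis not_less nth_mem takeWhile_nth)

lemma ins_pos_ge:
  assumes "sorted_wrt (<) r" "ins_pos x r \<le> j" "j < length r"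
  shows "x < r ! j"
proof -
  have t: "ins_pos x r < length r" using assms by linarith
  then have "x < r ! ins_pos x r" using nth_length_takeWhile[of "\<lambda>y. \<not> x < y" r] by (simp add: ins_pos_def)
  moreover have "r ! ins_pos x r \<le> r ! j"
    using assms t sorted_wrt_nth_less[of "(<)" r "ins_pos x r" j]
    by (cases "ins_pos x r = j") auto
  ultimately show ?thesis by linarith
qed

lemma ins_pos_eqI:
  assumes "t \<le> length r" "\<And>j. j < t \<Longrightarrow> r ! j \<le> x" "t < length r \<Longrightarrow> x < r ! t"
  shows "ins_pos x r = t"
  unfolding ins_pos_def
  by (subst takeWhile_eq_take_P_nth[of t]) (use assms in \<open>auto simp: not_less\<close>)

text \<open>
  Insertion into \<open>P\<close> alone, together with the row in which it grows. Unlike \<open>rs_insert\<close> it keeps the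
  recording tableau out of the inductions.
\<close>

fun ins :: "int \<Rightarrow> tableau \<Rightarrow> tableau \<times> nat" where
  "ins x [] = ([[x]], 0)"
| "ins x (r # P) = (case insert_row x r of
      (r', None) \<Rightarrow> (r' # P, 0)
    | (r', Some y) \<Rightarrow> (case ins y P of (P', k) \<Rightarrow> (r' # P', Suc k)))"

lemma ins_Cons_end:
  "ins_pos x r = length r \<Longrightarrow> ins x (r # P) = ((r @ [x]) # P, 0)"
  by (simp add: insert_row_eq)

lemma ins_Cons_bump:
  "ins_pos x r < length r \<Longrightarrow>
   ins x (r # P) = (r[ins_pos x r := x] # fst (ins (r ! ins_pos x r) P), Suc (snd (ins (r ! ins_pos x r) P)))"
  by (simp add: insert_row_eq split: prod.split)

declare ins.simps(2) [simp del]

definition add_at :: "nat \<Rightarrow> int \<Rightarrow> tableau \<Rightarrow> tableau" where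
  "add_at k p Q = (if k < length Q then Q[k := Q ! k @ [p]] else Q @ [[p]])"

definition grow :: "nat \<Rightarrow> nat list \<Rightarrow> nat list" where
  "grow k \<mu> = (if k < length \<mu> then \<mu>[k := Suc (\<mu> ! k)] else \<mu> @ [1])"

lemma rs_insert_eq_ins:
  "length P = length Q \<Longrightarrow> rs_insert x p P Q = (fst (ins x P), add_at (snd (ins x P)) p Q)"
proof (induction P arbitrary: x Q)
  case Nil
  then show ?case by (simp add: add_at_def)
next
  case (Cons r P)
  then obtain q Q' where Q: "Q = q # Q'" "length P = length Q'" by (cases Q) auto
  show ?case
  proof (cases "ins_pos x r < length r")
    case True
    then show ?thesis using Cons.IH[OF Q(2), of "r ! ins_pos x r"] Q(1)
      by (simp add: insert_row_eq ins.simps(2) add_at_def split: prod.split)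
  qed (simp add: insert_row_eq ins.simps(2) Q add_at_def)
qed

lemma map_length_add_at: "map length (add_at k p Q) = grow k (map length Q)"
  by (auto simp: add_at_def grow_def map_update)

lemma ins_shape:
  "snd (ins x P) \<le> length P \<and> map length (fst (ins x P)) = grow (snd (ins x P)) (map length P)"
proof (induction P arbitrary: x)
  case (Cons r P)
  show ?case
  proof (cases "ins_pos x r < length r")
    case True
    then show ?thesis using Cons.IH[of "r ! ins_pos x r"]
      by (auto simp: insert_row_eq ins.simps(2) grow_def split: prod.split)
  qed (simp add: insert_row_eq ins.simps(2) grow_def)
qed (simp add: grow_def)

lemma mset_concat_ins: "mset (concat (fst (ins x P))) = add_mset x (mset (concat P))"
proof (induction P arbitrary: x)
  case (Cons r P)
  show ?case
  proof (cases "ins_pos x r < length r")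
    case True
    then have "r ! ins_pos x r \<in># mset r" by simp
    then obtain M where M: "mset r = add_mset (r ! ins_pos x r) M" by (meson multi_member_split)
    have "mset (r[ins_pos x r := x]) = add_mset x M" using True M by (simp add: mset_update)
    then show ?thesis using True Cons.IH[of "r ! ins_pos x r"] M
      by (simp add: ins_Cons_bump)
  next
    case False
    then show ?thesis using ins_pos_le[of x r] by (simp add: ins_Cons_end)
  qed
qed simp

lemma mset_concat_add_at: "mset (concat (add_at k p Q)) = add_mset p (mset (concat Q))"
proof (induction Q arbitrary: k)
  case (Cons q Q)
  then show ?case
  proof (cases k)
    case (Suc k')
    have "add_at k p (q # Q) = q # add_at k' p Q" by (simp add: add_at_def Suc)
    then show ?thesis using Cons.IH[of k'] by simp
  qed (simp add: add_at_def)
qed (simp add: add_at_def)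

text \<open>
  \<open>r\<close> may be put on top of \<open>P\<close>. This turns the global condition on columns into one on adjacent rows.
\<close>

definition rows_fit :: "int list \<Rightarrow> tableau \<Rightarrow> bool" where
  "rows_fit r P \<longleftrightarrow> (P \<noteq> [] \<longrightarrow> length (hd P) \<le> length r \<and> (\<forall>k<length (hd P). r ! k < hd P ! k))"

lemma tableau_Nil [simp]: "tableau []" by (simp add: tableau_def int_partition_def)

lemma tableau_Cons:
  "tableau (r # P) \<longleftrightarrow> r \<noteq> [] \<and> sorted_wrt (<) r \<and> tableau P \<and> rows_fit r P"
proof
  assume t: "tableau (r # P)"
  have col: "(r # P) ! i ! k < (r # P) ! j ! k" if "i < j" "j < length (r # P)" "k < length ((r # P) ! j)" for i j k
    using t that unfolding tableau_def by blast
  have "tableau P" unfolding tableau_def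
  proof (intro conjI allI impI)
    show "int_partition (map length P)" "\<forall>r\<in>set P. sorted_wrt (<) r" using t by (auto simp: tableau_def int_partition_def)
    show "P ! i ! k < P ! j ! k" if "i < j \<and> j < length P \<and> k < length (P ! j)" for i j k
      using col[of "Suc i" "Suc j" k] that by simp
  qed
  moreover have "rows_fit r P"
  proof (cases P)
    case (Cons q P')
    then show ?thesis using t col[of 0 1] by (auto simp: rows_fit_def tableau_def int_partition_def)
  qed (simp add: rows_fit_def)
  ultimately show "r \<noteq> [] \<and> sorted_wrt (<) r \<and> tableau P \<and> rows_fit r P"
    using t by (auto simp: tableau_def int_partition_def)
next
  assume t: "r \<noteq> [] \<and> sorted_wrt (<) r \<and> tableau P \<and> rows_fit r P"
  show "tableau (r # P)"
  proof (cases P)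
    case Nil
    then show ?thesis using t by (simp add: tableau_def int_partition_def)
  next
    case (Cons q P')
    have ab: "length q \<le> length r" "\<And>k. k < length q \<Longrightarrow> r ! k < q ! k" using t Cons by (auto simp: rows_fit_def)
    have len: "length s \<le> length q" if "s \<in> set P" for s
      using t that Cons by (auto simp: tableau_def int_partition_def)
    show ?thesis unfolding tableau_def
    proof (intro conjI allI impI)
      show "int_partition (map length (r # P))"
        using t len ab by (force simp: tableau_def int_partition_def)
      show "\<forall>s\<in>set (r # P). sorted_wrt (<) s" using t by (simp add: tableau_def)
      fix i j k assume a: "i < j \<and> j < length (r # P) \<and> k < length ((r # P) ! j)"
      then obtain j' where j: "j = Suc j'" by (cases j) auto
      have colP: "P ! i ! k < P ! j ! k" if "i < j" "j < length P" "k < length (P ! j)" for i j k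
        using t that unfolding tableau_def by blast
      have j': "j' < length P" "k < length (P ! j')" using a j by auto
      show "(r # P) ! i ! k < (r # P) ! j ! k"
      proof (cases i)
        case (Suc i')
        then show ?thesis using colP[of i' j' k] a j by simp
      next
        case 0
        have kq: "k < length q" using len[of "P ! j'"] j' by auto
        have "q ! k \<le> P ! j' ! k"
          using colP[of 0 j' k] j' Cons by (cases j') auto
        then show ?thesis using ab(2)[OF kq] 0 j by simp
      qed
    qed
  qed
qed

text \<open>
  The bumped letter \<open>r ! t\<close> enters the next row at a column \<open>\<le> t\<close>, where after the replacement the letters above are
  smaller than it.
\<close>

lemma rows_fit_ins:
  assumes r: "sorted_wrt (<) r" and ab: "rows_fit r P" and P: "tableau P"
    and t: "t = ins_pos x r" "t < length r"
  shows "rows_fit (r[t := x]) (fst (ins (r ! t) P))"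
proof -
  let ?y = "r ! t" and ?r' = "r[t := x]"
  have xy: "x < ?y" using ins_pos_ge[OF r, of x t] t by simp
  have r'le: "?r' ! k \<le> r ! k" if "k < length r" for k using xy that by (cases "k = t") auto
  have r's: "?r' ! s < ?y" if "s \<le> t" for s
    using xy that t sorted_wrt_nth_less[OF r, of s t] by (cases "s = t") auto
  show ?thesis
  proof (cases P)
    case Nil
    then show ?thesis using r's[of 0] t by (auto simp: rows_fit_def)
  next
    case (Cons q P')
    have q: "sorted_wrt (<) q" using P Cons by (simp add: tableau_Cons)
    have lq: "length q \<le> length r" and rq: "\<And>k. k < length q \<Longrightarrow> r ! k < q ! k"
      using ab Cons by (auto simp: rows_fit_def)
    define s where "s = ins_pos ?y q"
    have st: "s \<le> t"
    proof (rule ccontr)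
      assume "\<not> s \<le> t"
      then have ts: "t < s" by simp
      then have "q ! t \<le> ?y" using ins_pos_less[of t ?y q] s_def by simp
      moreover have "t < length q" using ts ins_pos_le[of ?y q] s_def by simp
      ultimately show False using rq[of t] by simp
    qed
    show ?thesis
    proof (cases "s < length q")
      case True
      have "?r' ! k < q[s := ?y] ! k" if "k < length q" for k
        using r's[OF st] rq[OF that] r'le[of k] that lq by (cases "k = s") auto
      then show ?thesis using True lq Cons by (simp add: rows_fit_def ins_Cons_bump s_def)
    next
      case False
      then have s: "s = length q" using ins_pos_le[of ?y q] by (simp add: s_def)
      have "?r' ! k < (q @ [?y]) ! k" if "k < Suc (length q)" for k
        using r's[OF st] rq[of k] r'le[of k] that lq s by (cases "k = s") (auto simp: nth_append)
      then show ?thesis using s st t Cons by (simp add: rows_fit_def ins_Cons_end s_def)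
    qed
  qed
qed

lemma sorted_wrt_list_update:
  fixes r :: "int list"
  assumes "sorted_wrt (<) r" "t < length r" "\<And>j. j < t \<Longrightarrow> r ! j < x" "\<And>j. t < j \<Longrightarrow> j < length r \<Longrightarrow> x < r ! j"
  shows "sorted_wrt (<) (r[t := x])"
  unfolding sorted_wrt_iff_nth_less
proof (intro allI impI)
  fix i j assume ij: "i < j" "j < length (r[t := x])"
  then have "r ! i < r ! j" using sorted_wrt_nth_less[OF assms(1), of i j] by simp
  then show "r[t := x] ! i < r[t := x] ! j" using ij assms by (auto simp: nth_list_update)
qed

lemma tableau_ins:
  "tableau P \<Longrightarrow> distinct (x # concat P) \<Longrightarrow> tableau (fst (ins x P))"
proof (induction P arbitrary: x)
  case Nil
  then show ?case by (simp add: tableau_Cons rows_fit_def)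
next
  case (Cons r P)
  have r: "r \<noteq> []" "sorted_wrt (<) r" "tableau P" "rows_fit r P" using Cons.prems by (auto simp: tableau_Cons)
  define t where "t = ins_pos x r"
  have xr: "x \<notin> set r" using Cons.prems by auto
  have lt: "r ! j < x" if "j < t" for j
    using ins_pos_less[of j x r] that xr ins_pos_le[of x r] nth_mem[of j r] unfolding t_def
    by (metis le_neq_trans less_le_trans order_le_less)
  show ?case
  proof (cases "t < length r")
    case True
    let ?y = "r ! t"
    have "?y \<in> set r" using True by simp
    then have "distinct (?y # concat P)" using Cons.prems by auto
    then have IH: "tableau (fst (ins ?y P))" using Cons.IH r by blast
    have "sorted_wrt (<) (r[t := x])"
      by (rule sorted_wrt_list_update[OF r(2) True lt]) (use ins_pos_ge[OF r(2), of x] t_def in auto)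
    then show ?thesis using IH r rows_fit_ins[OF r(2,4,3) t_def True] True
      by (simp add: ins_Cons_bump tableau_Cons flip: t_def)
  next
    case False
    then have t: "t = length r" using ins_pos_le[of x r] by (simp add: t_def)
    have "sorted_wrt (<) (r @ [x])"
      using r(2) lt t by (auto simp: sorted_wrt_append in_set_conv_nth)
    moreover have "rows_fit (r @ [x]) P" using r(4) by (auto simp: rows_fit_def nth_append)
    ultimately show ?thesis using r t by (simp add: ins_Cons_end tableau_Cons t_def)
  qed
qed

text \<open>
  The inserted letter stands in the first row of the result, at its insertion position, and insertion only
  decreases the letters of that row. This is what inverse insertion has to know of the lower rows.
\<close>

lemma hd_ins:
  assumes "tableau P"
  shows "\<exists>s<length (hd (fst (ins y P))). hd (fst (ins y P)) ! s = y \<and>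
     (P \<noteq> [] \<longrightarrow> s = ins_pos y (hd P) \<and> length (hd P) \<le> length (hd (fst (ins y P))) \<and>
      (\<forall>k<length (hd P). hd (fst (ins y P)) ! k \<le> hd P ! k))"
proof (cases P)
  case (Cons q P')
  have q: "sorted_wrt (<) q" using assms Cons by (simp add: tableau_Cons)
  show ?thesis
  proof (cases "ins_pos y q < length q")
    case True
    then show ?thesis using ins_pos_ge[OF q, of y "ins_pos y q"]
      by (intro exI[of _ "ins_pos y q"]) (auto simp: Cons ins_Cons_bump nth_list_update)
  next
    case False
    then have "ins_pos y q = length q" using ins_pos_le[of y q] by simp
    then show ?thesis
      by (intro exI[of _ "ins_pos y q"]) (auto simp: Cons ins_Cons_end nth_append)
  qed
qed simp

text \<open>
  Inverse insertion: the letter at the end of row \<open>k\<close> is removed and moves upwards, in each row taking the place of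
  the largest smaller letter. Row \<open>k\<close> must end in a corner of the shape.
\<close>

lemma ins_surj:
  "tableau P' \<Longrightarrow> distinct (concat P') \<Longrightarrow> k < length P' \<Longrightarrow>
   (Suc k < length P' \<Longrightarrow> length (P' ! Suc k) < length (P' ! k)) \<Longrightarrow>
   \<exists>P x. tableau P \<and> ins x P = (P', k)"
proof (induction P' arbitrary: k)
  case (Cons r' R')
  have r': "r' \<noteq> []" "sorted_wrt (<) r'" "tableau R'" "rows_fit r' R'" using Cons.prems by (auto simp: tableau_Cons)
  show ?case
  proof (cases k)
    case 0
    define x where "x = last r'"
    define r where "r = butlast r'"
    have rx: "r' = r @ [x]" using r' by (simp add: r_def x_def)
    show ?thesis
    proof (cases "r = []")
      case True
      have "R' = []"
      proof (rule ccontr)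
        assume "R' \<noteq> []"
        then obtain q R where q: "R' = q # R" by (cases R') auto
        then have "length q < 1" using Cons.prems(4) 0 rx True by simp
        then show False using r'(3) q by (simp add: tableau_Cons)
      qed
      then have "ins x [] = (r' # R', k)" using rx True 0 by simp
      then show ?thesis using tableau_Nil by blast
    next
      case False
      have "sorted_wrt (<) r" "\<And>z. z \<in> set r \<Longrightarrow> z < x" using r'(2) unfolding rx by (auto simp: sorted_wrt_append)
      moreover have "ins_pos x r = length r"
        by (rule ins_pos_eqI) (use calculation(2) nth_mem in \<open>auto intro: less_imp_le\<close>)
      moreover have "rows_fit r R'"
      proof (cases R')
        case (Cons q R)
        have "length q < length r'" using Cons.prems(4) 0 Cons by simp
        then show ?thesis using r'(4) Cons unfolding rx rows_fit_def by (auto simp: nth_append)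
      qed (simp add: rows_fit_def)
      ultimately have "tableau (r # R')" "ins x (r # R') = (r' # R', k)"
        using False r'(3) 0 rx by (auto simp: tableau_Cons ins_Cons_end)
      then show ?thesis by blast
    qed
  next
    case (Suc k')
    have "\<exists>R y. tableau R \<and> ins y R = (R', k')"
      by (rule Cons.IH) (use r' Cons.prems Suc in auto)
    then obtain R y where R: "tableau R" "ins y R = (R', k')" by blast
    have fR: "fst (ins y R) = R'" using R(2) by simp
    obtain s where s: "s < length (hd R')" "hd R' ! s = y"
      "R \<noteq> [] \<Longrightarrow> s = ins_pos y (hd R) \<and> length (hd R) \<le> length (hd R') \<and> (\<forall>k<length (hd R). hd R' ! k \<le> hd R ! k)"
      using hd_ins[OF R(1), of y] unfolding fR by blast
    have R'ne: "R' \<noteq> []" using Cons.prems(3) Suc by auto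
    have ab: "length (hd R') \<le> length r'" "\<And>k. k < length (hd R') \<Longrightarrow> r' ! k < hd R' ! k"
      using r'(4) R'ne by (auto simp: rows_fit_def)
    have yR: "y \<in> set (concat R')"
      using s(1,2) R'ne by (metis concat.simps(2) hd_Cons_tl in_set_conv_decomp nth_mem set_append UnI1 list.exhaust_sel)
    \<comment> \<open>\<open>c - 1\<close> is the last position with a letter smaller than \<open>y\<close>, which \<open>y\<close> takes back\<close>
    define c where "c = length (takeWhile (\<lambda>z. z < y) r')"
    have cl: "c \<le> length r'" by (simp add: c_def length_takeWhile_le)
    have c1: "r' ! j < y" if "j < c" for j
      using that set_takeWhileD[of "r' ! j" "\<lambda>z. z < y" r'] unfolding c_def by (metis nth_mem takeWhile_nth)
    have c2: "y \<le> r' ! c" if "c < length r'"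
      using nth_length_takeWhile[of "\<lambda>z. z < y" r'] that by (simp add: c_def)
    have sc: "s < c"
    proof (rule ccontr)
      assume "\<not> s < c"
      then have cs: "c \<le> s" by simp
      have sl: "s < length r'" using s(1) ab(1) by simp
      have "r' ! c \<le> r' ! s" using cs sl sorted_wrt_nth_less[OF r'(2), of c s] by (cases "c = s") auto
      then show False using ab(2)[OF s(1)] s(2) c2 cs sl by simp
    qed
    define t where "t = c - 1"
    have t: "t < length r'" "Suc t = c" "s \<le> t" using sc cl by (auto simp: t_def)
    define x where "x = r' ! t"
    define r where "r = r'[t := y]"
    have xy: "x < y" using c1[of t] t by (simp add: x_def)
    have lr: "length r = length r'" by (simp add: r_def)
    have srt: "sorted_wrt (<) r" unfolding r_def
    proof (rule sorted_wrt_list_update[OF r'(2) t(1)])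
      show "r' ! j < y" if "j < t" for j using c1[of j] that t by simp
      fix j assume j: "t < j" "j < length r'"
      have "r' ! j \<noteq> y"
      proof
        assume "r' ! j = y"
        then have "y \<in> set r'" using j nth_mem by metis
        then show False using Cons.prems(2) yR by auto
      qed
      moreover have "r' ! c \<le> r' ! j" using j t sorted_wrt_nth_less[OF r'(2), of c j] by (cases "c = j") auto
      ultimately show "y < r' ! j" using c2 j t by simp
    qed
    have pos: "ins_pos x r = t"
    proof (rule ins_pos_eqI)
      show "t \<le> length r" using t lr by simp
      show "r ! j \<le> x" if "j < t" for j
        using sorted_wrt_nth_less[OF r'(2), of j t] that t by (simp add: r_def x_def)
      show "x < r ! t" using xy t by (simp add: r_def)
    qed
    have restore: "r[t := x] = r'" "r ! t = y" using t by (auto simp: r_def x_def)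
    have "rows_fit r R"
    proof (cases "R = []")
      case False
      have "r ! j < hd R ! j" if j: "j < length (hd R)" for j
      proof (cases "j = t")
        case True
        have "sorted_wrt (<) (hd R)" using R(1) False by (cases R) (auto simp: tableau_Cons)
        then have "y < hd R ! t" using ins_pos_ge[of "hd R" y t] s(3)[OF False] t j True by simp
        then show ?thesis using True restore by simp
      next
        case ne: False
        have "r ! j = r' ! j" using ne by (simp add: r_def)
        moreover have "j < length (hd R')" using s(3)[OF False] j by simp
        ultimately show ?thesis using ab(2)[of j] s(3)[OF False] j by force
      qed
      then show ?thesis using s(3)[OF False] ab(1) lr by (simp add: rows_fit_def)
    qed (simp add: rows_fit_def)
    then have "tableau (r # R)" using srt R(1) t lr by (auto simp: tableau_Cons)
    moreover have "ins x (r # R) = (r' # R', k)"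
      using ins_Cons_bump[of x r R] pos t lr restore R(2) Suc by simp
    ultimately show ?thesis by blast
  qed
qed simp

text \<open>
  In each row the position of the bump can be read off from the result: two different positions would give
  bumped letters that violate the order of the row.
\<close>

lemma ins_inj:
  "ins x1 P1 = ins x2 P2 \<Longrightarrow> tableau P1 \<Longrightarrow> tableau P2 \<Longrightarrow> x1 = x2 \<and> P1 = P2"
proof (induction P1 arbitrary: x1 x2 P2)
  case Nil
  show ?case
  proof (cases P2)
    case (Cons r2 R2)
    then have "r2 \<noteq> []" using Nil.prems by (simp add: tableau_Cons)
    then show ?thesis using Nil.prems(1) Cons ins_pos_le[of x2 r2]
      by (cases "ins_pos x2 r2 < length r2") (auto simp: insert_row_eq ins.simps(2) split: prod.splits)
  qed (use Nil in auto)
next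
  case (Cons r1 R1)
  have r1: "r1 \<noteq> []" "sorted_wrt (<) r1" "tableau R1" using Cons.prems by (auto simp: tableau_Cons)
  show ?case
  proof (cases P2)
    case Nil
    then show ?thesis using Cons.prems(1) r1 ins_pos_le[of x1 r1]
      by (cases "ins_pos x1 r1 < length r1") (auto simp: insert_row_eq ins.simps(2) split: prod.splits)
  next
    case P2: (Cons r2 R2)
    have r2: "r2 \<noteq> []" "sorted_wrt (<) r2" "tableau R2" using Cons.prems P2 by (auto simp: tableau_Cons)
    define t1 t2 where "t1 = ins_pos x1 r1" and "t2 = ins_pos x2 r2"
    have end1: "t1 = length r1" if "\<not> t1 < length r1" using that ins_pos_le[of x1 r1] by (simp add: t1_def)
    have end2: "t2 = length r2" if "\<not> t2 < length r2" using that ins_pos_le[of x2 r2] by (simp add: t2_def)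
    show ?thesis
    proof (cases "t1 < length r1")
      case b1: True
      show ?thesis
      proof (cases "t2 < length r2")
        case b2: True
        have e: "r1[t1 := x1] = r2[t2 := x2]" "ins (r1 ! t1) R1 = ins (r2 ! t2) R2"
          using Cons.prems(1) b1 b2 unfolding P2 by (auto simp: ins_Cons_bump t1_def t2_def prod_eq_iff)
        have y: "r1 ! t1 = r2 ! t2" and R: "R1 = R2" using Cons.IH[OF e(2) r1(3) r2(3)] by auto
        have l: "length r1 = length r2" using arg_cong[OF e(1), of length] by simp
        have x1: "x1 < r1 ! t1" using ins_pos_ge[OF r1(2), of x1 t1] b1 by (simp add: t1_def)
        have x2: "x2 < r2 ! t2" using ins_pos_ge[OF r2(2), of x2 t2] b2 by (simp add: t2_def)
        have "\<not> t1 < t2"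
        proof
          assume lt: "t1 < t2"
          have "x2 = r1[t1 := x1] ! t2" using e(1) b2 by simp
          also have "\<dots> = r1 ! t2" using lt by simp
          also have "\<dots> > r1 ! t1" using sorted_wrt_nth_less[OF r1(2) lt] b2 l by simp
          finally show False using x2 y by simp
        qed
        moreover have "\<not> t2 < t1"
        proof
          assume lt: "t2 < t1"
          have "x1 = r2[t2 := x2] ! t1" using e(1)[symmetric] b1 by simp
          also have "\<dots> = r2 ! t1" using lt by simp
          also have "\<dots> > r2 ! t2" using sorted_wrt_nth_less[OF r2(2) lt] b1 l by simp
          finally show False using x1 y by simp
        qed
        ultimately have t: "t1 = t2" by simp
        have "x1 = x2" using arg_cong[OF e(1), of "\<lambda>r. r ! t1"] b1 b2 t by simp
        moreover have "r1 = r2"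
          using arg_cong[OF e(1), of "\<lambda>r. r[t1 := r1 ! t1]"] y t by simp
        ultimately show ?thesis using R P2 by simp
      next
        case False
        then show ?thesis using Cons.prems(1) b1 end2 unfolding P2
          by (simp add: ins_Cons_bump ins_Cons_end t1_def t2_def)
      qed
    next
      case False
      note e1 = end1[OF False]
      show ?thesis
      proof (cases "t2 < length r2")
        case True
        then show ?thesis using Cons.prems(1) e1 unfolding P2
          by (simp add: ins_Cons_bump ins_Cons_end t1_def t2_def)
      next
        case False
        then show ?thesis using Cons.prems(1) e1 end2 unfolding P2
          by (simp add: ins_Cons_end t1_def t2_def)
      qed
    qed
  qed
qed

text \<open>
  The row bumping lemma. If \<open>x < y\<close> then in each row \<open>y\<close> goes strictly to the right of \<open>x\<close> and bumps a larger letter,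
  so its path ends in no lower row; if \<open>y < x\<close> it stays weakly to the left and ends in a lower row.
\<close>

lemma ins_consecutive:
  "tableau P \<Longrightarrow> distinct (x # y # concat P) \<Longrightarrow>
   snd (ins y (fst (ins x P))) \<le> snd (ins x P) \<longleftrightarrow> x < y"
proof (induction P arbitrary: x y)
  case Nil
  then show ?case by (auto simp: ins.simps(2))
next
  case (Cons r P)
  have r: "r \<noteq> []" "sorted_wrt (<) r" "tableau P" using Cons.prems by (auto simp: tableau_Cons)
  define t where "t = ins_pos x r"
  have xy: "x \<noteq> y" using Cons.prems by auto
  show ?case
  proof (cases "t < length r")
    case False
    then have t: "t = length r" using ins_pos_le[of x r] by (simp add: t_def)
    have rx: "r ! j \<le> x" if "j < length r" for j using ins_pos_less[of j x r] that t by (simp add: t_def)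
    have i: "ins x (r # P) = ((r @ [x]) # P, 0)" using t by (simp add: ins_Cons_end t_def)
    show ?thesis
    proof (cases "x < y")
      case True
      have "ins_pos y (r @ [x]) = length (r @ [x])"
        by (rule ins_pos_eqI) (use True rx in \<open>force simp: nth_append less_Suc_eq\<close>)+
      then show ?thesis using True i by (simp add: ins_Cons_end)
    next
      case False
      have "ins_pos y (r @ [x]) < length (r @ [x])"
      proof (rule ccontr)
        assume "\<not> ?thesis"
        then have "length r < ins_pos y (r @ [x])" by simp
        from ins_pos_less[OF this] have "x \<le> y" by simp
        then show False using False xy by simp
      qed
      then show ?thesis using False i by (simp add: ins_Cons_bump del: length_append)
    qed
  next
    case True
    let ?a = "r ! t" and ?r' = "r[t := x]"
    have i: "ins x (r # P) = (?r' # fst (ins ?a P), Suc (snd (ins ?a P)))"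
      using True by (simp add: ins_Cons_bump t_def)
    have xa: "x < ?a" using ins_pos_ge[OF r(2), of x t] True by (simp add: t_def)
    have ar: "?a \<in> set r" using True by simp
    have r'x: "?r' ! j \<le> x" if "j \<le> t" for j
      using ins_pos_less[of j x r] that True by (cases "j = t") (auto simp: t_def)
    have xr: "x \<notin> set r" using Cons.prems by simp
    have lt: "r ! j < x" if "j < t" for j
      using ins_pos_less[of j x r] that xr True nth_mem[of j r] unfolding t_def
      by (metis le_neq_trans less_trans order_le_less)
    have s': "sorted_wrt (<) ?r'"
      by (rule sorted_wrt_list_update[OF r(2) True lt]) (use ins_pos_ge[OF r(2), of x] t_def in auto)
    define s where "s = ins_pos y ?r'"
    show ?thesis
    proof (cases "x < y")
      case xy: True
      have ts: "t < s"
      proof (rule ccontr)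
        assume "\<not> t < s"
        then have "y < ?r' ! t" using ins_pos_ge[OF s', of y t] True by (simp add: s_def)
        then show False using r'x[of t] xy by simp
      qed
      show ?thesis
      proof (cases "s < length r")
        case sl: True
        let ?b = "?r' ! s"
        have b: "?b = r ! s" using ts by simp
        have ab: "?a < ?b" unfolding b using sorted_wrt_nth_less[OF r(2) ts sl] .
        have "?b \<in> set r" using sl b by simp
        then have "distinct (?a # ?b # concat P)" using Cons.prems(2) ar ab by auto
        then have "snd (ins ?b (fst (ins ?a P))) \<le> snd (ins ?a P)" using Cons.IH[OF r(3)] ab by blast
        then show ?thesis using xy i sl by (simp add: ins_Cons_bump s_def)
      next
        case False
        then have "s = length ?r'" using ins_pos_le[of y ?r'] by (simp add: s_def)
        then show ?thesis using xy i by (simp add: ins_Cons_end s_def)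
      qed
    next
      case False
      then have yx: "y < x" using xy by simp
      have st: "s \<le> t"
      proof (rule ccontr)
        assume "\<not> s \<le> t"
        then have "?r' ! t \<le> y" using ins_pos_less[of t y ?r'] by (simp add: s_def)
        then show False using True yx by simp
      qed
      then have sl: "s < length ?r'" using True by simp
      let ?b = "?r' ! s"
      have ba: "?b < ?a" using r'x[OF st] xa by simp
      have "?b \<in> insert x (set r)" using sl st by (cases "s = t") auto
      then have "distinct (?a # ?b # concat P)" using Cons.prems(2) ar ba by auto
      then have "\<not> snd (ins ?b (fst (ins ?a P))) \<le> snd (ins ?a P)" using Cons.IH[OF r(3)] ba by fastforce
      then show ?thesis using False i sl by (simp add: ins_Cons_bump s_def)
    qed
  qed
qed

section \<open>The Robinson--Schensted bijection\<close>

text \<open>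
  A partial permutation in two-line notation, in the order of the second components: a list of pairs
  of a letter and its position.
\<close>

definition biword :: "(int \<times> int) list \<Rightarrow> bool" where
  "biword u \<longleftrightarrow> distinct (map fst u) \<and> sorted_wrt (<) (map snd u)"

lemma biword_snoc:
  "biword (u @ [(x, p)]) \<longleftrightarrow> biword u \<and> x \<notin> fst ` set u \<and> (\<forall>a\<in>set u. snd a < p)"
  by (auto simp: biword_def sorted_wrt_append)

lemma rs_Nil [simp]: "rs [] = ([], [])" by (simp add: rs_def)

lemma rs_snoc: "rs (u @ [(x, p)]) = rs_insert x p (fst (rs u)) (snd (rs u))"
  by (simp add: rs_def split: prod.split)

lemma tableauD:
  assumes "tableau T"
  shows "i < length T \<Longrightarrow> T ! i \<noteq> []" "i < length T \<Longrightarrow> sorted_wrt (<) (T ! i)"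
    "i \<le> j \<Longrightarrow> j < length T \<Longrightarrow> length (T ! j) \<le> length (T ! i)"
    "i < j \<Longrightarrow> j < length T \<Longrightarrow> k < length (T ! j) \<Longrightarrow> T ! i ! k < T ! j ! k"
proof -
  show "T ! i \<noteq> []" if "i < length T"
  proof -
    have "0 \<notin> set (map length T)" using assms unfolding tableau_def int_partition_def by blast
    then show ?thesis using that by (metis length_0_conv length_map nth_map nth_mem)
  qed
  show "sorted_wrt (<) (T ! i)" if "i < length T" using assms that by (simp add: tableau_def)
  show "length (T ! j) \<le> length (T ! i)" if "i \<le> j" "j < length T"
    using assms that sorted_wrt_nth_less[of "(\<ge>)" "map length T" i j]
    by (cases "i = j") (auto simp: tableau_def int_partition_def)
  show "T ! i ! k < T ! j ! k" if "i < j" "j < length T" "k < length (T ! j)"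
    using assms that unfolding tableau_def by blast
qed

lemma tableauI:
  assumes "\<And>i. i < length T \<Longrightarrow> T ! i \<noteq> []" "\<And>i. i < length T \<Longrightarrow> sorted_wrt (<) (T ! i)"
    "\<And>i j. i < j \<Longrightarrow> j < length T \<Longrightarrow> length (T ! j) \<le> length (T ! i)"
    "\<And>i j k. i < j \<Longrightarrow> j < length T \<Longrightarrow> k < length (T ! j) \<Longrightarrow> T ! i ! k < T ! j ! k"
  shows "tableau T"
  unfolding tableau_def int_partition_def
  using assms by (auto simp: sorted_wrt_iff_nth_less in_set_conv_nth)

lemma nth_in_concat: "i < length T \<Longrightarrow> k < length (T ! i) \<Longrightarrow> T ! i ! k \<in> set (concat T)"
  by (auto intro!: bexI[of _ "T ! i"])

lemma add_at_nth:
  "k \<le> length Q \<Longrightarrow> i < length (add_at k p Q) \<Longrightarrow>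
   add_at k p Q ! i = (if i = k then (if k < length Q then Q ! k else []) @ [p] else Q ! i)"
  by (auto simp: add_at_def nth_append)

lemma length_add_at: "length (add_at k p Q) = (if k < length Q then length Q else Suc (length Q))"
  by (simp add: add_at_def)

text \<open>
  The new entry is the largest, so only the shape has to be checked; it is a partition because it is also the
  shape of the tableau \<open>P\<close>.
\<close>

lemma tableau_add_at:
  assumes Q: "tableau Q" and k: "k \<le> length Q" and p: "\<And>q. q \<in> set (concat Q) \<Longrightarrow> q < p"
    and P: "tableau P" "map length P = map length (add_at k p Q)"
  shows "tableau (add_at k p Q)"
proof (rule tableauI)
  let ?A = "add_at k p Q"
  have lP: "length (P ! i) = length (?A ! i)" if "i < length ?A" for i
    using that P(2) by (metis length_map nth_map)
  have lPA: "length P = length ?A" using P(2) by (metis length_map)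
  have bd: "Q ! i ! j < p" if "i < length Q" "j < length (Q ! i)" for i j
    using p nth_in_concat[OF that] by simp
  show "?A ! i \<noteq> []" if "i < length ?A" for i
    using that lP[OF that] tableauD(1)[OF P(1), of i] lPA by auto
  show "length (?A ! j) \<le> length (?A ! i)" if "i < j" "j < length ?A" for i j
    using that lP[of i] lP[of j] tableauD(3)[OF P(1), of i j] lPA by auto
  show "sorted_wrt (<) (?A ! i)" if i: "i < length ?A" for i
  proof (cases "i = k")
    case True
    show ?thesis
    proof (cases "k < length Q")
      case kl: True
      have "\<forall>x\<in>set (Q ! k). x < p" using bd[OF kl] by (auto simp: in_set_conv_nth)
      then show ?thesis using add_at_nth[OF k i] True kl tableauD(2)[OF Q kl] by (simp add: sorted_wrt_append)
    next
      case False
      then show ?thesis using add_at_nth[OF k i] True by simp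
    qed
  next
    case False
    then have "i < length Q" using i k by (auto simp: length_add_at split: if_splits)
    then show ?thesis using add_at_nth[OF k i] False tableauD(2)[OF Q] by simp
  qed
  show "?A ! i ! c < ?A ! j ! c" if ij: "i < j" "j < length ?A" "c < length (?A ! j)" for i j c
  proof -
    have i: "i < length ?A" "i < length Q" using ij k by (auto simp: length_add_at split: if_splits)
    have lij: "length (?A ! j) \<le> length (?A ! i)"
      using ij i lP[of i] lP[of j] tableauD(3)[OF P(1), of i j] lPA by auto
    have jQ: "j = k \<or> j < length Q" using ij k by (auto simp: length_add_at split: if_splits)
    show ?thesis
    proof (cases "i = k")
      case True
      then have jk: "j \<noteq> k" "j < length Q" using ij jQ by auto
      have lq: "length (Q ! j) \<le> length (Q ! i)" using tableauD(3)[OF Q, of i j] ij jk by simp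
      have "?A ! j = Q ! j" using add_at_nth[OF k ij(2)] jk by simp
      moreover have "?A ! i = Q ! i @ [p]" using add_at_nth[OF k i(1)] True i by simp
      ultimately show ?thesis using tableauD(4)[OF Q ij(1) jk(2), of c] ij lq by (simp add: nth_append)
    next
      case False
      then have Ai: "?A ! i = Q ! i" using add_at_nth[OF k i(1)] by simp
      show ?thesis
      proof (cases "j = k")
        case True
        have Aj: "?A ! j = (if k < length Q then Q ! k else []) @ [p]" using add_at_nth[OF k ij(2)] True by simp
        show ?thesis
        proof (cases "k < length Q \<and> c < length (Q ! k)")
          case True
          then show ?thesis using tableauD(4)[OF Q ij(1), of c] Ai Aj \<open>j = k\<close> by (simp add: nth_append)
        next
          case False
          then have "?A ! j ! c = p" using Aj ij(3) by (auto simp: nth_append split: if_splits)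
          moreover have "c < length (Q ! i)" using ij(3) lij Ai by simp
          ultimately show ?thesis using bd[OF i(2)] Ai by simp
        qed
      next
        case False
        then have "?A ! j = Q ! j" "j < length Q" using add_at_nth[OF k ij(2)] jQ by auto
        then show ?thesis using tableauD(4)[OF Q ij(1)] Ai ij by simp
      qed
    qed
  qed
qed

lemma rs_invariants:
  "biword u \<Longrightarrow> tableau (fst (rs u)) \<and> tableau (snd (rs u)) \<and> map length (fst (rs u)) = map length (snd (rs u)) \<and>
     mset (concat (fst (rs u))) = mset (map fst u) \<and> mset (concat (snd (rs u))) = mset (map snd u)"
proof (induction u rule: rev_induct)
  case (snoc a u)
  obtain x p where a: "a = (x, p)" by (cases a)
  define P Q where "P = fst (rs u)" and "Q = snd (rs u)"
  have b: "biword u" "x \<notin> fst ` set u" "\<forall>a\<in>set u. snd a < p" using snoc.prems unfolding a biword_snoc by auto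
  have IH: "tableau P" "tableau Q" "map length P = map length Q"
    "mset (concat P) = mset (map fst u)" "mset (concat Q) = mset (map snd u)"
    using snoc.IH[OF b(1)] by (auto simp: P_def Q_def)
  have lPQ: "length P = length Q" using IH(3) by (metis length_map)
  define k where "k = snd (ins x P)"
  have r: "rs (u @ [a]) = (fst (ins x P), add_at k p Q)"
    unfolding a rs_snoc rs_insert_eq_ins[OF lPQ, unfolded P_def Q_def] by (simp add: P_def Q_def k_def)
  have "distinct (concat P)" using IH(4) b(1) unfolding biword_def by (metis mset_eq_imp_distinct_iff)
  moreover have "set (concat P) = fst ` set u" using arg_cong[OF IH(4), of set_mset] by simp
  ultimately have "distinct (x # concat P)" using b(2) by simp
  then have tP: "tableau (fst (ins x P))" using tableau_ins IH(1) by blast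
  have k: "k \<le> length Q" and sh: "map length (fst (ins x P)) = map length (add_at k p Q)"
    using ins_shape[of x P] IH(3) lPQ by (auto simp: k_def map_length_add_at)
  have "set (concat Q) = snd ` set u" using arg_cong[OF IH(5), of set_mset] by simp
  then have "tableau (add_at k p Q)" using tableau_add_at[OF IH(2) k _ tP sh] b(3) by auto
  then show ?case using tP sh IH unfolding r by (simp add: a mset_concat_ins mset_concat_add_at)
qed simp

lemma rs_entries:
  assumes "biword u"
  shows "set (concat (fst (rs u))) = fst ` set u" "set (concat (snd (rs u))) = snd ` set u"
    "distinct (concat (fst (rs u)))" "distinct (concat (snd (rs u)))"
proof -
  note i = rs_invariants[OF assms]
  show "set (concat (fst (rs u))) = fst ` set u" "set (concat (snd (rs u))) = snd ` set u"
    using i by (metis mset_eq_setD set_map)+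
  show "distinct (concat (fst (rs u)))" using i assms unfolding biword_def by (metis mset_eq_imp_distinct_iff)
  have "distinct (map snd u)" using assms by (auto simp: biword_def strict_sorted_iff)
  then show "distinct (concat (snd (rs u)))" using i by (metis mset_eq_imp_distinct_iff)
qed

lemma rs_snoc_ins:
  assumes "biword (u @ [(x, p)])"
  shows "rs (u @ [(x, p)]) = (fst (ins x (fst (rs u))), add_at (snd (ins x (fst (rs u)))) p (snd (rs u)))"
    and "snd (ins x (fst (rs u))) \<le> length (snd (rs u))"
proof -
  have "biword u" using assms by (simp add: biword_snoc)
  then have l: "length (fst (rs u)) = length (snd (rs u))" using rs_invariants by (metis length_map)
  show "rs (u @ [(x, p)]) = (fst (ins x (fst (rs u))), add_at (snd (ins x (fst (rs u)))) p (snd (rs u)))"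
    unfolding rs_snoc rs_insert_eq_ins[OF l] ..
  show "snd (ins x (fst (rs u))) \<le> length (snd (rs u))" using ins_shape[of x "fst (rs u)"] l by simp
qed

text \<open>The row that grew is the one containing the new entry.\<close>

lemma add_at_inj:
  assumes e: "add_at k1 p Q1 = add_at k2 p Q2" and k: "k1 \<le> length Q1" "k2 \<le> length Q2"
    and n: "p \<notin> set (concat Q1)" "p \<notin> set (concat Q2)" and ne: "[] \<notin> set Q1" "[] \<notin> set Q2"
  shows "k1 = k2 \<and> Q1 = Q2"
proof -
  define del where "del T = filter (\<lambda>r. r \<noteq> []) (map (filter (\<lambda>q. q \<noteq> p)) T)" for T :: tableau
  have id: "filter (\<lambda>q. q \<noteq> p) r = r" if "r \<in> set Q" "p \<notin> set (concat Q)" for r Q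
    using that by (auto simp: filter_id_conv)
  have del: "del (add_at k p Q) = Q" if k: "k \<le> length Q" and n: "p \<notin> set (concat Q)" and ne: "[] \<notin> set Q" for k Q
  proof -
    have m: "map (filter (\<lambda>q. q \<noteq> p)) Q = Q" using id n by (auto intro!: map_idI)
    have f: "filter (\<lambda>r. r \<noteq> []) Q = Q" using ne by (auto simp: filter_id_conv)
    show ?thesis
    proof (cases "k < length Q")
      case True
      have "map (filter (\<lambda>q. q \<noteq> p)) (Q[k := Q ! k @ [p]]) = Q"
        using True n by (simp add: map_update m id[of "Q ! k" Q])
      then show ?thesis using True f by (simp add: del_def add_at_def)
    qed (simp add: del_def add_at_def m f)
  qed
  have Q: "Q1 = Q2" using del[OF k(1) n(1) ne(1)] del[OF k(2) n(2) ne(2)] e by simp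
  have inrow: "p \<in> set (add_at k1 p Q1 ! k1)" using add_at_nth[OF k(1), of k1 p] k(1) by (auto simp: length_add_at)
  have "k1 = k2"
  proof (rule ccontr)
    assume ne: "k1 \<noteq> k2"
    have l: "k1 < length (add_at k2 p Q2)" using k(1) unfolding e[symmetric] by (auto simp: length_add_at)
    then have "k1 < length Q2" using ne k(2) by (auto simp: length_add_at split: if_splits)
    moreover have "add_at k2 p Q2 ! k1 = Q2 ! k1" using add_at_nth[OF k(2) l] ne by simp
    ultimately show False using inrow n(2) unfolding e by auto
  qed
  with Q show ?thesis by simp
qed

lemma tableau_no_Nil: "tableau T \<Longrightarrow> [] \<notin> set T"
  using tableauD(1) by (metis in_set_conv_nth)

text \<open>
  The last position is the maximal entry of the recording tableau; it determines the row that grew last, and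
  then insertion can be undone.
\<close>

lemma rs_inj: "biword u \<Longrightarrow> biword v \<Longrightarrow> rs u = rs v \<Longrightarrow> u = v"
proof (induction u arbitrary: v rule: rev_induct)
  case Nil
  then have "mset (map fst v) = {#}" using rs_invariants[OF Nil.prems(2)] Nil.prems(3)[symmetric] by simp
  then show ?case by simp
next
  case (snoc a u)
  obtain x p where a: "a = (x, p)" by (cases a)
  have "v \<noteq> []"
  proof
    assume "v = []"
    then have "mset (map fst (u @ [a])) = {#}" using rs_invariants[of "u @ [a]"] snoc.prems by simp
    then show False by simp
  qed
  then obtain v' b where v: "v = v' @ [b]" by (metis append_butlast_last_id)
  obtain y q where b: "b = (y, q)" by (cases b)
  have u1: "biword u" "\<forall>a\<in>set u. snd a < p" using snoc.prems(1) unfolding a biword_snoc by auto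
  have v1: "biword v'" "\<forall>a\<in>set v'. snd a < q" using snoc.prems(2) unfolding v b biword_snoc by auto
  have "snd ` set (u @ [a]) = snd ` set (v' @ [b])"
    using rs_entries(2)[OF snoc.prems(1)] rs_entries(2)[OF snoc.prems(2)] snoc.prems(3) v by simp
  then have s: "insert p (snd ` set u) = insert q (snd ` set v')" by (simp add: a b)
  have pq: "p = q"
  proof (rule ccontr)
    assume "p \<noteq> q"
    then have "p \<in> snd ` set v'" "q \<in> snd ` set u" using s by auto
    then show False using u1(2) v1(2) by fastforce
  qed
  let ?k1 = "snd (ins x (fst (rs u)))" and ?k2 = "snd (ins y (fst (rs v')))"
  have eu: "rs (u @ [a]) = (fst (ins x (fst (rs u))), add_at ?k1 p (snd (rs u)))" "?k1 \<le> length (snd (rs u))"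
    using rs_snoc_ins[of u x p] snoc.prems(1) by (auto simp: a)
  have ev: "rs (v' @ [b]) = (fst (ins y (fst (rs v'))), add_at ?k2 q (snd (rs v')))" "?k2 \<le> length (snd (rs v'))"
    using rs_snoc_ins[of v' y q] snoc.prems(2) by (auto simp: b v)
  have np: "p \<notin> set (concat (snd (rs u)))" "p \<notin> set (concat (snd (rs v')))"
    unfolding rs_entries(2)[OF u1(1)] rs_entries(2)[OF v1(1)] using u1(2) v1(2) pq by auto
  have e1: "fst (ins x (fst (rs u))) = fst (ins y (fst (rs v')))"
    and e2: "add_at ?k1 p (snd (rs u)) = add_at ?k2 p (snd (rs v'))"
    using snoc.prems(3) eu(1) ev(1) pq v by auto
  have tb: "tableau (fst (rs u))" "tableau (snd (rs u))" "tableau (fst (rs v'))" "tableau (snd (rs v'))"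
    using rs_invariants u1(1) v1(1) by auto
  have kQ: "?k1 = ?k2" "snd (rs u) = snd (rs v')"
    using add_at_inj[OF e2 eu(2) ev(2) np tableau_no_Nil[OF tb(2)] tableau_no_Nil[OF tb(4)]] by auto
  have "ins x (fst (rs u)) = ins y (fst (rs v'))" using e1 kQ(1) by (simp add: prod_eq_iff)
  then have "x = y" "fst (rs u) = fst (rs v')" using ins_inj tb(1,3) by blast+
  then have "rs u = rs v'" using kQ(2) by (simp add: prod_eq_iff)
  then have "u = v'" using snoc.IH u1(1) v1(1) by blast
  then show ?case using \<open>x = y\<close> pq a b v by simp
qed

lemma grow_inj:
  assumes "grow k a = grow k b" "0 \<notin> set a" "0 \<notin> set b" "k \<le> length a" "k \<le> length b"
  shows "a = b"
proof (cases "k < length a")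
  case ka: True
  show ?thesis
  proof (cases "k < length b")
    case True
    have e: "a[k := Suc (a ! k)] = b[k := Suc (b ! k)]" using assms(1) ka True by (simp add: grow_def)
    have "a ! k = b ! k" using arg_cong[OF e, of "\<lambda>l. l ! k"] ka True by simp
    have "a = (a[k := Suc (a ! k)])[k := a ! k]" by simp
    also have "\<dots> = (b[k := Suc (b ! k)])[k := b ! k]" unfolding e using \<open>a ! k = b ! k\<close> by simp
    also have "\<dots> = b" by simp
    finally show ?thesis .
  next
    case False
    then have k: "k = length b" using assms(5) by simp
    have e: "a[k := Suc (a ! k)] = b @ [1]" using assms(1) ka False by (simp add: grow_def)
    have "Suc (a ! k) = 1" using arg_cong[OF e, of "\<lambda>l. l ! k"] ka k by simp
    then have "a ! k = 0" by simp
    then show ?thesis using assms(2) ka by (metis nth_mem)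
  qed
next
  case False
  then have k: "k = length a" using assms(4) by simp
  show ?thesis
  proof (cases "k < length b")
    case True
    have e: "b[k := Suc (b ! k)] = a @ [1]" using assms(1) True False by (simp add: grow_def)
    have "Suc (b ! k) = 1" using arg_cong[OF e, of "\<lambda>l. l ! k"] True k by simp
    then have "b ! k = 0" by simp
    then show ?thesis using assms(3) True by (metis nth_mem)
  next
    case f: False
    then show ?thesis using assms(1) False by (simp add: grow_def)
  qed
qed

text \<open>The maximal entry of a tableau is at the end of its row and of its column.\<close>

lemma remove_maximum:
  assumes Q: "tableau Q" and ne: "Q \<noteq> []" and d: "distinct (concat Q)"
  obtains k p Q0 where "tableau Q0" "k \<le> length Q0" "Q = add_at k p Q0" "\<And>q. q \<in> set (concat Q0) \<Longrightarrow> q < p"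
    "Suc k < length Q \<Longrightarrow> length (Q ! Suc k) < length (Q ! k)" "k < length Q"
proof -
  define p where "p = Max (set (concat Q))"
  have "concat Q \<noteq> []" using ne tableau_no_Nil[OF Q] by (cases Q) auto
  then have p: "p \<in> set (concat Q)" "\<And>q. q \<in> set (concat Q) \<Longrightarrow> q \<le> p"
    unfolding p_def by (metis List.finite_set Max_in set_empty2, simp)
  obtain k where k: "k < length Q" "p \<in> set (Q ! k)" using p(1) by (metis UN_E in_set_conv_nth set_concat)
  have bd: "Q ! i ! j \<le> p" if "i < length Q" "j < length (Q ! i)" for i j
    using p(2) nth_in_concat[OF that] by simp
  obtain c where c: "c < length (Q ! k)" "Q ! k ! c = p" using k(2) by (metis in_set_conv_nth)
  have c_last: "Suc c = length (Q ! k)"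
  proof (rule ccontr)
    assume "Suc c \<noteq> length (Q ! k)"
    then have "Suc c < length (Q ! k)" using c by simp
    then have "p < Q ! k ! Suc c" using sorted_wrt_nth_less[OF tableauD(2)[OF Q k(1)], of c "Suc c"] c by simp
    then show False using bd[OF k(1), of "Suc c"] \<open>Suc c < _\<close> by simp
  qed
  have short: "length (Q ! Suc k) < length (Q ! k)" if "Suc k < length Q"
  proof (rule ccontr)
    assume "\<not> ?thesis"
    then have "c < length (Q ! Suc k)" using c by simp
    then have "Q ! k ! c < Q ! Suc k ! c" using tableauD(4)[OF Q, of k "Suc k" c] that by simp
    then show False using bd[OF that, of c] c \<open>c < length (Q ! Suc k)\<close> by simp
  qed
  define q where "q = butlast (Q ! k)"
  have row: "Q ! k = q @ [p]"
    using c c_last by (metis q_def append_butlast_last_id last_conv_nth length_0_conv less_nat_zero_code diff_Suc_1)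
  define Q0 where "Q0 = (if q = [] then butlast Q else Q[k := q])"
  have kl: "Suc k = length Q" if "q = []"
  proof (rule ccontr)
    assume "Suc k \<noteq> length Q"
    then have "Suc k < length Q" using k by simp
    then have "length (Q ! Suc k) < 1" using short row that by simp
    then show False using tableauD(1)[OF Q \<open>Suc k < length Q\<close>] by simp
  qed
  have l0: "length Q0 = (if q = [] then k else length Q)" using kl by (auto simp: Q0_def)
  have kQ0: "k \<le> length Q0" using l0 k by auto
  have n0: "Q0 ! i = (if i = k then q else Q ! i)" if "i < length Q0" for i
    using that k kl by (auto simp: Q0_def nth_butlast)
  have "Q = add_at k p Q0"
  proof (rule nth_equalityI)
    show "length Q = length (add_at k p Q0)" using l0 kl k by (auto simp: length_add_at)
    fix i assume i: "i < length Q"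
    then have i': "i < length (add_at k p Q0)" using l0 kl k by (auto simp: length_add_at)
    show "Q ! i = add_at k p Q0 ! i"
      unfolding add_at_nth[OF kQ0 i'] using n0[of i] n0[of k] l0 kl i row k by (auto simp: less_Suc_eq)
  qed
  moreover have "tableau Q0"
  proof (rule tableauI)
    fix i assume i: "i < length Q0"
    then have iQ: "i < length Q" using l0 k by (auto split: if_splits)
    show "Q0 ! i \<noteq> []" using n0[OF i] tableauD(1)[OF Q iQ] i l0 by auto
    show "sorted_wrt (<) (Q0 ! i)" using n0[OF i] tableauD(2)[OF Q iQ] row by (auto simp: sorted_wrt_append)
  next
    fix i j assume ij: "i < j" "j < length Q0"
    then have jQ: "j < length Q" using l0 k by (auto split: if_splits)
    have le: "length (Q ! j) \<le> length (Q ! i)" using tableauD(3)[OF Q] ij jQ by simp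
    have i0: "i < length Q0" using ij by simp
    show "length (Q0 ! j) \<le> length (Q0 ! i)"
    proof (cases "i = k")
      case True
      have sk: "Suc k < length Q" using True ij jQ by simp
      have "length (Q ! j) \<le> length (Q ! Suc k)" using tableauD(3)[OF Q, of "Suc k" j] True ij jQ by simp
      then show ?thesis using True n0[OF i0] n0[OF ij(2)] ij short[OF sk] row by auto
    next
      case False
      then show ?thesis using le n0[OF i0] n0[OF ij(2)] row by auto
    qed
    fix c assume c: "c < length (Q0 ! j)"
    have cj: "c < length (Q ! j)" "Q0 ! j ! c = Q ! j ! c" using c n0[OF ij(2)] row by (auto simp: nth_append split: if_splits)
    have ci: "Q0 ! i ! c = Q ! i ! c"
      using n0[OF i0] row c \<open>length (Q0 ! j) \<le> length (Q0 ! i)\<close> by (auto simp: nth_append)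
    show "Q0 ! i ! c < Q0 ! j ! c" using tableauD(4)[OF Q ij(1) jQ cj(1)] cj ci by simp
  qed
  moreover have "r < p" if "r \<in> set (concat Q0)" for r
  proof -
    have m: "mset (concat Q) = add_mset p (mset (concat Q0))"
      using mset_concat_add_at[of k p Q0] calculation(1) by simp
    have "distinct (p # concat Q0)" using m d by (metis mset.simps(2) mset_eq_imp_distinct_iff)
    moreover have "r \<in> set (concat Q)" using arg_cong[OF m, of set_mset] that by auto
    ultimately show ?thesis using p(2)[of r] that by (metis distinct.simps(2) le_neq_trans)
  qed
  ultimately show ?thesis using that kQ0 short k(1) by blast
qed

text \<open>
  The word is built from its end, removing the maximum of \<open>Q\<close> and undoing the insertion in \<open>P\<close> at that corner.
\<close>

lemma rs_surj:
  "tableau P \<Longrightarrow> tableau Q \<Longrightarrow> map length P = map length Q \<Longrightarrow> distinct (concat P) \<Longrightarrow> distinct (concat Q) \<Longrightarrow>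
   \<exists>u. biword u \<and> rs u = (P, Q)"
proof (induction "length (concat Q)" arbitrary: P Q rule: less_induct)
  case less
  show ?case
  proof (cases "Q = []")
    case True
    then have "rs [] = (P, Q)" using less.prems by simp
    moreover have "biword []" by (simp add: biword_def)
    ultimately show ?thesis by blast
  next
    case False
    obtain k p Q0 where Q0: "tableau Q0" "k \<le> length Q0" "Q = add_at k p Q0" "\<And>q. q \<in> set (concat Q0) \<Longrightarrow> q < p"
      and short: "Suc k < length Q \<Longrightarrow> length (Q ! Suc k) < length (Q ! k)" and k: "k < length Q"
      by (rule remove_maximum[OF less.prems(2) False less.prems(5)]) (rule that)
    have lPQ: "length P = length Q" using less.prems(3) by (metis length_map)
    have lrow: "length (P ! i) = length (Q ! i)" if "i < length Q" for i
      using less.prems(3) lPQ that by (metis nth_map)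
    have "\<exists>P0 x. tableau P0 \<and> ins x P0 = (P, k)"
      by (rule ins_surj[OF less.prems(1,4)]) (use lPQ k short lrow in auto)
    then obtain P0 x where P0: "tableau P0" "ins x P0 = (P, k)" by blast
    have sh: "k \<le> length P0" "map length P = grow k (map length P0)" using ins_shape[of x P0] P0(2) by auto
    have "map length P0 = map length Q0"
    proof (rule grow_inj[of k])
      show "grow k (map length P0) = grow k (map length Q0)"
        using sh(2) less.prems(3) Q0(3) by (simp add: map_length_add_at)
      show "0 \<notin> set (map length P0)" "0 \<notin> set (map length Q0)"
        using tableau_no_Nil[OF P0(1)] tableau_no_Nil[OF Q0(1)] by auto
    qed (use sh Q0 in auto)
    have mP: "mset (concat P) = add_mset x (mset (concat P0))" using mset_concat_ins[of x P0] P0(2) by simp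
    have mQ: "mset (concat Q) = add_mset p (mset (concat Q0))" using mset_concat_add_at[of k p Q0] Q0(3) by simp
    have dP: "distinct (x # concat P0)" using mP less.prems(4) by (metis mset.simps(2) mset_eq_imp_distinct_iff)
    have dQ: "distinct (p # concat Q0)" using mQ less.prems(5) by (metis mset.simps(2) mset_eq_imp_distinct_iff)
    have "length (concat Q0) < length (concat Q)" using arg_cong[OF mQ, of size] by simp
    then obtain u where u: "biword u" "rs u = (P0, Q0)"
      using less.hyps[of Q0 P0] P0(1) Q0(1) \<open>map length P0 = map length Q0\<close> dP dQ by auto
    have "x \<notin> fst ` set u" unfolding rs_entries(1)[OF u(1), symmetric] u(2) using dP by simp
    moreover have "\<forall>a\<in>set u. snd a < p"
    proof
      fix a assume "a \<in> set u"
      then have "snd a \<in> set (concat Q0)" using rs_entries(2)[OF u(1)] u(2) by simp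
      then show "snd a < p" by (rule Q0(4))
    qed
    ultimately have b: "biword (u @ [(x, p)])" using u(1) by (simp add: biword_snoc)
    have "rs (u @ [(x, p)]) = (P, Q)" using rs_snoc_ins(1)[OF b] u(2) P0(2) Q0(3) by simp
    then show ?thesis using b by blast
  qed
qed

section \<open>Exchange of the two tableaux\<close>

text \<open>
  What one letter does to the first row: the new first rows of both tableaux, and the list of the bumped letters,
  each with the position at which it was bumped.
\<close>

definition row_step :: "int \<times> int \<Rightarrow> int list \<times> int list \<times> (int \<times> int) list \<Rightarrow> int list \<times> int list \<times> (int \<times> int) list" where
  "row_step = (\<lambda>(x, p) (r, q, b). if ins_pos x r < length r
     then (r[ins_pos x r := x], q, b @ [(r ! ins_pos x r, p)]) else (r @ [x], q @ [p], b))"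

definition row_pass :: "(int \<times> int) list \<Rightarrow> int list \<times> int list \<times> (int \<times> int) list" where
  "row_pass u = fold row_step u ([], [], [])"

lemma row_pass_snoc: "row_pass (u @ [a]) = row_step a (row_pass u)"
  by (simp add: row_pass_def)

text \<open>The lower rows arise from the biword of bumped letters.\<close>

lemma rs_row_pass:
  "u \<noteq> [] \<Longrightarrow> row_pass u = (r, q, b) \<Longrightarrow> rs u = (r # fst (rs b), q # snd (rs b))"
proof (induction u arbitrary: r q b rule: rev_induct)
  case (snoc a u)
  obtain x p where a: "a = (x, p)" by (cases a)
  show ?case
  proof (cases "u = []")
    case True
    then show ?thesis using snoc.prems(2) rs_snoc[of "[]" x p]
      by (auto simp: a row_pass_def row_step_def ins_pos_def)
  next
    case False
    obtain r0 q0 b0 where u: "row_pass u = (r0, q0, b0)" by (cases "row_pass u") auto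
    have IH: "rs u = (r0 # fst (rs b0), q0 # snd (rs b0))" using snoc.IH[OF False u] .
    have st: "row_step (x, p) (r0, q0, b0) = (r, q, b)" using snoc.prems(2) u a by (simp add: row_pass_snoc)
    show ?thesis
    proof (cases "ins_pos x r0 < length r0")
      case True
      have b: "b = b0 @ [(r0 ! ins_pos x r0, p)]" and r: "r = r0[ins_pos x r0 := x]" "q = q0"
        using st True by (auto simp: row_step_def)
      show ?thesis unfolding a rs_snoc IH b r
        using True by (simp add: insert_row_eq rs_snoc split: prod.split)
    next
      case False
      then show ?thesis using st unfolding a rs_snoc IH by (auto simp: insert_row_eq row_step_def)
    qed
  qed
qed simp

text \<open>
  \<open>\<kappa> a\<close> is the length of a longest chain of points strictly below and to the left of \<open>a\<close>. The description is
  symmetric in the two coordinates, and it determines \<open>\<kappa>\<close> (\<open>rank_on_unique\<close>).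
\<close>

definition rank_on :: "(int \<times> int) set \<Rightarrow> (int \<times> int \<Rightarrow> nat) \<Rightarrow> bool" where
  "rank_on S \<kappa> \<longleftrightarrow> (\<forall>a\<in>S. \<forall>b\<in>S. fst a < fst b \<and> snd a < snd b \<longrightarrow> \<kappa> a < \<kappa> b) \<and>
     (\<forall>b\<in>S. \<kappa> b \<noteq> 0 \<longrightarrow> (\<exists>a\<in>S. fst a < fst b \<and> snd a < snd b \<and> Suc (\<kappa> a) = \<kappa> b))"

text \<open>
  Points of equal rank form a decreasing chain, and \<open>a\<close>, \<open>b\<close> are neighbours in it. The set consists of the corners
  of the broken lines through these chains: Viennot's shadow construction.
\<close>

definition bump_set :: "(int \<times> int) set \<Rightarrow> (int \<times> int \<Rightarrow> nat) \<Rightarrow> (int \<times> int) set" where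
  "bump_set S \<kappa> = {(fst a, snd b) | a b. a \<in> S \<and> b \<in> S \<and> \<kappa> a = \<kappa> b \<and> snd a < snd b \<and>
     (\<forall>c\<in>S. \<kappa> c = \<kappa> a \<longrightarrow> \<not> (snd a < snd c \<and> snd c < snd b))}"

lemma bump_setI:
  "a \<in> S \<Longrightarrow> b \<in> S \<Longrightarrow> \<kappa> a = \<kappa> b \<Longrightarrow> snd a < snd b \<Longrightarrow>
   \<forall>c\<in>S. \<kappa> c = \<kappa> a \<longrightarrow> \<not> (snd a < snd c \<and> snd c < snd b) \<Longrightarrow> (fst a, snd b) \<in> bump_set S \<kappa>"
  unfolding bump_set_def by (intro CollectI exI conjI) (rule refl)

definition class_mins :: "(int \<times> int) set \<Rightarrow> (int \<times> int \<Rightarrow> nat) \<Rightarrow> (int \<times> int \<Rightarrow> int) \<Rightarrow> int list \<Rightarrow> bool" where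
  "class_mins S \<kappa> f r \<longleftrightarrow> \<kappa> ` S = {..<length r} \<and>
     (\<forall>t<length r. r ! t \<in> f ` {a \<in> S. \<kappa> a = t} \<and> (\<forall>a\<in>S. \<kappa> a = t \<longrightarrow> r ! t \<le> f a))"

lemma class_minsD:
  assumes "class_mins S \<kappa> f r"
  shows "\<kappa> ` S = {..<length r}" "t < length r \<Longrightarrow> \<exists>a\<in>S. \<kappa> a = t \<and> f a = r ! t"
    "a \<in> S \<Longrightarrow> r ! \<kappa> a \<le> f a"
proof -
  show im: "\<kappa> ` S = {..<length r}" using assms unfolding class_mins_def by blast
  show "\<exists>a\<in>S. \<kappa> a = t \<and> f a = r ! t" if "t < length r"
  proof -
    have "r ! t \<in> f ` {a \<in> S. \<kappa> a = t}" using assms that unfolding class_mins_def by blast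
    then show ?thesis by auto
  qed
  show "r ! \<kappa> a \<le> f a" if "a \<in> S"
  proof -
    have "\<kappa> a < length r" using im that by auto
    then show ?thesis using assms that unfolding class_mins_def by blast
  qed
qed

text \<open>The new point enters the class of rank \<open>t\<close>, or forms a new one.\<close>

lemma class_mins_insert:
  assumes c: "class_mins S \<kappa> f l" and new: "a \<notin> S" and t: "t \<le> length l"
  shows "class_mins (insert a S) (\<kappa>(a := t)) f (if t < length l then l[t := min (l ! t) (f a)] else l @ [f a])"
    (is "class_mins ?S ?k f ?l")
proof -
  have k: "?k x = \<kappa> x" if "x \<in> S" for x using that new by auto
  have im: "\<kappa> ` S = {..<length l}" using c by (simp add: class_mins_def)
  have "S \<inter> {x. x \<noteq> a} = S" using new by auto
  then have "?k ` ?S = insert t (\<kappa> ` S)" by simp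
  also have "\<dots> = {..<length ?l}" unfolding im using t by auto
  finally have img: "?k ` ?S = {..<length ?l}" .
  have pt: "?l ! s \<in> f ` {x \<in> ?S. ?k x = s} \<and> (\<forall>x\<in>?S. ?k x = s \<longrightarrow> ?l ! s \<le> f x)" if s: "s < length ?l" for s
  proof (cases "s < length l")
    case True
    obtain y where y: "y \<in> S" "\<kappa> y = s" "f y = l ! s" using class_minsD(2)[OF c True] by blast
    have ya: "y \<noteq> a" using y(1) new by auto
    have low: "l ! s \<le> f x" if "x \<in> S" "\<kappa> x = s" for x using class_minsD(3)[OF c that(1)] that(2) by simp
    show ?thesis
    proof (cases "s = t")
      case st: True
      have l: "?l ! s = min (f y) (f a)" using True st y(3) by simp
      have "min (f y) (f a) \<in> f ` {x \<in> ?S. ?k x = s}" using y(1,2) ya st by (auto simp: min_def)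
      moreover have "min (f y) (f a) \<le> f x" if "x \<in> ?S" "?k x = s" for x
        using low[of x] y(3) that by (cases "x = a") auto
      ultimately show ?thesis unfolding l by blast
    next
      case False
      then have l: "?l ! s = f y" using True y(3) by (simp add: nth_append)
      have "f y \<in> f ` {x \<in> ?S. ?k x = s}" by (rule imageI) (use y(1,2) ya in simp)
      moreover have "f y \<le> f x" if "x \<in> ?S" "?k x = s" for x
        using low[of x] y(3) that False by (cases "x = a") auto
      ultimately show ?thesis unfolding l by blast
    qed
  next
    case False
    then have st: "s = t" "t = length l" using s t by (auto split: if_splits)
    have l: "?l ! s = f a" using st by simp
    have none: "\<not> (x \<in> S \<and> \<kappa> x = s)" for x using im st by (metis imageI lessThan_iff less_irrefl)
    show ?thesis unfolding l
    proof (intro conjI ballI impI)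
      show "f a \<in> f ` {x \<in> ?S. ?k x = s}" using st by simp
      fix x assume "x \<in> ?S" "?k x = s"
      then have "x = a" using none[of x] k[of x] by auto
      then show "f a \<le> f x" by simp
    qed
  qed
  show ?thesis unfolding class_mins_def by (rule conjI[OF img], intro allI impI, erule pt)
qed

text \<open>
  Geometric description of one pass through the first row: the first rows of the two tableaux
  are the coordinates at which the broken lines leave the picture, and the bumped letters are the corners.
  The description is symmetric under exchange of coordinates, while the insertion procedure is not.
\<close>

definition row_inv :: "(int \<times> int) list \<Rightarrow> int list \<Rightarrow> int list \<Rightarrow> (int \<times> int) list \<Rightarrow> (int \<times> int \<Rightarrow> nat) \<Rightarrow> bool" where
  "row_inv u r q b \<kappa> \<longleftrightarrow> rank_on (set u) \<kappa> \<and> class_mins (set u) \<kappa> fst r \<and> class_mins (set u) \<kappa> snd q \<and>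
     set b = bump_set (set u) \<kappa> \<and> sorted_wrt (<) r \<and> mset r + mset (map fst b) = mset (map fst u) \<and>
     sorted_wrt (<) (map snd b) \<and> snd ` set b \<subseteq> snd ` set u"

lemma biword_inj:
  assumes "biword u" shows "inj_on fst (set u)" "inj_on snd (set u)"
  using assms by (auto simp: biword_def distinct_map strict_sorted_iff)

text \<open>
  The new point is the topmost, so it becomes the last point in its chain; the corner it creates lies between it
  and the former last point, whose first coordinate is \<open>r ! t\<close>.
\<close>

lemma bump_set_insert:
  assumes S: "rank_on S \<kappa>" "inj_on fst S" "inj_on snd S" and r: "class_mins S \<kappa> fst r"
    and new: "\<forall>a\<in>S. snd a < p" "x \<notin> fst ` S" and t: "t \<le> length r"
  shows "bump_set (insert (x, p) S) (\<kappa>((x, p) := t)) =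
    (if t < length r then insert (r ! t, p) (bump_set S \<kappa>) else bump_set S \<kappa>)"
proof -
  let ?S = "insert (x, p) S"
  define K where "K = \<kappa>((x, p) := t)"
  have nS: "(x, p) \<notin> S" using new by force
  have k: "K a = \<kappa> a" if "a \<in> S" for a using that nS by (auto simp: K_def)
  have kt: "K (x, p) = t" by (simp add: K_def)
  have oldp: "a \<in> S" if "a \<in> ?S" "b \<in> ?S" "snd a < snd b" for a b
  proof -
    have "snd b \<le> p" using that(2) new(1) by (auto intro: less_imp_le)
    then have "a \<noteq> (x, p)" using that(3) by auto
    then show ?thesis using that(1) by simp
  qed
  \<comment> \<open>the last point of the chain of rank \<open>t\<close> is the one with the least letter\<close>
  have top: "(\<forall>c\<in>S. \<kappa> c = t \<longrightarrow> \<not> snd a < snd c) \<longleftrightarrow> fst a = r ! t"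
    if a: "a \<in> S" "\<kappa> a = t" and tl: "t < length r" for a
  proof -
    obtain a0 where a0: "a0 \<in> S" "\<kappa> a0 = t" "r ! t = fst a0" and min: "\<forall>c\<in>S. \<kappa> c = t \<longrightarrow> r ! t \<le> fst c"
      using class_minsD(2)[OF r tl] class_minsD(3)[OF r] by (metis)
    have last: "\<not> snd a0 < snd c" if c: "c \<in> S" "\<kappa> c = t" for c
    proof
      assume lt: "snd a0 < snd c"
      then have "fst a0 \<noteq> fst c" using inj_onD[OF S(2), of a0 c] a0(1) c(1) by auto
      then have "fst a0 < fst c" using min c a0(3) by (metis le_neq_trans)
      then have "\<kappa> a0 < \<kappa> c" using S(1) lt a0(1) c(1) unfolding rank_on_def by blast
      then show False using a0 c by simp
    qed
    show ?thesis
    proof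
      assume "\<forall>c\<in>S. \<kappa> c = t \<longrightarrow> \<not> snd a < snd c"
      then have "\<not> snd a < snd a0" using a0 by blast
      then have "snd a = snd a0" using last[OF a] by simp
      then show "fst a = r ! t" using inj_onD[OF S(3), of a a0] a a0 by simp
    next
      assume "fst a = r ! t"
      then have "a = a0" using inj_onD[OF S(2), of a a0] a a0 by simp
      then show "\<forall>c\<in>S. \<kappa> c = t \<longrightarrow> \<not> snd a < snd c" using last by blast
    qed
  qed
  have old: "(\<forall>c\<in>?S. K c = \<kappa> a \<longrightarrow> \<not> (snd a < snd c \<and> snd c < snd b)) \<longleftrightarrow>
      (\<forall>c\<in>S. \<kappa> c = \<kappa> a \<longrightarrow> \<not> (snd a < snd c \<and> snd c < snd b))" if "b \<in> S" for a b
  proof -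
    have "snd b < p" using new(1) that by blast
    then have "\<not> p < snd b" by simp
    then have "\<not> (snd a < snd (x, p) \<and> snd (x, p) < snd b)" by simp
    then show ?thesis using k by (metis insert_iff)
  qed
  define X where "X = {(fst a, p) | a. a \<in> S \<and> \<kappa> a = t \<and> (\<forall>c\<in>S. \<kappa> c = t \<longrightarrow> \<not> snd a < snd c)}"
  have e1: "bump_set ?S K = bump_set S \<kappa> \<union> X"
    (is "?L = ?R")
  proof (intro equalityI subsetI)
    fix z assume "z \<in> ?L"
    then obtain a b where ab: "z = (fst a, snd b)" "a \<in> ?S" "b \<in> ?S" "K a = K b" "snd a < snd b"
      "\<forall>c\<in>?S. K c = K a \<longrightarrow> \<not> (snd a < snd c \<and> snd c < snd b)" unfolding bump_set_def by blast
    have a: "a \<in> S" using oldp ab by blast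
    show "z \<in> ?R"
    proof (cases "b \<in> S")
      case True
      then have "(fst a, snd b) \<in> bump_set S \<kappa>"
        using a True ab(4-6) unfolding k[OF a] k[OF True] old[OF True, of a] by (intro bump_setI)
      then show ?thesis using ab(1) by simp
    next
      case False
      then have b: "b = (x, p)" using ab(3) by simp
      have ka: "\<kappa> a = t" using ab(4) k[OF a] b kt by simp
      have nl: "\<not> snd a < snd c" if c: "c \<in> S" "\<kappa> c = t" for c
      proof
        assume "snd a < snd c"
        moreover have "snd c < snd b" using new(1) c b by simp
        moreover have "K c = K a" using k[OF c(1)] k[OF a] c ka by simp
        moreover have "c \<in> ?S" using c(1) by simp
        ultimately show False using bspec[OF ab(6), of c] by simp
      qed
      have "z \<in> X" unfolding X_def using ab(1) b a ka nl by (intro CollectI exI[of _ a]) simp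
      then show ?thesis by simp
    qed
  next
    fix z assume "z \<in> ?R"
    show "z \<in> ?L"
    proof (cases "z \<in> bump_set S \<kappa>")
      case True
      then obtain a b where ab: "z = (fst a, snd b)" "a \<in> S" "b \<in> S" "\<kappa> a = \<kappa> b" "snd a < snd b"
        "\<forall>c\<in>S. \<kappa> c = \<kappa> a \<longrightarrow> \<not> (snd a < snd c \<and> snd c < snd b)" unfolding bump_set_def by blast
      have "\<forall>c\<in>?S. K c = K a \<longrightarrow> \<not> (snd a < snd c \<and> snd c < snd b)"
        unfolding k[OF ab(2)] old[OF ab(3)] by (rule ab(6))
      moreover have "K a = K b" using k[OF ab(2)] k[OF ab(3)] ab(4) by simp
      ultimately show ?thesis unfolding ab(1) using ab(2,3,5) by (intro bump_setI) simp_all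
    next
      case False
      then have "z \<in> X" using \<open>z \<in> ?R\<close> by simp
      then obtain a where 2: "z = (fst a, p)" "a \<in> S" "\<kappa> a = t" "\<forall>c\<in>S. \<kappa> c = t \<longrightarrow> \<not> snd a < snd c"
        unfolding X_def by auto
      have "\<forall>c\<in>?S. K c = K a \<longrightarrow> \<not> (snd a < snd c \<and> snd c < snd (x, p))"
      proof (intro ballI impI)
        fix c assume c: "c \<in> ?S" "K c = K a"
        show "\<not> (snd a < snd c \<and> snd c < snd (x, p))"
        proof (cases "c \<in> S")
          case True
          then show ?thesis using c(2) k[OF True] k[OF 2(2)] 2(3,4) by simp
        qed (use c in auto)
      qed
      moreover have "K a = K (x, p)" using k[OF 2(2)] 2(3) kt by simp
      moreover have "snd a < snd (x, p)" using new(1) 2(2) by simp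
      moreover have "z = (fst a, snd (x, p))" using 2(1) by simp
      ultimately show ?thesis using bump_setI[of a ?S "(x, p)" K] 2(2) by simp
    qed
  qed
  have e2: "X = (if t < length r then {(r ! t, p)} else {})"
  proof (cases "t < length r")
    case True
    obtain a0 where "a0 \<in> S" "\<kappa> a0 = t" "fst a0 = r ! t" using class_minsD(2)[OF r True] by blast
    then have "(r ! t, p) \<in> X" unfolding X_def using top[of a0] True by (intro CollectI exI[of _ a0]) simp
    moreover have "z = (r ! t, p)" if "z \<in> X" for z
    proof -
      obtain a where "z = (fst a, p)" "a \<in> S" "\<kappa> a = t" "\<forall>c\<in>S. \<kappa> c = t \<longrightarrow> \<not> snd a < snd c"
        using \<open>z \<in> X\<close> unfolding X_def by blast
      then show ?thesis using top[of a] True by simp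
    qed
    then have "X \<subseteq> {(r ! t, p)}" by blast
    ultimately show ?thesis using True by auto
  next
    case False
    have "\<kappa> ` S = {..<length r}" using r by (simp add: class_mins_def)
    then have "\<kappa> a \<noteq> t" if "a \<in> S" for a using False that by auto
    then have "X = {}" unfolding X_def by blast
    then show ?thesis using False by simp
  qed
  have "bump_set ?S K = (if t < length r then insert (r ! t, p) (bump_set S \<kappa>) else bump_set S \<kappa>)"
    unfolding e1 e2 by simp
  then show ?thesis by (simp only: K_def)
qed

text \<open>
  The insertion position is the rank of the new point: the letters before it in the row are smaller and belong to
  points of every smaller rank, and no point with a smaller letter has rank at least \<open>t\<close>.
\<close>

lemma row_inv_step:
  assumes inv: "row_inv u r q b \<kappa>" and bw: "biword (u @ [(x, p)])"
    and step: "row_step (x, p) (r, q, b) = (r', q', b')"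
  shows "row_inv (u @ [(x, p)]) r' q' b' (\<kappa>((x, p) := ins_pos x r))"
proof -
  define S t where "S = set u" and "t = ins_pos x r"
  have bu: "biword u" and new: "\<forall>a\<in>S. snd a < p" "x \<notin> fst ` S" using bw by (auto simp: biword_snoc S_def)
  have i: "rank_on S \<kappa>" "class_mins S \<kappa> fst r" "class_mins S \<kappa> snd q" "set b = bump_set S \<kappa>" "sorted_wrt (<) r"
    "mset r + mset (map fst b) = mset (map fst u)" "sorted_wrt (<) (map snd b)" "snd ` set b \<subseteq> snd ` S"
    using inv by (auto simp: row_inv_def S_def)
  have lq: "length q = length r" using i(2,3) by (metis class_mins_def lessThan_eq_iff)
  let ?S = "insert (x, p) S"
  define K where "K = \<kappa>((x, p) := t)"
  have nS: "(x, p) \<notin> S" using new by force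
  have k: "K a = \<kappa> a" if "a \<in> S" for a using that nS by (auto simp: K_def)
  have kt: "K (x, p) = t" by (simp add: K_def)
  have tl: "t \<le> length r" unfolding t_def by (rule ins_pos_le)
  have kl: "\<kappa> a < length r" "r ! \<kappa> a \<le> fst a" if "a \<in> S" for a
  proof -
    have "\<kappa> ` S = {..<length r}" using i(2) by (simp add: class_mins_def)
    then show l: "\<kappa> a < length r" using that by auto
    show "r ! \<kappa> a \<le> fst a" using i(2) that l unfolding class_mins_def by blast
  qed
  have F1: "\<kappa> a < t" if "a \<in> S" "fst a < x" for a
  proof (rule ccontr)
    assume "\<not> \<kappa> a < t"
    then have "x < r ! \<kappa> a" using ins_pos_ge[OF i(5), of x "\<kappa> a"] kl(1)[OF that(1)] by (simp add: t_def)
    then show False using kl(2)[OF that(1)] that(2) by simp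
  qed
  have rmem: "\<exists>a\<in>S. \<kappa> a = j \<and> fst a = r ! j" if "j < length r" for j
  proof -
    have "r ! j \<in> fst ` {a \<in> S. \<kappa> a = j}" using i(2) that unfolding class_mins_def by blast
    then show ?thesis by auto
  qed
  have rlt: "r ! j < x" if "j < t" for j
  proof -
    have "r ! j \<le> x" using ins_pos_less that by (simp add: t_def)
    moreover have "r ! j \<noteq> x" using rmem[of j] that tl new(2) by (metis image_eqI less_le_trans)
    ultimately show ?thesis by simp
  qed
  have rank: "rank_on ?S K"
    unfolding rank_on_def
  proof (intro conjI ballI impI)
    fix a b assume ab: "a \<in> ?S" "b \<in> ?S" "fst a < fst b \<and> snd a < snd b"
    have "snd b \<le> p" using ab(2) new(1) by (auto intro: less_imp_le)
    then have "a \<noteq> (x, p)" using ab(3) by auto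
    then have aS: "a \<in> S" using ab(1) by simp
    show "K a < K b"
    proof (cases "b \<in> S")
      case True
      then show ?thesis using i(1) ab(3) aS k[OF aS] k[OF True] unfolding rank_on_def by metis
    next
      case False
      then have "b = (x, p)" using ab(2) by simp
      then show ?thesis using F1[OF aS] ab(3) k[OF aS] kt by simp
    qed
  next
    fix b assume b: "b \<in> ?S" "K b \<noteq> 0"
    show "\<exists>a\<in>?S. fst a < fst b \<and> snd a < snd b \<and> Suc (K a) = K b"
    proof (cases "b \<in> S")
      case True
      then obtain a where "a \<in> S" "fst a < fst b" "snd a < snd b" "Suc (\<kappa> a) = \<kappa> b"
        using i(1) b(2) k[OF True] unfolding rank_on_def by metis
      then show ?thesis using k True by (intro bexI[of _ a]) simp_all
    next
      case False
      then have bx: "b = (x, p)" using b(1) by simp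
      then have t0: "t \<noteq> 0" using b(2) kt by simp
      have "t - 1 < length r" using t0 tl by simp
      then obtain a where a: "a \<in> S" "\<kappa> a = t - 1" "fst a = r ! (t - 1)" using rmem by blast
      have "fst a < x" using a(3) rlt[of "t - 1"] t0 by simp
      then show ?thesis using a(1,2) t0 bx k[OF a(1)] kt new(1) by (intro bexI[of _ a]) simp_all
    qed
  qed
  have sets: "set (u @ [(x, p)]) = ?S" by (simp add: S_def)
  have bump: "bump_set ?S K = (if t < length r then insert (r ! t, p) (bump_set S \<kappa>) else bump_set S \<kappa>)"
    unfolding K_def by (rule bump_set_insert[OF i(1) biword_inj[OF bu, folded S_def] i(2) new tl])
  have qmem: "q ! j < p" if "j < length r" for j
  proof -
    have "q ! j \<in> snd ` {a \<in> S. \<kappa> a = j}" using i(3) that lq unfolding class_mins_def by auto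
    then show ?thesis using new(1) by auto
  qed
  note mins = class_mins_insert[OF i(2) nS tl, folded K_def] class_mins_insert[OF i(3) nS tl[folded lq], unfolded lq, folded K_def]
  show ?thesis
  proof (cases "t < length r")
    case True
    have e: "r' = r[t := x]" "q' = q" "b' = b @ [(r ! t, p)]" using step True by (auto simp: row_step_def t_def)
    have xt: "x < r ! t" using ins_pos_ge[OF i(5), of x t] True by (simp add: t_def)
    have "class_mins ?S K fst r'" "class_mins ?S K snd q'"
      using mins True xt qmem[OF True] by (simp_all add: e min_def)
    moreover have "sorted_wrt (<) r'" unfolding e(1)
      by (rule sorted_wrt_list_update[OF i(5) True rlt]) (use ins_pos_ge[OF i(5), of x] t_def in auto)
    moreover have "mset r' + mset (map fst b') = mset (map fst (u @ [(x, p)]))"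
    proof -
      obtain M where M: "mset r = add_mset (r ! t) M" using True by (meson multi_member_split nth_mem_mset)
      then have "mset (r[t := x]) = add_mset x M" using True by (simp add: mset_update)
      then show ?thesis using i(6) M by (simp add: e)
    qed
    moreover have "sorted_wrt (<) (map snd b')"
    proof -
      have "z < p" if "z \<in> snd ` set b" for z
      proof -
        have "z \<in> snd ` S" using i(8) that by (rule subsetD)
        then show ?thesis using new(1) by auto
      qed
      then show ?thesis using i(7) by (auto simp: e sorted_wrt_append)
    qed
    moreover have "snd ` set b' \<subseteq> snd ` ?S" using i(8) by (auto simp: e)
    moreover have "set b' = bump_set ?S K" unfolding bump using True i(4) by (auto simp: e)
    ultimately show ?thesis using rank unfolding row_inv_def sets K_def t_def by blast
  next
    case False
    then have tr: "t = length r" using tl by simp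
    have e: "r' = r @ [x]" "q' = q @ [p]" "b' = b" using step False by (auto simp: row_step_def t_def)
    have "class_mins ?S K fst r'" "class_mins ?S K snd q'" using mins False by (simp_all add: e)
    moreover have "sorted_wrt (<) r'" unfolding e(1)
      using i(5) rlt tr by (auto simp: sorted_wrt_append in_set_conv_nth)
    moreover have "mset r' + mset (map fst b') = mset (map fst (u @ [(x, p)]))"
      using i(6) by (simp add: e)
    moreover have "set b' = bump_set ?S K" unfolding bump using False i(4) by (auto simp: e)
    moreover have "snd ` set b' \<subseteq> snd ` ?S" using i(8) by (auto simp: e)
    ultimately show ?thesis using rank i(7) unfolding row_inv_def sets K_def t_def e(3) by blast
  qed
qed

lemma row_pass_inv:
  "biword u \<Longrightarrow> row_pass u = (r, q, b) \<Longrightarrow> \<exists>\<kappa>. row_inv u r q b \<kappa>"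
proof (induction u arbitrary: r q b rule: rev_induct)
  case Nil
  then show ?case by (auto simp: row_pass_def row_inv_def rank_on_def class_mins_def bump_set_def)
next
  case (snoc a u)
  obtain x p where a: "a = (x, p)" by (cases a)
  obtain r0 q0 b0 where u: "row_pass u = (r0, q0, b0)" by (cases "row_pass u") auto
  have "biword u" using snoc.prems(1) by (simp add: a biword_snoc)
  then obtain \<kappa> where "row_inv u r0 q0 b0 \<kappa>" using snoc.IH u by blast
  moreover have "row_step (x, p) (r0, q0, b0) = (r, q, b)" using snoc.prems(2) u a by (simp add: row_pass_snoc)
  ultimately show ?case using row_inv_step snoc.prems(1) unfolding a by blast
qed

text \<open>Going down a chain of points with ranks decreasing by one.\<close>

lemma rank_on_le:
  assumes "rank_on S \<kappa>" "rank_on S \<kappa>'"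
  shows "a \<in> S \<Longrightarrow> \<kappa> a \<le> \<kappa>' a"
proof (induction "\<kappa> a" arbitrary: a)
  case (Suc n)
  then obtain b where b: "b \<in> S" "fst b < fst a" "snd b < snd a" "Suc (\<kappa> b) = \<kappa> a"
    using assms(1) unfolding rank_on_def by (metis nat.distinct(1))
  then have "\<kappa> b \<le> \<kappa>' b" using Suc.hyps(1)[of b] Suc.hyps(2) by simp
  moreover have "\<kappa>' b < \<kappa>' a" using assms(2) b Suc.prems unfolding rank_on_def by blast
  ultimately show ?case using b(4) by simp
qed simp

lemma rank_on_unique: "rank_on S \<kappa> \<Longrightarrow> rank_on S \<kappa>' \<Longrightarrow> a \<in> S \<Longrightarrow> \<kappa> a = \<kappa>' a"
  using rank_on_le by (meson le_antisym)

lemma class_mins_unique: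
  assumes "class_mins S \<kappa> f r" "class_mins S \<kappa>' f r'" "\<And>a. a \<in> S \<Longrightarrow> \<kappa> a = \<kappa>' a"
  shows "r = r'"
proof (rule nth_equalityI)
  have "\<kappa> ` S = \<kappa>' ` S" using assms(3) by (rule image_cong[OF refl])
  then show l: "length r = length r'" using class_minsD(1)[OF assms(1)] class_minsD(1)[OF assms(2)] by simp
  fix i assume i: "i < length r"
  obtain a where a: "a \<in> S" "\<kappa> a = i" "f a = r ! i" using class_minsD(2)[OF assms(1) i] by blast
  obtain a' where a': "a' \<in> S" "\<kappa>' a' = i" "f a' = r' ! i" using class_minsD(2)[OF assms(2)] i l by metis
  have "r ! i \<le> f a'" using class_minsD(3)[OF assms(1) a'(1)] assms(3)[OF a'(1)] a' by simp
  moreover have "r' ! i \<le> f a" using class_minsD(3)[OF assms(2) a(1)] assms(3)[OF a(1)] a by simp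
  ultimately show "r ! i = r' ! i" using a(3) a'(3) by simp
qed

lemma rank_on_swap: "rank_on S \<kappa> \<Longrightarrow> rank_on (prod.swap ` S) (\<kappa> \<circ> prod.swap)"
  unfolding rank_on_def by (auto simp: image_iff)

lemma class_mins_swap:
  assumes "class_mins S \<kappa> f r"
  shows "class_mins (prod.swap ` S) (\<kappa> \<circ> prod.swap) (f \<circ> prod.swap) r"
proof -
  have c: "{a \<in> prod.swap ` S. (\<kappa> \<circ> prod.swap) a = t} = prod.swap ` {a \<in> S. \<kappa> a = t}" for t by auto
  have "(\<kappa> \<circ> prod.swap) ` prod.swap ` S = \<kappa> ` S" by (simp add: image_image)
  then show ?thesis using assms unfolding class_mins_def c by (simp add: image_image)
qed

text \<open>
  Within a chain one coordinate increases as the other decreases, so neighbours remain neighbours.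
\<close>

lemma bump_set_swap:
  assumes S: "rank_on S \<kappa>" "inj_on fst S" "inj_on snd S"
  shows "prod.swap ` bump_set S \<kappa> \<subseteq> bump_set (prod.swap ` S) (\<kappa> \<circ> prod.swap)"
proof
  fix z assume "z \<in> prod.swap ` bump_set S \<kappa>"
  then obtain a b where ab: "z = (snd b, fst a)" "a \<in> S" "b \<in> S" "\<kappa> a = \<kappa> b" "snd a < snd b"
    "\<forall>c\<in>S. \<kappa> c = \<kappa> a \<longrightarrow> \<not> (snd a < snd c \<and> snd c < snd b)" unfolding bump_set_def by auto
  have anti: "fst d < fst c" if "c \<in> S" "d \<in> S" "\<kappa> c = \<kappa> d" "snd c < snd d" for c d
  proof -
    have "\<not> fst c < fst d" using S(1) that unfolding rank_on_def by (metis less_irrefl)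
    moreover have "fst c \<noteq> fst d" using inj_onD[OF S(2), of c d] that by auto
    ultimately show ?thesis by simp
  qed
  have anti': "snd d < snd c" if "c \<in> S" "d \<in> S" "\<kappa> c = \<kappa> d" "fst c < fst d" for c d
    using anti[of c d] inj_onD[OF S(3), of c d] that by (metis less_asym less_irrefl neqE)
  have "fst b < fst a" using anti ab by simp
  moreover have "\<not> (fst b < fst c \<and> fst c < fst a)" if "c \<in> S" "\<kappa> c = \<kappa> b" for c
  proof
    assume h: "fst b < fst c \<and> fst c < fst a"
    have "snd c < snd b" using anti'[of b c] ab(3) that h by simp
    moreover have "snd a < snd c" using anti'[of c a] ab(2,4) that h by simp
    moreover have "\<kappa> c = \<kappa> a" using ab(4) that by simp
    ultimately show False using bspec[OF ab(6) that(1)] by simp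
  qed
  ultimately show "z \<in> bump_set (prod.swap ` S) (\<kappa> \<circ> prod.swap)"
    unfolding bump_set_def
    by (intro CollectI exI[of _ "prod.swap b"] exI[of _ "prod.swap a"]) (use ab in auto)
qed

lemma bump_set_cong: "(\<And>a. a \<in> S \<Longrightarrow> \<kappa> a = \<kappa>' a) \<Longrightarrow> bump_set S \<kappa> = bump_set S \<kappa>'"
  unfolding bump_set_def by (intro Collect_cong ex_cong1) metis

text \<open>
  Exchanging the coordinates exchanges the first rows and reflects the set of corners, which is the biword
  that produces the lower rows.
\<close>

lemma rs_symmetric:
  "biword u \<Longrightarrow> biword v \<Longrightarrow> set v = prod.swap ` set u \<Longrightarrow> rs v = prod.swap (rs u)"
proof (induction "length u" arbitrary: u v rule: less_induct)
  case less
  show ?case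
  proof (cases "u = []")
    case True
    then show ?thesis using less.prems(3) by simp
  next
    case False
    then have v: "v \<noteq> []" using less.prems(3) by auto
    obtain r q b where ru: "row_pass u = (r, q, b)" by (cases "row_pass u") auto
    obtain r' q' b' where rv: "row_pass v = (r', q', b')" by (cases "row_pass v") auto
    obtain \<kappa> where iu: "row_inv u r q b \<kappa>" using row_pass_inv[OF less.prems(1) ru] by blast
    obtain \<kappa>' where iv: "row_inv v r' q' b' \<kappa>'" using row_pass_inv[OF less.prems(2) rv] by blast
    let ?k = "\<kappa> \<circ> prod.swap"
    have rk: "rank_on (set v) ?k" unfolding less.prems(3) using rank_on_swap iu by (simp add: row_inv_def)
    have kk: "?k a = \<kappa>' a" if "a \<in> set v" for a using rank_on_unique[OF rk _ that] iv by (simp add: row_inv_def)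
    have sw: "fst \<circ> prod.swap = snd" "snd \<circ> prod.swap = fst" by (auto simp: fun_eq_iff)
    have "class_mins (set v) ?k snd r" "class_mins (set v) ?k fst q"
      using class_mins_swap[of "set u" \<kappa> fst r] class_mins_swap[of "set u" \<kappa> snd q] iu
      unfolding less.prems(3) sw by (auto simp: row_inv_def)
    then have rq: "r = q'" "q = r'"
      using class_mins_unique[of "set v" ?k _ _ \<kappa>'] kk iv by (auto simp: row_inv_def)
    have sbv: "set b' = bump_set (set v) ?k"
      using iv bump_set_cong[of "set v" ?k \<kappa>'] kk by (simp add: row_inv_def)
    have i1: "prod.swap ` set b \<subseteq> set b'"
      unfolding sbv using bump_set_swap[OF _ biword_inj[OF less.prems(1)], of \<kappa>] iu less.prems(3) by (simp add: row_inv_def)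
    have i2: "prod.swap ` set b' \<subseteq> set b"
    proof -
      have "prod.swap ` bump_set (set v) ?k \<subseteq> bump_set (prod.swap ` set v) (?k \<circ> prod.swap)"
        by (rule bump_set_swap[OF rk biword_inj[OF less.prems(2)]])
      also have "prod.swap ` set v = set u" unfolding less.prems(3) by (simp add: image_image)
      also have "?k \<circ> prod.swap = \<kappa>" by (simp add: fun_eq_iff)
      finally show ?thesis unfolding sbv using iu by (simp add: row_inv_def comp_def)
    qed
    have sb: "set b' = prod.swap ` set b"
    proof
      show "set b' \<subseteq> prod.swap ` set b"
      proof
        fix z assume "z \<in> set b'"
        then have "prod.swap z \<in> set b" using i2 by auto
        then show "z \<in> prod.swap ` set b" by (metis image_eqI swap_swap)
      qed
    qed (rule i1)
    have bw: "biword b0" and lb: "u0 \<noteq> [] \<longrightarrow> length b0 < length u0"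
      if "row_inv u0 r0 q0 b0 k0" "biword u0" for u0 r0 q0 b0 k0
    proof -
      have m: "mset r0 + mset (map fst b0) = mset (map fst u0)" using that(1) by (simp add: row_inv_def)
      have "mset (r0 @ map fst b0) = mset (map fst u0)" using m by simp
      then have "distinct (r0 @ map fst b0)" using that(2) unfolding biword_def by (metis mset_eq_imp_distinct_iff)
      then show "biword b0" using that(1) by (simp add: biword_def row_inv_def)
      have "length r0 + length b0 = length u0" using arg_cong[OF m, of size] by simp
      moreover have "r0 \<noteq> []" if "u0 \<noteq> []"
        using that \<open>row_inv u0 r0 q0 b0 k0\<close> by (auto simp: row_inv_def class_mins_def)
      ultimately show "u0 \<noteq> [] \<longrightarrow> length b0 < length u0" by (cases r0) auto
    qed
    have "rs b' = prod.swap (rs b)"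
      using less.hyps[of b b'] lb[OF iu less.prems(1)] bw[OF iu less.prems(1)] bw[OF iv less.prems(2)] sb False by blast
    then show ?thesis using rs_row_pass[OF False ru] rs_row_pass[OF v rv] rq by simp
  qed
qed

section \<open>Descents and the recording tableau\<close>

definition row_of :: "tableau \<Rightarrow> int \<Rightarrow> nat" where
  "row_of T e = (THE i. i < length T \<and> e \<in> set (T ! i))"

lemma row_of_eqI:
  assumes "distinct (concat T)" "i < length T" "e \<in> set (T ! i)"
  shows "row_of T e = i"
  unfolding row_of_def
proof (rule the_equality)
  fix j assume j: "j < length T \<and> e \<in> set (T ! j)"
  show "j = i"
  proof (rule ccontr)
    have nc: "set (T ! a) \<inter> set (T ! b) = {}" if "a < b" "b < length T" for a b
    proof -
      have "T = take b T @ T ! b # drop (Suc b) T" using that by (simp add: id_take_nth_drop)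
      then have "distinct (concat (take b T) @ T ! b @ concat (drop (Suc b) T))"
        using assms(1) by (metis concat.simps(2) concat_append)
      then have "set (concat (take b T)) \<inter> set (T ! b) = {}" by auto
      moreover have "set (T ! a) \<subseteq> set (concat (take b T))"
        using that by (auto simp: in_set_conv_nth intro!: bexI[of _ "T ! a"] exI[of _ a])
      ultimately show ?thesis by blast
    qed
    assume "j \<noteq> i"
    then consider "j < i" | "i < j" by linarith
    then show False using nc[of j i] nc[of i j] j assms by cases auto
  qed
qed (use assms in auto)

text \<open>Entries of the recording tableau never move.\<close>

lemma rs_append_rows:
  assumes "biword (u @ v)" "i < length (snd (rs u))" "e \<in> set (snd (rs u) ! i)"
  shows "i < length (snd (rs (u @ v))) \<and> e \<in> set (snd (rs (u @ v)) ! i)"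
  using assms
proof (induction v rule: rev_induct)
  case (snoc a v)
  obtain x p where a: "a = (x, p)" by (cases a)
  have b: "biword ((u @ v) @ [(x, p)])" using snoc.prems(1) by (simp add: a)
  then have "biword (u @ v)" using biword_snoc by blast
  then have IH: "i < length (snd (rs (u @ v)))" "e \<in> set (snd (rs (u @ v)) ! i)" using snoc by auto
  have r: "snd (rs (u @ v @ [a])) = add_at (snd (ins x (fst (rs (u @ v))))) p (snd (rs (u @ v)))"
    using rs_snoc_ins(1)[OF b] by (simp add: a)
  show ?case unfolding r using IH
    add_at_nth[OF rs_snoc_ins(2)[OF b], of i p] by (auto simp: length_add_at)
qed simp

text \<open>
  Of two consecutive letters the second is larger if and only if its position is recorded in no lower row than
  the first; this is the row bumping lemma.
\<close>

lemma rs_descent: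
  assumes "biword (u @ [(x, p), (y, q)] @ v)"
  shows "row_of (snd (rs (u @ [(x, p), (y, q)] @ v))) q \<le> row_of (snd (rs (u @ [(x, p), (y, q)] @ v))) p \<longleftrightarrow> x < y"
proof -
  let ?w = "u @ [(x, p), (y, q)] @ v"
  have b2: "biword ((u @ [(x, p)]) @ [(y, q)])" using assms by (auto simp: biword_def sorted_wrt_append)
  then have b1: "biword (u @ [(x, p)])" using biword_snoc by blast
  then have b0: "biword u" using biword_snoc by blast
  define P k1 k2 where "P = fst (rs u)" and "k1 = snd (ins x P)" and "k2 = snd (ins y (fst (ins x P)))"
  note r1 = rs_snoc_ins[OF b1, folded P_def, folded k1_def]
  note r2 = rs_snoc_ins[OF b2, unfolded r1(1) fst_conv snd_conv, folded k2_def]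
  have tP: "tableau P" using rs_invariants[OF b0] by (simp add: P_def)
  have "distinct (x # y # concat P)"
    using b1 b2 rs_entries(1,3)[OF b0] unfolding biword_snoc P_def by auto
  then have ineq: "k2 \<le> k1 \<longleftrightarrow> x < y" using ins_consecutive[OF tP] by (simp add: k1_def k2_def)
  have p1: "k1 < length (snd (rs (u @ [(x, p)]))) \<and> p \<in> set (snd (rs (u @ [(x, p)])) ! k1)"
    unfolding r1(1) using r1(2) add_at_nth[OF r1(2), of k1 p] by (auto simp: length_add_at)
  have p2: "k2 < length (snd (rs ((u @ [(x, p)]) @ [(y, q)]))) \<and> q \<in> set (snd (rs ((u @ [(x, p)]) @ [(y, q)])) ! k2)"
    unfolding r2(1) using r2(2) add_at_nth[OF r2(2), of k2 q] by (auto simp: length_add_at)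
  have e: "?w = (u @ [(x, p)]) @ ((y, q) # v)" "?w = ((u @ [(x, p)]) @ [(y, q)]) @ v" by auto
  have d: "distinct (concat (snd (rs ?w)))" using rs_entries(4)[OF assms] .
  have "row_of (snd (rs ?w)) p = k1"
    using row_of_eqI[OF d, of k1 p] rs_append_rows[of "u @ [(x, p)]" "(y, q) # v" k1 p] p1 assms by simp
  moreover have "row_of (snd (rs ?w)) q = k2"
    using row_of_eqI[OF d, of k2 q] rs_append_rows[of "(u @ [(x, p)]) @ [(y, q)]" v k2 q] p2 assms by simp
  ultimately show ?thesis using ineq by simp
qed

section \<open>Blocks and generalized parabolic subgroups\<close>

text \<open>The usual notation for the inverse is taken by the inverse in a group.\<close>

abbreviation perm_inv :: "(int \<Rightarrow> int) \<Rightarrow> int \<Rightarrow> int" where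
  "perm_inv w \<equiv> inv_into UNIV w"

lemma int_comp_size: "int (comp_size C) = (\<Sum>j<length C. \<bar>C ! j\<bar>)"
proof -
  have "int (comp_size C) = (\<Sum>c\<leftarrow>C. \<bar>c\<bar>)"
    unfolding comp_size_def by (induction C) auto
  also have "\<dots> = (\<Sum>j<length C. \<bar>C ! j\<bar>)"
    by (simp add: sum_list_sum_nth atLeast0LessThan)
  finally show ?thesis .
qed

lemma block_pos_Union:
  "k \<le> length C \<Longrightarrow> (\<Union>i<k. block_pos C i) = {1..(\<Sum>j<k. \<bar>C ! j\<bar>)}"
proof (induction k)
  case (Suc k)
  have "(\<Union>i<Suc k. block_pos C i) = block_pos C k \<union> (\<Union>i<k. block_pos C i)" by (simp add: lessThan_Suc)
  also have "\<dots> = block_pos C k \<union> {1..(\<Sum>j<k. \<bar>C ! j\<bar>)}" using Suc by simp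
  also have "\<dots> = {1..(\<Sum>j<Suc k. \<bar>C ! j\<bar>)}"
  proof -
    define m where "m = (\<Sum>j<k. \<bar>C ! j\<bar>)"
    have "0 \<le> m" unfolding m_def by (rule sum_nonneg) simp
    then show ?thesis unfolding block_pos_def sum.lessThan_Suc m_def[symmetric] by auto
  qed
  finally show ?case .
qed simp

lemma block_pos_cover:
  "p \<in> {1..int (comp_size C)} \<longleftrightarrow> (\<exists>i<length C. p \<in> block_pos C i)"
  using block_pos_Union[of "length C" C] unfolding int_comp_size by blast

lemma block_pos_range: "p \<in> block_pos C i \<Longrightarrow> i < length C \<Longrightarrow> 1 \<le> p \<and> p \<le> int (comp_size C)"
  using block_pos_cover[of p C] by auto

lemma block_pos_less:
  assumes "i < j" "p \<in> block_pos C i" "q \<in> block_pos C j"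
  shows "p < q"
proof -
  have "(\<Sum>k<Suc i. \<bar>C ! k\<bar>) \<le> (\<Sum>k<j. \<bar>C ! k\<bar>)"
    by (rule sum_mono2) (use assms(1) in auto)
  then show ?thesis using assms(2,3) by (simp add: block_pos_def)
qed

lemma block_pos_unique: "p \<in> block_pos C i \<Longrightarrow> p \<in> block_pos C j \<Longrightarrow> i = j"
  using block_pos_less[of i j p C p] block_pos_less[of j i p C p] by (cases i j rule: linorder_cases) auto

definition same_block :: "int list \<Rightarrow> int \<Rightarrow> int \<Rightarrow> bool" where
  "same_block C p q \<longleftrightarrow> (\<exists>i<length C. p \<in> block_pos C i \<and> q \<in> block_pos C i)"

definition pos_block :: "int list \<Rightarrow> int \<Rightarrow> bool" where
  "pos_block C p \<longleftrightarrow> (\<exists>i<length C. 0 < C ! i \<and> p \<in> block_pos C i)"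

lemma same_block_range:
  "same_block C p q \<Longrightarrow> 1 \<le> p \<and> p \<le> int (comp_size C) \<and> 1 \<le> q \<and> q \<le> int (comp_size C)"
  using block_pos_range by (auto simp: same_block_def)

lemma pos_block_range: "pos_block C p \<Longrightarrow> 1 \<le> p \<and> p \<le> int (comp_size C)"
  using block_pos_range by (auto simp: pos_block_def)

lemma same_block_mem:
  "p \<in> block_pos C i \<Longrightarrow> i < length C \<Longrightarrow> same_block C p q \<longleftrightarrow> q \<in> block_pos C i"
  using block_pos_unique by (metis same_block_def)

lemma pos_block_mem:
  "p \<in> block_pos C i \<Longrightarrow> i < length C \<Longrightarrow> pos_block C p \<longleftrightarrow> 0 < C ! i"
  using block_pos_unique by (metis pos_block_def)

lemma I_set_iff: "i \<in> I_set n \<longleftrightarrow> 1 \<le> \<bar>i\<bar> \<and> \<bar>i\<bar> \<le> int n"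
  by (auto simp: I_set_def)

lemma finite_I_set: "finite (I_set n)"
  by (rule finite_subset[of _ "{-int n..int n}"]) (auto simp: I_set_def)

lemma hyperoctD:
  assumes "w \<in> hyperoct n"
  shows "w permutes I_set n" "w (- i) = - w i" "inj w" "w i \<in> I_set n \<longleftrightarrow> i \<in> I_set n" "w i = w j \<longleftrightarrow> i = j"
proof -
  show p: "w permutes I_set n" using assms by (simp add: hyperoct_def)
  show "w (- i) = - w i"
  proof (cases "i \<in> I_set n")
    case True
    then show ?thesis using assms by (simp add: hyperoct_def)
  next
    case False
    then have "- i \<notin> I_set n" by (simp add: I_set_def)
    then show ?thesis using False p by (simp add: permutes_not_in)
  qed
  show "inj w" using p by (rule permutes_inj)
  show "w i \<in> I_set n \<longleftrightarrow> i \<in> I_set n" using p by (rule permutes_in_image)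
  show "w i = w j \<longleftrightarrow> i = j" using permutes_inj[OF p] by (simp add: inj_eq)
qed

lemma hyperoctI:
  assumes "w permutes I_set n" "\<And>i. i \<in> I_set n \<Longrightarrow> w (- i) = - w i"
  shows "w \<in> hyperoct n"
  using assms by (simp add: hyperoct_def)

lemma hyperoct_abs_range:
  assumes "w \<in> hyperoct n" "1 \<le> p" "p \<le> int n"
  shows "1 \<le> \<bar>w p\<bar>" "\<bar>w p\<bar> \<le> int n" "w p \<noteq> 0"
proof -
  have "w p \<in> I_set n" using hyperoctD(4)[OF assms(1)] assms(2,3) by (simp add: I_set_iff)
  then show "1 \<le> \<bar>w p\<bar>" "\<bar>w p\<bar> \<le> int n" "w p \<noteq> 0" by (auto simp: I_set_iff)
qed

lemma hyperoct_eqI: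
  assumes "v \<in> hyperoct n" "w \<in> hyperoct n" "\<And>p. 1 \<le> p \<Longrightarrow> p \<le> int n \<Longrightarrow> v p = w p"
  shows "v = w"
proof
  fix i :: int
  consider "1 \<le> i" "i \<le> int n" | "1 \<le> - i" "- i \<le> int n" | "i \<notin> I_set n"
    unfolding I_set_iff by linarith
  then show "v i = w i"
  proof cases
    case 1
    then show ?thesis by (rule assms(3))
  next
    case 2
    then have "v (- i) = w (- i)" by (rule assms(3))
    then show ?thesis using hyperoctD(2)[OF assms(1), of i] hyperoctD(2)[OF assms(2), of i] by simp
  next
    case 3
    then show ?thesis using hyperoctD(1)[OF assms(1)] hyperoctD(1)[OF assms(2)] by (simp add: permutes_not_in)
  qed
qed

lemma hyperoct_id: "id \<in> hyperoct n"
  by (rule hyperoctI) (auto simp: permutes_id)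

lemma hyperoct_comp: "v \<in> hyperoct n \<Longrightarrow> w \<in> hyperoct n \<Longrightarrow> v \<circ> w \<in> hyperoct n"
  by (rule hyperoctI) (simp_all add: permutes_compose hyperoctD)

lemma hyperoct_inv:
  assumes w: "w \<in> hyperoct n" shows "perm_inv w \<in> hyperoct n"
proof (rule hyperoctI)
  note p = hyperoctD(1)[OF w]
  show "perm_inv w permutes I_set n" using p by (rule permutes_inv)
  fix i
  have "w (- perm_inv w i) = - i" using hyperoctD(2)[OF w] permutes_inverses(1)[OF p] by simp
  then show "perm_inv w (- i) = - perm_inv w i" using permutes_inverses(2)[OF p] by metis
qed

lemma hyperoct_inv_simps:
  assumes "w \<in> hyperoct n"
  shows "w (perm_inv w i) = i" "perm_inv w (w i) = i" "w \<circ> perm_inv w = id" "perm_inv w \<circ> w = id" "perm_inv (perm_inv w) = w"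
proof -
  note p = hyperoctD(1)[OF assms]
  show "w (perm_inv w i) = i" "perm_inv w (w i) = i" using permutes_inverses[OF p] by auto
  show "w \<circ> perm_inv w = id" "perm_inv w \<circ> w = id" using permutes_inv_o[OF p] by auto
  show "perm_inv (perm_inv w) = w" by (rule permutes_inv_inv[OF p])
qed

lemma hyperoct_inv_comp:
  assumes "v \<in> hyperoct n" "w \<in> hyperoct n"
  shows "perm_inv (v \<circ> w) = perm_inv w \<circ> perm_inv v"
  using assms hyperoctD(1) permutes_bij by (intro o_inv_distrib) blast+

lemma finite_hyperoct: "finite (hyperoct n)"
  by (rule finite_subset[OF _ finite_permutations[OF finite_I_set[of n]]]) (auto simp: hyperoct_def)

lemma s_gen_simps:
  assumes "1 \<le> p"
  shows "s_gen p p = p + 1" "s_gen p (p + 1) = p" "1 \<le> i \<Longrightarrow> s_gen p i = Transposition.transpose p (p + 1) i"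
    "s_gen p (- i) = - s_gen p i"
  using assms by (auto simp: s_gen_def Transposition.transpose_def)

lemma t_gen_simps:
  "t_gen p i = (if i = p then - p else if i = - p then p else i)" "t_gen p (- i) = - t_gen p i"
  by (auto simp: t_gen_def Transposition.transpose_def)

lemma s_gen_hyperoct: "1 \<le> p \<Longrightarrow> p < int n \<Longrightarrow> s_gen p \<in> hyperoct n"
proof (rule hyperoctI)
  assume p: "1 \<le> p" "p < int n"
  show "s_gen p permutes I_set n" unfolding s_gen_def
    by (intro permutes_compose permutes_swap_id) (use p in \<open>auto simp: I_set_iff\<close>)
qed (simp add: s_gen_simps)

lemma t_gen_hyperoct: "1 \<le> p \<Longrightarrow> p \<le> int n \<Longrightarrow> t_gen p \<in> hyperoct n"
proof (rule hyperoctI)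
  assume p: "1 \<le> p" "p \<le> int n"
  show "t_gen p permutes I_set n" unfolding t_gen_def
    by (intro permutes_swap_id) (use p in \<open>auto simp: I_set_iff\<close>)
qed (simp add: t_gen_simps)

lemma gen_involution:
  "1 \<le> p \<Longrightarrow> s_gen p \<circ> s_gen p = id" "t_gen p \<circ> t_gen p = id"
  by (auto simp: fun_eq_iff s_gen_def t_gen_def Transposition.transpose_def)

text \<open>
  A signed permutation preserves all blocks if and only if it preserves their positive parts up to
  sign, and changes signs only in the blocks that contain both signs.
\<close>

lemma W_iff:
  "w \<in> W C \<longleftrightarrow> w \<in> hyperoct (comp_size C) \<and>
     (\<forall>p. 1 \<le> p \<and> p \<le> int (comp_size C) \<longrightarrow> same_block C p \<bar>w p\<bar> \<and> (w p < 0 \<longrightarrow> pos_block C p))"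
  (is "_ \<longleftrightarrow> _ \<and> ?P")
proof (cases "w \<in> hyperoct (comp_size C)")
  case w: True
  have "(\<forall>i<length C. w ` block C i = block C i) \<longleftrightarrow> ?P"
  proof
    assume b: "\<forall>i<length C. w ` block C i = block C i"
    show ?P
    proof (intro allI impI)
      fix p assume "1 \<le> p \<and> p \<le> int (comp_size C)"
      then obtain i where i: "i < length C" "p \<in> block_pos C i" using block_pos_cover[of p C] by auto
      have "p \<in> block C i" using i by (simp add: block_def)
      then have wp: "w p \<in> block C i" using b i(1) by blast
      have pos: "1 \<le> q" if "q \<in> block_pos C i" for q using block_pos_range[OF that i(1)] by simp
      have "\<bar>w p\<bar> \<in> block_pos C i"
      proof (cases "w p \<in> block_pos C i")
        case True
        then show ?thesis using pos[of "w p"] by simp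
      next
        case False
        then obtain q where "q \<in> block_pos C i" "w p = - q" using wp by (auto simp: block_def split: if_splits)
        then show ?thesis using pos[of q] by simp
      qed
      then have "same_block C p \<bar>w p\<bar>" using i by (auto simp: same_block_def)
      moreover have "pos_block C p" if "w p < 0"
      proof -
        have "w p \<notin> block_pos C i" using pos[of "w p"] that by auto
        then have "\<not> C ! i < 0" using wp by (auto simp: block_def)
        moreover have "C ! i \<noteq> 0" using i(2) by (auto simp: block_pos_def)
        ultimately show ?thesis using i by (auto simp: pos_block_def)
      qed
      ultimately show "same_block C p \<bar>w p\<bar> \<and> (w p < 0 \<longrightarrow> pos_block C p)" by blast
    qed
  next
    assume P: ?P
    show "\<forall>i<length C. w ` block C i = block C i"
    proof (intro allI impI)
      fix i assume i: "i < length C"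
      have key: "w p \<in> block_pos C i \<or> C ! i > 0 \<and> - w p \<in> block_pos C i" if p: "p \<in> block_pos C i" for p
      proof -
        have r: "1 \<le> p \<and> p \<le> int (comp_size C)" using block_pos_range[OF p i] .
        have "\<bar>w p\<bar> \<in> block_pos C i" using P r same_block_mem[OF p i] by blast
        moreover have "w p < 0 \<Longrightarrow> 0 < C ! i" using P r pos_block_mem[OF p i] by blast
        ultimately show ?thesis by (cases "w p < 0") auto
      qed
      have "w q \<in> block C i" if q: "q \<in> block C i" for q
      proof (cases "q \<in> block_pos C i")
        case True
        then show ?thesis using key[OF True] by (auto simp: block_def image_iff intro: bexI[of _ "- w q"])
      next
        case False
        then have c: "\<not> C ! i < 0" and mq: "- q \<in> block_pos C i" using q by (auto simp: block_def split: if_splits)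
        have "w q = - w (- q)" using hyperoctD(2)[OF w, of q] by simp
        then show ?thesis using key[OF mq] c by (auto simp: block_def image_iff)
      qed
      then have sub: "w ` block C i \<subseteq> block C i" by blast
      have "finite (block C i)" by (simp add: block_def block_pos_def)
      moreover have "inj_on w (block C i)" using hyperoctD(3)[OF w] by (rule inj_on_subset) simp
      ultimately show "w ` block C i = block C i" using sub by (simp add: endo_inj_surj)
    qed
  qed
  then show ?thesis using w by (simp add: W_def)
qed (simp add: W_def)

lemma W_hyperoct: "w \<in> W C \<Longrightarrow> w \<in> hyperoct (comp_size C)"
  by (simp add: W_def)

lemma W_id: "id \<in> W C"
  by (simp add: W_def hyperoct_id)

lemma W_comp: "v \<in> W C \<Longrightarrow> w \<in> W C \<Longrightarrow> v \<circ> w \<in> W C"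
proof -
  assume vw: "v \<in> W C" "w \<in> W C"
  have "(v \<circ> w) ` block C i = block C i" if "i < length C" for i
    unfolding image_comp[symmetric] using vw that by (simp add: W_def)
  moreover have "v \<circ> w \<in> hyperoct (comp_size C)" using vw by (intro hyperoct_comp) (simp_all add: W_def)
  ultimately show ?thesis unfolding W_def by blast
qed

lemma W_inv: "w \<in> W C \<Longrightarrow> perm_inv w \<in> W C"
proof -
  assume w: "w \<in> W C"
  have "perm_inv w ` block C i = block C i" if "i < length C" for i
  proof -
    have "perm_inv w ` block C i = perm_inv w ` w ` block C i" using w that by (simp add: W_def)
    also have "\<dots> = block C i" using hyperoct_inv_simps(2)[OF W_hyperoct[OF w]] by (simp add: image_image)
    finally show ?thesis .
  qed
  then show ?thesis using w by (simp add: W_def hyperoct_inv)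
qed

lemma finite_W: "finite (W C)"
  by (rule finite_subset[OF _ finite_hyperoct]) (auto simp: W_def)

lemma W_group_simps [simp]:
  "carrier (W_group D) = W D" "monoid.mult (W_group D) = (\<circ>)" "one (W_group D) = id"
  by (auto simp: W_group_def)

lemma group_W_group: "group (W_group D)"
proof (rule groupI)
  fix x assume "x \<in> carrier (W_group D)"
  then show "\<exists>y\<in>carrier (W_group D). y \<otimes>\<^bsub>W_group D\<^esub> x = \<one>\<^bsub>W_group D\<^esub>"
    using hyperoct_inv_simps(4)[OF W_hyperoct] by (intro bexI[of _ "perm_inv x"]) (auto simp: W_inv)
qed (auto simp: W_comp W_id comp_assoc)

lemma W_group_inv: "w \<in> W D \<Longrightarrow> inv\<^bsub>W_group D\<^esub> w = perm_inv w"
  using hyperoct_inv_simps(4)[OF W_hyperoct[of w D]]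
  by (intro group.inv_equality[OF group_W_group]) (simp_all add: W_inv)

lemma subgroup_W: "W C \<subseteq> W D \<Longrightarrow> subgroup (W C) (W_group D)"
  by (rule group.subgroupI[OF group_W_group]) (use W_id in \<open>auto simp: W_group_inv W_inv W_comp subset_iff\<close>)

lemma s_gen_in_W: "same_block C p (p + 1) \<Longrightarrow> s_gen p \<in> W C"
proof -
  assume s: "same_block C p (p + 1)"
  have p: "1 \<le> p" "p < int (comp_size C)" using same_block_range[OF s] by auto
  have "same_block C q \<bar>s_gen p q\<bar> \<and> \<not> s_gen p q < 0" if q: "1 \<le> q" "q \<le> int (comp_size C)" for q
  proof -
    obtain i where i: "i < length C" "q \<in> block_pos C i" using q block_pos_cover[of q C] by auto
    obtain j where j: "j < length C" "p \<in> block_pos C j" "p + 1 \<in> block_pos C j" using s by (auto simp: same_block_def)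
    have "s_gen p q = (if q = p then p + 1 else if q = p + 1 then p else q)"
      using s_gen_simps(3)[OF p(1) q(1)] by (simp add: Transposition.transpose_def)
    then show ?thesis using i j p q by (auto simp: same_block_def)
  qed
  then show ?thesis unfolding W_iff using s_gen_hyperoct[OF p] by blast
qed

lemma t_gen_in_W: "pos_block C p \<Longrightarrow> t_gen p \<in> W C"
proof -
  assume s: "pos_block C p"
  have p: "1 \<le> p" "p \<le> int (comp_size C)" using pos_block_range[OF s] by auto
  have "same_block C q \<bar>t_gen p q\<bar> \<and> (t_gen p q < 0 \<longrightarrow> pos_block C q)" if q: "1 \<le> q" "q \<le> int (comp_size C)" for q
  proof -
    obtain i where "i < length C" "q \<in> block_pos C i" using q block_pos_cover[of q C] by auto
    then have "same_block C q q" by (auto simp: same_block_def)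
    then show ?thesis using p q s by (auto simp: t_gen_simps)
  qed
  then show ?thesis unfolding W_iff using t_gen_hyperoct[OF p] by blast
qed

lemma same_block_subset:
  assumes "W C \<subseteq> W D" "comp_size C = comp_size D" "same_block C p (p + 1)"
  shows "same_block D p (p + 1)"
proof -
  have "s_gen p \<in> W D" using s_gen_in_W[OF assms(3)] assms(1) by blast
  then have "same_block D p \<bar>s_gen p p\<bar>" using same_block_range[OF assms(3)] assms(2) by (simp add: W_iff)
  then show ?thesis using same_block_range[OF assms(3)] by (simp add: s_gen_simps)
qed

lemma W_subsetI:
  assumes "comp_size C = comp_size D" "\<And>p q. same_block C p q \<Longrightarrow> same_block D p q" "\<And>p. pos_block C p \<Longrightarrow> pos_block D p"
  shows "W C \<subseteq> W D"
  using assms unfolding W_iff by (auto simp: subset_iff W_iff)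

section \<open>The length function\<close>

definition pos_pairs :: "nat \<Rightarrow> (int \<times> int) set" where
  "pos_pairs n = {(i, j). 1 \<le> i \<and> i < j \<and> j \<le> int n}"

text \<open>
  Each pair of positions carries two positive roots, the difference and the sum of the coordinates.
\<close>

definition pair_weight :: "int \<Rightarrow> int \<Rightarrow> nat" where
  "pair_weight a b = of_bool (b < a) + of_bool (a + b < 0)"

text \<open>
  The number of positive roots of type \<open>C\<close> made negative by \<open>w\<close>; it is the length (\<open>len_eq_inversions\<close>).
\<close>

definition inversions :: "nat \<Rightarrow> (int \<Rightarrow> int) \<Rightarrow> nat" where
  "inversions n w = (\<Sum>(i, j)\<in>pos_pairs n. pair_weight (w i) (w j)) + (\<Sum>i\<in>{1..int n}. of_bool (w i < 0))"

lemma finite_pos_pairs: "finite (pos_pairs n)"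
  by (rule finite_subset[of _ "{1..int n} \<times> {1..int n}"]) (auto simp: pos_pairs_def)

text \<open>A simple reflection permutes all pairs except \<open>(p, p + 1)\<close>.\<close>

lemma inversions_s_gen:
  assumes p: "1 \<le> p" "p < int n"
  shows "inversions n (w \<circ> s_gen p) + of_bool (w (p + 1) < w p) = inversions n w + of_bool (w p < w (p + 1))"
proof -
  define \<pi> where "\<pi> = Transposition.transpose p (p + 1)"
  have \<pi>: "\<pi> i = (if i = p then p + 1 else if i = p + 1 then p else i)" for i
    by (simp add: \<pi>_def Transposition.transpose_def)
  have s: "s_gen p i = \<pi> i" if "1 \<le> i" for i using s_gen_simps(3)[OF p(1) that] by (simp add: \<pi>_def)
  define P where "P = pos_pairs n - {(p, p + 1)}"
  have mem: "(p, p + 1) \<in> pos_pairs n" using p by (simp add: pos_pairs_def)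
  have split: "(\<Sum>(i, j)\<in>pos_pairs n. g i j) = (\<Sum>(i, j)\<in>P. g i j) + g p (p + 1)" for g :: "int \<Rightarrow> int \<Rightarrow> nat"
    unfolding P_def using sum.remove[OF finite_pos_pairs mem, of "\<lambda>(i, j). g i j"] by simp
  have maps: "(\<pi> i, \<pi> j) \<in> P" if "(i, j) \<in> P" for i j
    using that p by (auto simp: P_def pos_pairs_def \<pi>)
  have inv: "\<pi> (\<pi> i) = i" for i by (simp add: \<pi>)
  have "(\<Sum>(i, j)\<in>P. pair_weight (w (\<pi> i)) (w (\<pi> j))) = (\<Sum>(i, j)\<in>P. pair_weight (w i) (w j))"
    by (rule sum.reindex_bij_witness[of _ "map_prod \<pi> \<pi>" "map_prod \<pi> \<pi>"]) (auto simp: inv maps)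
  moreover have "(\<Sum>(i, j)\<in>P. pair_weight ((w \<circ> s_gen p) i) ((w \<circ> s_gen p) j)) = (\<Sum>(i, j)\<in>P. pair_weight (w (\<pi> i)) (w (\<pi> j)))"
    by (rule sum.cong) (auto simp: P_def pos_pairs_def s)
  moreover have "(\<Sum>i\<in>{1..int n}. of_bool ((w \<circ> s_gen p) i < 0)) = (\<Sum>i\<in>{1..int n}. of_bool (w i < 0) :: nat)"
  proof -
    have "(\<Sum>i\<in>{1..int n}. of_bool ((w \<circ> s_gen p) i < 0)) = (\<Sum>i\<in>{1..int n}. of_bool (w (\<pi> i) < 0) :: nat)"
      by (rule sum.cong) (auto simp: s)
    also have "\<dots> = (\<Sum>i\<in>{1..int n}. of_bool (w i < 0))"
      by (rule sum.reindex_bij_witness[of _ \<pi> \<pi>]) (use p in \<open>auto simp: inv \<pi>\<close>)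
    finally show ?thesis .
  qed
  moreover have "pair_weight ((w \<circ> s_gen p) p) ((w \<circ> s_gen p) (p + 1)) + of_bool (w (p + 1) < w p) =
      pair_weight (w p) (w (p + 1)) + of_bool (w p < w (p + 1))"
    using p by (simp add: s \<pi> pair_weight_def add.commute)
  ultimately show ?thesis unfolding inversions_def split by simp
qed

lemma pair_weight_flip_left: "x \<noteq> 0 \<Longrightarrow> pair_weight (- x) y = pair_weight x y"
  by (auto simp: pair_weight_def)

lemma pair_weight_flip_right: "x < 0 \<Longrightarrow> pair_weight y (- x) \<le> pair_weight y x"
  by (auto simp: pair_weight_def)

text \<open>
  This includes the reflections that are not simple, which occur as generators of \<open>W C\<close>. Making the value at \<open>p\<close>
  positive does not increase the contribution of any pair.
\<close>

lemma inversions_t_gen_less: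
  assumes p: "1 \<le> p" "p \<le> int n" and neg: "w p < 0" and odd: "\<And>i. w (- i) = - w i"
  shows "inversions n (w \<circ> t_gen p) < inversions n w"
proof -
  have t: "(w \<circ> t_gen p) i = (if i = p then - w p else w i)" if "1 \<le> i" for i
    using that p odd[of p] by (simp add: t_gen_simps)
  have "(\<Sum>(i, j)\<in>pos_pairs n. pair_weight ((w \<circ> t_gen p) i) ((w \<circ> t_gen p) j)) \<le> (\<Sum>(i, j)\<in>pos_pairs n. pair_weight (w i) (w j))"
  proof (rule sum_mono)
    fix z assume z: "z \<in> pos_pairs n"
    obtain i j where ij: "z = (i, j)" "1 \<le> i" "i < j" using z by (auto simp: pos_pairs_def)
    show "(case z of (i, j) \<Rightarrow> pair_weight ((w \<circ> t_gen p) i) ((w \<circ> t_gen p) j)) \<le> (case z of (i, j) \<Rightarrow> pair_weight (w i) (w j))"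
      using ij neg pair_weight_flip_left[of "w p"] pair_weight_flip_right[of "w p"] t[of i] t[of j] by auto
  qed
  moreover have "(\<Sum>i\<in>{1..int n}. of_bool ((w \<circ> t_gen p) i < 0)) < (\<Sum>i\<in>{1..int n}. of_bool (w i < 0) :: nat)"
  proof (rule sum_strict_mono_ex1)
    show "\<forall>i\<in>{1..int n}. of_bool ((w \<circ> t_gen p) i < 0) \<le> (of_bool (w i < 0) :: nat)" using t neg by auto
    show "\<exists>i\<in>{1..int n}. of_bool ((w \<circ> t_gen p) i < 0) < (of_bool (w i < 0) :: nat)" 
      using t[OF p(1)] p neg by (intro bexI[of _ p]) auto
  qed simp
  ultimately show ?thesis unfolding inversions_def by simp
qed

lemma inversions_t_gen_one:
  assumes n: "1 \<le> n" and odd: "\<And>i. w (- i) = - w i" and nz: "w 1 \<noteq> 0"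
  shows "inversions n (w \<circ> t_gen 1) + of_bool (w 1 < 0) = inversions n w + of_bool (0 < w 1)"
proof -
  have t: "(w \<circ> t_gen 1) i = (if i = 1 then - w 1 else w i)" if "1 \<le> i" for i
    using that odd[of 1] by (simp add: t_gen_simps)
  have "(\<Sum>(i, j)\<in>pos_pairs n. pair_weight ((w \<circ> t_gen 1) i) ((w \<circ> t_gen 1) j)) = (\<Sum>(i, j)\<in>pos_pairs n. pair_weight (w i) (w j))"
  proof (rule sum.cong)
    fix z assume z: "z \<in> pos_pairs n"
    obtain i j where ij: "z = (i, j)" "1 \<le> i" "i < j" using z by (auto simp: pos_pairs_def)
    show "(case z of (i, j) \<Rightarrow> pair_weight ((w \<circ> t_gen 1) i) ((w \<circ> t_gen 1) j)) = (case z of (i, j) \<Rightarrow> pair_weight (w i) (w j))"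
      using ij pair_weight_flip_left[OF nz] t[of i] t[of j] by auto
  qed simp
  moreover have "(\<Sum>i\<in>{1..int n}. of_bool (v i < 0)) = of_bool (v 1 < 0) + (\<Sum>i\<in>{1..int n} - {1}. of_bool (v i < 0) :: nat)" for v :: "int \<Rightarrow> int"
    using n by (intro sum.remove) auto
  moreover have "(\<Sum>i\<in>{1..int n} - {1}. of_bool ((w \<circ> t_gen 1) i < 0)) = (\<Sum>i\<in>{1..int n} - {1}. of_bool (w i < 0) :: nat)"
    by (rule sum.cong) (auto simp: t_gen_simps)
  ultimately show ?thesis unfolding inversions_def using t[of 1] nz by (auto simp: not_less)
qed

text \<open>The largest element is split off: there both functions take the largest common value.\<close>

lemma weakly_increasing_unique:
  fixes f g :: "int \<Rightarrow> int"
  assumes "finite A" "\<And>a b. a \<in> A \<Longrightarrow> b \<in> A \<Longrightarrow> a < b \<Longrightarrow> f a \<le> f b" "\<And>a b. a \<in> A \<Longrightarrow> b \<in> A \<Longrightarrow> a < b \<Longrightarrow> g a \<le> g b"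
    "\<And>v. card {a \<in> A. f a = v} = card {a \<in> A. g a = v}"
  shows "\<forall>a\<in>A. f a = g a"
  using assms
proof (induction A rule: finite_linorder_max_induct)
  case (insert b A)
  have bA: "b \<notin> A" using insert.hyps(2) by auto
  have attained: "(\<exists>a\<in>insert b A. f a = v) \<longleftrightarrow> (\<exists>a\<in>insert b A. g a = v)" for v
  proof -
    have "card {a \<in> insert b A. f a = v} = 0 \<longleftrightarrow> card {a \<in> insert b A. g a = v} = 0" using insert.prems(3) by simp
    moreover have "finite {a \<in> insert b A. f a = v}" "finite {a \<in> insert b A. g a = v}" using insert.hyps(1) by auto
    ultimately have "{a \<in> insert b A. f a = v} = {} \<longleftrightarrow> {a \<in> insert b A. g a = v} = {}"
      by (simp only: card_0_eq)
    then show ?thesis by blast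
  qed
  have fmax: "f a \<le> f b" if "a \<in> insert b A" for a using that insert.hyps(2) insert.prems(1)[of a b] by auto
  have gmax: "g a \<le> g b" if "a \<in> insert b A" for a using that insert.hyps(2) insert.prems(2)[of a b] by auto
  obtain a where a: "a \<in> insert b A" "g a = f b" using attained[of "f b"] by blast
  obtain a' where a': "a' \<in> insert b A" "f a' = g b" using attained[of "g b"] by blast
  have fg: "f b = g b" using gmax[OF a(1)] fmax[OF a'(1)] a(2) a'(2) by simp
  have count: "card {a \<in> insert b A. h a = v} = card {a \<in> A. h a = v} + of_bool (h b = v)" for h :: "int \<Rightarrow> int" and v
  proof (cases "h b = v")
    case True
    then have "{a \<in> insert b A. h a = v} = insert b {a \<in> A. h a = v}" by auto
    then show ?thesis using True bA insert.hyps(1) by simp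
  next
    case False
    then have "{a \<in> insert b A. h a = v} = {a \<in> A. h a = v}" by auto
    then show ?thesis using False by simp
  qed
  have "\<forall>a\<in>A. f a = g a"
  proof (rule insert.IH)
    show "card {a \<in> A. f a = v} = card {a \<in> A. g a = v}" for v
      using insert.prems(3)[of v] fg unfolding count by simp
    show "f a \<le> f c" if "a \<in> A" "c \<in> A" "a < c" for a c using insert.prems(1)[of a c] that by simp
    show "g a \<le> g c" if "a \<in> A" "c \<in> A" "a < c" for a c using insert.prems(2)[of a c] that by simp
  qed
  then show ?case using fg by simp
qed simp

lemma strictly_increasing_unique:
  fixes f g :: "int \<Rightarrow> int"
  assumes fin: "finite A" and f: "\<And>a b. a \<in> A \<Longrightarrow> b \<in> A \<Longrightarrow> a < b \<Longrightarrow> f a < f b"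
    and g: "\<And>a b. a \<in> A \<Longrightarrow> b \<in> A \<Longrightarrow> a < b \<Longrightarrow> g a < g b" and im: "f ` A = g ` A"
  shows "\<forall>a\<in>A. f a = g a"
proof (rule weakly_increasing_unique[OF fin])
  show "f a \<le> f b" if "a \<in> A" "b \<in> A" "a < b" for a b using f[OF that] by simp
  show "g a \<le> g b" if "a \<in> A" "b \<in> A" "a < b" for a b using g[OF that] by simp
  have c: "card {a \<in> A. h a = v} = of_bool (v \<in> h ` A)" if h: "\<And>a b. a \<in> A \<Longrightarrow> b \<in> A \<Longrightarrow> a < b \<Longrightarrow> h a < h b" for h :: "int \<Rightarrow> int" and v
  proof (cases "v \<in> h ` A")
    case True
    then obtain a where a: "a \<in> A" "h a = v" by auto
    have "{a \<in> A. h a = v} = {a}"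
    proof (intro equalityI subsetI)
      fix b assume b: "b \<in> {a \<in> A. h a = v}"
      show "b \<in> {a}" using h[of a b] h[of b a] a b by (cases a b rule: linorder_cases) auto
    qed (use a in auto)
    then show ?thesis using True by simp
  next
    case False
    then have none: "{a \<in> A. h a = v} = {}" by auto
    show ?thesis unfolding none using False by simp
  qed
  show "card {a \<in> A. f a = v} = card {a \<in> A. g a = v}" for v
    using c[of f v, OF f] c[of g v, OF g] im by simp
qed

text \<open>Such a \<open>w\<close> is an increasing bijection of \<open>{1..n}\<close> to itself.\<close>

lemma id_of_no_descent:
  assumes w: "w \<in> hyperoct n" and inc: "\<And>p. 1 \<le> p \<Longrightarrow> p < int n \<Longrightarrow> w p < w (p + 1)" and pos: "1 \<le> n \<Longrightarrow> 0 < w 1"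
  shows "w = id"
proof (rule hyperoct_eqI[OF w hyperoct_id])
  have mono: "w p < w (p + 1 + int k)" if "1 \<le> p" "p + 1 + int k \<le> int n" for p k
    using that
  proof (induction k)
    case (Suc k)
    have "w p < w (p + 1 + int k)" using Suc by simp
    also have "\<dots> < w (p + 1 + int k + 1)" using Suc.prems by (intro inc) auto
    also have "p + 1 + int k + 1 = p + 1 + int (Suc k)" by simp
    finally show ?case .
  qed (use inc in simp)
  have lt: "w p < w q" if "1 \<le> p" "p < q" "q \<le> int n" for p q
    using mono[of p "nat (q - p - 1)"] that by simp
  have sub: "w ` {1..int n} \<subseteq> {1..int n}"
  proof
    fix y assume "y \<in> w ` {1..int n}"
    then obtain p where p: "1 \<le> p" "p \<le> int n" "y = w p" by auto
    have "0 < w 1" using pos p by simp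
    then have "0 < w p" using lt[of 1 p] p by (cases "p = 1") auto
    then show "y \<in> {1..int n}" using hyperoct_abs_range[OF w p(1,2)] p by simp
  qed
  have "inj_on w {1..int n}" using hyperoctD(3)[OF w] by (rule inj_on_subset) simp
  then have im: "w ` {1..int n} = id ` {1..int n}" using sub by (simp add: endo_inj_surj)
  have "\<forall>p\<in>{1..int n}. w p = id p"
    by (rule strictly_increasing_unique[OF _ _ _ im]) (use lt in auto)
  then show "w p = id p" if "1 \<le> p" "p \<le> int n" for p using that by simp
qed

lemma word_prod_snoc: "word_prod (us @ [s]) = word_prod us \<circ> s"
proof (induction us)
  case (Cons a us)
  then show ?case by (simp add: word_prod_def comp_assoc)
qed (simp add: word_prod_def)

lemma gens_cases:
  assumes "s \<in> gens n"
  obtains "1 \<le> n" "s = t_gen 1" | p where "1 \<le> p" "p < int n" "s = s_gen p"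
  using assms by (auto simp: gens_def split: if_splits)

lemma gens_hyperoct: "s \<in> gens n \<Longrightarrow> s \<in> hyperoct n"
  by (erule gens_cases) (auto intro: t_gen_hyperoct s_gen_hyperoct)

lemma gens_invol: "s \<in> gens n \<Longrightarrow> s \<circ> s = id"
  by (erule gens_cases) (auto simp: gen_involution)

lemma word_prod_hyperoct: "set us \<subseteq> gens n \<Longrightarrow> word_prod us \<in> hyperoct n"
proof (induction us rule: rev_induct)
  case (snoc s us)
  then show ?case unfolding word_prod_snoc by (intro hyperoct_comp) (auto intro: gens_hyperoct)
qed (simp add: word_prod_def hyperoct_id)

lemma inversions_id: "inversions n id = 0"
proof -
  have "(\<Sum>(i, j)\<in>pos_pairs n. pair_weight (id i) (id j)) = 0"
    by (rule sum.neutral) (auto simp: pos_pairs_def pair_weight_def)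
  moreover have "(\<Sum>i\<in>{1..int n}. of_bool (id i < 0)) = (0::nat)" by (rule sum.neutral) auto
  ultimately show ?thesis by (simp add: inversions_def)
qed

lemma inversions_gen_le:
  assumes "w \<in> hyperoct n" "s \<in> gens n"
  shows "inversions n (w \<circ> s) \<le> Suc (inversions n w)"
  using assms(2)
proof (cases rule: gens_cases)
  case 1
  have "w 1 \<noteq> 0" using hyperoct_abs_range(3)[OF assms(1), of 1] 1 by simp
  then show ?thesis using inversions_t_gen_one[of n w, OF 1(1) hyperoctD(2)[OF assms(1)]] 1
    by (cases "0 < w 1") auto
next
  case (2 p)
  then show ?thesis using inversions_s_gen[OF 2(1,2), of w]
    by (cases "w p" "w (p + 1)" rule: linorder_cases) auto
qed

lemma inversions_word_le: "set us \<subseteq> gens n \<Longrightarrow> inversions n (word_prod us) \<le> length us"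
proof (induction us rule: rev_induct)
  case (snoc s us)
  then have "inversions n (word_prod us \<circ> s) \<le> Suc (length us)"
    by (intro order_trans[OF inversions_gen_le[OF word_prod_hyperoct]]) auto
  then show ?case unfolding word_prod_snoc length_append_singleton .
qed (simp add: word_prod_def inversions_id[unfolded id_def] inversions_id)

text \<open>
  As long as \<open>w\<close> is not the identity it has a descent, and multiplying by that generator lowers the number of inversions.
\<close>

lemma reduced_word_exists:
  "w \<in> hyperoct n \<Longrightarrow> \<exists>us. length us = inversions n w \<and> set us \<subseteq> gens n \<and> word_prod us = w"
proof (induction "inversions n w" arbitrary: w rule: less_induct)
  case less
  show ?case
  proof (cases "w = id")
    case True
    then show ?thesis by (intro exI[of _ "[]"]) (simp add: inversions_id word_prod_def)
  next
    case False
    have "\<exists>s\<in>gens n. Suc (inversions n (w \<circ> s)) = inversions n w"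
    proof (rule ccontr)
      assume no: "\<not> ?thesis"
      have "w p < w (p + 1)" if p: "1 \<le> p" "p < int n" for p
      proof (rule ccontr)
        assume "\<not> w p < w (p + 1)"
        then have "w (p + 1) < w p" using hyperoctD(5)[OF less.prems, of p "p + 1"] by simp
        then have "Suc (inversions n (w \<circ> s_gen p)) = inversions n w" using inversions_s_gen[OF p, of w] by simp
        moreover have "s_gen p \<in> gens n" using p by (auto simp: gens_def)
        ultimately show False using no by blast
      qed
      moreover have "0 < w 1" if n: "1 \<le> n"
      proof (rule ccontr)
        assume "\<not> 0 < w 1"
        moreover have nz: "w 1 \<noteq> 0" using hyperoct_abs_range(3)[OF less.prems, of 1] n by simp
        ultimately have "w 1 < 0" by simp
        then have "Suc (inversions n (w \<circ> t_gen 1)) = inversions n w"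
          using inversions_t_gen_one[of n w, OF n hyperoctD(2)[OF less.prems] nz] by simp
        moreover have "t_gen 1 \<in> gens n" using n by (auto simp: gens_def)
        ultimately show False using no by blast
      qed
      ultimately show False using id_of_no_descent[OF less.prems] False by blast
    qed
    then obtain s where s: "s \<in> gens n" "Suc (inversions n (w \<circ> s)) = inversions n w" by blast
    have "w \<circ> s \<in> hyperoct n" using less.prems gens_hyperoct[OF s(1)] by (rule hyperoct_comp)
    then obtain us where us: "length us = inversions n (w \<circ> s)" "set us \<subseteq> gens n" "word_prod us = w \<circ> s"
      using less.hyps[of "w \<circ> s"] s(2) by auto
    have "word_prod (us @ [s]) = w" unfolding word_prod_snoc us(3) comp_assoc gens_invol[OF s(1)] by simp
    then show ?thesis using us s by (intro exI[of _ "us @ [s]"]) simp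
  qed
qed

lemma len_eq_inversions:
  assumes "w \<in> hyperoct n" shows "len n w = inversions n w"
  unfolding len_def
proof (rule Least_equality)
  show "\<exists>us. length us = inversions n w \<and> set us \<subseteq> gens n \<and> word_prod us = w" by (rule reduced_word_exists[OF assms])
  show "inversions n w \<le> k" if "\<exists>us. length us = k \<and> set us \<subseteq> gens n \<and> word_prod us = w" for k
    using that inversions_word_le by blast
qed

lemma word_prod_rev: "set us \<subseteq> gens n \<Longrightarrow> word_prod (rev us) = perm_inv (word_prod us)"
proof (induction us rule: rev_induct)
  case (snoc s us)
  have s: "s \<in> gens n" and us: "set us \<subseteq> gens n" using snoc.prems by auto
  have "perm_inv s = s"
    using gens_invol[OF s] hyperoct_inv_simps[OF gens_hyperoct[OF s]] by (metis comp_assoc comp_id id_comp)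
  have "word_prod (rev (us @ [s])) = s \<circ> word_prod (rev us)" by (simp add: word_prod_def)
  also have "\<dots> = perm_inv s \<circ> perm_inv (word_prod us)" using snoc.IH[OF us] \<open>perm_inv s = s\<close> by simp
  also have "\<dots> = perm_inv (word_prod us \<circ> s)"
    using hyperoct_inv_comp[OF word_prod_hyperoct[OF us] gens_hyperoct[OF s]] by simp
  finally show ?case unfolding word_prod_snoc .
qed (simp add: word_prod_def)

lemma len_inv:
  assumes "w \<in> hyperoct n" shows "len n (perm_inv w) = len n w"
proof -
  have le: "len n (perm_inv v) \<le> len n v" if v: "v \<in> hyperoct n" for v
  proof -
    obtain us where us: "length us = inversions n v" "set us \<subseteq> gens n" "word_prod us = v"
      using reduced_word_exists[OF v] by blast
    have "inversions n (word_prod (rev us)) \<le> length (rev us)" using us by (intro inversions_word_le) simp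
    then show ?thesis using us word_prod_rev[OF us(2)] len_eq_inversions[OF v] len_eq_inversions[OF hyperoct_inv[OF v]] by simp
  qed
  show ?thesis using le[OF assms] le[OF hyperoct_inv[OF assms]] hyperoct_inv_simps(5)[OF assms] by simp
qed

section \<open>Minimal coset representatives\<close>

definition block_increasing :: "int list \<Rightarrow> (int \<Rightarrow> int) \<Rightarrow> bool" where
  "block_increasing C x \<longleftrightarrow> (\<forall>p. same_block C p (p + 1) \<longrightarrow> x p < x (p + 1)) \<and> (\<forall>p. pos_block C p \<longrightarrow> 0 < x p)"

lemma block_increasing_less:
  assumes x: "block_increasing C x" and i: "i < length C" and p: "p \<in> block_pos C i" and q: "q \<in> block_pos C i" and pq: "p < q"
  shows "x p < x q"
proof -
  have "x p < x (p + 1 + int k)" if "p + 1 + int k \<in> block_pos C i" for k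
    using that
  proof (induction k)
    case 0
    then have "same_block C p (p + 1)" using p i by (auto simp: same_block_def)
    then show ?case using x by (simp add: block_increasing_def)
  next
    case (Suc k)
    have e: "p + 1 + int k + 1 = p + 1 + int (Suc k)" by simp
    have m: "p + 1 + int k \<in> block_pos C i" using Suc.prems p by (simp add: block_pos_def)
    have "same_block C (p + 1 + int k) (p + 1 + int k + 1)"
      unfolding e same_block_def using m Suc.prems i by blast
    then have "x (p + 1 + int k) < x (p + 1 + int k + 1)" using x unfolding block_increasing_def by blast
    then show ?case using Suc.IH[OF m] unfolding e by simp
  qed
  from this[of "nat (q - p - 1)"] show ?thesis using pq q by simp
qed

text \<open>
  Both \<open>x\<close> and \<open>x \<circ> w\<close> increase on each block with the same set of values there: where \<open>w\<close> could change
  signs, positivity of both prevents it.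
\<close>

lemma block_increasing_unique:
  assumes x: "x \<in> hyperoct (comp_size C)" "block_increasing C x" and w: "w \<in> W C" and xw: "block_increasing C (x \<circ> w)"
  shows "w = id"
proof (rule hyperoct_eqI[OF W_hyperoct[OF w] hyperoct_id])
  fix p assume p: "1 \<le> p" "p \<le> int (comp_size C)"
  then obtain i where i: "i < length C" "p \<in> block_pos C i" using block_pos_cover[of p C] by auto
  have range: "1 \<le> q \<and> q \<le> int (comp_size C)" if "q \<in> block_pos C i" for q using block_pos_range[OF that i(1)] .
  have sub: "w q \<in> block_pos C i" if q: "q \<in> block_pos C i" for q
  proof -
    have sb: "same_block C q \<bar>w q\<bar>" and pb: "w q < 0 \<longrightarrow> pos_block C q" using w range[OF q] by (auto simp: W_iff)
    have m: "\<bar>w q\<bar> \<in> block_pos C i" using sb same_block_mem[OF q i(1)] by blast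
    have "\<not> w q < 0"
    proof
      assume neg: "w q < 0"
      then have ci: "0 < C ! i" using pb pos_block_mem[OF q i(1)] by blast
      then have "0 < x \<bar>w q\<bar>" using x(2) pos_block_mem[OF m i(1)] by (simp add: block_increasing_def)
      moreover have "0 < (x \<circ> w) q" using xw ci pos_block_mem[OF q i(1)] unfolding block_increasing_def by blast
      moreover have "x \<bar>w q\<bar> = - x (w q)" using neg hyperoctD(2)[OF x(1), of "w q"] by simp
      ultimately show False by simp
    qed
    then show ?thesis using m by simp
  qed
  have fin: "finite (block_pos C i)" by (simp add: block_pos_def)
  have "inj_on w (block_pos C i)" using hyperoctD(3)[OF W_hyperoct[OF w]] by (rule inj_on_subset) simp
  then have "w ` block_pos C i = block_pos C i" using sub fin by (intro endo_inj_surj) auto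
  then have im: "(x \<circ> w) ` block_pos C i = x ` block_pos C i" by (metis image_comp)
  have "\<forall>q\<in>block_pos C i. (x \<circ> w) q = x q"
    by (rule strictly_increasing_unique[OF fin _ _ im])
      (use block_increasing_less[OF xw i(1)] block_increasing_less[OF x(2) i(1)] in blast)+
  then have "x (w p) = x p" using i(2) by simp
  then show "w p = id p" using hyperoctD(5)[OF x(1)] by simp
qed

text \<open>A violation would be repaired, with smaller length, by a reflection in \<open>W C\<close>.\<close>

lemma block_increasing_of_minimal:
  assumes v: "v \<in> hyperoct (comp_size C)" and min: "\<And>w. w \<in> W C \<Longrightarrow> len (comp_size C) v \<le> len (comp_size C) (v \<circ> w)"
  shows "block_increasing C v"
  unfolding block_increasing_def
proof (intro conjI allI impI)
  let ?n = "comp_size C"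
  have le: "inversions ?n v \<le> inversions ?n (v \<circ> w)" if w: "w \<in> W C" for w
    using min[OF w] len_eq_inversions[OF v] len_eq_inversions[OF hyperoct_comp[OF v W_hyperoct[OF w]]] by simp
  fix p
  show "v p < v (p + 1)" if s: "same_block C p (p + 1)"
  proof (rule ccontr)
    assume "\<not> v p < v (p + 1)"
    then have "v (p + 1) < v p" using hyperoctD(5)[OF v, of p "p + 1"] by simp
    then show False using inversions_s_gen[of p ?n v] same_block_range[OF s] le[OF s_gen_in_W[OF s]] by simp
  qed
  show "0 < v p" if s: "pos_block C p"
  proof (rule ccontr)
    assume "\<not> 0 < v p"
    then have "v p < 0" using hyperoct_abs_range(3)[OF v, of p] pos_block_range[OF s] by simp
    then show False using inversions_t_gen_less[of p ?n v] pos_block_range[OF s] hyperoctD(2)[OF v] le[OF t_gen_in_W[OF s]] by simp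
  qed
qed

lemma minimal_in_coset:
  "\<exists>w\<in>W C. \<forall>w'\<in>W C. len (comp_size C) (x \<circ> w) \<le> len (comp_size C) (x \<circ> w')"
proof -
  have "finite (W C)" "W C \<noteq> {}" using finite_W W_id by auto
  from ex_min_if_finite[of "(\<lambda>w. len (comp_size C) (x \<circ> w)) ` W C"] this
  show ?thesis by (auto simp: not_less)
qed

text \<open>
  A block increasing element is the only one in its coset, and the minimal elements of the coset are block increasing.
\<close>

lemma X_iff: "x \<in> X C \<longleftrightarrow> x \<in> hyperoct (comp_size C) \<and> block_increasing C x"
proof
  assume x: "x \<in> X C"
  then have h: "x \<in> hyperoct (comp_size C)" by (simp add: X_def)
  show "x \<in> hyperoct (comp_size C) \<and> block_increasing C x"
    using h block_increasing_of_minimal[OF h] x by (auto simp: X_def)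
next
  assume x: "x \<in> hyperoct (comp_size C) \<and> block_increasing C x"
  obtain w where w: "w \<in> W C" "\<And>w'. w' \<in> W C \<Longrightarrow> len (comp_size C) (x \<circ> w) \<le> len (comp_size C) (x \<circ> w')"
    using minimal_in_coset[of C x] by blast
  have h: "x \<circ> w \<in> hyperoct (comp_size C)" using x W_hyperoct[OF w(1)] by (intro hyperoct_comp) auto
  have "block_increasing C (x \<circ> w)"
  proof (rule block_increasing_of_minimal[OF h])
    fix w' assume "w' \<in> W C"
    then show "len (comp_size C) (x \<circ> w) \<le> len (comp_size C) (x \<circ> w \<circ> w')"
      using w(2)[OF W_comp[OF w(1), of w']] by (simp add: comp_assoc)
  qed
  then have "w = id" using block_increasing_unique x w(1) by blast
  then show "x \<in> X C" using w(2) x by (simp add: X_def)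
qed

lemma X_coset_representative:
  assumes "x \<in> hyperoct (comp_size C)"
  shows "\<exists>w\<in>W C. x \<circ> w \<in> X C"
proof -
  obtain w where w: "w \<in> W C" "\<And>w'. w' \<in> W C \<Longrightarrow> len (comp_size C) (x \<circ> w) \<le> len (comp_size C) (x \<circ> w')"
    using minimal_in_coset[of C x] by blast
  have h: "x \<circ> w \<in> hyperoct (comp_size C)" using assms W_hyperoct[OF w(1)] by (rule hyperoct_comp)
  have "len (comp_size C) (x \<circ> w) \<le> len (comp_size C) (x \<circ> w \<circ> w')" if "w' \<in> W C" for w'
    using w(2)[OF W_comp[OF w(1) that]] by (simp add: comp_assoc)
  then show ?thesis using h w(1) by (intro bexI[of _ w]) (simp_all add: X_def)
qed

lemma card_X_times_card_W:
  assumes sub: "W C \<subseteq> W D" and sz: "comp_size C = comp_size D"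
  shows "card (X C \<inter> W D) * card (W C) = card (W D)"
proof -
  have "bij_betw (\<lambda>(x, w). x \<circ> w) ((X C \<inter> W D) \<times> W C) (W D)"
  proof (rule bij_betwI')
    fix a b assume a: "a \<in> (X C \<inter> W D) \<times> W C" and b: "b \<in> (X C \<inter> W D) \<times> W C"
    obtain x w x' w' where ab: "a = (x, w)" "b = (x', w')" by (cases a, cases b)
    show "((case a of (x, w) \<Rightarrow> x \<circ> w) = (case b of (x, w) \<Rightarrow> x \<circ> w)) = (a = b)"
    proof
      assume "(case a of (x, w) \<Rightarrow> x \<circ> w) = (case b of (x, w) \<Rightarrow> x \<circ> w)"
      then have e: "x \<circ> w = x' \<circ> w'" using ab by simp
      have w: "w \<in> W C" "w' \<in> W C" "x \<in> X C" "x' \<in> X C" using a b ab by auto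
      have "x' = x \<circ> (w \<circ> perm_inv w')"
        using e hyperoct_inv_simps(3)[OF W_hyperoct[OF w(2)]] by (metis comp_assoc comp_id)
      moreover have ww: "w \<circ> perm_inv w' \<in> W C" using W_comp W_inv w by blast
      ultimately have "w \<circ> perm_inv w' = id"
        using block_increasing_unique[OF _ _ ww] w(3,4) X_iff by metis
      then have "x' = x" using \<open>x' = x \<circ> (w \<circ> perm_inv w')\<close> by simp
      moreover have "w = w'"
        using \<open>w \<circ> perm_inv w' = id\<close> hyperoct_inv_simps(4)[OF W_hyperoct[OF w(2)]] by (metis comp_assoc comp_id id_comp)
      ultimately show "a = b" using ab by simp
    qed simp
  next
    fix a assume "a \<in> (X C \<inter> W D) \<times> W C"
    then show "(case a of (x, w) \<Rightarrow> x \<circ> w) \<in> W D" using sub W_comp by auto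
  next
    fix y assume y: "y \<in> W D"
    then have "y \<in> hyperoct (comp_size C)" using W_hyperoct sz by metis
    then obtain w where w: "w \<in> W C" "y \<circ> w \<in> X C" using X_coset_representative by blast
    have "y \<circ> w \<in> W D" using y w(1) sub W_comp by blast
    moreover have "y = (y \<circ> w) \<circ> perm_inv w"
      using hyperoct_inv_simps(3)[OF W_hyperoct[OF w(1)]] by (simp add: comp_assoc)
    ultimately show "\<exists>a\<in>(X C \<inter> W D) \<times> W C. y = (case a of (x, w) \<Rightarrow> x \<circ> w)"
      using w W_inv by (intro bexI[of _ "(y \<circ> w, perm_inv w)"]) auto
  qed
  then show ?thesis using bij_betw_same_card card_cartesian_product by metis
qed

section \<open>Double cosets\<close>

text \<open>
  The number of the block of \<open>q\<close>, counted from \<open>1\<close>, with the sign of \<open>q\<close>. It is weakly increasing on \<open>I_set\<close>, and up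
  to sign it is constant on orbits of \<open>W C\<close>.
\<close>

definition block_label :: "int list \<Rightarrow> int \<Rightarrow> int" where
  "block_label C q = sgn q * (1 + int (THE i. i < length C \<and> \<bar>q\<bar> \<in> block_pos C i))"

lemma block_label_pos:
  assumes "i < length C" "p \<in> block_pos C i"
  shows "block_label C p = 1 + int i"
proof -
  have p: "1 \<le> p" using block_pos_range[OF assms(2,1)] by simp
  have "(THE j. j < length C \<and> p \<in> block_pos C j) = i"
    by (rule the_equality) (use assms block_pos_unique in auto)
  then show ?thesis using p by (simp add: block_label_def)
qed

lemma block_label_minus: "block_label C (- q) = - block_label C q"
  by (simp add: block_label_def sgn_minus)

lemma block_label_sgn: "block_label C q = sgn q * \<bar>block_label C q\<bar>"
  by (cases q "0::int" rule: linorder_cases) (auto simp: block_label_def abs_mult)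

lemma block_label_abs: "\<bar>block_label C \<bar>q\<bar>\<bar> = \<bar>block_label C q\<bar>"
  by (cases "0 \<le> q") (simp_all add: block_label_minus)

lemma block_label_same_block: "same_block C p q \<Longrightarrow> block_label C p = block_label C q"
  by (auto simp: same_block_def block_label_pos)

lemma block_label_mono_pos:
  assumes "1 \<le> p" "p < q" "q \<le> int (comp_size C)"
  shows "1 \<le> block_label C p" "block_label C p \<le> block_label C q"
proof -
  obtain i where i: "i < length C" "p \<in> block_pos C i" using assms block_pos_cover[of p C] by auto
  obtain j where j: "j < length C" "q \<in> block_pos C j" using assms block_pos_cover[of q C] by auto
  have "\<not> j < i" using block_pos_less[of j i q C p] i j assms by auto
  then show "1 \<le> block_label C p" "block_label C p \<le> block_label C q" using block_label_pos[OF i] block_label_pos[OF j] by auto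
qed

lemma block_label_ge_1: "1 \<le> p \<Longrightarrow> p \<le> int (comp_size C) \<Longrightarrow> 1 \<le> block_label C p"
  using block_pos_cover[of p C] by (auto simp: block_label_pos)

lemma block_label_mono:
  assumes p: "p \<in> I_set (comp_size C)" and q: "q \<in> I_set (comp_size C)" and pq: "p < q"
  shows "block_label C p \<le> block_label C q"
proof -
  have r: "1 \<le> \<bar>p\<bar>" "\<bar>p\<bar> \<le> int (comp_size C)" "1 \<le> \<bar>q\<bar>" "\<bar>q\<bar> \<le> int (comp_size C)" using p q by (auto simp: I_set_iff)
  consider "0 < p" | "p < 0" "0 < q" | "q < 0" using r pq by linarith
  then show ?thesis
  proof cases
    case 1
    then show ?thesis using block_label_mono_pos(2)[of p q C] r pq by simp
  next
    case 2
    then have "1 \<le> block_label C (- p)" "1 \<le> block_label C q" using r by (auto intro: block_label_ge_1)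
    then show ?thesis by (simp add: block_label_minus)
  next
    case 3
    then have "block_label C (- q) \<le> block_label C (- p)" using block_label_mono_pos(2)[of "- q" "- p" C] r pq by simp
    then show ?thesis by (simp add: block_label_minus)
  qed
qed

lemma W_abs: 
  assumes a: "a \<in> W C" and q: "q \<in> I_set (comp_size C)"
  shows "same_block C \<bar>q\<bar> \<bar>a q\<bar>" "\<not> pos_block C \<bar>q\<bar> \<Longrightarrow> sgn (a q) = sgn q"
proof -
  have r: "1 \<le> \<bar>q\<bar>" "\<bar>q\<bar> \<le> int (comp_size C)" using q by (auto simp: I_set_iff)
  note h = W_hyperoct[OF a]
  have P: "same_block C \<bar>q\<bar> \<bar>a \<bar>q\<bar>\<bar>" "a \<bar>q\<bar> < 0 \<Longrightarrow> pos_block C \<bar>q\<bar>" using a r by (auto simp: W_iff)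
  show "same_block C \<bar>q\<bar> \<bar>a q\<bar>"
  proof (cases "0 \<le> q")
    case True
    then have e: "\<bar>q\<bar> = q" by simp
    show ?thesis using P(1) unfolding e .
  next
    case False
    then have e: "\<bar>q\<bar> = - q" by simp
    show ?thesis using P(1) unfolding e hyperoctD(2)[OF h] abs_minus_cancel .
  qed
  show "sgn (a q) = sgn q" if "\<not> pos_block C \<bar>q\<bar>"
  proof -
    have pos: "0 < a \<bar>q\<bar>" using P(2) that hyperoct_abs_range(3)[OF h r] by (metis linorder_neqE)
    show ?thesis
    proof (cases "0 \<le> q")
      case True
      then have e: "\<bar>q\<bar> = q" by simp
      show ?thesis using pos r(1) unfolding e by simp
    next
      case False
      then have e: "\<bar>q\<bar> = - q" by simp
      show ?thesis using pos r(1) unfolding e hyperoctD(2)[OF h] by simp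
    qed
  qed
qed

lemma pos_block_same: "same_block C p q \<Longrightarrow> pos_block C p \<longleftrightarrow> pos_block C q"
  using pos_block_mem by (auto simp: same_block_def)

lemma block_increasing_inv_pos:
  assumes r: "r \<in> hyperoct n" and inc: "block_increasing C (perm_inv r)" and p: "0 < p" and pb: "pos_block C \<bar>r p\<bar>"
  shows "0 < r p"
proof (rule ccontr)
  assume n: "\<not> 0 < r p"
  have "0 < perm_inv r \<bar>r p\<bar>" using inc pb by (simp add: block_increasing_def)
  moreover have "perm_inv r \<bar>r p\<bar> = - p"
    using n hyperoctD(2)[OF hyperoct_inv[OF r], of "r p"] hyperoct_inv_simps(2)[OF r, of p] by simp
  ultimately show False using p by simp
qed

text \<open>
  On a block of \<open>C\<close> the labels of the values of \<open>r\<close> and of \<open>r'\<close> are both weakly increasing, and they are the same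
  up to a permutation of the block: \<open>a\<close> does not change the label of a value, except for the sign, and \<open>b\<close> permutes the
  block up to signs. The signs agree because in the blocks where they could change both values are positive.
\<close>

lemma double_coset_labels:
  assumes sz: "comp_size C = n" "comp_size C' = n" and r: "r \<in> hyperoct n" "r' \<in> hyperoct n"
    and a: "a \<in> W C'" and b: "b \<in> W C" and r': "r' = a \<circ> r \<circ> b"
    and inc: "block_increasing C r" "block_increasing C r'" "block_increasing C' (perm_inv r)" "block_increasing C' (perm_inv r')"
    and p: "1 \<le> p" "p \<le> int n"
  shows "block_label C' (r p) = block_label C' (r' p)"
proof -
  obtain i where i: "i < length C" "p \<in> block_pos C i" using p sz block_pos_cover[of p C] by auto
  define A where "A = block_pos C i"
  define \<beta> where "\<beta> q = \<bar>b q\<bar>" for q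
  have finA: "finite A" by (simp add: A_def block_pos_def)
  note hb = W_hyperoct[OF b, unfolded sz(1)]
  have Ar: "1 \<le> q" "q \<le> int n" "q \<in> I_set n" if "q \<in> A" for q
    using block_pos_range[OF that[unfolded A_def] i(1)] sz by (auto simp: I_set_iff)
  have bA: "\<beta> q \<in> A" if "q \<in> A" for q
  proof -
    have "same_block C q \<bar>b q\<bar>" using b Ar[OF that] sz by (simp add: W_iff)
    then show ?thesis unfolding \<beta>_def A_def using same_block_mem[OF that[unfolded A_def] i(1)] by blast
  qed
  have inj: "inj_on \<beta> A"
  proof (rule inj_onI)
    fix x y assume xy: "x \<in> A" "y \<in> A" "\<beta> x = \<beta> y"
    then have "b x = b y \<or> b x = b (- y)" unfolding \<beta>_def hyperoctD(2)[OF hb] by linarith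
    then have "x = y \<or> x = - y" using hyperoctD(5)[OF hb] by blast
    then show "x = y" using Ar(1)[OF xy(1)] Ar(1)[OF xy(2)] by linarith
  qed
  have bij: "bij_betw \<beta> A A" unfolding bij_betw_def
    using inj bA finA by (intro conjI endo_inj_surj) auto
  \<comment> \<open>the labels of \<open>r'\<close> are those of \<open>r\<close>, permuted by \<open>\<beta>\<close>\<close>
  have key: "block_label C' (r' q) = block_label C' (r (\<beta> q))" if q: "q \<in> A" for q
  proof -
    define u v where "u = r' q" and "v = r (\<beta> q)"
    have uI: "u \<in> I_set n" "v \<in> I_set n"
      using Ar(3)[OF q] Ar(3)[OF bA[OF q]] hyperoctD(4)[OF r(1)] hyperoctD(4)[OF r(2)] by (auto simp: u_def v_def)
    have uv: "u = a (r (b q))" by (simp add: u_def r')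
    have rbq: "\<bar>r (b q)\<bar> = \<bar>v\<bar>" using hyperoctD(2)[OF r(1), of "b q"] by (auto simp: v_def \<beta>_def abs_if)
    have "r (b q) \<in> I_set n" using Ar(3)[OF q] hyperoctD(4)[OF r(1)] hyperoctD(4)[OF hb] by simp
    then have sb: "same_block C' \<bar>r (b q)\<bar> \<bar>u\<bar>" using W_abs(1)[OF a] sz uv by simp
    then have sb': "same_block C' \<bar>v\<bar> \<bar>u\<bar>" using rbq by simp
    then have labs: "\<bar>block_label C' u\<bar> = \<bar>block_label C' v\<bar>"
      using block_label_same_block block_label_abs by metis
    have "sgn u = sgn v"
    proof (cases "0 < C ! i")
      case True
      then have "pos_block C q" "pos_block C (\<beta> q)" using q bA[OF q] i(1) by (auto simp: pos_block_def A_def)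
      then have "0 < u" "0 < v" using inc(1,2) by (auto simp: block_increasing_def u_def v_def)
      then show ?thesis by simp
    next
      case False
      have "\<not> b q < 0"
        using b Ar[OF q] sz False pos_block_mem[OF q[unfolded A_def] i(1)] by (auto simp: W_iff)
      then have bq: "\<beta> q = b q" by (simp add: \<beta>_def)
      show ?thesis
      proof (cases "pos_block C' \<bar>v\<bar>")
        case True
        then have "pos_block C' \<bar>u\<bar>" using pos_block_same[OF sb'] by simp
        then have "0 < u" using block_increasing_inv_pos[OF r(2) inc(4), of q] Ar(1)[OF q] by (simp add: u_def)
        moreover have "0 < v" using block_increasing_inv_pos[OF r(1) inc(3), of "\<beta> q"] Ar(1)[OF bA[OF q]] True by (simp add: v_def)
        ultimately show ?thesis by simp
      next
        case False
        then show ?thesis using W_abs(2)[OF a, of v] uI(2) sz uv bq by (simp add: v_def)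
      qed
    qed
    then show ?thesis using labs block_label_sgn[of C' u] block_label_sgn[of C' v] by (simp add: u_def v_def)
  qed
  have mono: "block_label C' (s x) \<le> block_label C' (s y)"
    if s: "s \<in> hyperoct n" "block_increasing C s" and xy: "x \<in> A" "y \<in> A" "x < y" for s x y
    using block_label_mono[of "s x" C' "s y"] block_increasing_less[OF s(2) i(1), of x y] xy
      hyperoctD(4)[OF s(1)] Ar(3) sz by (simp add: A_def)
  have "\<forall>q\<in>A. block_label C' (r q) = block_label C' (r' q)"
  proof (rule weakly_increasing_unique[OF finA])
    fix v
    have "card {q \<in> A. block_label C' (r' q) = v} = card {q \<in> A. block_label C' (r q) = v}"
    proof (rule bij_betw_same_card[of \<beta>])
      show "bij_betw \<beta> {q \<in> A. block_label C' (r' q) = v} {q \<in> A. block_label C' (r q) = v}"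
      proof (rule bij_betw_imageI)
        show "inj_on \<beta> {q \<in> A. block_label C' (r' q) = v}" using inj by (rule inj_on_subset) auto
        show "\<beta> ` {q \<in> A. block_label C' (r' q) = v} = {q \<in> A. block_label C' (r q) = v}"
        proof (intro equalityI subsetI)
          fix y assume "y \<in> \<beta> ` {q \<in> A. block_label C' (r' q) = v}"
          then obtain x where "x \<in> A" "block_label C' (r' x) = v" "y = \<beta> x" by auto
          then show "y \<in> {q \<in> A. block_label C' (r q) = v}" using key[of x] bA[of x] by simp
        next
          fix y assume y: "y \<in> {q \<in> A. block_label C' (r q) = v}"
          then have "y \<in> \<beta> ` A" using bij by (simp add: bij_betw_def)
          then obtain x where "x \<in> A" "y = \<beta> x" by auto
          then show "y \<in> \<beta> ` {q \<in> A. block_label C' (r' q) = v}" using y key[of x] by auto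
        qed
      qed
    qed
    then show "card {q \<in> A. block_label C' (r q) = v} = card {q \<in> A. block_label C' (r' q) = v}" by simp
  qed (use mono[OF r(1) inc(1)] mono[OF r(2) inc(2)] in auto)
  then show ?thesis using i(2) by (simp add: A_def)
qed

text \<open>
  By the previous lemma, applied to \<open>r\<close> and to its inverse, \<open>r\<close> and \<open>r'\<close> map every set of
  positions in a block with given label of the value onto the same set, and both are increasing there.
\<close>

lemma double_coset_unique:
  assumes sz: "comp_size C = n" "comp_size C' = n" and r: "r \<in> X C" "perm_inv r \<in> X C'" "r' \<in> X C" "perm_inv r' \<in> X C'"
    and a: "a \<in> W C'" and b: "b \<in> W C" and r': "r' = a \<circ> r \<circ> b"
  shows "r = r'"
proof -
  have h: "r \<in> hyperoct n" "r' \<in> hyperoct n" and inc: "block_increasing C r" "block_increasing C r'"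
    "block_increasing C' (perm_inv r)" "block_increasing C' (perm_inv r')"
    using r sz X_iff by auto
  note hi = hyperoct_inv[OF h(1)] hyperoct_inv[OF h(2)]
  have ha: "a \<in> hyperoct n" "b \<in> hyperoct n" using W_hyperoct a b sz by metis+
  have lab1: "block_label C' (r p) = block_label C' (r' p)" if "1 \<le> p" "p \<le> int n" for p
    by (rule double_coset_labels[OF sz h a b r' inc that])
  have inv': "perm_inv r' = perm_inv b \<circ> perm_inv r \<circ> perm_inv a"
    unfolding r' using hyperoct_inv_comp[OF hyperoct_comp[OF ha(1) h(1)] ha(2)] hyperoct_inv_comp[OF ha(1) h(1)]
    by (simp add: comp_assoc)
  have lab2: "block_label C (perm_inv r q) = block_label C (perm_inv r' q)" if "1 \<le> q" "q \<le> int n" for q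
    by (rule double_coset_labels[OF sz(2,1) hi W_inv[OF b] W_inv[OF a] inv' inc(3,4) _ _ that])
       (simp_all add: hyperoct_inv_simps(5)[OF h(1)] hyperoct_inv_simps(5)[OF h(2)] inc(1,2))
  have lab2': "block_label C (perm_inv r q) = block_label C (perm_inv r' q)" if "q \<in> I_set n" for q
  proof (cases "0 < q")
    case True
    then show ?thesis using lab2[of q] that by (simp add: I_set_iff)
  next
    case False
    then have "block_label C (perm_inv r (- q)) = block_label C (perm_inv r' (- q))" using lab2[of "- q"] that by (simp add: I_set_iff)
    then show ?thesis by (simp add: hyperoctD(2)[OF hi(1)] hyperoctD(2)[OF hi(2)] block_label_minus)
  qed
  show ?thesis
  proof (rule hyperoct_eqI[OF h])
    fix p assume p: "1 \<le> p" "p \<le> int n"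
    then obtain i where i: "i < length C" "p \<in> block_pos C i" using sz block_pos_cover[of p C] by auto
    define v where "v = block_label C' (r p)"
    define M where "M = {q \<in> block_pos C i. block_label C' (r q) = v}"
    have "finite (block_pos C i)" by (simp add: block_pos_def)
    then have finM: "finite M" by (simp add: M_def)
    have rng: "1 \<le> q" "q \<le> int n" "q \<in> I_set n" if "q \<in> block_pos C i" for q
      using block_pos_range[OF that i(1)] sz by (auto simp: I_set_iff)
    have M': "M = {q \<in> block_pos C i. block_label C' (r' q) = v}"
      unfolding M_def using lab1 rng by auto
    have img: "s ` {q \<in> block_pos C i. block_label C' (s q) = v} =
        {x \<in> I_set n. block_label C' x = v \<and> block_label C (perm_inv s x) = 1 + int i}"
      if s: "s \<in> hyperoct n" for s
    proof (intro equalityI subsetI)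
      fix x assume "x \<in> s ` {q \<in> block_pos C i. block_label C' (s q) = v}"
      then obtain q where q: "q \<in> block_pos C i" "block_label C' (s q) = v" "x = s q" by auto
      then show "x \<in> {x \<in> I_set n. block_label C' x = v \<and> block_label C (perm_inv s x) = 1 + int i}"
        using rng(3)[OF q(1)] hyperoctD(4)[OF s] hyperoct_inv_simps(2)[OF s] block_label_pos[OF i(1) q(1)] by simp
    next
      fix x assume x: "x \<in> {x \<in> I_set n. block_label C' x = v \<and> block_label C (perm_inv s x) = 1 + int i}"
      define q where "q = perm_inv s x"
      have xq: "x = s q" by (simp add: q_def hyperoct_inv_simps(1)[OF s])
      have "q \<in> I_set n" using x xq hyperoctD(4)[OF s] by simp
      moreover have l: "block_label C q = 1 + int i" using x by (simp add: q_def)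
      moreover have "0 < q"
      proof (rule ccontr)
        assume "\<not> 0 < q"
        then have "sgn q \<le> 0" by (simp add: sgn_if)
        then have "block_label C q \<le> 0" using block_label_sgn[of C q] by (metis abs_ge_zero mult_nonneg_nonpos mult.commute)
        then show False using l by simp
      qed
      ultimately have "1 \<le> q" "q \<le> int (comp_size C)" using sz by (auto simp: I_set_iff)
      then obtain j where j: "j < length C" "q \<in> block_pos C j" using block_pos_cover[of q C] by auto
      then have "j = i" using block_label_pos[OF j] l by simp
      then show "x \<in> s ` {q \<in> block_pos C i. block_label C' (s q) = v}" using j(2) x xq by auto
    qed
    have "r ` M = r' ` M"
    proof -
      have "r ` M = {x \<in> I_set n. block_label C' x = v \<and> block_label C (perm_inv r x) = 1 + int i}"
        unfolding M_def by (rule img[OF h(1)])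
      also have "\<dots> = {x \<in> I_set n. block_label C' x = v \<and> block_label C (perm_inv r' x) = 1 + int i}"
        using lab2' by auto
      also have "\<dots> = r' ` M" unfolding M' by (rule img[OF h(2), symmetric])
      finally show ?thesis .
    qed
    then have "\<forall>q\<in>M. r q = r' q"
    proof (rule strictly_increasing_unique[OF finM, rotated 2])
      show "r x < r y" if "x \<in> M" "y \<in> M" "x < y" for x y
        using block_increasing_less[OF inc(1) i(1)] that by (simp add: M_def)
      show "r' x < r' y" if "x \<in> M" "y \<in> M" "x < y" for x y
        using block_increasing_less[OF inc(2) i(1)] that by (simp add: M_def)
    qed
    then show "r p = r' p" using i(2) by (simp add: M_def v_def)
  qed
qed

text \<open>
  An element of minimal length in the double coset will do, since inversion preserves the length.
\<close>

lemma double_coset_exists: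
  assumes sz: "comp_size C = n" "comp_size C' = n" and w: "w \<in> hyperoct n"
  shows "\<exists>a\<in>W C'. \<exists>b\<in>W C. a \<circ> w \<circ> b \<in> X C \<and> perm_inv (a \<circ> w \<circ> b) \<in> X C'"
proof -
  define f where "f = (\<lambda>(a, b). len n (a \<circ> w \<circ> b))"
  have fin: "finite (W C' \<times> W C)" "W C' \<times> W C \<noteq> {}" using finite_W W_id by auto
  have "\<exists>z\<in>W C' \<times> W C. \<forall>y\<in>W C' \<times> W C. f z \<le> f y"
    using ex_min_if_finite[of "f ` (W C' \<times> W C)"] fin by (auto simp: not_less)
  then obtain a b where ab: "a \<in> W C'" "b \<in> W C" and min: "\<And>a' b'. a' \<in> W C' \<Longrightarrow> b' \<in> W C \<Longrightarrow> len n (a \<circ> w \<circ> b) \<le> len n (a' \<circ> w \<circ> b')"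
    by (auto simp: f_def)
  define r where "r = a \<circ> w \<circ> b"
  have h: "a \<in> hyperoct n" "b \<in> hyperoct n" using ab W_hyperoct sz by metis+
  have r: "r \<in> hyperoct n" unfolding r_def by (intro hyperoct_comp h w)
  have "r \<in> X C" unfolding X_def sz
  proof (intro CollectI conjI ballI r)
    fix b' assume b': "b' \<in> W C"
    show "len n r \<le> len n (r \<circ> b')"
      using min[OF ab(1) W_comp[OF ab(2) b']] by (simp add: r_def comp_assoc)
  qed
  moreover have "perm_inv r \<in> X C'" unfolding X_def sz
  proof (intro CollectI conjI ballI hyperoct_inv r)
    fix a' assume a': "a' \<in> W C'"
    have a'h: "a' \<in> hyperoct n" using a' W_hyperoct sz by metis
    have "perm_inv r \<circ> a' = perm_inv (perm_inv a' \<circ> r)"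
      using hyperoct_inv_comp[OF hyperoct_inv[OF a'h] r] hyperoct_inv_simps(5)[OF a'h] by simp
    then have "len n (perm_inv r \<circ> a') = len n (perm_inv a' \<circ> r)"
      using len_inv[OF hyperoct_comp[OF hyperoct_inv[OF a'h] r]] by simp
    also have "perm_inv a' \<circ> r = (perm_inv a' \<circ> a) \<circ> w \<circ> b" by (simp add: r_def comp_assoc)
    finally show "len n (perm_inv r) \<le> len n (perm_inv r \<circ> a')"
      using min[OF W_comp[OF W_inv[OF a'] ab(1)] ab(2)] unfolding len_inv[OF r] unfolding r_def by (simp only:)
  qed
  ultimately show ?thesis using ab r_def by blast
qed

text \<open>
  Every \<open>w\<close> lies in the double coset of exactly one \<open>r\<close>, and the pairs stabilizing \<open>w\<close> are in bijection with the
  ways of writing \<open>w = a r b\<close>. Summing over \<open>w\<close> counts all triples \<open>(r, a, b)\<close>.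
\<close>

lemma sum_stabilizers_double_cosets:
  assumes C: "W C \<subseteq> W D" "comp_size C = comp_size D" and C': "W C' \<subseteq> W D" "comp_size C' = comp_size D"
  shows "(\<Sum>w\<in>W D. card {(a, b) \<in> W C' \<times> W C. a \<circ> w \<circ> b = w}) =
    card {r \<in> W D. r \<in> X C \<and> perm_inv r \<in> X C'} * (card (W C') * card (W C))"
proof -
  define n where "n = comp_size D"
  define R where "R = {r \<in> W D. r \<in> X C \<and> perm_inv r \<in> X C'}"
  define T where "T = R \<times> (W C' \<times> W C)"
  define \<phi> :: "(int \<Rightarrow> int) \<times> (int \<Rightarrow> int) \<times> (int \<Rightarrow> int) \<Rightarrow> int \<Rightarrow> int" where
    "\<phi> = (\<lambda>(r, a, b). a \<circ> r \<circ> b)"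
  have finR: "finite R" unfolding R_def using finite_W by simp
  have finT: "finite T" unfolding T_def using finR finite_W by simp
  have sz: "comp_size C = n" "comp_size C' = n" using C C' by (auto simp: n_def)
  have hyp: "w \<in> hyperoct n" if "w \<in> W D" for w using W_hyperoct[OF that] by (simp add: n_def)
  have "card {(a, b) \<in> W C' \<times> W C. a \<circ> w \<circ> b = w} = card {t \<in> T. \<phi> t = w}" if w: "w \<in> W D" for w
  proof -
    obtain a0 b0 where ab0: "a0 \<in> W C'" "b0 \<in> W C" "a0 \<circ> w \<circ> b0 \<in> X C" "perm_inv (a0 \<circ> w \<circ> b0) \<in> X C'"
      using double_coset_exists[OF sz hyp[OF w]] by blast
    define r where "r = a0 \<circ> w \<circ> b0"
    have a0D: "a0 \<in> W D" "b0 \<in> W D" using ab0 C C' by auto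
    have rD: "r \<in> W D" unfolding r_def by (intro W_comp a0D w)
    have rR: "r \<in> R" using rD ab0 by (simp add: R_def r_def)
    note ia = hyperoct_inv_simps(3,4)[OF hyp[OF a0D(1)]] and ib = hyperoct_inv_simps(3,4)[OF hyp[OF a0D(2)]]
    have wr: "w = perm_inv a0 \<circ> r \<circ> perm_inv b0"
    proof -
      have "perm_inv a0 \<circ> r \<circ> perm_inv b0 = (perm_inv a0 \<circ> a0) \<circ> w \<circ> (b0 \<circ> perm_inv b0)" by (simp add: r_def comp_assoc)
      then show ?thesis using ia ib by simp
    qed
    define \<psi> :: "(int \<Rightarrow> int) \<times> (int \<Rightarrow> int) \<Rightarrow> (int \<Rightarrow> int) \<times> (int \<Rightarrow> int) \<times> (int \<Rightarrow> int)" where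
      "\<psi> = (\<lambda>(a, b). (r, a \<circ> perm_inv a0, perm_inv b0 \<circ> b))"
    have "bij_betw \<psi> {(a, b) \<in> W C' \<times> W C. a \<circ> w \<circ> b = w} {t \<in> T. \<phi> t = w}"
    proof (rule bij_betw_byWitness[where f' = "\<lambda>(r', a, b). (a \<circ> a0, b0 \<circ> b)"])
      show "\<forall>z\<in>{(a, b) \<in> W C' \<times> W C. a \<circ> w \<circ> b = w}. (\<lambda>(r', a, b). (a \<circ> a0, b0 \<circ> b)) (\<psi> z) = z"
      proof
        fix z assume "z \<in> {(a, b) \<in> W C' \<times> W C. a \<circ> w \<circ> b = w}"
        obtain a b where z: "z = (a, b)" by (cases z)
        have "a \<circ> perm_inv a0 \<circ> a0 = a" "b0 \<circ> (perm_inv b0 \<circ> b) = b"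
          unfolding comp_assoc[of a] comp_assoc[of b0, symmetric] ia(2) ib(1) by simp_all
        then show "(\<lambda>(r', a, b). (a \<circ> a0, b0 \<circ> b)) (\<psi> z) = z" by (simp add: z \<psi>_def)
      qed
      show "\<forall>t\<in>{t \<in> T. \<phi> t = w}. \<psi> ((\<lambda>(r', a, b). (a \<circ> a0, b0 \<circ> b)) t) = t"
      proof
        fix t assume t: "t \<in> {t \<in> T. \<phi> t = w}"
        obtain r' a b where t': "t = (r', a, b)" by (cases t) auto
        have m: "r' \<in> R" "a \<in> W C'" "b \<in> W C" "a \<circ> r' \<circ> b = w" using t t' by (auto simp: T_def \<phi>_def)
        have "r = (a0 \<circ> a) \<circ> r' \<circ> (b \<circ> b0)" unfolding r_def m(4)[symmetric] by (simp add: comp_assoc)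
        then have "r' = r"
          using double_coset_unique[OF sz, of r' r "a0 \<circ> a" "b \<circ> b0"] m rR W_comp ab0(1,2) by (simp add: R_def)
        moreover have "a \<circ> a0 \<circ> perm_inv a0 = a" "perm_inv b0 \<circ> (b0 \<circ> b) = b"
          unfolding comp_assoc[of a] comp_assoc[of "perm_inv b0", symmetric] ia(1) ib(2) by simp_all
        ultimately show "\<psi> ((\<lambda>(r', a, b). (a \<circ> a0, b0 \<circ> b)) t) = t" by (simp add: t' \<psi>_def)
      qed
      show "\<psi> ` {(a, b) \<in> W C' \<times> W C. a \<circ> w \<circ> b = w} \<subseteq> {t \<in> T. \<phi> t = w}"
      proof
        fix t assume "t \<in> \<psi> ` {(a, b) \<in> W C' \<times> W C. a \<circ> w \<circ> b = w}"
        then obtain a b where ab: "a \<in> W C'" "b \<in> W C" "a \<circ> w \<circ> b = w" "t = \<psi> (a, b)" by auto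
        have "a \<circ> perm_inv a0 \<in> W C'" "perm_inv b0 \<circ> b \<in> W C" using ab ab0 W_comp W_inv by auto
        moreover have "(a \<circ> perm_inv a0) \<circ> r \<circ> (perm_inv b0 \<circ> b) = w"
        proof -
          have "(a \<circ> perm_inv a0) \<circ> r \<circ> (perm_inv b0 \<circ> b) = a \<circ> (perm_inv a0 \<circ> r \<circ> perm_inv b0) \<circ> b" by (simp add: comp_assoc)
          then show ?thesis using wr ab(3) by simp
        qed
        ultimately show "t \<in> {t \<in> T. \<phi> t = w}" using rR ab(4) by (simp add: T_def \<phi>_def \<psi>_def)
      qed
      show "(\<lambda>(r', a, b). (a \<circ> a0, b0 \<circ> b)) ` {t \<in> T. \<phi> t = w} \<subseteq> {(a, b) \<in> W C' \<times> W C. a \<circ> w \<circ> b = w}"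
      proof
        fix z assume "z \<in> (\<lambda>(r', a, b). (a \<circ> a0, b0 \<circ> b)) ` {t \<in> T. \<phi> t = w}"
        then obtain r' a b where m: "r' \<in> R" "a \<in> W C'" "b \<in> W C" "a \<circ> r' \<circ> b = w" "z = (a \<circ> a0, b0 \<circ> b)"
          by (auto simp: T_def \<phi>_def)
        have "r = (a0 \<circ> a) \<circ> r' \<circ> (b \<circ> b0)" unfolding r_def m(4)[symmetric] by (simp add: comp_assoc)
        then have "r' = r"
          using double_coset_unique[OF sz, of r' r "a0 \<circ> a" "b \<circ> b0"] m rR W_comp ab0(1,2) by (simp add: R_def)
        then have "a \<circ> a0 \<circ> w \<circ> (b0 \<circ> b) = w" using m(4) by (simp add: r_def comp_assoc)
        then show "z \<in> {(a, b) \<in> W C' \<times> W C. a \<circ> w \<circ> b = w}" using m ab0 W_comp by simp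
      qed
    qed
    then show ?thesis by (rule bij_betw_same_card)
  qed
  then have "(\<Sum>w\<in>W D. card {(a, b) \<in> W C' \<times> W C. a \<circ> w \<circ> b = w}) = (\<Sum>w\<in>W D. \<Sum>t\<in>{t \<in> T. \<phi> t = w}. 1)"
    by simp
  also have "\<dots> = (\<Sum>t\<in>T. 1)"
  proof (rule sum.group[OF finT finite_W])
    show "\<phi> ` T \<subseteq> W D"
    proof
      fix w assume "w \<in> \<phi> ` T"
      then obtain r a b where "r \<in> W D" "a \<in> W C'" "b \<in> W C" "w = a \<circ> r \<circ> b"
        by (auto simp: T_def \<phi>_def R_def)
      then show "w \<in> W D" using C(1) C'(1) W_comp by (metis subsetD)
    qed
  qed
  also have "\<dots> = card R * (card (W C') * card (W C))" by (simp add: T_def card_cartesian_product)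
  finally show ?thesis by (simp add: R_def)
qed

section \<open>The generalized Robinson--Schensted bijection\<close>

text \<open>The biwords read by \<open>rs_Q\<close>.\<close>

definition pos_word :: "int list \<Rightarrow> (int \<Rightarrow> int) \<Rightarrow> nat \<Rightarrow> (int \<times> int) list" where
  "pos_word D w i = map (\<lambda>p. (w p, p)) (filter (\<lambda>p. w p > 0) (sorted_list_of_set (block_pos D i)))"

definition neg_word :: "int list \<Rightarrow> (int \<Rightarrow> int) \<Rightarrow> nat \<Rightarrow> (int \<times> int) list" where
  "neg_word D w i = map (\<lambda>p. (\<bar>w p\<bar>, p)) (filter (\<lambda>p. w p < 0) (sorted_list_of_set (block_pos D i)))"

lemma length_rs_Q [simp]: "length (rs_Q D w) = length D"
  by (simp add: rs_Q_def)

lemma rs_Q_nth: "i < length D \<Longrightarrow> rs_Q D w ! i = (snd (rs (pos_word D w i)), snd (rs (neg_word D w i)))"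
  by (simp add: rs_Q_def pos_word_def neg_word_def Let_def)

lemma finite_block_pos [simp]: "finite (block_pos D i)"
  by (simp add: block_pos_def)

lemma set_pos_word: "set (pos_word D w i) = {(w p, p) | p. p \<in> block_pos D i \<and> 0 < w p}"
  by (auto simp: pos_word_def)

lemma set_neg_word: "set (neg_word D w i) = {(\<bar>w p\<bar>, p) | p. p \<in> block_pos D i \<and> w p < 0}"
  by (auto simp: neg_word_def)

lemma biword_map_filter:
  assumes inj: "inj_on f {p \<in> A. R p}" and fin: "finite A"
  shows "biword (map (\<lambda>p. (f p, p)) (filter R (sorted_list_of_set A)))"
proof -
  have m: "map fst (map (\<lambda>p. (f p, p)) (filter R (sorted_list_of_set A))) = map f (filter R (sorted_list_of_set A))"
    "map snd (map (\<lambda>p. (f p, p)) (filter R (sorted_list_of_set A))) = filter R (sorted_list_of_set A)"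
    by (simp_all add: comp_def)
  have "set (filter R (sorted_list_of_set A)) = {p \<in> A. R p}" using fin by simp
  then show ?thesis unfolding biword_def m using inj
    by (simp add: distinct_map sorted_wrt_filter)
qed

lemma biword_pos_word: "w \<in> hyperoct n \<Longrightarrow> biword (pos_word D w i)"
  unfolding pos_word_def
  by (rule biword_map_filter) (auto intro!: inj_onI simp: hyperoctD(5))

lemma biword_neg_word:
  assumes "w \<in> hyperoct n" shows "biword (neg_word D w i)"
  unfolding neg_word_def
proof (rule biword_map_filter)
  show "inj_on (\<lambda>p. \<bar>w p\<bar>) {p \<in> block_pos D i. w p < 0}"
  proof (rule inj_onI)
    fix x y assume "x \<in> {p \<in> block_pos D i. w p < 0}" "y \<in> {p \<in> block_pos D i. w p < 0}" "\<bar>w x\<bar> = \<bar>w y\<bar>"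
    then have "w x = w y" by simp
    then show "x = y" using hyperoctD(5)[OF assms] by simp
  qed
qed simp

lemma W_block:
  assumes w: "w \<in> W D" and i: "i < length D" and p: "p \<in> block_pos D i"
  shows "\<bar>w p\<bar> \<in> block_pos D i" "w p \<noteq> 0" "w p < 0 \<Longrightarrow> 0 < D ! i"
proof -
  have r: "1 \<le> p" "p \<le> int (comp_size D)" using block_pos_range[OF p i] by auto
  show "\<bar>w p\<bar> \<in> block_pos D i" using w r same_block_mem[OF p i] by (auto simp: W_iff)
  show "w p \<noteq> 0" by (rule hyperoct_abs_range(3)[OF W_hyperoct[OF w] r])
  show "0 < D ! i" if "w p < 0" using w r that pos_block_mem[OF p i] by (auto simp: W_iff)
qed

lemma snd_image_graph: "snd ` {(g p, p) | p. R p} = {p. R p}"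
  by (auto simp: image_iff)

lemma rs_Q_entries:
  assumes w: "w \<in> W D" and i: "i < length D"
  shows "set (concat (fst (rs_Q D w ! i))) = {p \<in> block_pos D i. 0 < w p}"
    "set (concat (snd (rs_Q D w ! i))) = {p \<in> block_pos D i. w p < 0}"
proof -
  note h = W_hyperoct[OF w]
  show "set (concat (fst (rs_Q D w ! i))) = {p \<in> block_pos D i. 0 < w p}"
    using rs_entries(2)[OF biword_pos_word[OF h, of D i]] unfolding rs_Q_nth[OF i] set_pos_word snd_image_graph by (simp only: fst_conv)
  show "set (concat (snd (rs_Q D w ! i))) = {p \<in> block_pos D i. w p < 0}"
    using rs_entries(2)[OF biword_neg_word[OF h, of D i]] unfolding rs_Q_nth[OF i] set_neg_word snd_image_graph by (simp only: snd_conv)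
qed

lemma SBT_D:
  assumes "T \<in> SBT D" "i < length D"
  shows "length T = length D" "tableau (fst (T ! i))" "tableau (snd (T ! i))"
    "distinct (concat (fst (T ! i)))" "distinct (concat (snd (T ! i)))"
    "set (concat (fst (T ! i))) \<inter> set (concat (snd (T ! i))) = {}"
    "set (concat (fst (T ! i))) \<union> set (concat (snd (T ! i))) = block_pos D i"
    "D ! i < 0 \<Longrightarrow> snd (T ! i) = []"
  using assms by (auto simp: SBT_def)

lemma SBT_I:
  assumes "length T = length D" "\<And>i. i < length D \<Longrightarrow> tableau (fst (T ! i)) \<and> tableau (snd (T ! i)) \<and>
    distinct (concat (fst (T ! i))) \<and> distinct (concat (snd (T ! i))) \<and>
    set (concat (fst (T ! i))) \<inter> set (concat (snd (T ! i))) = {} \<and>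
    set (concat (fst (T ! i))) \<union> set (concat (snd (T ! i))) = block_pos D i \<and> (D ! i < 0 \<longrightarrow> snd (T ! i) = [])"
  shows "T \<in> SBT D"
proof -
  have "tableau (fst (T ! i)) \<and> tableau (snd (T ! i)) \<and>
     distinct (concat (fst (T ! i)) @ concat (snd (T ! i))) \<and>
     set (concat (fst (T ! i)) @ concat (snd (T ! i))) = block_pos D i \<and>
     (D ! i < 0 \<longrightarrow> snd (T ! i) = [])" if "i < length D" for i
    using assms(2)[OF that] unfolding distinct_append set_append by blast
  then show ?thesis unfolding SBT_def using assms(1) by blast
qed

lemma rs_Q_in_SBT:
  assumes w: "w \<in> W D" shows "rs_Q D w \<in> SBT D"
proof (rule SBT_I)
  note h = W_hyperoct[OF w]
  fix i assume i: "i < length D"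
  note e = rs_Q_entries[OF w i]
  have "tableau (fst (rs_Q D w ! i)) \<and> tableau (snd (rs_Q D w ! i)) \<and>
     distinct (concat (fst (rs_Q D w ! i))) \<and> distinct (concat (snd (rs_Q D w ! i)))"
    unfolding rs_Q_nth[OF i] fst_conv snd_conv
    using rs_invariants[OF biword_pos_word[OF h]] rs_invariants[OF biword_neg_word[OF h]]
      rs_entries(4)[OF biword_pos_word[OF h]] rs_entries(4)[OF biword_neg_word[OF h]] by blast
  moreover have "set (concat (fst (rs_Q D w ! i))) \<inter> set (concat (snd (rs_Q D w ! i))) = {}"
    unfolding e by auto
  moreover have "set (concat (fst (rs_Q D w ! i))) \<union> set (concat (snd (rs_Q D w ! i))) = block_pos D i"
    unfolding e using W_block(2)[OF w i] by (auto simp: neq_iff)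
  moreover have "snd (rs_Q D w ! i) = []" if neg: "D ! i < 0"
  proof -
    have "\<not> w p < 0" if "p \<in> block_pos D i" for p using W_block(3)[OF w i that] neg by auto
    then have "set (neg_word D w i) = {}" unfolding set_neg_word by blast
    then show ?thesis unfolding rs_Q_nth[OF i] by simp
  qed
  ultimately show "tableau (fst (rs_Q D w ! i)) \<and> tableau (snd (rs_Q D w ! i)) \<and>
    distinct (concat (fst (rs_Q D w ! i))) \<and> distinct (concat (snd (rs_Q D w ! i))) \<and>
    set (concat (fst (rs_Q D w ! i))) \<inter> set (concat (snd (rs_Q D w ! i))) = {} \<and>
    set (concat (fst (rs_Q D w ! i))) \<union> set (concat (snd (rs_Q D w ! i))) = block_pos D i \<and>
    (D ! i < 0 \<longrightarrow> snd (rs_Q D w ! i) = [])" by blast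
qed simp

text \<open>
  Inversion exchanges the coordinates of all points; as the blocks are preserved, so are the words of each block.
\<close>

lemma words_inverse_subset:
  assumes w: "w \<in> W D" and i: "i < length D"
  shows "prod.swap ` set (pos_word D w i) \<subseteq> set (pos_word D (perm_inv w) i)"
    "prod.swap ` set (neg_word D w i) \<subseteq> set (neg_word D (perm_inv w) i)"
proof -
  note h = W_hyperoct[OF w]
  show "prod.swap ` set (pos_word D w i) \<subseteq> set (pos_word D (perm_inv w) i)"
  proof
    fix z assume "z \<in> prod.swap ` set (pos_word D w i)"
    then obtain p where p: "p \<in> block_pos D i" "0 < w p" "z = (p, w p)" unfolding set_pos_word by auto
    have "w p \<in> block_pos D i" using W_block(1)[OF w i p(1)] p(2) by simp
    moreover have "perm_inv w (w p) = p" by (rule hyperoct_inv_simps(2)[OF h])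
    moreover have "0 < p" using block_pos_range[OF p(1) i] by simp
    ultimately show "z \<in> set (pos_word D (perm_inv w) i)" unfolding set_pos_word p(3)
      by (intro CollectI exI[of _ "w p"]) simp
  qed
  show "prod.swap ` set (neg_word D w i) \<subseteq> set (neg_word D (perm_inv w) i)"
  proof
    fix z assume "z \<in> prod.swap ` set (neg_word D w i)"
    then obtain p where p: "p \<in> block_pos D i" "w p < 0" "z = (p, \<bar>w p\<bar>)" unfolding set_neg_word by auto
    have "\<bar>w p\<bar> \<in> block_pos D i" using W_block(1)[OF w i p(1)] .
    moreover have "perm_inv w \<bar>w p\<bar> = - p"
      using p(2) hyperoctD(2)[OF hyperoct_inv[OF h], of "w p"] hyperoct_inv_simps(2)[OF h, of p] by simp
    moreover have "0 < p" using block_pos_range[OF p(1) i] by simp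
    ultimately show "z \<in> set (neg_word D (perm_inv w) i)" unfolding set_neg_word p(3)
      by (intro CollectI exI[of _ "\<bar>w p\<bar>"]) simp
  qed
qed

lemma rs_words_inverse:
  assumes w: "w \<in> W D" and i: "i < length D"
  shows "rs (pos_word D (perm_inv w) i) = prod.swap (rs (pos_word D w i))"
    "rs (neg_word D (perm_inv w) i) = prod.swap (rs (neg_word D w i))"
proof -
  note h = W_hyperoct[OF w]
  note h' = hyperoct_inv[OF h]
  have inv: "perm_inv (perm_inv w) = w" by (rule hyperoct_inv_simps(5)[OF h])
  have flip: "set v = prod.swap ` set u" if "prod.swap ` set u \<subseteq> set v" "prod.swap ` set v \<subseteq> set u" for u v :: "(int \<times> int) list"
  proof
    show "set v \<subseteq> prod.swap ` set u"
    proof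
      fix z assume "z \<in> set v"
      then have "prod.swap z \<in> set u" using that(2) by auto
      then show "z \<in> prod.swap ` set u" by (metis image_eqI swap_swap)
    qed
  qed (rule that(1))
  show "rs (pos_word D (perm_inv w) i) = prod.swap (rs (pos_word D w i))"
    by (rule rs_symmetric[OF biword_pos_word[OF h] biword_pos_word[OF h'] flip])
      (use words_inverse_subset(1)[OF w i] words_inverse_subset(1)[OF W_inv[OF w] i] inv in auto)
  show "rs (neg_word D (perm_inv w) i) = prod.swap (rs (neg_word D w i))"
    by (rule rs_symmetric[OF biword_neg_word[OF h] biword_neg_word[OF h'] flip])
      (use words_inverse_subset(2)[OF w i] words_inverse_subset(2)[OF W_inv[OF w] i] inv in auto)
qed

lemma sh_rs_Q_inverse:
  assumes w: "w \<in> W D" shows "sh (rs_Q D (perm_inv w)) = sh (rs_Q D w)"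
proof (rule nth_equalityI)
  note h = W_hyperoct[OF w]
  fix i assume "i < length (sh (rs_Q D (perm_inv w)))"
  then have i: "i < length D" by (simp add: sh_def)
  show "sh (rs_Q D (perm_inv w)) ! i = sh (rs_Q D w) ! i"
    using i rs_invariants[OF biword_pos_word[OF h, of D i]] rs_invariants[OF biword_neg_word[OF h, of D i]]
    by (simp add: sh_def rs_Q_nth rs_words_inverse[OF w i])
qed (simp add: sh_def)

text \<open>Both recording tableaux determine the biwords of all blocks, and these contain all values.\<close>

lemma rs_Q_inj:
  assumes w: "w \<in> W D" "w' \<in> W D" and Q: "rs_Q D w = rs_Q D w'" "rs_Q D (perm_inv w) = rs_Q D (perm_inv w')"
  shows "w = w'"
proof (rule hyperoct_eqI[OF W_hyperoct[OF w(1)] W_hyperoct[OF w(2)]])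
  note h = W_hyperoct[OF w(1)] W_hyperoct[OF w(2)]
  fix p assume "1 \<le> p" "p \<le> int (comp_size D)"
  then obtain i where i: "i < length D" "p \<in> block_pos D i" using block_pos_cover[of p D] by auto
  have "rs (pos_word D w i) = rs (pos_word D w' i)" "rs (neg_word D w i) = rs (neg_word D w' i)"
    using arg_cong[OF Q(1), of "\<lambda>T. T ! i"] arg_cong[OF Q(2), of "\<lambda>T. T ! i"]
    unfolding rs_Q_nth[OF i(1)] rs_words_inverse[OF w(1) i(1)] rs_words_inverse[OF w(2) i(1)]
    by (simp_all add: prod_eq_iff)
  then have "pos_word D w i = pos_word D w' i" "neg_word D w i = neg_word D w' i"
    using rs_inj biword_pos_word biword_neg_word h by blast+
  then have s: "set (pos_word D w i) = set (pos_word D w' i)" "set (neg_word D w i) = set (neg_word D w' i)" by auto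
  show "w p = w' p"
  proof (cases "0 < w p")
    case True
    then have "(w p, p) \<in> set (pos_word D w i)" using i by (auto simp: set_pos_word)
    then show ?thesis unfolding s(1) by (auto simp: set_pos_word)
  next
    case False
    then have "w p < 0" using W_block(2)[OF w(1) i] by simp
    then have "(\<bar>w p\<bar>, p) \<in> set (neg_word D w i)" using i by (auto simp: set_neg_word)
    then have "\<bar>w p\<bar> = \<bar>w' p\<bar> \<and> w' p < 0" unfolding s(2) by (auto simp: set_neg_word)
    then show ?thesis using \<open>w p < 0\<close> by linarith
  qed
qed

lemma biword_eqI:
  assumes u: "biword u" and v: "biword v" and s: "set u = set v"
  shows "u = v"
proof -
  have "set (map snd u) = set (map snd v)" using s by simp
  then have m: "map snd u = map snd v"
    using u v by (intro strict_sorted_equal) (auto simp: biword_def)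
  then have l: "length u = length v" by (metis length_map)
  show ?thesis
  proof (rule nth_equalityI[OF l])
    fix k assume k: "k < length u"
    have "snd (u ! k) = snd (v ! k)" using m k l by (metis nth_map)
    moreover have "u ! k \<in> set v" using nth_mem[OF k] unfolding s .
    moreover have "v ! k \<in> set v" using k l by simp
    ultimately show "u ! k = v ! k" using inj_onD[OF biword_inj(2)[OF v]] by blast
  qed
qed

text \<open>
  The biwords of the blocks, obtained from surjectivity of the Robinson--Schensted map, are glued to
  one signed permutation \<open>w\<close>.
\<close>

lemma rs_Q_surj:
  assumes Q: "Q \<in> SBT D" "Q' \<in> SBT D" and shape: "sh Q = sh Q'"
  shows "\<exists>w\<in>W D. rs_Q D w = Q \<and> rs_Q D (perm_inv w) = Q'"
proof -
  define n where "n = comp_size D"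
  have lens: "map length (fst (Q ! i)) = map length (fst (Q' ! i)) \<and> map length (snd (Q ! i)) = map length (snd (Q' ! i))"
    if i: "i < length D" for i
    using arg_cong[OF shape, of "\<lambda>L. L ! i"] i SBT_D(1)[OF Q(1) i] SBT_D(1)[OF Q(2) i]
    by (simp add: sh_def prod_eq_iff)
  have "\<exists>u. biword u \<and> rs u = (fst (Q' ! i), fst (Q ! i))" if i: "i < length D" for i
    using rs_surj SBT_D[OF Q(1) i] SBT_D[OF Q(2) i] lens[OF i] by metis
  then obtain U where U: "\<And>i. i < length D \<Longrightarrow> biword (U i) \<and> rs (U i) = (fst (Q' ! i), fst (Q ! i))" by metis
  have "\<exists>u. biword u \<and> rs u = (snd (Q' ! i), snd (Q ! i))" if i: "i < length D" for i
    using rs_surj SBT_D[OF Q(1) i] SBT_D[OF Q(2) i] lens[OF i] by metis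
  then obtain V where V: "\<And>i. i < length D \<Longrightarrow> biword (V i) \<and> rs (V i) = (snd (Q' ! i), snd (Q ! i))" by metis
  have ent: "snd ` set (U i) \<inter> snd ` set (V i) = {}" "snd ` set (U i) \<union> snd ` set (V i) = block_pos D i"
    "fst ` set (U i) \<inter> fst ` set (V i) = {}" "fst ` set (U i) \<union> fst ` set (V i) = block_pos D i"
    if i: "i < length D" for i
    using rs_entries(1,2)[of "U i"] rs_entries(1,2)[of "V i"] U[OF i] V[OF i] SBT_D(6,7)[OF Q(1) i] SBT_D(6,7)[OF Q(2) i]
    by (simp_all del: set_concat)
  \<comment> \<open>a letter of the positive word is a value, one of the negative word the negative of a value\<close>
  define f where "f p = (THE y. \<exists>i<length D. \<exists>x. (x, p) \<in> set (U i) \<and> y = x \<or> (x, p) \<in> set (V i) \<and> y = - x)" for p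
  have blk: "p \<in> block_pos D i" "x \<in> block_pos D i" if "i < length D" "(x, p) \<in> set (U i) \<or> (x, p) \<in> set (V i)" for i x p
  proof -
    have "p \<in> snd ` set (U i) \<union> snd ` set (V i)" "x \<in> fst ` set (U i) \<union> fst ` set (V i)" using that(2) by force+
    then show "p \<in> block_pos D i" "x \<in> block_pos D i" using ent[OF that(1)] by auto
  qed
  have fU: "f p = x" if i: "i < length D" and m: "(x, p) \<in> set (U i)" for i x p
    unfolding f_def
  proof (rule the_equality)
    show "\<exists>i<length D. \<exists>x'. (x', p) \<in> set (U i) \<and> x = x' \<or> (x', p) \<in> set (V i) \<and> x = - x'" using i m by blast
    fix y assume "\<exists>i<length D. \<exists>x. (x, p) \<in> set (U i) \<and> y = x \<or> (x, p) \<in> set (V i) \<and> y = - x"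
    then obtain j x' where j: "j < length D" "(x', p) \<in> set (U j) \<and> y = x' \<or> (x', p) \<in> set (V j) \<and> y = - x'" by blast
    have "j = i" using block_pos_unique blk(1)[OF i] blk(1)[OF j(1)] m j(2) by blast
    then show "y = x"
      using j(2) m ent(1)[OF i] inj_onD[OF biword_inj(2), of "U i" "(x, p)" "(x', p)"] U[OF i] by (auto simp: image_iff) force
  qed
  have fV: "f p = - x" if i: "i < length D" and m: "(x, p) \<in> set (V i)" for i x p
    unfolding f_def
  proof (rule the_equality)
    show "\<exists>i<length D. \<exists>x'. (x', p) \<in> set (U i) \<and> - x = x' \<or> (x', p) \<in> set (V i) \<and> - x = - x'" using i m by blast
    fix y assume "\<exists>i<length D. \<exists>x. (x, p) \<in> set (U i) \<and> y = x \<or> (x, p) \<in> set (V i) \<and> y = - x"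
    then obtain j x' where j: "j < length D" "(x', p) \<in> set (U j) \<and> y = x' \<or> (x', p) \<in> set (V j) \<and> y = - x'" by blast
    have "j = i" using block_pos_unique blk(1)[OF i] blk(1)[OF j(1)] m j(2) by blast
    then show "y = - x"
      using j(2) m ent(1)[OF i] inj_onD[OF biword_inj(2), of "V i" "(x, p)" "(x', p)"] V[OF i] by (auto simp: image_iff) force
  qed
  have val: "\<exists>x. ((x, p) \<in> set (U i) \<and> f p = x \<or> (x, p) \<in> set (V i) \<and> f p = - x) \<and> x \<in> block_pos D i \<and> 1 \<le> x"
    if i: "i < length D" and p: "p \<in> block_pos D i" for i p
  proof -
    have "p \<in> snd ` set (U i) \<union> snd ` set (V i)" using ent(2)[OF i] p by simp
    then obtain z where "z \<in> set (U i) \<union> set (V i)" "snd z = p" by blast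
    then have "(fst z, p) \<in> set (U i) \<or> (fst z, p) \<in> set (V i)" by (cases z) simp
    then obtain x where x: "(x, p) \<in> set (U i) \<or> (x, p) \<in> set (V i)" by blast
    then show ?thesis using fU[OF i] fV[OF i] blk(2)[OF i x] block_pos_range[OF blk(2)[OF i x] i] by auto
  qed
  have fabs: "\<bar>f p\<bar> \<in> block_pos D i \<and> f p \<noteq> 0" if i: "i < length D" and p: "p \<in> block_pos D i" for i p
    using val[OF i p] by auto
  have finj: "p = q" if pq: "1 \<le> p" "p \<le> int n" "1 \<le> q" "q \<le> int n" "\<bar>f p\<bar> = \<bar>f q\<bar>" for p q
  proof -
    obtain i where i: "i < length D" "p \<in> block_pos D i" using pq block_pos_cover[of p D] by (auto simp: n_def)
    obtain j where j: "j < length D" "q \<in> block_pos D j" using pq block_pos_cover[of q D] by (auto simp: n_def)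
    have ij: "j = i" using block_pos_unique[of "\<bar>f p\<bar>" D j i] fabs[OF i] fabs[OF j] pq(5) by simp
    obtain x where x: "(x, p) \<in> set (U i) \<and> f p = x \<or> (x, p) \<in> set (V i) \<and> f p = - x" "1 \<le> x" using val[OF i] by blast
    obtain y where y: "(y, q) \<in> set (U i) \<and> f q = y \<or> (y, q) \<in> set (V i) \<and> f q = - y" "1 \<le> y" using val[OF j] ij by blast
    have xy: "x = y" using x y pq(5) by auto
    have "\<not> ((x, p) \<in> set (U i) \<and> (x, q) \<in> set (V i))" "\<not> ((x, p) \<in> set (V i) \<and> (x, q) \<in> set (U i))"
      using ent(3)[OF i(1)] by (auto simp: disjoint_iff image_iff) force+
    then consider "(x, p) \<in> set (U i)" "(x, q) \<in> set (U i)" | "(x, p) \<in> set (V i)" "(x, q) \<in> set (V i)"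
      using x(1) y(1) xy by blast
    then show ?thesis
    proof cases
      case 1
      then show ?thesis using inj_onD[OF biword_inj(1), of "U i" "(x, p)" "(x, q)"] U[OF i(1)] by simp
    next
      case 2
      then show ?thesis using inj_onD[OF biword_inj(1), of "V i" "(x, p)" "(x, q)"] V[OF i(1)] by simp
    qed
  qed
  define w where "w q = (if q \<in> I_set n then (if 0 < q then f q else - f (- q)) else q)" for q
  have wf: "w p = f p" if "1 \<le> p" "p \<le> int n" for p using that by (simp add: w_def I_set_iff)
  have wabs: "\<bar>w q\<bar> = \<bar>f \<bar>q\<bar>\<bar>" if "q \<in> I_set n" for q using that by (auto simp: w_def I_set_iff)
  have wodd: "w (- q) = - w q" if "q \<in> I_set n" for q
    using that by (auto simp: w_def I_set_iff)
  have wI: "w q \<in> I_set n" "w q \<noteq> 0" if q: "q \<in> I_set n" for q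
  proof -
    obtain i where i: "i < length D" "\<bar>q\<bar> \<in> block_pos D i"
      using q block_pos_cover[of "\<bar>q\<bar>" D] by (auto simp: n_def I_set_iff)
    have "\<bar>w q\<bar> \<in> block_pos D i" using fabs[OF i] wabs[OF q] by simp
    from block_pos_range[OF this i(1)] show "w q \<in> I_set n" "w q \<noteq> 0" by (auto simp: I_set_iff n_def)
  qed
  have "inj_on w (I_set n)"
  proof (rule inj_onI)
    fix x y assume xy: "x \<in> I_set n" "y \<in> I_set n" "w x = w y"
    have "\<bar>f \<bar>x\<bar>\<bar> = \<bar>f \<bar>y\<bar>\<bar>" using wabs[OF xy(1)] wabs[OF xy(2)] xy(3) by simp
    then have "\<bar>x\<bar> = \<bar>y\<bar>" using finj[of "\<bar>x\<bar>" "\<bar>y\<bar>"] xy by (simp add: I_set_iff)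
    then consider "x = y" | "x = - y" by linarith
    then show "x = y"
    proof cases
      case 2
      then have "w y = - w y" using wodd[OF xy(2)] xy(3) by simp
      then show ?thesis using wI(2)[OF xy(2)] by simp
    qed
  qed
  then have "bij_betw w (I_set n) (I_set n)"
    unfolding bij_betw_def using finite_I_set[of n] wI(1) by (intro conjI endo_inj_surj) auto
  then have "w permutes I_set n" by (rule bij_imp_permutes) (simp add: w_def)
  then have h: "w \<in> hyperoct n" using wodd by (rule hyperoctI)
  have wW: "w \<in> W D" unfolding W_iff
  proof (intro conjI allI impI)
    show "w \<in> hyperoct (comp_size D)" using h by (simp add: n_def)
    fix p assume p: "1 \<le> p \<and> p \<le> int (comp_size D)"
    then obtain i where i: "i < length D" "p \<in> block_pos D i" using block_pos_cover[of p D] by auto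
    have wp: "w p = f p" using wf p by (simp add: n_def)
    show "same_block D p \<bar>w p\<bar>" using i fabs[OF i] wp by (auto simp: same_block_def)
    assume neg: "w p < 0"
    obtain x where "(x, p) \<in> set (V i)" using val[OF i] neg wp by force
    then have "snd (Q ! i) \<noteq> []" using rs_entries(2)[of "V i"] V[OF i(1)] by (auto simp: image_iff)
    then have "\<not> D ! i < 0" using SBT_D(8)[OF Q(1) i(1)] by blast
    moreover have "D ! i \<noteq> 0" using i(2) by (auto simp: block_pos_def)
    ultimately show "pos_block D p" using i by (auto simp: pos_block_def)
  qed
  have words: "pos_word D w i = U i \<and> neg_word D w i = V i" if i: "i < length D" for i
  proof -
    have wfb: "w p = f p" if "p \<in> block_pos D i" for p using wf block_pos_range[OF that i] by (simp add: n_def)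
    have "set (pos_word D w i) = set (U i)"
    proof (intro equalityI subsetI)
      fix z assume "z \<in> set (pos_word D w i)"
      then obtain p where p: "p \<in> block_pos D i" "0 < w p" "z = (w p, p)" by (auto simp: set_pos_word)
      show "z \<in> set (U i)" using val[OF i p(1)] p wfb[OF p(1)] by auto
    next
      fix z assume z: "z \<in> set (U i)"
      obtain x p where xp: "z = (x, p)" by (cases z)
      have b: "p \<in> block_pos D i" "x \<in> block_pos D i" using blk[OF i, of x p] z xp by auto
      have "f p = x" using fU[OF i] z xp by simp
      then show "z \<in> set (pos_word D w i)" using wfb[OF b(1)] b block_pos_range[OF b(2) i] by (auto simp: set_pos_word xp)
    qed
    moreover have "set (neg_word D w i) = set (V i)"
    proof (intro equalityI subsetI)
      fix z assume "z \<in> set (neg_word D w i)"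
      then obtain p where p: "p \<in> block_pos D i" "w p < 0" "z = (\<bar>w p\<bar>, p)" by (auto simp: set_neg_word)
      show "z \<in> set (V i)" using val[OF i p(1)] p wfb[OF p(1)] by auto
    next
      fix z assume z: "z \<in> set (V i)"
      obtain x p where xp: "z = (x, p)" by (cases z)
      have b: "p \<in> block_pos D i" "x \<in> block_pos D i" using blk[OF i, of x p] z xp by auto
      have "f p = - x" using fV[OF i] z xp by simp
      then show "z \<in> set (neg_word D w i)" using wfb[OF b(1)] b block_pos_range[OF b(2) i] by (auto simp: set_neg_word xp)
    qed
    ultimately show ?thesis using biword_eqI biword_pos_word[OF h] biword_neg_word[OF h] U[OF i] V[OF i] by blast
  qed
  have "rs_Q D w = Q"
    by (rule nth_equalityI) (use Q(1) words U V in \<open>auto simp: SBT_def rs_Q_nth\<close>)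
  moreover have "rs_Q D (perm_inv w) = Q'"
    by (rule nth_equalityI) (use Q(2) words U V in \<open>auto simp: SBT_def rs_Q_nth rs_words_inverse[OF wW]\<close>)
  ultimately show ?thesis using wW by blast
qed

text \<open>
  By symmetry \<open>rs_Q D (perm_inv w)\<close> is the insertion tableau of \<open>w\<close>.
\<close>

lemma card_rs_Q_pair:
  assumes "Q \<in> SBT D" "Q' \<in> SBT D"
  shows "card {w \<in> W D. rs_Q D w = Q \<and> rs_Q D (perm_inv w) = Q'} = (if sh Q = sh Q' then 1 else 0)"
proof (cases "sh Q = sh Q'")
  case True
  then obtain w where w: "w \<in> W D" "rs_Q D w = Q" "rs_Q D (perm_inv w) = Q'" using rs_Q_surj assms by blast
  have "{w \<in> W D. rs_Q D w = Q \<and> rs_Q D (perm_inv w) = Q'} = {w}"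
    using w rs_Q_inj by blast
  then show ?thesis using True by simp
next
  case False
  have none: "{w \<in> W D. rs_Q D w = Q \<and> rs_Q D (perm_inv w) = Q'} = {}"
  proof -
    have "\<not> (rs_Q D w = Q \<and> rs_Q D (perm_inv w) = Q')" if "w \<in> W D" for w
      using sh_rs_Q_inverse[OF that] False by auto
    then show ?thesis by blast
  qed
  show ?thesis unfolding none using False by simp
qed

lemma sorted_list_of_block_split:
  assumes "p \<in> block_pos D i" "p + 1 \<in> block_pos D i"
  shows "\<exists>xs ys. sorted_list_of_set (block_pos D i) = xs @ [p, p + 1] @ ys"
proof -
  have "\<exists>a b. block_pos D i = {a..b}" unfolding block_pos_def by blast
  then obtain a b where ab: "block_pos D i = {a..b}" by blast
  have pab: "a \<le> p" "p + 1 \<le> b" using assms unfolding ab by auto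
  have "sorted_list_of_set {a..b} = [a..b]"
    using sorted_list_of_set.idem_if_sorted_distinct[of "[a..b]"] by simp
  also have "\<dots> = [a..p - 1] @ [p..b]" using pab by (intro upto_split1) auto
  also have "[p..b] = p # [p + 1..b]" using pab by (intro upto_rec1) simp
  also have "[p + 1..b] = (p + 1) # [p + 1 + 1..b]" using pab by (intro upto_rec1) simp
  finally show ?thesis unfolding ab by (intro exI[of _ "[a..p - 1]"] exI[of _ "[p + 1 + 1..b]"]) simp
qed

section \<open>Sums over cosets as sums over tableaux\<close>

text \<open>
  The condition \<open>w p < w (p + 1)\<close> in terms of the recording tableaux: negative values precede positive ones, and as
  negative letters are inserted by absolute value, their order is reversed.
\<close>

definition ascent_at :: "tableau \<times> tableau \<Rightarrow> int \<Rightarrow> bool" where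
  "ascent_at T p \<longleftrightarrow> (if p \<in> set (concat (fst T))
     then p + 1 \<in> set (concat (fst T)) \<and> row_of (fst T) (p + 1) \<le> row_of (fst T) p
     else p + 1 \<in> set (concat (snd T)) \<longrightarrow> row_of (snd T) p < row_of (snd T) (p + 1))"

lemma ascent_at_iff:
  assumes w: "w \<in> W D" and i: "i < length D" and p: "p \<in> block_pos D i" "p + 1 \<in> block_pos D i"
  shows "w p < w (p + 1) \<longleftrightarrow> ascent_at (rs_Q D w ! i) p"
proof -
  note h = W_hyperoct[OF w]
  note e = rs_Q_entries[OF w i]
  obtain xs ys where l: "sorted_list_of_set (block_pos D i) = xs @ [p, p + 1] @ ys"
    using sorted_list_of_block_split[OF p] by blast
  note nz = W_block(2)[OF w i p(1)] W_block(2)[OF w i p(2)]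
  consider "0 < w p" "0 < w (p + 1)" | "0 < w p" "w (p + 1) < 0" | "w p < 0" "0 < w (p + 1)" | "w p < 0" "w (p + 1) < 0"
    using nz by linarith
  then show ?thesis
  proof cases
    case 1
    have u: "pos_word D w i = map (\<lambda>p. (w p, p)) (filter (\<lambda>p. w p > 0) xs) @ [(w p, p), (w (p + 1), p + 1)] @ map (\<lambda>p. (w p, p)) (filter (\<lambda>p. w p > 0) ys)"
      unfolding pos_word_def l using 1 by simp
    show ?thesis using rs_descent[OF biword_pos_word[OF h, of D i, unfolded u]] 1 p
      unfolding ascent_at_def e by (simp add: rs_Q_nth[OF i] u)
  next
    case 2
    then show ?thesis using p unfolding ascent_at_def e by simp
  next
    case 3
    then show ?thesis using p unfolding ascent_at_def e by simp
  next
    case 4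
    have u: "neg_word D w i = map (\<lambda>p. (\<bar>w p\<bar>, p)) (filter (\<lambda>p. w p < 0) xs) @ [(\<bar>w p\<bar>, p), (\<bar>w (p + 1)\<bar>, p + 1)] @ map (\<lambda>p. (\<bar>w p\<bar>, p)) (filter (\<lambda>p. w p < 0) ys)"
      unfolding neg_word_def l using 4 by simp
    have "w p \<noteq> w (p + 1)" using hyperoctD(5)[OF h, of p "p + 1"] by simp
    then have "w p < w (p + 1) \<longleftrightarrow> \<not> \<bar>w p\<bar> < \<bar>w (p + 1)\<bar>" using 4 by auto
    moreover have "ascent_at (rs_Q D w ! i) p \<longleftrightarrow>
        row_of (snd (rs (neg_word D w i))) p < row_of (snd (rs (neg_word D w i))) (p + 1)"
      using 4 p unfolding ascent_at_def e by (simp add: rs_Q_nth[OF i])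
    moreover note rs_descent[OF biword_neg_word[OF h, of D i, unfolded u], folded u]
    ultimately show ?thesis by (metis not_le)
  qed
qed

text \<open>The condition \<open>block_increasing C w\<close> in terms of \<open>Q = rs_Q D w\<close>.\<close>

definition compatible :: "int list \<Rightarrow> int list \<Rightarrow> (tableau \<times> tableau) list \<Rightarrow> bool" where
  "compatible D C Q \<longleftrightarrow> (\<forall>i<length D. \<forall>p\<in>block_pos D i.
     (same_block C p (p + 1) \<longrightarrow> ascent_at (Q ! i) p) \<and> (pos_block C p \<longrightarrow> p \<in> set (concat (fst (Q ! i)))))"

lemma block_increasing_iff_compatible:
  assumes w: "w \<in> W D" and C: "W C \<subseteq> W D" "comp_size C = comp_size D"
  shows "block_increasing C w \<longleftrightarrow> compatible D C (rs_Q D w)"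
proof
  assume b: "block_increasing C w"
  show "compatible D C (rs_Q D w)" unfolding compatible_def
  proof (intro allI impI ballI conjI)
    fix i p assume i: "i < length D" and p: "p \<in> block_pos D i"
    show "ascent_at (rs_Q D w ! i) p" if s: "same_block C p (p + 1)"
    proof -
      have "p + 1 \<in> block_pos D i" using same_block_subset[OF C s] same_block_mem[OF p i] by blast
      then show ?thesis using ascent_at_iff[OF w i p] b s by (simp add: block_increasing_def)
    qed
    show "p \<in> set (concat (fst (rs_Q D w ! i)))" if "pos_block C p"
      unfolding rs_Q_entries(1)[OF w i] using b that p by (simp add: block_increasing_def)
  qed
next
  assume c: "compatible D C (rs_Q D w)"
  show "block_increasing C w" unfolding block_increasing_def
  proof (intro allI impI conjI)
    fix p
    show "w p < w (p + 1)" if s: "same_block C p (p + 1)"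
    proof -
      obtain i where i: "i < length D" "p \<in> block_pos D i" "p + 1 \<in> block_pos D i"
        using same_block_subset[OF C s] by (auto simp: same_block_def)
      then show ?thesis using ascent_at_iff[OF w i] c s by (simp add: compatible_def)
    qed
    show "0 < w p" if s: "pos_block C p"
    proof -
      obtain i where i: "i < length D" "p \<in> block_pos D i"
        using pos_block_range[OF s] block_pos_cover[of p D] C(2) by auto
      then have "p \<in> set (concat (fst (rs_Q D w ! i)))" using c s by (simp add: compatible_def del: set_concat)
      then show ?thesis unfolding rs_Q_entries(1)[OF w i(1)] by simp
    qed
  qed
qed

lemma SBT_attained: "Q \<in> SBT D \<Longrightarrow> \<exists>w\<in>W D. rs_Q D w = Q"
  using rs_Q_surj[of Q D Q] by blast

lemma SBT_eq: "SBT D = rs_Q D ` W D"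
  using SBT_attained rs_Q_in_SBT by blast

lemma finite_SBT: "finite (SBT D)"
  unfolding SBT_eq using finite_W by simp

lemma x_elt_eq_sum_z_elt:
  assumes C: "W C \<subseteq> W D" "comp_size C = comp_size D"
  shows "x_elt D C = (\<Sum>Q\<in>{Q \<in> SBT D. compatible D C Q}. z_elt D Q)"
proof
  fix w
  have "(\<Sum>Q\<in>{Q \<in> SBT D. compatible D C Q}. z_elt D Q) w = (\<Sum>Q\<in>{Q \<in> SBT D. compatible D C Q}. z_elt D Q w)"
    by (rule sum_fun_apply)
  also have "\<dots> = x_elt D C w"
  proof (cases "w \<in> W D")
    case w: True
    have "(\<Sum>Q\<in>{Q \<in> SBT D. compatible D C Q}. z_elt D Q w) = (\<Sum>Q\<in>{Q \<in> SBT D. compatible D C Q}. if Q = rs_Q D w then 1 else 0)"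
      using w by (intro sum.cong) (auto simp: z_elt_def indicator_def)
    also have "\<dots> = (if compatible D C (rs_Q D w) then 1 else 0)"
      using finite_SBT rs_Q_in_SBT[OF w] by simp
    also have "\<dots> = x_elt D C w"
      using w block_increasing_iff_compatible[OF w C] X_iff[of w C] W_hyperoct[OF w] C(2)
      by (simp add: x_elt_def indicator_def)
    finally show ?thesis .
  next
    case False
    then show ?thesis by (simp add: z_elt_def x_elt_def indicator_def)
  qed
  finally show "x_elt D C w = (\<Sum>Q\<in>{Q \<in> SBT D. compatible D C Q}. z_elt D Q) w" by simp
qed

section \<open>Cells and weights of tableaux\<close>

definition col_of :: "tableau \<Rightarrow> int \<Rightarrow> nat" where
  "col_of T e = (THE c. \<exists>r<length T. c < length (T ! r) \<and> T ! r ! c = e)"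

lemma cell_exists: "e \<in> set (concat T) \<Longrightarrow> \<exists>r c. r < length T \<and> c < length (T ! r) \<and> T ! r ! c = e"
  by (metis UN_E in_set_conv_nth set_concat)

lemma cell_unique:
  assumes T: "tableau T" "distinct (concat T)"
    and a: "r < length T" "c < length (T ! r)" and b: "r' < length T" "c' < length (T ! r')" and e: "T ! r ! c = T ! r' ! c'"
  shows "r = r' \<and> c = c'"
proof -
  have "row_of T (T ! r ! c) = r" by (rule row_of_eqI[OF T(2) a(1)]) (use a in auto)
  moreover have "row_of T (T ! r ! c) = r'" by (rule row_of_eqI[OF T(2) b(1)]) (use b e in auto)
  ultimately have r: "r = r'" by simp
  have s: "sorted_wrt (<) (T ! r)" by (rule tableauD(2)[OF T(1) a(1)])
  have "c = c'" using sorted_wrt_nth_less[OF s, of c c'] sorted_wrt_nth_less[OF s, of c' c] a b e r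
    by (cases c c' rule: linorder_cases) auto
  then show ?thesis using r by simp
qed

lemma row_of_cell:
  assumes T: "tableau T" "distinct (concat T)" and a: "r < length T" "c < length (T ! r)"
  shows "row_of T (T ! r ! c) = r" "col_of T (T ! r ! c) = c"
proof -
  show "row_of T (T ! r ! c) = r" by (rule row_of_eqI[OF T(2) a(1)]) (use a in auto)
  show "col_of T (T ! r ! c) = c" unfolding col_of_def
  proof (rule the_equality)
    show "\<exists>r'<length T. c < length (T ! r') \<and> T ! r' ! c = T ! r ! c" using a by blast
    show "c' = c" if "\<exists>r'<length T. c' < length (T ! r') \<and> T ! r' ! c' = T ! r ! c" for c'
      using that cell_unique[OF T a] by metis
  qed
qed

lemma cellE:
  assumes T: "tableau T" "distinct (concat T)" and e: "e \<in> set (concat T)"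
  shows "row_of T e < length T" "col_of T e < length (T ! row_of T e)" "T ! row_of T e ! col_of T e = e"
proof -
  obtain r c where rc: "r < length T" "c < length (T ! r)" "T ! r ! c = e" using cell_exists[OF e] by blast
  have "row_of T e = r" "col_of T e = c" using row_of_cell[OF T rc(1,2)] rc(3) by auto
  then show "row_of T e < length T" "col_of T e < length (T ! row_of T e)" "T ! row_of T e ! col_of T e = e"
    using rc by auto
qed

lemma tableau_eq_by_rows:
  assumes T: "tableau T" "distinct (concat T)" and S: "tableau S" "distinct (concat S)"
    and ent: "set (concat T) = set (concat S)" and rows: "\<And>e. e \<in> set (concat T) \<Longrightarrow> row_of T e = row_of S e"
  shows "T = S"
proof -
  have idx: "i < length U \<longleftrightarrow> (\<exists>e\<in>set (concat U). row_of U e = i)" if U: "tableau U" "distinct (concat U)" for U i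
  proof
    assume i: "i < length U"
    then have "0 < length (U ! i)" using tableauD(1)[OF U(1) i] by simp
    then show "\<exists>e\<in>set (concat U). row_of U e = i"
      using row_of_cell(1)[OF U i] nth_in_concat[OF i] by blast
  qed (use cellE(1)[OF U] in blast)
  have sets: "set (U ! i) = {e \<in> set (concat U). row_of U e = i}" if U: "tableau U" "distinct (concat U)" and i: "i < length U" for U i
  proof (intro equalityI subsetI)
    fix e assume e: "e \<in> set (U ! i)"
    then have "e \<in> set (concat U)" using i by auto
    then show "e \<in> {e \<in> set (concat U). row_of U e = i}" using row_of_eqI[OF U(2) i e] by simp
  next
    fix e assume e: "e \<in> {e \<in> set (concat U). row_of U e = i}"
    then show "e \<in> set (U ! i)" using cellE[OF U, of e] by (metis (mono_tags, lifting) mem_Collect_eq nth_mem)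
  qed
  have "i < length T \<longleftrightarrow> i < length S" for i
    unfolding idx[OF T] idx[OF S] using ent rows by (metis (no_types, lifting))
  then have l: "length T = length S" by (metis linorder_neq_iff)
  show ?thesis
  proof (rule nth_equalityI[OF l])
    fix i assume i: "i < length T"
    have "set (T ! i) = set (S ! i)" unfolding sets[OF T i] sets[OF S i[unfolded l]] using ent rows by (intro Collect_cong) metis
    then show "T ! i = S ! i"
      using tableauD(2)[OF T(1) i] tableauD(2)[OF S(1) i[unfolded l]] by (intro strict_sorted_equal) auto
  qed
qed

text \<open>
  Columns determine rows: the row of an entry is the number of smaller entries in its column.
\<close>

lemma row_of_eq_card_column:
  assumes T: "tableau T" "distinct (concat T)" and e: "e \<in> set (concat T)"
  shows "row_of T e = card {x \<in> set (concat T). col_of T x = col_of T e \<and> x < e}"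
proof -
  define r c where "r = row_of T e" and "c = col_of T e"
  have rc: "r < length T" "c < length (T ! r)" "T ! r ! c = e" using cellE[OF T e] by (auto simp: r_def c_def)
  have len: "c < length (T ! i)" if "i \<le> r" for i using tableauD(3)[OF T(1) that rc(1)] rc(2) by simp
  have "{x \<in> set (concat T). col_of T x = c \<and> x < e} = (\<lambda>i. T ! i ! c) ` {..<r}"
  proof (intro equalityI subsetI)
    fix x assume x: "x \<in> {x \<in> set (concat T). col_of T x = c \<and> x < e}"
    define i where "i = row_of T x"
    have i: "i < length T" "c < length (T ! i)" "T ! i ! c = x" using cellE[OF T, of x] x by (auto simp: i_def)
    have "\<not> r \<le> i"
    proof
      assume "r \<le> i"
      then have "T ! r ! c \<le> T ! i ! c" using tableauD(4)[OF T(1), of r i c] i by (cases "r = i") auto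
      then show False using i rc x by simp
    qed
    then show "x \<in> (\<lambda>i. T ! i ! c) ` {..<r}" using i(3) by auto
  next
    fix x assume "x \<in> (\<lambda>i. T ! i ! c) ` {..<r}"
    then obtain i where i: "i < r" "x = T ! i ! c" by auto
    have ic: "i < length T" "c < length (T ! i)" using i(1) rc(1) len[of i] by auto
    have "x < e" using tableauD(4)[OF T(1) i(1) rc(1,2)] i(2) rc(3) by simp
    then show "x \<in> {x \<in> set (concat T). col_of T x = c \<and> x < e}"
      using row_of_cell(2)[OF T ic] nth_in_concat[OF ic] i(2) by (simp del: set_concat)
  qed
  moreover have "inj_on (\<lambda>i. T ! i ! c) {..<r}"
  proof (rule inj_onI)
    fix i j assume ij: "i \<in> {..<r}" "j \<in> {..<r}" "T ! i ! c = T ! j ! c"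
    then show "i = j" using cell_unique[OF T, of i c j c] len[of i] len[of j] rc(1) by simp
  qed
  ultimately show ?thesis by (simp add: card_image flip: r_def c_def del: set_concat)
qed

lemma tableau_eq_by_cols:
  assumes T: "tableau T" "distinct (concat T)" and S: "tableau S" "distinct (concat S)"
    and ent: "set (concat T) = set (concat S)" and cols: "\<And>e. e \<in> set (concat T) \<Longrightarrow> col_of T e = col_of S e"
  shows "T = S"
proof (rule tableau_eq_by_rows[OF T S ent])
  fix e assume e: "e \<in> set (concat T)"
  have "{x \<in> set (concat T). col_of T x = col_of T e \<and> x < e} = {x \<in> set (concat S). col_of S x = col_of S e \<and> x < e}"
    using ent cols e by (intro Collect_cong) (metis (no_types))
  then show "row_of T e = row_of S e"
    using row_of_eq_card_column[OF T e] row_of_eq_card_column[OF S e[unfolded ent]] by simp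
qed

text \<open>
  Rows in the positive tableau, columns in the negative one. As \<open>B\<close> will bound the number of
  rows, every entry of the negative tableau weighs more than any entry of the positive one.
\<close>

definition weight :: "nat \<Rightarrow> tableau \<times> tableau \<Rightarrow> int \<Rightarrow> nat" where
  "weight B T p = (if p \<in> set (concat (fst T)) then row_of (fst T) p else B + col_of (snd T) p)"

text \<open>
  The sum of the weights of all entries; it depends only on the shape (\<open>sum_weight\<close>).
\<close>

definition shape_weight :: "nat \<Rightarrow> bipartition \<Rightarrow> nat" where
  "shape_weight B L = (\<Sum>r<length (fst L). \<Sum>c<fst L ! r. r) + (\<Sum>r<length (snd L). \<Sum>c<snd L ! r. B + c)"

lemma sum_over_cells:
  fixes T :: tableau and f :: "int \<Rightarrow> nat"
  assumes "distinct (concat T)"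
  shows "(\<Sum>e\<in>set (concat T). f e) = (\<Sum>r<length T. \<Sum>c<length (T ! r). f (T ! r ! c))"
proof -
  have l: "sum_list (map f xs) = (\<Sum>c<length xs. f (xs ! c))" for xs :: "int list"
    by (simp add: sum_list_sum_nth atLeast0LessThan)
  have "(\<Sum>e\<in>set (concat T). f e) = sum_list (map f (concat T))"
    using assms by (simp only: sum_list_distinct_conv_sum_set)
  also have "\<dots> = (\<Sum>r<length T. sum_list (map f (T ! r)))"
    by (induction T) (simp_all add: sum.lessThan_Suc_shift del: sum.lessThan_Suc)
  also have "\<dots> = (\<Sum>r<length T. \<Sum>c<length (T ! r). f (T ! r ! c))"
    by (intro sum.cong refl l)
  finally show ?thesis .
qed

lemma sum_weight:
  assumes T: "tableau (fst T)" "distinct (concat (fst T))" "tableau (snd T)" "distinct (concat (snd T))"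
    and disj: "set (concat (fst T)) \<inter> set (concat (snd T)) = {}"
  shows "(\<Sum>p\<in>set (concat (fst T)) \<union> set (concat (snd T)). weight B T p) = shape_weight B (map_prod (map length) (map length) T)"
proof -
  have "(\<Sum>p\<in>set (concat (fst T)) \<union> set (concat (snd T)). weight B T p) =
     (\<Sum>p\<in>set (concat (fst T)). weight B T p) + (\<Sum>p\<in>set (concat (snd T)). weight B T p)"
    by (rule sum.union_disjoint[OF _ _ disj]) (rule finite_set)+
  also have "(\<Sum>p\<in>set (concat (fst T)). weight B T p) = (\<Sum>p\<in>set (concat (fst T)). row_of (fst T) p)"
    by (rule sum.cong) (simp_all add: weight_def del: set_concat)
  also have "\<dots> = (\<Sum>r<length (fst T). \<Sum>c<length (fst T ! r). row_of (fst T) (fst T ! r ! c))"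
    by (rule sum_over_cells[OF T(2)])
  also have "\<dots> = (\<Sum>r<length (fst T). \<Sum>c<length (fst T ! r). r)"
    by (intro sum.cong refl row_of_cell(1)[OF T(1,2)]) auto
  also have "(\<Sum>p\<in>set (concat (snd T)). weight B T p) = (\<Sum>p\<in>set (concat (snd T)). B + col_of (snd T) p)"
    using disj by (intro sum.cong refl) (auto simp: weight_def simp del: set_concat)
  also have "\<dots> = (\<Sum>r<length (snd T). \<Sum>c<length (snd T ! r). B + col_of (snd T) (snd T ! r ! c))"
    by (rule sum_over_cells[OF T(4)])
  also have "\<dots> = (\<Sum>r<length (snd T). \<Sum>c<length (snd T ! r). B + c)"
    using row_of_cell(2)[OF T(3,4)] by (intro sum.cong refl) auto
  finally show ?thesis by (cases T) (simp add: shape_weight_def)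
qed

section \<open>Superstandard tableaux\<close>

definition psum :: "nat list \<Rightarrow> nat \<Rightarrow> int" where
  "psum xs k = int (sum_list (take k xs))"

text \<open>
  \<open>p\<close> is in the segment number \<open>k\<close> if the integers after \<open>a\<close> are cut into segments of lengths \<open>xs\<close>.
\<close>

definition in_seg :: "int \<Rightarrow> nat list \<Rightarrow> nat \<Rightarrow> int \<Rightarrow> bool" where
  "in_seg a xs k p \<longleftrightarrow> a + psum xs k < p \<and> p \<le> a + psum xs (Suc k)"

lemma psum_0 [simp]: "psum xs 0 = 0" by (simp add: psum_def)

lemma psum_Suc: "k < length xs \<Longrightarrow> psum xs (Suc k) = psum xs k + int (xs ! k)"
  by (simp add: psum_def take_Suc_conv_app_nth)

lemma psum_length: "psum xs (length xs) = int (sum_list xs)" by (simp add: psum_def)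

lemma psum_mono: "k \<le> l \<Longrightarrow> psum xs k \<le> psum xs l"
proof -
  assume "k \<le> l"
  then obtain d where "l = k + d" using le_Suc_ex by blast
  then show ?thesis by (simp add: psum_def take_add)
qed

lemma psum_nonneg: "0 \<le> psum xs k" by (simp add: psum_def)

lemma psum_strict:
  assumes "k < l" "l \<le> length xs" "0 \<notin> set xs"
  shows "psum xs k < psum xs l"
proof -
  have "xs ! k \<noteq> 0" using assms by (metis less_le_trans nth_mem)
  then have "psum xs k < psum xs (Suc k)" using psum_Suc[of k xs] assms by simp
  then show ?thesis using psum_mono[of "Suc k" l xs] assms(1) by simp
qed

lemma psum_append1: "k \<le> length xs \<Longrightarrow> psum (xs @ ys) k = psum xs k"
  by (simp add: psum_def)

lemma psum_append2: "psum (xs @ ys) (length xs + c) = psum xs (length xs) + psum ys c"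
  by (simp add: psum_def)

lemma in_seg_exists: "a < p \<Longrightarrow> p \<le> a + psum xs k \<Longrightarrow> k \<le> length xs \<Longrightarrow> \<exists>j<k. in_seg a xs j p"
proof (induction k)
  case (Suc k)
  show ?case
  proof (cases "p \<le> a + psum xs k")
    case True
    then obtain j where "j < k" "in_seg a xs j p" using Suc by auto
    then show ?thesis by (intro exI[of _ j]) simp
  next
    case False
    then show ?thesis using Suc.prems by (intro exI[of _ k]) (simp add: in_seg_def)
  qed
qed simp

lemma in_seg_mono:
  assumes "in_seg a xs j p" "in_seg a xs k q" "p \<le> q"
  shows "j \<le> k"
proof (rule ccontr)
  assume "\<not> j \<le> k"
  then have "psum xs (Suc k) \<le> psum xs j" by (intro psum_mono) simp
  then show False using assms by (simp add: in_seg_def)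
qed

lemma in_seg_range:
  "in_seg a xs k p \<Longrightarrow> k < length xs \<Longrightarrow> a < p \<and> p \<le> a + int (sum_list xs)"
  using psum_nonneg[of xs k] psum_mono[of "Suc k" "length xs" xs] by (simp add: in_seg_def psum_length)

lemma in_seg_append1: "k < length xs \<Longrightarrow> in_seg a (xs @ ys) k p \<longleftrightarrow> in_seg a xs k p"
  by (simp add: in_seg_def psum_append1)

lemma in_seg_append2: "in_seg a (xs @ ys) (length xs + c) p \<longleftrightarrow> in_seg (a + int (sum_list xs)) ys c p"
  using psum_append2[of xs ys c] psum_append2[of xs ys "Suc c"] by (simp add: in_seg_def psum_length add.assoc)

text \<open>Rows filled one after the other with consecutive integers.\<close>

definition row_tab :: "int \<Rightarrow> nat list \<Rightarrow> tableau" where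
  "row_tab a xs = map (\<lambda>r. [a + psum xs r + 1..a + psum xs (Suc r)]) [0..<length xs]"

lemma length_row_tab [simp]: "length (row_tab a xs) = length xs" by (simp add: row_tab_def)

lemma row_tab_nth: "r < length xs \<Longrightarrow> row_tab a xs ! r = [a + psum xs r + 1..a + psum xs (Suc r)]"
  by (simp add: row_tab_def)

lemma map_length_row_tab: "map length (row_tab a xs) = xs"
  by (rule nth_equalityI) (simp_all add: row_tab_nth psum_Suc)

lemma set_row_tab: "r < length xs \<Longrightarrow> p \<in> set (row_tab a xs ! r) \<longleftrightarrow> in_seg a xs r p"
  by (auto simp: row_tab_nth in_seg_def)

lemma set_concat_row_tab: "set (concat (row_tab a xs)) = {a + 1..a + int (sum_list xs)}"
proof (intro equalityI subsetI)
  fix p assume "p \<in> set (concat (row_tab a xs))"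
  then obtain r where "r < length xs" "p \<in> set (row_tab a xs ! r)"
    using cell_exists[of p "row_tab a xs"] by (metis length_row_tab nth_mem)
  then show "p \<in> {a + 1..a + int (sum_list xs)}" using in_seg_range[of a xs r p] by (simp add: set_row_tab)
next
  fix p assume "p \<in> {a + 1..a + int (sum_list xs)}"
  then obtain r where r: "r < length xs" "in_seg a xs r p"
    using in_seg_exists[of a p xs "length xs"] by (auto simp: psum_length)
  then have "p \<in> set (row_tab a xs ! r)" by (simp add: set_row_tab)
  then show "p \<in> set (concat (row_tab a xs))" using r(1) by (auto intro!: bexI[of _ "row_tab a xs ! r"])
qed

text \<open>There are as many entries as elements of the interval.\<close>

lemma distinct_concat_of_interval:
  assumes "map length T = xs" "set (concat T) = {a + 1..a + int (sum_list xs)}"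
  shows "distinct (concat T)"
proof (rule card_distinct)
  have "length (concat T) = sum_list xs" using assms(1) by (simp add: length_concat)
  then show "card (set (concat T)) = length (concat T)" unfolding assms(2) by simp
qed

lemma distinct_row_tab: "distinct (concat (row_tab a xs))"
  using distinct_concat_of_interval[OF map_length_row_tab set_concat_row_tab] .

lemma int_partition_nth:
  assumes "int_partition xs"
  shows "i < length xs \<Longrightarrow> 0 < xs ! i" "i \<le> j \<Longrightarrow> j < length xs \<Longrightarrow> xs ! j \<le> xs ! i"
proof -
  show "0 < xs ! i" if "i < length xs" using assms that nth_mem[OF that] unfolding int_partition_def by (metis neq0_conv)
  show "xs ! j \<le> xs ! i" if "i \<le> j" "j < length xs"
    using assms that sorted_wrt_nth_less[of "(\<ge>)" xs i j] unfolding int_partition_def by (cases "i = j") auto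
qed

lemma tableau_row_tab:
  assumes xs: "int_partition xs" shows "tableau (row_tab a xs)"
proof (rule tableauI)
  have len: "length (row_tab a xs ! i) = xs ! i" if "i < length xs" for i
    using that by (simp add: row_tab_nth psum_Suc)
  fix i assume "i < length (row_tab a xs)"
  then have i: "i < length xs" by simp
  have "length (row_tab a xs ! i) \<noteq> 0" using len[OF i] int_partition_nth(1)[OF xs i] by simp
  then show "row_tab a xs ! i \<noteq> []" by simp
  show "sorted_wrt (<) (row_tab a xs ! i)" using i by (simp add: row_tab_nth)
next
  have len: "length (row_tab a xs ! i) = xs ! i" if "i < length xs" for i
    using that by (simp add: row_tab_nth psum_Suc)
  fix i j assume ij: "i < j" "j < length (row_tab a xs)"
  then have ij': "i < length xs" "j < length xs" by auto
  show "length (row_tab a xs ! j) \<le> length (row_tab a xs ! i)"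
    using len[OF ij'(1)] len[OF ij'(2)] int_partition_nth(2)[OF xs, of i j] ij by simp
  fix k assume k: "k < length (row_tab a xs ! j)"
  have kj: "k < xs ! j" "k < xs ! i" using k len[OF ij'(2)] int_partition_nth(2)[OF xs, of i j] ij by auto
  have "psum xs i < psum xs j" using psum_strict[of i j xs] ij xs by (simp add: int_partition_def)
  moreover have "row_tab a xs ! i ! k = a + psum xs i + 1 + int k" "row_tab a xs ! j ! k = a + psum xs j + 1 + int k"
    using ij' kj by (simp_all add: row_tab_nth psum_Suc)
  ultimately show "row_tab a xs ! i ! k < row_tab a xs ! j ! k" by simp
qed

lemma row_of_row_tab: "r < length xs \<Longrightarrow> in_seg a xs r p \<Longrightarrow> row_of (row_tab a xs) p = r"
  by (rule row_of_eqI[OF distinct_row_tab]) (simp_all add: set_row_tab)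

text \<open>The conjugate partition, whose parts are the lengths of the columns.\<close>

definition conj_part :: "nat list \<Rightarrow> nat list" where
  "conj_part \<beta> = map (\<lambda>c. length (filter (\<lambda>l. c < l) \<beta>)) [0..<(if \<beta> = [] then 0 else hd \<beta>)]"

lemma conj_part_cell:
  assumes \<beta>: "int_partition \<beta>" and c: "c < length (conj_part \<beta>)"
  shows "r < conj_part \<beta> ! c \<longleftrightarrow> r < length \<beta> \<and> c < \<beta> ! r"
proof -
  have l: "conj_part \<beta> ! c = card {i. i < length \<beta> \<and> c < \<beta> ! i}"
    using c by (simp add: conj_part_def length_filter_conv_card)
  define S where "S = {i. i < length \<beta> \<and> c < \<beta> ! i}"
  have fin: "finite S" by (simp add: S_def)
  have down: "j \<in> S" if "i \<in> S" "j \<le> i" for i j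
    using that int_partition_nth(2)[OF \<beta> that(2)] by (auto simp: S_def)
  have "S = {..<card S}"
  proof (cases "S = {}")
    case False
    define m where "m = Max S"
    have m: "m \<in> S" "\<And>i. i \<in> S \<Longrightarrow> i \<le> m" using Max_in[OF fin False] Max_ge[OF fin] by (auto simp: m_def)
    have "S = {..m}" using m down by auto
    then show ?thesis by (simp add: lessThan_Suc_atMost)
  qed simp
  then show ?thesis unfolding l S_def[symmetric] by (metis (mono_tags, lifting) S_def lessThan_iff mem_Collect_eq)
qed

lemma conj_part_length:
  assumes \<beta>: "int_partition \<beta>" and r: "r < length \<beta>" and c: "c < \<beta> ! r"
  shows "c < length (conj_part \<beta>)"
proof -
  have "\<beta> ! r \<le> \<beta> ! 0" using int_partition_nth(2)[OF \<beta>, of 0 r] r by simp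
  then show ?thesis using r c by (cases \<beta>) (auto simp: conj_part_def)
qed

lemma conj_part_pos:
  assumes \<beta>: "int_partition \<beta>" shows "0 \<notin> set (conj_part \<beta>)"
proof
  assume "0 \<in> set (conj_part \<beta>)"
  then obtain c where c: "c < length (conj_part \<beta>)" "conj_part \<beta> ! c = 0" by (metis in_set_conv_nth)
  have "\<beta> \<noteq> []" using c by (auto simp: conj_part_def)
  then have "0 < length \<beta> \<and> c < \<beta> ! 0" using c by (auto simp: conj_part_def hd_conv_nth)
  then have "0 < conj_part \<beta> ! c" using conj_part_cell[OF \<beta> c(1), of 0] by simp
  then show False using c(2) by simp
qed

lemma sum_list_conj_part:
  assumes \<beta>: "int_partition \<beta>" shows "sum_list (conj_part \<beta>) = sum_list \<beta>"
proof -
  let ?m = "length (conj_part \<beta>)"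
  have "sum_list (conj_part \<beta>) = (\<Sum>c<?m. conj_part \<beta> ! c)" by (simp add: sum_list_sum_nth atLeast0LessThan)
  also have "\<dots> = (\<Sum>c<?m. \<Sum>r<length \<beta>. if c < \<beta> ! r then 1 else 0)"
  proof (intro sum.cong refl)
    fix c assume c: "c \<in> {..<?m}"
    have "(\<Sum>r<length \<beta>. if c < \<beta> ! r then 1 else 0) = card {r \<in> {..<length \<beta>}. c < \<beta> ! r}"
      by (simp flip: sum.inter_filter)
    also have "{r \<in> {..<length \<beta>}. c < \<beta> ! r} = {..<conj_part \<beta> ! c}"
      using conj_part_cell[OF \<beta>, of c] c by auto
    finally show "conj_part \<beta> ! c = (\<Sum>r<length \<beta>. if c < \<beta> ! r then 1 else 0)" by simp
  qed
  also have "\<dots> = (\<Sum>r<length \<beta>. \<Sum>c<?m. if c < \<beta> ! r then 1 else 0)" by (rule sum.swap)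
  also have "\<dots> = (\<Sum>r<length \<beta>. \<beta> ! r)"
  proof (intro sum.cong refl)
    fix r assume r: "r \<in> {..<length \<beta>}"
    have "(\<Sum>c<?m. if c < \<beta> ! r then 1 else 0) = card {c \<in> {..<?m}. c < \<beta> ! r}"
      by (simp flip: sum.inter_filter)
    also have "{c \<in> {..<?m}. c < \<beta> ! r} = {..<\<beta> ! r}" using conj_part_length[OF \<beta>, of r] r by auto
    finally show "(\<Sum>c<?m. if c < \<beta> ! r then 1 else 0) = \<beta> ! r" by simp
  qed
  also have "\<dots> = sum_list \<beta>" by (simp add: sum_list_sum_nth atLeast0LessThan)
  finally show ?thesis .
qed

text \<open>Columns filled one after the other with consecutive integers.\<close>

definition col_tab :: "int \<Rightarrow> nat list \<Rightarrow> tableau" where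
  "col_tab b \<beta> = map (\<lambda>r. map (\<lambda>c. b + psum (conj_part \<beta>) c + 1 + int r) [0..<\<beta> ! r]) [0..<length \<beta>]"

lemma length_col_tab [simp]: "length (col_tab b \<beta>) = length \<beta>" by (simp add: col_tab_def)

lemma map_length_col_tab: "map length (col_tab b \<beta>) = \<beta>"
  by (rule nth_equalityI) (simp_all add: col_tab_def)

lemma length_col_tab_nth: "r < length \<beta> \<Longrightarrow> length (col_tab b \<beta> ! r) = \<beta> ! r"
  by (simp add: col_tab_def)

lemma col_tab_nth: "r < length \<beta> \<Longrightarrow> c < \<beta> ! r \<Longrightarrow> col_tab b \<beta> ! r ! c = b + psum (conj_part \<beta>) c + 1 + int r"
  by (simp add: col_tab_def)

lemma col_tab_in_seg:
  assumes \<beta>: "int_partition \<beta>" and r: "r < length \<beta>" and c: "c < \<beta> ! r"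
  shows "in_seg b (conj_part \<beta>) c (col_tab b \<beta> ! r ! c)"
proof -
  have cl: "c < length (conj_part \<beta>)" by (rule conj_part_length[OF \<beta> r c])
  have "r < conj_part \<beta> ! c" using conj_part_cell[OF \<beta> cl] r c by simp
  then show ?thesis unfolding in_seg_def psum_Suc[OF cl] col_tab_nth[OF r c] by simp
qed

lemma in_seg_col_tab:
  assumes \<beta>: "int_partition \<beta>" and c: "c < length (conj_part \<beta>)" and p: "in_seg b (conj_part \<beta>) c p"
  shows "\<exists>r<length \<beta>. c < \<beta> ! r \<and> col_tab b \<beta> ! r ! c = p"
proof -
  define r where "r = nat (p - b - psum (conj_part \<beta>) c - 1)"
  have "r < conj_part \<beta> ! c" and pr: "p = b + psum (conj_part \<beta>) c + 1 + int r"
    using p unfolding in_seg_def psum_Suc[OF c] by (auto simp: r_def)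
  then have "r < length \<beta>" "c < \<beta> ! r" using conj_part_cell[OF \<beta> c] by auto
  then show ?thesis using pr col_tab_nth by auto
qed

lemma set_concat_col_tab:
  assumes \<beta>: "int_partition \<beta>"
  shows "set (concat (col_tab b \<beta>)) = {b + 1..b + int (sum_list \<beta>)}"
proof (intro equalityI subsetI)
  fix p assume "p \<in> set (concat (col_tab b \<beta>))"
  then obtain r c where rc: "r < length \<beta>" "c < \<beta> ! r" "col_tab b \<beta> ! r ! c = p"
    using cell_exists[of p "col_tab b \<beta>"] length_col_tab_nth by auto
  have "in_seg b (conj_part \<beta>) c p" using col_tab_in_seg[OF \<beta> rc(1,2), of b] rc(3) by simp
  then show "p \<in> {b + 1..b + int (sum_list \<beta>)}"
    using in_seg_range conj_part_length[OF \<beta> rc(1,2)] sum_list_conj_part[OF \<beta>] by fastforce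
next
  fix p assume "p \<in> {b + 1..b + int (sum_list \<beta>)}"
  then obtain c where c: "c < length (conj_part \<beta>)" "in_seg b (conj_part \<beta>) c p"
    using in_seg_exists[of b p "conj_part \<beta>" "length (conj_part \<beta>)"] sum_list_conj_part[OF \<beta>] by (auto simp: psum_length)
  obtain r where r: "r < length \<beta>" "c < \<beta> ! r" "col_tab b \<beta> ! r ! c = p" using in_seg_col_tab[OF \<beta> c] by blast
  then show "p \<in> set (concat (col_tab b \<beta>))"
    using nth_in_concat[of r "col_tab b \<beta>" c] length_col_tab_nth[OF r(1)] by simp
qed

lemma tableau_col_tab:
  assumes \<beta>: "int_partition \<beta>" shows "tableau (col_tab b \<beta>)"
proof (rule tableauI)
  fix i assume "i < length (col_tab b \<beta>)"
  then have i: "i < length \<beta>" by simp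
  have "length (col_tab b \<beta> ! i) \<noteq> 0" using length_col_tab_nth[OF i, of b] int_partition_nth(1)[OF \<beta> i] by simp
  then show "col_tab b \<beta> ! i \<noteq> []" by simp
  show "sorted_wrt (<) (col_tab b \<beta> ! i)" unfolding sorted_wrt_iff_nth_less
  proof (intro allI impI)
    fix c d assume cd: "c < d" "d < length (col_tab b \<beta> ! i)"
    then have d: "d < \<beta> ! i" using length_col_tab_nth[OF i, of b] by simp
    have "psum (conj_part \<beta>) c < psum (conj_part \<beta>) d"
      using psum_strict[OF cd(1), of "conj_part \<beta>"] conj_part_length[OF \<beta> i d] conj_part_pos[OF \<beta>] by simp
    then show "col_tab b \<beta> ! i ! c < col_tab b \<beta> ! i ! d" using col_tab_nth[OF i] d cd(1) by simp
  qed
next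
  fix i j assume ij: "i < j" "j < length (col_tab b \<beta>)"
  then have ij': "i < length \<beta>" "j < length \<beta>" by auto
  show "length (col_tab b \<beta> ! j) \<le> length (col_tab b \<beta> ! i)"
    using length_col_tab_nth[OF ij'(1), of b] length_col_tab_nth[OF ij'(2), of b] int_partition_nth(2)[OF \<beta>, of i j] ij by simp
  fix c assume c: "c < length (col_tab b \<beta> ! j)"
  have cj: "c < \<beta> ! j" "c < \<beta> ! i" using c length_col_tab_nth[OF ij'(2), of b] int_partition_nth(2)[OF \<beta>, of i j] ij by auto
  show "col_tab b \<beta> ! i ! c < col_tab b \<beta> ! j ! c" using col_tab_nth[OF ij'(1) cj(2)] col_tab_nth[OF ij'(2) cj(1)] ij(1) by simp
qed

lemma distinct_col_tab: "int_partition \<beta> \<Longrightarrow> distinct (concat (col_tab b \<beta>))"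
  using distinct_concat_of_interval[OF map_length_col_tab set_concat_col_tab] .

lemma col_of_col_tab:
  assumes \<beta>: "int_partition \<beta>" and c: "c < length (conj_part \<beta>)" "in_seg b (conj_part \<beta>) c p"
  shows "col_of (col_tab b \<beta>) p = c" "\<exists>r. in_seg b (conj_part \<beta>) c p \<and> row_of (col_tab b \<beta>) p = r \<and> p = b + psum (conj_part \<beta>) c + 1 + int r"
proof -
  obtain r where r: "r < length \<beta>" "c < \<beta> ! r" "col_tab b \<beta> ! r ! c = p" using in_seg_col_tab[OF \<beta> c] by blast
  have rl: "r < length (col_tab b \<beta>)" "c < length (col_tab b \<beta> ! r)" using r length_col_tab_nth[OF r(1)] by auto
  note rc = row_of_cell[OF tableau_col_tab[OF \<beta>] distinct_col_tab[OF \<beta>] rl]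
  show "col_of (col_tab b \<beta>) p = c" using rc(2) r(3) by simp
  have "row_of (col_tab b \<beta>) p = r" using rc(1) r(3) by simp
  then show "\<exists>r. in_seg b (conj_part \<beta>) c p \<and> row_of (col_tab b \<beta>) p = r \<and> p = b + psum (conj_part \<beta>) c + 1 + int r"
    using c(2) col_tab_nth[OF r(1,2)] r(3) by auto
qed

section \<open>Superstandard tableaux have the largest weight\<close>

text \<open>
  Induction on \<open>p\<close>. The entry above \<open>p\<close> is smaller, and by induction its row is at most the number of its
  segment. If it were in the same segment as \<open>p\<close>, then \<open>p\<close> could not be in a lower row.
\<close>

lemma row_of_le_segment:
  assumes P: "tableau P" "distinct (concat P)" and lower: "\<And>e. e \<in> set (concat P) \<Longrightarrow> a < e"
    and sub: "{a + 1..a + int (sum_list xs)} \<subseteq> set (concat P)"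
    and asc: "\<And>r p. r < length xs \<Longrightarrow> in_seg a xs r p \<Longrightarrow> in_seg a xs r (p + 1) \<Longrightarrow> row_of P (p + 1) \<le> row_of P p"
    and r: "r < length xs" "in_seg a xs r p"
  shows "row_of P p \<le> r"
  using r
proof (induction "nat (p - a)" arbitrary: p r rule: less_induct)
  case less
  have rng: "a < p" "p \<le> a + int (sum_list xs)" using in_seg_range[OF less.prems(2,1)] by auto
  then have pP: "p \<in> set (concat P)" using sub by (auto simp del: set_concat)
  note cell = cellE[OF P pP]
  show ?case
  proof (cases "row_of P p")
    case (Suc k)
    define e where "e = P ! k ! col_of P p"
    have k: "k < length P" "col_of P p < length (P ! k)"
      using cell Suc tableauD(3)[OF P(1), of k "Suc k"] by auto
    have eP: "e \<in> set (concat P)" unfolding e_def by (rule nth_in_concat[OF k])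
    have rowe: "row_of P e = k" unfolding e_def by (rule row_of_cell(1)[OF P k])
    have ep: "e < p" using tableauD(4)[OF P(1), of k "Suc k" "col_of P p"] cell Suc by (simp add: e_def)
    have ea: "a < e" by (rule lower[OF eP])
    have "e \<le> a + psum xs (length xs)" using ep rng by (simp add: psum_length)
    then obtain r' where r': "r' < length xs" "in_seg a xs r' e" using in_seg_exists[OF ea] by blast
    have "k \<le> r'" using less.hyps[of e r'] r' ep ea rng rowe by simp
    moreover have "r' \<le> r" using in_seg_mono[OF r'(2) less.prems(2)] ep by simp
    moreover have "r' \<noteq> r"
    proof
      assume "r' = r"
      have "row_of P q \<le> k" if "e \<le> q" "q \<le> p" for q
        using that
      proof (induction q rule: int_ge_induct)
        case base
        show ?case using rowe by simp
      next
        case (step q)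
        have "in_seg a xs r q" "in_seg a xs r (q + 1)"
          using step.hyps step.prems r'(2) \<open>r' = r\<close> less.prems(2) by (auto simp: in_seg_def)
        then show ?case using asc[OF less.prems(1)] step.IH step.prems by fastforce
      qed
      from this[of p] show False using Suc ep by simp
    qed
    ultimately show ?thesis using Suc by simp
  qed simp
qed

text \<open>
  The same argument with the entry to the left of \<open>p\<close>: in a common segment the rows would strictly increase.
  By the ascent condition \<open>p + 1\<close> can be in the negative tableau only if \<open>p\<close> is, so the path is followed downwards.
\<close>

lemma col_of_le_segment:
  assumes N: "tableau N" "distinct (concat N)" and sub: "set (concat N) \<subseteq> {b + 1..b + int (sum_list ys)}"
    and asc: "\<And>c p. c < length ys \<Longrightarrow> in_seg b ys c p \<Longrightarrow> in_seg b ys c (p + 1) \<Longrightarrow> p + 1 \<in> set (concat N) \<Longrightarrow>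
      p \<in> set (concat N) \<and> row_of N p < row_of N (p + 1)"
    and c: "c < length ys" "in_seg b ys c p" and pN: "p \<in> set (concat N)"
  shows "col_of N p \<le> c"
  using c pN
proof (induction "nat (p - b)" arbitrary: p c rule: less_induct)
  case less
  note pN = less.prems(3)
  have rng: "b < p" "p \<le> b + int (sum_list ys)" using in_seg_range[OF less.prems(2,1)] by auto
  note cell = cellE[OF N pN]
  show ?case
  proof (cases "col_of N p")
    case (Suc k)
    define e where "e = N ! row_of N p ! k"
    have k: "row_of N p < length N" "k < length (N ! row_of N p)" using cell Suc by auto
    have eN: "e \<in> set (concat N)" unfolding e_def by (rule nth_in_concat[OF k])
    have cole: "row_of N e = row_of N p" "col_of N e = k" unfolding e_def using row_of_cell[OF N k] by auto
    have ep: "e < p" using sorted_wrt_nth_less[OF tableauD(2)[OF N(1) k(1)], of k "Suc k"] cell Suc by (simp add: e_def)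
    have eb: "b < e" using sub eN by (auto simp del: set_concat)
    have "e \<le> b + psum ys (length ys)" using ep rng by (simp add: psum_length)
    then obtain c' where c': "c' < length ys" "in_seg b ys c' e" using in_seg_exists[OF eb] by blast
    have "k \<le> c'" using less.hyps[of e c'] c' ep eb rng cole(2) eN by simp
    moreover have "c' \<le> c" using in_seg_mono[OF c'(2) less.prems(2)] ep by simp
    moreover have "c' \<noteq> c"
    proof
      assume "c' = c"
      have "q \<in> set (concat N) \<and> row_of N q \<le> row_of N p \<and> (q < p \<longrightarrow> row_of N q < row_of N p)" if "q \<le> p" "e \<le> q" for q
        using that
      proof (induction q rule: int_le_induct)
        case base
        show ?case using pN by simp
      next
        case (step q)
        have s: "in_seg b ys c (q - 1)" "in_seg b ys c (q - 1 + 1)"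
          using step.hyps step.prems c'(2) \<open>c' = c\<close> less.prems(2) by (auto simp: in_seg_def)
        have IH: "q \<in> set (concat N)" "row_of N q \<le> row_of N p" using step.IH step.prems by auto
        have "q - 1 \<in> set (concat N) \<and> row_of N (q - 1) < row_of N q"
          using asc[OF less.prems(1) s] IH(1) by (simp del: set_concat)
        then show ?case using IH(2) by (simp del: set_concat)
      qed
      from this[of e] show False using ep cole(1) by simp
    qed
    ultimately show ?thesis using Suc by simp
  qed simp
qed

text \<open>
  The entries of the row segments are in the positive tableau. The remaining ones either are in the negative tableau, where
  the bound on columns applies, or in the positive one, where the weight is less than \<open>B\<close>. In the case of
  equality the latter does not happen, and rows and columns determine the tableaux.
\<close>

lemma weight_le_superstandard:
  fixes T :: "tableau \<times> tableau"
  defines "P \<equiv> fst T" and "N \<equiv> snd T"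
  assumes \<alpha>: "int_partition \<alpha>" and \<beta>: "int_partition \<beta>" and b: "b = a + int (sum_list \<alpha>)"
    and T: "tableau P" "distinct (concat P)" "tableau N" "distinct (concat N)"
      "set (concat P) \<inter> set (concat N) = {}" "set (concat P) \<union> set (concat N) = {a + 1..b + int (sum_list \<beta>)}"
    and pos: "{a + 1..b} \<subseteq> set (concat P)"
    and rows: "\<And>r p. r < length \<alpha> \<Longrightarrow> in_seg a \<alpha> r p \<Longrightarrow> in_seg a \<alpha> r (p + 1) \<Longrightarrow> ascent_at T p"
    and cols: "\<And>c p. c < length (conj_part \<beta>) \<Longrightarrow> in_seg b (conj_part \<beta>) c p \<Longrightarrow> in_seg b (conj_part \<beta>) c (p + 1) \<Longrightarrow> ascent_at T p"
    and B: "sum_list \<alpha> + sum_list \<beta> \<le> B"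
  shows "\<And>p. p \<in> {a + 1..b + int (sum_list \<beta>)} \<Longrightarrow> weight B T p \<le> weight B (row_tab a \<alpha>, col_tab b \<beta>) p"
    and "(\<And>p. p \<in> {a + 1..b + int (sum_list \<beta>)} \<Longrightarrow> weight B T p = weight B (row_tab a \<alpha>, col_tab b \<beta>) p)
      \<Longrightarrow> T = (row_tab a \<alpha>, col_tab b \<beta>)"
proof -
  let ?T0 = "(row_tab a \<alpha>, col_tab b \<beta>)"
  have mem: "p \<in> set (concat P) \<longleftrightarrow> p \<in> {a + 1..b + int (sum_list \<beta>)} \<and> p \<notin> set (concat N)" for p
    using T(5,6) by blast
  have Nsub: "set (concat N) \<subseteq> {b + 1..b + int (sum_list \<beta>)}"
  proof
    fix p assume p: "p \<in> set (concat N)"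
    then have "p \<notin> {a + 1..b}" "p \<in> {a + 1..b + int (sum_list \<beta>)}" using T(5,6) pos by blast+
    then show "p \<in> {b + 1..b + int (sum_list \<beta>)}" by auto
  qed
  have row_le: "row_of P p \<le> r" if "r < length \<alpha>" "in_seg a \<alpha> r p" for r p
  proof (rule row_of_le_segment[OF T(1,2) _ _ _ that])
    show "a < e" if "e \<in> set (concat P)" for e
    proof -
      have "e \<in> {a + 1..b + int (sum_list \<beta>)}" using that T(6) by blast
      then show ?thesis by simp
    qed
    show "{a + 1..a + int (sum_list \<alpha>)} \<subseteq> set (concat P)" using pos b by blast
    fix r p assume r: "r < length \<alpha>" "in_seg a \<alpha> r p" "in_seg a \<alpha> r (p + 1)"
    have "p \<in> set (concat P)" using in_seg_range[OF r(2,1)] pos b by (auto simp del: set_concat)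
    then show "row_of P (p + 1) \<le> row_of P p" using rows[OF r] unfolding ascent_at_def P_def by (simp del: set_concat)
  qed
  have col_le: "col_of N p \<le> c" if "c < length (conj_part \<beta>)" "in_seg b (conj_part \<beta>) c p" "p \<in> set (concat N)" for c p
  proof (rule col_of_le_segment[OF T(3,4) _ _ that])
    show "set (concat N) \<subseteq> {b + 1..b + int (sum_list (conj_part \<beta>))}" using Nsub sum_list_conj_part[OF \<beta>] by simp
    fix c p assume c: "c < length (conj_part \<beta>)" "in_seg b (conj_part \<beta>) c p" "in_seg b (conj_part \<beta>) c (p + 1)"
      and p1: "p + 1 \<in> set (concat N)"
    have rng: "b < p" "p \<le> b + int (sum_list \<beta>)" using in_seg_range[OF c(2,1)] sum_list_conj_part[OF \<beta>] by auto
    have n1: "p + 1 \<notin> set (concat P)" using p1 T(5) by blast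
    have nP: "p \<notin> set (concat P)" using cols[OF c] n1 unfolding ascent_at_def P_def by (auto simp del: set_concat)
    then have "p \<in> set (concat N)" using mem[of p] rng b by (simp del: set_concat)
    moreover have "row_of N p < row_of N (p + 1)"
      using cols[OF c] nP p1 unfolding ascent_at_def P_def N_def by (simp del: set_concat)
    ultimately show "p \<in> set (concat N) \<and> row_of N p < row_of N (p + 1)" by blast
  qed
  \<comment> \<open>rows are not empty, so there are at most as many rows as entries\<close>
  have row_lt: "row_of P p < B" if p: "p \<in> set (concat P)" "b < p" for p
  proof -
    have "row_of P p < length P" by (rule cellE(1)[OF T(1,2) p(1)])
    also have "length P \<le> sum_list (map length P)"
    proof -
      have "(\<Sum>x\<leftarrow>P. 1) \<le> (\<Sum>x\<leftarrow>P. length x)"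
        using tableau_no_Nil[OF T(1)] by (intro sum_list_mono) (metis One_nat_def Suc_leI length_greater_0_conv)
      then show ?thesis by (simp add: sum_list_triv)
    qed
    also have "\<dots> = card (set (concat P))" using distinct_card[OF T(2)] by (simp add: length_concat)
    also have "\<dots> \<le> card {a + 1..b + int (sum_list \<beta>)}" using T(6) by (intro card_mono) (auto simp del: set_concat)
    also have "\<dots> \<le> B" using B b by simp
    finally show ?thesis .
  qed
  have w0: "weight B ?T0 p = r" if "r < length \<alpha>" "in_seg a \<alpha> r p" for r p
    using row_of_row_tab[OF that] in_seg_range[OF that(2,1)] unfolding weight_def fst_conv snd_conv set_concat_row_tab by simp
  have w1: "weight B ?T0 p = B + c" if "c < length (conj_part \<beta>)" "in_seg b (conj_part \<beta>) c p" for c p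
    using col_of_col_tab(1)[OF \<beta> that] in_seg_range[OF that(2,1)] b unfolding weight_def fst_conv snd_conv set_concat_row_tab by simp
  have cases: "(\<exists>r<length \<alpha>. in_seg a \<alpha> r p \<and> p \<in> {a + 1..b}) \<or> (\<exists>c<length (conj_part \<beta>). in_seg b (conj_part \<beta>) c p \<and> b < p)"
    if p: "p \<in> {a + 1..b + int (sum_list \<beta>)}" for p
  proof (cases "p \<le> b")
    case True
    then obtain r where "r < length \<alpha>" "in_seg a \<alpha> r p"
      using in_seg_exists[of a p \<alpha> "length \<alpha>"] p b by (auto simp: psum_length)
    then show ?thesis using p True by auto
  next
    case False
    then obtain c where "c < length (conj_part \<beta>)" "in_seg b (conj_part \<beta>) c p"
      using in_seg_exists[of b p "conj_part \<beta>" "length (conj_part \<beta>)"] p sum_list_conj_part[OF \<beta>] by (auto simp: psum_length)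
    then show ?thesis using False by auto
  qed
  show "weight B T p \<le> weight B ?T0 p" if p: "p \<in> {a + 1..b + int (sum_list \<beta>)}" for p
    using cases[OF p]
  proof (elim disjE exE conjE)
    fix r assume r: "r < length \<alpha>" "in_seg a \<alpha> r p" "p \<in> {a + 1..b}"
    have "p \<in> set (concat P)" using r(3) pos by blast
    then show ?thesis unfolding w0[OF r(1,2)] using row_le[OF r(1,2)] by (simp add: weight_def P_def del: set_concat)
  next
    fix c assume c: "c < length (conj_part \<beta>)" "in_seg b (conj_part \<beta>) c p" "b < p"
    show ?thesis
    proof (cases "p \<in> set (concat P)")
      case True
      then show ?thesis unfolding w1[OF c(1,2)] using row_lt[OF True c(3)] by (simp add: weight_def P_def del: set_concat)
    next
      case False
      then have "p \<in> set (concat N)" using mem[of p] p by blast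
      then show ?thesis unfolding w1[OF c(1,2)] using col_le[OF c(1,2)] False by (simp add: weight_def P_def N_def del: set_concat)
    qed
  qed
  assume eq: "\<And>p. p \<in> {a + 1..b + int (sum_list \<beta>)} \<Longrightarrow> weight B T p = weight B ?T0 p"
  have Pset: "set (concat P) = {a + 1..b}"
  proof
    show "set (concat P) \<subseteq> {a + 1..b}"
    proof
      fix p assume p: "p \<in> set (concat P)"
      then have rng: "p \<in> {a + 1..b + int (sum_list \<beta>)}" using T(6) by blast
      show "p \<in> {a + 1..b}" using cases[OF rng]
      proof (elim disjE exE conjE)
        fix c assume c: "c < length (conj_part \<beta>)" "in_seg b (conj_part \<beta>) c p" "b < p"
        have "row_of P p = B + c" using eq[OF rng] p unfolding w1[OF c(1,2)] by (simp add: weight_def P_def del: set_concat)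
        then show ?thesis using row_lt[OF p c(3)] by simp
      qed
    qed
  qed (rule pos)
  have Nset: "set (concat N) = {b + 1..b + int (sum_list \<beta>)}"
  proof
    show "{b + 1..b + int (sum_list \<beta>)} \<subseteq> set (concat N)"
    proof
      fix p assume p: "p \<in> {b + 1..b + int (sum_list \<beta>)}"
      then show "p \<in> set (concat N)" using mem[of p] b unfolding Pset by auto
    qed
  qed (rule Nsub)
  have "P = row_tab a \<alpha>"
  proof (rule tableau_eq_by_rows[OF T(1,2) tableau_row_tab[OF \<alpha>] distinct_row_tab])
    show "set (concat P) = set (concat (row_tab a \<alpha>))" unfolding Pset set_concat_row_tab b ..
    fix p assume p: "p \<in> set (concat P)"
    then have rng: "p \<in> {a + 1..b}" "p \<in> {a + 1..b + int (sum_list \<beta>)}" unfolding Pset by auto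
    then show "row_of P p = row_of (row_tab a \<alpha>) p"
      using eq[OF rng(2)] p unfolding weight_def fst_conv snd_conv set_concat_row_tab P_def b by (simp del: set_concat)
  qed
  moreover have "N = col_tab b \<beta>"
  proof (rule tableau_eq_by_cols[OF T(3,4) tableau_col_tab[OF \<beta>] distinct_col_tab[OF \<beta>]])
    show "set (concat N) = set (concat (col_tab b \<beta>))" unfolding Nset set_concat_col_tab[OF \<beta>] ..
    fix p assume p: "p \<in> set (concat N)"
    then have rng: "b < p" "p \<in> {a + 1..b + int (sum_list \<beta>)}" "p \<notin> set (concat P)" using T(5,6) unfolding Nset by auto
    then show "col_of N p = col_of (col_tab b \<beta>) p"
      using eq[OF rng(2)] unfolding weight_def fst_conv snd_conv set_concat_row_tab P_def N_def b by (simp del: set_concat)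
  qed
  ultimately show "T = ?T0" unfolding P_def N_def by (simp add: prod_eq_iff)
qed

section \<open>The composition attached to a shape\<close>

lemma ex_less_add: "(\<exists>k<m + n. P k) \<longleftrightarrow> (\<exists>k<m. P k) \<or> (\<exists>k<n. P (m + k))" for m n :: nat
proof
  assume "\<exists>k<m + n. P k"
  then obtain k where k: "k < m + n" "P k" by blast
  show "(\<exists>k<m. P k) \<or> (\<exists>k<n. P (m + k))"
  proof (cases "k < m")
    case False
    then have "k - m < n" "P (m + (k - m))" using k by auto
    then show ?thesis by blast
  qed (use k in blast)
next
  show "(\<exists>k<m. P k) \<or> (\<exists>k<n. P (m + k)) \<Longrightarrow> \<exists>k<m + n. P k"
    by (metis nat_add_left_cancel_less trans_less_add1)
qed

lemma in_seg_append_ex: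
  "(\<exists>k<length (xs @ ys). in_seg a (map f (xs @ ys)) k p \<and> in_seg a (map f (xs @ ys)) k q \<and> R ((xs @ ys) ! k)) \<longleftrightarrow>
   (\<exists>k<length xs. in_seg a (map f xs) k p \<and> in_seg a (map f xs) k q \<and> R (xs ! k)) \<or>
   (\<exists>k<length ys. in_seg (a + int (sum_list (map f xs))) (map f ys) k p \<and> in_seg (a + int (sum_list (map f xs))) (map f ys) k q \<and> R (ys ! k))"
proof -
  have 1: "in_seg a (map f (xs @ ys)) k r \<longleftrightarrow> in_seg a (map f xs) k r" if "k < length xs" for k r
    using in_seg_append1[of k "map f xs"] that by simp
  have 2: "in_seg a (map f (xs @ ys)) (length xs + k) r \<longleftrightarrow> in_seg (a + int (sum_list (map f xs))) (map f ys) k r" for k r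
    using in_seg_append2[of a "map f xs"] by simp
  show ?thesis unfolding length_append ex_less_add 2
    using 1 by (simp add: nth_append cong: conj_cong)
qed

text \<open>Segments of a concatenation, found block by block.\<close>

lemma in_seg_concat:
  "(\<exists>k<length (concat cs). in_seg a (map f (concat cs)) k p \<and> in_seg a (map f (concat cs)) k q \<and> R (concat cs ! k)) \<longleftrightarrow>
   (\<exists>i<length cs. \<exists>j<length (cs ! i). in_seg (a + psum (map (\<lambda>c. sum_list (map f c)) cs) i) (map f (cs ! i)) j p \<and>
      in_seg (a + psum (map (\<lambda>c. sum_list (map f c)) cs) i) (map f (cs ! i)) j q \<and> R (cs ! i ! j))"
proof (induction cs arbitrary: a)
  case (Cons c cs)
  have ps: "psum (x # xs) (Suc i) = int x + psum xs i" for x xs i by (simp add: psum_def)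
  show ?case unfolding concat.simps(2) in_seg_append_ex Cons.IH
    by (simp only: list.map(2) length_Cons Ex_less_Suc2 psum_0 ps nth_Cons_0 nth_Cons_Suc add_0_right add.assoc)
qed simp

lemma block_pos_psum: "i < length C \<Longrightarrow> block_pos C i = {psum (map (nat \<circ> abs) C) i + 1..psum (map (nat \<circ> abs) C) i + \<bar>C ! i\<bar>}"
proof -
  have "(\<Sum>j<i. \<bar>C ! j\<bar>) = psum (map (nat \<circ> abs) C) i" if "i \<le> length C" for i
    using that by (induction i) (simp_all add: psum_Suc)
  then show "i < length C \<Longrightarrow> ?thesis" by (simp add: block_pos_def)
qed

lemma block_pos_in_seg: "k < length C \<Longrightarrow> p \<in> block_pos C k \<longleftrightarrow> in_seg 0 (map (nat \<circ> abs) C) k p"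
  by (auto simp: block_pos_psum in_seg_def psum_Suc)

text \<open>
  Rows of the positive part are blocks of type \<open>C\<close>, columns of the negative part are blocks of type \<open>A\<close>. If \<open>d\<close>
  is negative there are only rows and no signs, so all blocks are of type \<open>A\<close>.
\<close>

definition shape_comp :: "int \<Rightarrow> bipartition \<Rightarrow> int list" where
  "shape_comp d L = (if d > 0 then map int (fst L) @ map (\<lambda>k. - int k) (conj_part (snd L)) else map (\<lambda>k. - int k) (fst L))"

definition superstandard_comp :: "int list \<Rightarrow> bipartition list \<Rightarrow> int list" where
  "superstandard_comp D L = concat (map (\<lambda>i. shape_comp (D ! i) (L ! i)) [0..<length D])"

definition block_start :: "int list \<Rightarrow> nat \<Rightarrow> int" where
  "block_start D i = psum (map (nat \<circ> abs) D) i"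

definition superstandard_block :: "int \<Rightarrow> bipartition \<Rightarrow> tableau \<times> tableau" where
  "superstandard_block a L = (row_tab a (fst L), col_tab (a + int (sum_list (fst L))) (snd L))"

definition superstandard :: "int list \<Rightarrow> bipartition list \<Rightarrow> (tableau \<times> tableau) list" where
  "superstandard D L = map (\<lambda>i. superstandard_block (block_start D i) (L ! i)) [0..<length D]"

lemma Bip_D:
  assumes "L \<in> Bip D" "i < length D"
  shows "length L = length D" "int_partition (fst (L ! i))" "int_partition (snd (L ! i))"
    "sum_list (fst (L ! i)) + sum_list (snd (L ! i)) = nat \<bar>D ! i\<bar>" "D ! i < 0 \<Longrightarrow> snd (L ! i) = []"
  using assms by (auto simp: Bip_def)

lemma block_pos_start:
  assumes L: "L \<in> Bip D" and i: "i < length D"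
  shows "block_pos D i = {block_start D i + 1..block_start D i + int (sum_list (fst (L ! i))) + int (sum_list (snd (L ! i)))}"
proof -
  have "int (sum_list (fst (L ! i))) + int (sum_list (snd (L ! i))) = \<bar>D ! i\<bar>"
    using Bip_D(4)[OF L i] by linarith
  then show ?thesis unfolding block_pos_psum[OF i] block_start_def by (simp add: add.assoc)
qed

lemma abs_shape_comp:
  assumes L: "L \<in> Bip D" and D: "0 \<notin> set D" and i: "i < length D"
  shows "map (nat \<circ> abs) (shape_comp (D ! i) (L ! i)) = fst (L ! i) @ conj_part (snd (L ! i))"
proof -
  have m: "map (nat \<circ> abs) (map int xs) = xs" "map (nat \<circ> abs) (map (\<lambda>k. - int k) xs) = xs" for xs
    by (induction xs) auto
  show ?thesis
  proof (cases "0 < D ! i")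
    case True
    then show ?thesis by (simp only: shape_comp_def m map_append if_True)
  next
    case False
    then have "D ! i < 0" using D nth_mem[OF i] by (metis linorder_neqE_linordered_idom)
    then have "conj_part (snd (L ! i)) = []" using Bip_D(5)[OF L i] by (simp add: conj_part_def)
    then show ?thesis using False by (simp only: shape_comp_def m if_False append_Nil2)
  qed
qed

lemma sum_shape_comp:
  assumes L: "L \<in> Bip D" and D: "0 \<notin> set D" and i: "i < length D"
  shows "sum_list (map (nat \<circ> abs) (shape_comp (D ! i) (L ! i))) = nat \<bar>D ! i\<bar>"
  unfolding abs_shape_comp[OF assms] using Bip_D(4)[OF L i] sum_list_conj_part[OF Bip_D(3)[OF L i]] by simp

lemma superstandard_comp_size:
  assumes L: "L \<in> Bip D" and D: "0 \<notin> set D"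
  shows "comp_size (superstandard_comp D L) = comp_size D" "0 \<notin> set (superstandard_comp D L)"
proof -
  have cs: "comp_size C = sum_list (map (nat \<circ> abs) C)" for C by (simp add: comp_size_def comp_def)
  have "sum_list (map (nat \<circ> abs) (concat xss)) = sum_list (map (\<lambda>xs. sum_list (map (nat \<circ> abs) xs)) xss)" for xss :: "int list list"
    by (induction xss) auto
  then have "comp_size (superstandard_comp D L) = (\<Sum>i\<leftarrow>[0..<length D]. sum_list (map (nat \<circ> abs) (shape_comp (D ! i) (L ! i))))"
    unfolding cs superstandard_comp_def by (simp add: comp_def)
  also have "\<dots> = (\<Sum>i\<leftarrow>[0..<length D]. nat \<bar>D ! i\<bar>)"
    using sum_shape_comp[OF L D] by (intro arg_cong[of _ _ sum_list] map_cong) auto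
  also have "\<dots> = comp_size D"
    unfolding comp_size_def by (metis (no_types, lifting) map_nth map_map comp_def map_eq_conv)
  finally show "comp_size (superstandard_comp D L) = comp_size D" .
  have "0 \<notin> set (shape_comp (D ! i) (L ! i))" if i: "i < length D" for i
  proof -
    have "0 \<notin> set (fst (L ! i))" using Bip_D(2)[OF L i] by (simp add: int_partition_def)
    then show ?thesis using conj_part_pos[OF Bip_D(3)[OF L i]] by (auto simp: shape_comp_def)
  qed
  then show "0 \<notin> set (superstandard_comp D L)" unfolding superstandard_comp_def by auto
qed

lemma superstandard_comp_blocks:
  assumes L: "L \<in> Bip D" and D: "0 \<notin> set D"
  shows "(\<exists>k<length (superstandard_comp D L). p \<in> block_pos (superstandard_comp D L) k \<and> q \<in> block_pos (superstandard_comp D L) k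
      \<and> R (superstandard_comp D L ! k)) \<longleftrightarrow>
    (\<exists>i<length D. \<exists>j<length (fst (L ! i) @ conj_part (snd (L ! i))).
      in_seg (block_start D i) (fst (L ! i) @ conj_part (snd (L ! i))) j p \<and>
      in_seg (block_start D i) (fst (L ! i) @ conj_part (snd (L ! i))) j q \<and> R (shape_comp (D ! i) (L ! i) ! j))"
proof -
  let ?cs = "map (\<lambda>i. shape_comp (D ! i) (L ! i)) [0..<length D]"
  have sums: "map (\<lambda>c. sum_list (map (nat \<circ> abs) c)) ?cs = map (nat \<circ> abs) D"
    using sum_shape_comp[OF L D] by (intro nth_equalityI) auto
  have lens: "length (shape_comp (D ! i) (L ! i)) = length (fst (L ! i) @ conj_part (snd (L ! i)))" if "i < length D" for i
    using abs_shape_comp[OF L D that] by (metis length_map)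
  have "(\<exists>k<length (concat ?cs). p \<in> block_pos (concat ?cs) k \<and> q \<in> block_pos (concat ?cs) k \<and> R (concat ?cs ! k)) \<longleftrightarrow>
    (\<exists>k<length (concat ?cs). in_seg 0 (map (nat \<circ> abs) (concat ?cs)) k p \<and> in_seg 0 (map (nat \<circ> abs) (concat ?cs)) k q \<and> R (concat ?cs ! k))"
    using block_pos_in_seg[of _ "concat ?cs"] by (metis (no_types, lifting))
  also have "\<dots> \<longleftrightarrow> (\<exists>i<length ?cs. \<exists>j<length (?cs ! i). in_seg (0 + psum (map (nat \<circ> abs) D) i) (map (nat \<circ> abs) (?cs ! i)) j p \<and>
      in_seg (0 + psum (map (nat \<circ> abs) D) i) (map (nat \<circ> abs) (?cs ! i)) j q \<and> R (?cs ! i ! j))"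
    unfolding in_seg_concat sums ..
  also have "\<dots> \<longleftrightarrow> (\<exists>i<length D. \<exists>j<length (fst (L ! i) @ conj_part (snd (L ! i))).
      in_seg (block_start D i) (fst (L ! i) @ conj_part (snd (L ! i))) j p \<and>
      in_seg (block_start D i) (fst (L ! i) @ conj_part (snd (L ! i))) j q \<and> R (shape_comp (D ! i) (L ! i) ! j))"
  proof -
    have "?cs ! i = shape_comp (D ! i) (L ! i)" if "i < length D" for i using that by simp
    then show ?thesis using abs_shape_comp[OF L D] lens unfolding block_start_def
      by (simp del: map_append length_append cong: conj_cong)
  qed
  finally show ?thesis unfolding superstandard_comp_def .
qed

lemma same_block_superstandard:
  assumes L: "L \<in> Bip D" and D: "0 \<notin> set D"
  shows "same_block (superstandard_comp D L) p q \<longleftrightarrow>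
    (\<exists>i<length D. (\<exists>r<length (fst (L ! i)). in_seg (block_start D i) (fst (L ! i)) r p \<and> in_seg (block_start D i) (fst (L ! i)) r q) \<or>
      (\<exists>c<length (conj_part (snd (L ! i))). in_seg (block_start D i + int (sum_list (fst (L ! i)))) (conj_part (snd (L ! i))) c p \<and>
         in_seg (block_start D i + int (sum_list (fst (L ! i)))) (conj_part (snd (L ! i))) c q))"
proof -
  have 1: "in_seg a (xs @ ys) k r \<longleftrightarrow> in_seg a xs k r" if "k < length xs" for a xs ys k r
    using in_seg_append1[OF that] .
  show ?thesis unfolding same_block_def
    using superstandard_comp_blocks[OF L D, of p q "\<lambda>_. True"]
    unfolding length_append ex_less_add in_seg_append2
    by (simp add: 1 cong: conj_cong)
qed

lemma pos_block_superstandard: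
  assumes L: "L \<in> Bip D" and D: "0 \<notin> set D"
  shows "pos_block (superstandard_comp D L) p \<longleftrightarrow>
    (\<exists>i<length D. 0 < D ! i \<and> p \<in> {block_start D i + 1..block_start D i + int (sum_list (fst (L ! i)))})"
proof -
  have 1: "in_seg a (xs @ ys) k r \<longleftrightarrow> in_seg a xs k r" if "k < length xs" for a xs ys k r
    using in_seg_append1[OF that] .
  have R1: "0 < shape_comp (D ! i) (L ! i) ! j \<longleftrightarrow> 0 < D ! i" if "i < length D" "j < length (fst (L ! i))" for i j
  proof -
    have "0 < fst (L ! i) ! j" using int_partition_nth(1)[OF Bip_D(2)[OF L that(1)] that(2)] .
    then show ?thesis using that(2) by (auto simp: shape_comp_def nth_append)
  qed
  have R2: "\<not> 0 < shape_comp (D ! i) (L ! i) ! (length (fst (L ! i)) + j)" if "i < length D" "j < length (conj_part (snd (L ! i)))" for i j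
  proof (cases "0 < D ! i")
    case True
    then show ?thesis using that(2) by (auto simp: shape_comp_def nth_append)
  next
    case False
    then have "D ! i < 0" using D nth_mem[OF that(1)] by (metis linorder_neqE_linordered_idom)
    then show ?thesis using that(2) Bip_D(5)[OF L that(1)] by (simp add: conj_part_def)
  qed
  have S: "(\<exists>r<length xs. in_seg a xs r p) \<longleftrightarrow> p \<in> {a + 1..a + int (sum_list xs)}" for a xs
    using in_seg_exists[of a p xs "length xs"] in_seg_range[of a xs _ p] by (force simp: psum_length)
  have "pos_block (superstandard_comp D L) p \<longleftrightarrow>
    (\<exists>i<length D. (\<exists>j<length (fst (L ! i)). in_seg (block_start D i) (fst (L ! i)) j p \<and> 0 < D ! i))"
    unfolding pos_block_def
    using superstandard_comp_blocks[OF L D, of p p "\<lambda>x. 0 < x"]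
    unfolding length_append ex_less_add in_seg_append2
    using R1 R2 by (simp add: 1 conj_commute cong: conj_cong)
  also have "\<dots> \<longleftrightarrow> (\<exists>i<length D. 0 < D ! i \<and> (\<exists>j<length (fst (L ! i)). in_seg (block_start D i) (fst (L ! i)) j p))"
    by blast
  finally show ?thesis unfolding S .
qed

lemma in_seg_block:
  assumes L: "L \<in> Bip D" and i: "i < length D"
  shows "r < length (fst (L ! i)) \<Longrightarrow> in_seg (block_start D i) (fst (L ! i)) r p \<Longrightarrow> p \<in> block_pos D i"
    "c < length (conj_part (snd (L ! i))) \<Longrightarrow> in_seg (block_start D i + int (sum_list (fst (L ! i)))) (conj_part (snd (L ! i))) c p \<Longrightarrow> p \<in> block_pos D i"
  unfolding block_pos_start[OF L i]
  using in_seg_range[of "block_start D i" "fst (L ! i)" r p]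
    in_seg_range[of "block_start D i + int (sum_list (fst (L ! i)))" "conj_part (snd (L ! i))" c p]
    sum_list_conj_part[OF Bip_D(3)[OF L i]] by auto

lemma superstandard_comp_in_sub_comps:
  assumes L: "L \<in> Bip D" and D: "0 \<notin> set D"
  shows "superstandard_comp D L \<in> sub_comps D"
proof -
  have "W (superstandard_comp D L) \<subseteq> W D"
  proof (rule W_subsetI[OF superstandard_comp_size(1)[OF L D]])
    show "same_block D p q" if s: "same_block (superstandard_comp D L) p q" for p q
    proof -
      obtain i where i: "i < length D" "p \<in> block_pos D i" "q \<in> block_pos D i"
        using s in_seg_block[OF L] unfolding same_block_superstandard[OF L D] by metis
      then show ?thesis by (auto simp: same_block_def)
    qed
    show "pos_block D p" if s: "pos_block (superstandard_comp D L) p" for p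
    proof -
      obtain i where i: "i < length D" "0 < D ! i" "p \<in> {block_start D i + 1..block_start D i + int (sum_list (fst (L ! i)))}"
        using s unfolding pos_block_superstandard[OF L D] by blast
      have "p \<in> block_pos D i" unfolding block_pos_start[OF L i(1)] using i(3) by auto
      then show ?thesis using i(1,2) by (auto simp: pos_block_def)
    qed
  qed
  then show ?thesis using superstandard_comp_size[OF L D] by (simp add: sub_comps_def signed_composition_def)
qed

lemma superstandard_nth: "i < length D \<Longrightarrow> superstandard D L ! i = superstandard_block (block_start D i) (L ! i)"
  by (simp add: superstandard_def)

lemma superstandard_in_SBT:
  assumes L: "L \<in> Bip D" shows "superstandard D L \<in> SBT D"
proof (rule SBT_I)
  fix i assume i: "i < length D"
  note p = Bip_D[OF L i]
  have "snd (superstandard D L ! i) = []" if "D ! i < 0"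
    using p(5)[OF that] by (simp add: superstandard_nth[OF i] superstandard_block_def col_tab_def)
  moreover have "set (concat (fst (superstandard D L ! i))) = {block_start D i + 1..block_start D i + int (sum_list (fst (L ! i)))}"
    "set (concat (snd (superstandard D L ! i))) = {block_start D i + int (sum_list (fst (L ! i))) + 1..block_start D i + int (sum_list (fst (L ! i))) + int (sum_list (snd (L ! i)))}"
    unfolding superstandard_nth[OF i] superstandard_block_def fst_conv snd_conv set_concat_row_tab set_concat_col_tab[OF p(3)] by auto
  moreover have "{a + 1..a + int x} \<inter> {a + int x + 1..a + int x + int y} = {}"
    "{a + 1..a + int x} \<union> {a + int x + 1..a + int x + int y} = {a + 1..a + int x + int y}" for a x y by auto
  ultimately show "tableau (fst (superstandard D L ! i)) \<and> tableau (snd (superstandard D L ! i)) \<and>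
    distinct (concat (fst (superstandard D L ! i))) \<and> distinct (concat (snd (superstandard D L ! i))) \<and>
    set (concat (fst (superstandard D L ! i))) \<inter> set (concat (snd (superstandard D L ! i))) = {} \<and>
    set (concat (fst (superstandard D L ! i))) \<union> set (concat (snd (superstandard D L ! i))) = block_pos D i \<and>
    (D ! i < 0 \<longrightarrow> snd (superstandard D L ! i) = [])"
    unfolding block_pos_start[OF L i]
    using tableau_row_tab[OF p(2)] tableau_col_tab[OF p(3)] distinct_row_tab distinct_col_tab[OF p(3)]
    by (simp add: superstandard_nth[OF i] superstandard_block_def del: set_concat)
qed (simp add: superstandard_def)

lemma sh_superstandard:
  assumes L: "L \<in> Bip D" shows "sh (superstandard D L) = L"
proof (rule nth_equalityI)
  show "length (sh (superstandard D L)) = length L" using L by (simp add: sh_def superstandard_def Bip_def)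
  fix i assume "i < length (sh (superstandard D L))"
  then have i: "i < length D" by (simp add: sh_def superstandard_def)
  show "sh (superstandard D L) ! i = L ! i"
    using i by (simp add: sh_def superstandard_def superstandard_block_def map_length_row_tab map_length_col_tab)
qed

lemma compatible_superstandard:
  assumes L: "L \<in> Bip D" and D: "0 \<notin> set D"
  shows "compatible D (superstandard_comp D L) (superstandard D L)"
  unfolding compatible_def
proof (intro allI impI ballI conjI)
  fix i p assume i: "i < length D" and p: "p \<in> block_pos D i"
  let ?a = "block_start D i" and ?\<alpha> = "fst (L ! i)" and ?\<beta> = "snd (L ! i)"
  let ?b = "?a + int (sum_list ?\<alpha>)"
  note B = Bip_D[OF L i]
  have T: "superstandard D L ! i = (row_tab ?a ?\<alpha>, col_tab ?b ?\<beta>)"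
    by (simp add: superstandard_nth[OF i] superstandard_block_def)
  show "ascent_at (superstandard D L ! i) p" if s: "same_block (superstandard_comp D L) p (p + 1)"
  proof -
    obtain i' where i': "i' < length D" "(\<exists>r<length (fst (L ! i')). in_seg (block_start D i') (fst (L ! i')) r p \<and> in_seg (block_start D i') (fst (L ! i')) r (p + 1)) \<or>
      (\<exists>c<length (conj_part (snd (L ! i'))). in_seg (block_start D i' + int (sum_list (fst (L ! i')))) (conj_part (snd (L ! i'))) c p \<and>
         in_seg (block_start D i' + int (sum_list (fst (L ! i')))) (conj_part (snd (L ! i'))) c (p + 1))"
      using s unfolding same_block_superstandard[OF L D] by blast
    then have "p \<in> block_pos D i'" using in_seg_block[OF L i'(1)] by blast
    then have [simp]: "i' = i" using block_pos_unique p by blast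
    from i'(2) show ?thesis
    proof (elim disjE exE conjE)
      fix r assume "r < length (fst (L ! i'))" "in_seg (block_start D i') (fst (L ! i')) r p" "in_seg (block_start D i') (fst (L ! i')) r (p + 1)"
      then have r: "r < length ?\<alpha>" "in_seg ?a ?\<alpha> r p" "in_seg ?a ?\<alpha> r (p + 1)" by auto
      show ?thesis unfolding ascent_at_def T fst_conv snd_conv set_concat_row_tab
        using row_of_row_tab[OF r(1,2)] row_of_row_tab[OF r(1,3)] in_seg_range[OF r(2,1)] in_seg_range[OF r(3,1)] by simp
    next
      fix c assume "c < length (conj_part (snd (L ! i')))" "in_seg (block_start D i' + int (sum_list (fst (L ! i')))) (conj_part (snd (L ! i'))) c p"
        "in_seg (block_start D i' + int (sum_list (fst (L ! i')))) (conj_part (snd (L ! i'))) c (p + 1)"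
      then have c: "c < length (conj_part ?\<beta>)" "in_seg ?b (conj_part ?\<beta>) c p" "in_seg ?b (conj_part ?\<beta>) c (p + 1)" by auto
      have "row_of (col_tab ?b ?\<beta>) p < row_of (col_tab ?b ?\<beta>) (p + 1)"
        using col_of_col_tab(2)[OF B(3) c(1,2)] col_of_col_tab(2)[OF B(3) c(1,3)] by auto
      then show ?thesis unfolding ascent_at_def T fst_conv snd_conv set_concat_row_tab
        using in_seg_range[OF c(2,1)] by simp
    qed
  qed
  show "p \<in> set (concat (fst (superstandard D L ! i)))" if s: "pos_block (superstandard_comp D L) p"
  proof -
    obtain i' where i': "i' < length D" "p \<in> {block_start D i' + 1..block_start D i' + int (sum_list (fst (L ! i')))}"
      using s unfolding pos_block_superstandard[OF L D] by blast
    then have "p \<in> block_pos D i'" unfolding block_pos_start[OF L i'(1)] by auto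
    then have "i' = i" using block_pos_unique p by blast
    then show ?thesis using i'(2) unfolding T fst_conv set_concat_row_tab by simp
  qed
qed

text \<open>
  The size of \<open>D\<close> bounds the number of entries in each of its blocks, as \<open>weight_le_superstandard\<close> requires of \<open>B\<close>.
\<close>

definition total_weight :: "int list \<Rightarrow> bipartition list \<Rightarrow> nat" where
  "total_weight D L = (\<Sum>i<length D. shape_weight (comp_size D) (L ! i))"

lemma sum_weight_SBT:
  assumes Q: "Q \<in> SBT D"
  shows "(\<Sum>i<length D. \<Sum>p\<in>block_pos D i. weight (comp_size D) (Q ! i) p) = total_weight D (sh Q)"
  unfolding total_weight_def
proof (intro sum.cong refl)
  fix i assume "i \<in> {..<length D}"
  then have i: "i < length D" by simp
  note q = SBT_D[OF Q i]
  have "sh Q ! i = map_prod (map length) (map length) (Q ! i)" using i q(1) by (simp add: sh_def)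
  then show "(\<Sum>p\<in>block_pos D i. weight (comp_size D) (Q ! i) p) = shape_weight (comp_size D) (sh Q ! i)"
    using sum_weight[OF q(2,4,3,5,6), of "comp_size D"] unfolding q(7) by simp
qed

text \<open>
  The bound holds entry by entry in every block of \<open>D\<close>, and the sum of weights depends on the shape only.
\<close>

lemma compatible_weight:
  assumes L: "L \<in> Bip D" and D: "0 \<notin> set D" and Q: "Q \<in> SBT D" and c: "compatible D (superstandard_comp D L) Q"
  shows "Q = superstandard D L \<or> total_weight D (sh Q) < total_weight D L"
proof -
  let ?B = "comp_size D"
  have blk: "(\<forall>p\<in>block_pos D i. weight ?B (Q ! i) p \<le> weight ?B (superstandard D L ! i) p) \<and>
      ((\<forall>p\<in>block_pos D i. weight ?B (Q ! i) p = weight ?B (superstandard D L ! i) p) \<longrightarrow> Q ! i = superstandard D L ! i)"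
    if i: "i < length D" for i
  proof -
    let ?a = "block_start D i" and ?\<alpha> = "fst (L ! i)" and ?\<beta> = "snd (L ! i)"
    let ?b = "?a + int (sum_list ?\<alpha>)"
    note B = Bip_D[OF L i] and q = SBT_D[OF Q i] and bp = block_pos_start[OF L i]
    have T: "superstandard D L ! i = (row_tab ?a ?\<alpha>, col_tab ?b ?\<beta>)"
      by (simp add: superstandard_nth[OF i] superstandard_block_def)
    have pos: "{?a + 1..?b} \<subseteq> set (concat (fst (Q ! i)))"
    proof
      fix p assume p: "p \<in> {?a + 1..?b}"
      have pb: "p \<in> block_pos D i" using p unfolding bp by auto
      show "p \<in> set (concat (fst (Q ! i)))"
      proof (cases "0 < D ! i")
        case True
        then have "pos_block (superstandard_comp D L) p" using i p unfolding pos_block_superstandard[OF L D] by blast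
        then show ?thesis using c i pb unfolding compatible_def by blast
      next
        case False
        then have "D ! i < 0" using D nth_mem[OF i] by (metis linorder_neqE_linordered_idom)
        then show ?thesis using q(7,8) pb by auto
      qed
    qed
    have rows: "ascent_at (Q ! i) p" if "r < length ?\<alpha>" "in_seg ?a ?\<alpha> r p" "in_seg ?a ?\<alpha> r (p + 1)" for r p
    proof -
      have "same_block (superstandard_comp D L) p (p + 1)" using that i unfolding same_block_superstandard[OF L D] by blast
      then show ?thesis using c i in_seg_block(1)[OF L i that(1,2)] unfolding compatible_def by blast
    qed
    have cols: "ascent_at (Q ! i) p" if "k < length (conj_part ?\<beta>)" "in_seg ?b (conj_part ?\<beta>) k p" "in_seg ?b (conj_part ?\<beta>) k (p + 1)" for k p
    proof -
      have "same_block (superstandard_comp D L) p (p + 1)" using that i unfolding same_block_superstandard[OF L D] by blast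
      then show ?thesis using c i in_seg_block(2)[OF L i that(1,2)] unfolding compatible_def by blast
    qed
    have bound: "sum_list ?\<alpha> + sum_list ?\<beta> \<le> ?B"
    proof -
      have "D ! i \<in> set D" using i by simp
      then have "nat \<bar>D ! i\<bar> \<le> ?B" unfolding comp_size_def by (intro member_le_sum_list) auto
      then show ?thesis using B(4) by simp
    qed
    note main = weight_le_superstandard[OF B(2,3) refl q(2,4,3,5,6) q(7)[unfolded bp] pos rows cols bound]
    show ?thesis unfolding T bp
      by (intro conjI ballI impI main(1) main(2)) (simp_all)
  qed
  have le: "(\<Sum>p\<in>block_pos D i. weight ?B (Q ! i) p) \<le> (\<Sum>p\<in>block_pos D i. weight ?B (superstandard D L ! i) p)" if "i < length D" for i
    using blk[OF that] by (intro sum_mono) blast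
  show ?thesis
  proof (cases "Q = superstandard D L")
    case False
    have "\<exists>i<length D. Q ! i \<noteq> superstandard D L ! i"
    proof (rule ccontr)
      assume eq: "\<not> ?thesis"
      have "length Q = length D" using Q by (simp add: SBT_def)
      then have "Q = superstandard D L" using eq by (intro nth_equalityI) (auto simp: superstandard_def)
      then show False using False by blast
    qed
    then obtain i where i: "i < length D" "Q ! i \<noteq> superstandard D L ! i" by blast
    have "(\<Sum>p\<in>block_pos D i. weight ?B (Q ! i) p) < (\<Sum>p\<in>block_pos D i. weight ?B (superstandard D L ! i) p)"
      using blk[OF i(1)] i(2) by (intro sum_strict_mono_ex1) (auto simp: order_less_le)
    then have "(\<Sum>i<length D. \<Sum>p\<in>block_pos D i. weight ?B (Q ! i) p) <
        (\<Sum>i<length D. \<Sum>p\<in>block_pos D i. weight ?B (superstandard D L ! i) p)"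
      using le i(1) by (intro sum_strict_mono_ex1) auto
    then show ?thesis
      unfolding sum_weight_SBT[OF Q] sum_weight_SBT[OF superstandard_in_SBT[OF L]] sh_superstandard[OF L] by simp
  qed simp
qed

lemma sh_in_Bip:
  assumes Q: "Q \<in> SBT D" shows "sh Q \<in> Bip D"
  unfolding Bip_def
proof (intro CollectI conjI allI impI)
  show "length (sh Q) = length D" using Q by (simp add: sh_def SBT_def)
  fix i assume i: "i < length D"
  note q = SBT_D[OF Q i]
  have s: "sh Q ! i = (map length (fst (Q ! i)), map length (snd (Q ! i)))"
    using i q(1) by (cases "Q ! i") (simp add: sh_def)
  show "int_partition (fst (sh Q ! i))" "int_partition (snd (sh Q ! i))" using q(2,3) by (simp_all add: s tableau_def)
  show "snd (sh Q ! i) = []" if "D ! i < 0" using q(8)[OF that] by (simp add: s)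
  have "sum_list (fst (sh Q ! i)) + sum_list (snd (sh Q ! i)) = card (set (concat (fst (Q ! i))) \<union> set (concat (snd (Q ! i))))"
    using q(6) distinct_card[OF q(4)] distinct_card[OF q(5)] by (simp add: card_Un_disjoint s length_concat del: set_concat)
  also have "\<dots> = nat \<bar>D ! i\<bar>" unfolding q(7) block_pos_psum[OF i] by simp
  finally show "sum_list (fst (sh Q ! i)) + sum_list (snd (sh Q ! i)) = nat \<bar>D ! i\<bar>" .
qed

lemma Bip_eq: "Bip D = sh ` SBT D"
  using sh_in_Bip sh_superstandard superstandard_in_SBT by (metis (no_types, opaque_lifting) image_eqI subsetI subset_antisym image_subsetI)

lemma finite_Bip: "finite (Bip D)"
  unfolding Bip_eq using finite_SBT by blast

section \<open>The trace form\<close>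

lemma zscale_eq_qscale: "zscale c f = qscale (of_int c) f"
  by (simp add: zscale_def qscale_def)

lemma (in Modules.module) span_image_expand:
  assumes fin: "finite A" and x: "x \<in> span (f ` A)"
  shows "\<exists>a. x = (\<Sum>i\<in>A. scale (a i) (f i))"
proof -
  have "subspace {x. \<exists>a. x = (\<Sum>i\<in>A. scale (a i) (f i))}"
    unfolding subspace_def
  proof (intro conjI ballI allI)
    show "0 \<in> {x. \<exists>a. x = (\<Sum>i\<in>A. scale (a i) (f i))}" by (intro CollectI exI[of _ "\<lambda>_. 0"]) simp
  next
    fix x y assume "x \<in> {x. \<exists>a. x = (\<Sum>i\<in>A. scale (a i) (f i))}" "y \<in> {x. \<exists>a. x = (\<Sum>i\<in>A. scale (a i) (f i))}"
    then obtain a b where "x = (\<Sum>i\<in>A. scale (a i) (f i))" "y = (\<Sum>i\<in>A. scale (b i) (f i))" by blast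
    then show "x + y \<in> {x. \<exists>a. x = (\<Sum>i\<in>A. scale (a i) (f i))}"
      by (intro CollectI exI[of _ "\<lambda>i. a i + b i"]) (simp add: scale_left_distrib sum.distrib)
  next
    fix c x assume "x \<in> {x. \<exists>a. x = (\<Sum>i\<in>A. scale (a i) (f i))}"
    then obtain a where "x = (\<Sum>i\<in>A. scale (a i) (f i))" by blast
    then show "scale c x \<in> {x. \<exists>a. x = (\<Sum>i\<in>A. scale (a i) (f i))}"
      by (intro CollectI exI[of _ "\<lambda>i. c * a i"]) (simp add: scale_sum_right)
  qed
  moreover have "f ` A \<subseteq> {x. \<exists>a. x = (\<Sum>i\<in>A. scale (a i) (f i))}"
  proof (intro image_subsetI CollectI)
    fix i assume i: "i \<in> A"
    have "(\<Sum>j\<in>A. scale (if j = i then 1 else 0) (f j)) = (\<Sum>j\<in>A. if j = i then f j else 0)"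
      by (intro sum.cong) auto
    also have "\<dots> = f i" using fin i by simp
    finally show "\<exists>a. f i = (\<Sum>j\<in>A. scale (a j) (f j))"
      by (intro exI[of _ "\<lambda>j. if j = i then 1 else 0"]) (rule sym)
  qed
  ultimately show ?thesis using span_minimal x by blast
qed

lemma sum_indicator_card:
  assumes "finite A" shows "(\<Sum>x\<in>A. indicator B x) = (of_nat (card (A \<inter> B)) :: 'b::semiring_1)"
  using assms by (simp add: indicator_def sum.If_cases Int_def)

text \<open>\<open>\<tau>(x y)\<close> written out, see \<open>tau_alg_mult\<close>.\<close>

definition tau_form :: "int list \<Rightarrow> ((int \<Rightarrow> int) \<Rightarrow> rat) \<Rightarrow> ((int \<Rightarrow> int) \<Rightarrow> rat) \<Rightarrow> rat" where
  "tau_form D x y = (\<Sum>u\<in>W D. x u * y (perm_inv u))"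

lemma tau_alg_mult: "tau (alg_mult D x y) = tau_form D x y"
  unfolding tau_def alg_mult_def tau_form_def
proof (rule sum.cong[OF refl])
  fix u assume u: "u \<in> W D"
  have "(u \<circ> v = id) = (v = perm_inv u)" for v
  proof
    assume "u \<circ> v = id"
    then have "perm_inv u (u (v x)) = perm_inv u x" for x by (metis comp_apply id_apply)
    then show "v = perm_inv u" using hyperoct_inv_simps(2)[OF W_hyperoct[OF u]] by fastforce
  next
    assume "v = perm_inv u"
    then show "u \<circ> v = id" using hyperoct_inv_simps(1)[OF W_hyperoct[OF u]] by fastforce
  qed
  then have "(\<Sum>v\<in>W D. if u \<circ> v = id then x u * y v else 0) = (\<Sum>v\<in>W D. if v = perm_inv u then x u * y v else 0)"
    by simp
  also have "\<dots> = x u * y (perm_inv u)" using finite_W W_inv[OF u] by simp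
  finally show "(\<Sum>v\<in>W D. if u \<circ> v = id then x u * y v else 0) = x u * y (perm_inv u)" .
qed

lemma tau_form_commute: "tau_form D x y = tau_form D y x"
  unfolding tau_form_def
  by (rule sum.reindex_bij_witness[of _ perm_inv perm_inv])
     (auto simp: W_inv hyperoct_inv_simps(5)[OF W_hyperoct])

lemma tau_form_sum_left: "tau_form D (\<Sum>i\<in>A. qscale (r i) (f i)) y = (\<Sum>i\<in>A. r i * tau_form D (f i) y)"
  unfolding tau_form_def sum_fun_apply sum_distrib_right sum_distrib_left qscale_def of_rat_eq_id id_apply
  by (subst sum.swap) (simp add: mult.assoc)

lemma tau_form_sum_right: "tau_form D y (\<Sum>i\<in>A. qscale (r i) (f i)) = (\<Sum>i\<in>A. r i * tau_form D y (f i))"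
  unfolding tau_form_commute[of D y] by (rule tau_form_sum_left)

lemma tau_form_add_left: "tau_form D (x + x') y = tau_form D x y + tau_form D x' y"
  by (simp add: tau_form_def algebra_simps sum.distrib)

lemma tau_form_add_right: "tau_form D y (x + x') = tau_form D y x + tau_form D y x'"
  unfolding tau_form_commute[of D y] by (rule tau_form_add_left)

lemma tau_form_diff_left: "tau_form D (x - x') y = tau_form D x y - tau_form D x' y"
  by (simp add: tau_form_def algebra_simps sum_subtractf)

lemma tau_form_zero_left [simp]: "tau_form D 0 y = 0"
  by (simp add: tau_form_def)

lemma tau_form_z_elt:
  assumes "Q \<in> SBT D" "Q' \<in> SBT D"
  shows "tau_form D (z_elt D Q) (z_elt D Q') = (if sh Q = sh Q' then 1 else 0)"
proof -
  have "tau_form D (z_elt D Q) (z_elt D Q') = (\<Sum>u\<in>W D. if rs_Q D u = Q \<and> rs_Q D (perm_inv u) = Q' then 1 else 0)"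
    unfolding tau_form_def z_elt_def using W_inv by (intro sum.cong refl) (auto simp: indicator_def)
  also have "\<dots> = of_nat (card {w \<in> W D. rs_Q D w = Q \<and> rs_Q D (perm_inv w) = Q'})"
    using finite_W by (simp flip: sum.inter_filter)
  finally show ?thesis unfolding card_rs_Q_pair[OF assms] by simp
qed

lemma finite_sub_comps: "finite (sub_comps D)"
proof -
  let ?n = "comp_size D"
  have "sub_comps D \<subseteq> {C. set C \<subseteq> {- int ?n..int ?n} \<and> length C \<le> ?n}"
  proof
    fix C assume "C \<in> sub_comps D"
    then have C: "0 \<notin> set C" "comp_size C = ?n" by (auto simp: sub_comps_def signed_composition_def)
    have "nat \<bar>c\<bar> \<le> ?n" if "c \<in> set C" for c
      using member_le_sum_list[of "nat \<bar>c\<bar>" "map (\<lambda>c. nat \<bar>c\<bar>) C"] that C(2) by (auto simp: comp_size_def)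
    then have "set C \<subseteq> {- int ?n..int ?n}" by fastforce
    moreover have "(\<Sum>c\<leftarrow>C. 1) \<le> (\<Sum>c\<leftarrow>C. nat \<bar>c\<bar>)"
      using C(1) by (intro sum_list_mono) (metis One_nat_def Suc_leI zero_less_nat_eq zero_less_abs_iff)
    ultimately show "C \<in> {C. set C \<subseteq> {- int ?n..int ?n} \<and> length C \<le> ?n}"
      using C(2) by (simp add: sum_list_triv comp_size_def)
  qed
  then show ?thesis using finite_lists_length_le[of "{- int ?n..int ?n}" ?n] finite_subset by blast
qed

lemma sub_compsD: "C \<in> sub_comps D \<Longrightarrow> W C \<subseteq> W D" "C \<in> sub_comps D \<Longrightarrow> comp_size C = comp_size D"
  by (auto simp: sub_comps_def signed_composition_def)

section \<open>The isometry theta\<close>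

definition ind_triv :: "int list \<Rightarrow> int list \<Rightarrow> (int \<Rightarrow> int) \<Rightarrow> complex" where
  "ind_triv D C = induced (W_group D) (W C) (\<lambda>_. 1)"

lemma carrier_W_group: "carrier (W_group D) = W D" by (simp add: W_group_def)

lemma finite_W_group: "finite (carrier (W_group D))"
  unfolding carrier_W_group by (rule finite_W)

text \<open>
  The left side is the number of representatives of double cosets; the right side is the same number by
  orbit counting.
\<close>

lemma tau_form_x_elt:
  assumes C: "C \<in> sub_comps D" and C': "C' \<in> sub_comps D"
  shows "of_rat (tau_form D (x_elt D C) (x_elt D C')) = avg_form (W_group D) (ind_triv D C) (ind_triv D C')"
proof -
  note s = sub_compsD[OF C] and s' = sub_compsD[OF C']
  let ?R = "{r \<in> W D. r \<in> X C \<and> perm_inv r \<in> X C'}"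
  have pos: "card (W C) \<noteq> 0" "card (W C') \<noteq> 0" using finite_W W_id by (auto simp: card_eq_0_iff)
  have "tau_form D (x_elt D C) (x_elt D C') = (\<Sum>u\<in>W D. if u \<in> X C \<and> perm_inv u \<in> X C' then 1 else 0)"
    unfolding tau_form_def x_elt_def using W_inv by (intro sum.cong refl) (auto simp: indicator_def)
  also have "\<dots> = of_nat (card ?R)"
    using finite_W by (simp flip: sum.inter_filter)
  finally have l: "tau_form D (x_elt D C) (x_elt D C') = of_nat (card ?R)" .
  have "avg_form (W_group D) (ind_triv D C) (ind_triv D C') =
      of_nat (\<Sum>w\<in>W D. card {(a, b) \<in> W C' \<times> W C. a \<circ> w \<circ> b = w}) / (of_nat (card (W C)) * of_nat (card (W C')))"
    unfolding ind_triv_def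
    using avg_form_induced_trivial[OF group_W_group finite_W_group subgroup_W[OF s(1)] subgroup_W[OF s'(1)]]
    by (simp add: W_group_def)
  also have "\<dots> = of_nat (card ?R)"
    unfolding sum_stabilizers_double_cosets[OF s s'] using pos by simp
  finally show ?thesis unfolding l by simp
qed

definition x_comb :: "int list \<Rightarrow> (int list \<Rightarrow> rat) \<Rightarrow> (int \<Rightarrow> int) \<Rightarrow> rat" where
  "x_comb D a = (\<Sum>C\<in>sub_comps D. qscale (a C) (x_elt D C))"

definition ind_comb :: "int list \<Rightarrow> (int list \<Rightarrow> rat) \<Rightarrow> (int \<Rightarrow> int) \<Rightarrow> complex" where
  "ind_comb D a = (\<Sum>C\<in>sub_comps D. qscale (a C) (ind_triv D C))"

lemma tau_form_x_comb: "of_rat (tau_form D (x_comb D a) (x_comb D b)) = avg_form (W_group D) (ind_comb D a) (ind_comb D b)"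
  unfolding x_comb_def ind_comb_def tau_form_sum_left tau_form_sum_right avg_form_sum_left avg_form_sum_right
  by (simp add: of_rat_sum of_rat_mult tau_form_x_elt)

lemma ind_triv_in_span: "C \<in> sub_comps D \<Longrightarrow> ind_triv D C \<in> ZM.span (irr_chars (W_group D))"
  unfolding ind_triv_def using induced_trivial_in_span_irr[OF group_W_group finite_W_group subgroup_W] sub_compsD(1) by blast

lemma ind_comb_in_span: "ind_comb D a \<in> QM.span (irr_chars (W_group D))"
  unfolding ind_comb_def
  using ind_triv_in_span ZM_span_subset_QM_span by (intro QM.span_sum QM.span_scale) blast

text \<open>In the coordinates on irreducible characters the form is a sum of squares of rationals.\<close>

lemma avg_form_definite:
  assumes G: "group G" "finite (carrier G)" and \<phi>: "\<phi> \<in> QM.span (irr_chars G)" and z: "avg_form G \<phi> \<phi> = 0"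
  shows "\<phi> = 0"
proof -
  let ?r = "QM.representation (irr_chars G) \<phi>"
  have "of_rat (char_inner G \<phi> \<phi>) = (0 :: complex)" using char_inner_eq_avg_form[OF G \<phi> \<phi>] z by simp
  then have "(\<Sum>\<chi>\<in>irr_chars G. ?r \<chi> * ?r \<chi>) = 0" by (simp add: char_inner_def)
  then have "\<forall>\<chi>\<in>irr_chars G. ?r \<chi> * ?r \<chi> = 0"
    using sum_nonneg_eq_0_iff[OF finite_irr_chars[OF G], of "\<lambda>\<chi>. ?r \<chi> * ?r \<chi>"] by simp
  then have "?r \<chi> = 0" if "\<chi> \<in> irr_chars G" for \<chi> using that by simp
  then have "(\<Sum>\<chi>\<in>irr_chars G. qscale (?r \<chi>) \<chi>) = 0" by (intro sum.neutral ballI) simp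
  then show ?thesis using span_irr_expand[OF G \<phi>] by simp
qed

lemma x_comb_diff: "x_comb D (\<lambda>C. a C - b C) = x_comb D a - x_comb D b"
  unfolding x_comb_def by (simp add: QM.scale_left_diff_distrib sum_subtractf)

lemma ind_comb_diff: "ind_comb D (\<lambda>C. a C - b C) = ind_comb D a - ind_comb D b"
  unfolding ind_comb_def by (simp add: QM.scale_left_diff_distrib sum_subtractf)

text \<open>
  The image of a relation between the \<open>x_elt D C\<close> has scalar product \<open>0\<close> with itself.
\<close>

lemma theta_x_comb: "theta D (x_comb D a) = ind_comb D a"
  unfolding theta_def
proof (rule the_equality)
  show "\<exists>b. x_comb D a = (\<Sum>C\<in>sub_comps D. qscale (b C) (x_elt D C)) \<and>
      ind_comb D a = (\<Sum>C\<in>sub_comps D. qscale (b C) (induced (W_group D) (W C) (\<lambda>_. 1)))"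
    by (intro exI[of _ a]) (simp add: x_comb_def ind_comb_def ind_triv_def)
  fix \<phi> assume "\<exists>b. x_comb D a = (\<Sum>C\<in>sub_comps D. qscale (b C) (x_elt D C)) \<and>
      \<phi> = (\<Sum>C\<in>sub_comps D. qscale (b C) (induced (W_group D) (W C) (\<lambda>_. 1)))"
  then obtain b where b: "x_comb D a = x_comb D b" "\<phi> = ind_comb D b"
    unfolding ind_comb_def ind_triv_def x_comb_def by blast
  have "avg_form (W_group D) (ind_comb D (\<lambda>C. b C - a C)) (ind_comb D (\<lambda>C. b C - a C)) = 0"
    unfolding tau_form_x_comb[symmetric] x_comb_diff b(1) by simp
  then have "ind_comb D (\<lambda>C. b C - a C) = 0"
    by (rule avg_form_definite[OF group_W_group finite_W_group ind_comb_in_span])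
  then show "\<phi> = ind_comb D a" unfolding ind_comb_diff b(2) by simp
qed

lemma QSigma'_expand: "x \<in> QSigma' D \<Longrightarrow> \<exists>a. x = x_comb D a"
  unfolding QSigma'_def x_comb_def by (rule QM.span_image_expand[OF finite_sub_comps])

lemma Sigma'_subset_QSigma': "Sigma' D \<subseteq> QSigma' D"
  unfolding Sigma'_def QSigma'_def by (rule ZM_span_subset_QM_span)

lemma theta_isometry:
  assumes "x \<in> QSigma' D" "y \<in> QSigma' D"
  shows "of_rat (tau_form D x y) = avg_form (W_group D) (theta D x) (theta D y)"
  using QSigma'_expand[OF assms(1)] QSigma'_expand[OF assms(2)] tau_form_x_comb theta_x_comb by metis

lemma theta_add:
  assumes "x \<in> QSigma' D" "y \<in> QSigma' D" shows "theta D (x + y) = theta D x + theta D y"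
proof -
  obtain a b where ab: "x = x_comb D a" "y = x_comb D b" using QSigma'_expand assms by metis
  have "x_comb D a + x_comb D b = x_comb D (\<lambda>C. a C + b C)"
    unfolding x_comb_def by (simp add: QM.scale_left_distrib sum.distrib)
  moreover have "ind_comb D a + ind_comb D b = ind_comb D (\<lambda>C. a C + b C)"
    unfolding ind_comb_def by (simp add: QM.scale_left_distrib sum.distrib)
  ultimately show ?thesis unfolding ab theta_x_comb by (simp add: theta_x_comb)
qed

lemma theta_diff:
  assumes "x \<in> QSigma' D" "y \<in> QSigma' D" shows "theta D (x - y) = theta D x - theta D y"
proof -
  have "x - y \<in> QSigma' D" using assms unfolding QSigma'_def by (rule QM.span_diff)
  from theta_add[OF this assms(2)] show ?thesis by simp
qed

lemma theta_in_span: "x \<in> QSigma' D \<Longrightarrow> theta D x \<in> QM.span (irr_chars (W_group D))"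
  using QSigma'_expand theta_x_comb ind_comb_in_span by metis

lemma theta_virtual:
  assumes "x \<in> Sigma' D" shows "theta D x \<in> virtual_chars (W_group D)"
proof -
  obtain a where a: "x = (\<Sum>C\<in>sub_comps D. zscale (a C) (x_elt D C))"
    using ZM.span_image_expand[OF finite_sub_comps assms[unfolded Sigma'_def]] by blast
  then have "x = x_comb D (\<lambda>C. of_int (a C))" by (simp add: x_comb_def zscale_eq_qscale)
  then have "theta D x = (\<Sum>C\<in>sub_comps D. zscale (a C) (ind_triv D C))"
    using theta_x_comb by (simp add: ind_comb_def zscale_eq_qscale)
  then show ?thesis unfolding virtual_chars_def
    using ind_triv_in_span by (simp add: ZM.span_sum ZM.span_scale)
qed

text \<open>Both sides are the index of \<open>W C\<close> in \<open>W D\<close>.\<close>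

lemma ind_triv_id:
  assumes C: "C \<in> sub_comps D" shows "ind_triv D C id = of_rat (aug D (x_elt D C))"
proof -
  note s = sub_compsD[OF C]
  have pos: "card (W C) \<noteq> 0" using finite_W W_id by (auto simp: card_eq_0_iff)
  have "{x \<in> W D. inv\<^bsub>W_group D\<^esub> x \<otimes>\<^bsub>W_group D\<^esub> id \<otimes>\<^bsub>W_group D\<^esub> x \<in> W C} = W D"
  proof -
    have "inv\<^bsub>W_group D\<^esub> x \<otimes>\<^bsub>W_group D\<^esub> id \<otimes>\<^bsub>W_group D\<^esub> x = id" if "x \<in> W D" for x
      using that group.l_inv[OF group_W_group, of x D] by (simp add: W_group_def)
    then show ?thesis using W_id by auto
  qed
  then have "ind_triv D C id = of_nat (card (W D)) / of_nat (card (W C))"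
    unfolding ind_triv_def induced_def carrier_W_group using W_id by simp
  also have "\<dots> = of_nat (card (X C \<inter> W D))"
    using card_X_times_card_W[OF s] pos by (metis nonzero_mult_div_cancel_right of_nat_eq_0_iff of_nat_mult)
  also have "card (X C \<inter> W D) = card (W D \<inter> (X C \<inter> W D))" by (rule arg_cong[of _ _ card]) blast
  finally have "ind_triv D C id = of_nat (card (W D \<inter> (X C \<inter> W D)))" .
  moreover have "aug D (x_elt D C) = of_nat (card (W D \<inter> (X C \<inter> W D)))"
    unfolding aug_def x_elt_def by (rule sum_indicator_card[OF finite_W])
  ultimately show ?thesis by simp
qed

lemma theta_id:
  assumes "x \<in> QSigma' D" shows "theta D x id = of_rat (aug D x)"
proof -
  obtain a where a: "x = x_comb D a" using QSigma'_expand[OF assms] by blast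
  have "aug D x = (\<Sum>C\<in>sub_comps D. a C * aug D (x_elt D C))"
    unfolding a aug_def x_comb_def sum_fun_apply qscale_def of_rat_eq_id id_apply sum_distrib_left by (rule sum.swap)
  moreover have "theta D x id = (\<Sum>C\<in>sub_comps D. of_rat (a C) * ind_triv D C id)"
    unfolding a theta_x_comb ind_comb_def sum_fun_apply qscale_def ..
  ultimately show ?thesis using ind_triv_id by (simp add: of_rat_sum of_rat_mult)
qed

section \<open>The coplactic space\<close>

lemma z_elt_in_span: "Q \<in> SBT D \<Longrightarrow> z_elt D Q \<in> ZM.span (z_elt D ` SBT D)"
  by (intro ZM.span_base) simp

lemma Sigma'_subset_coplactic: "Sigma' D \<subseteq> coplactic D"
  unfolding Sigma'_def coplactic_def
proof (intro ZM.span_minimal ZM.subspace_span image_subsetI)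
  fix C assume C: "C \<in> sub_comps D"
  show "x_elt D C \<in> ZM.span (z_elt D ` SBT D)"
    unfolding x_elt_eq_sum_z_elt[OF sub_compsD[OF C]] by (intro ZM.span_sum z_elt_in_span) simp
qed

lemma coplactic_perp_subset_coplactic: "coplactic_perp D \<subseteq> coplactic D"
  unfolding coplactic_perp_def coplactic_def
  by (intro ZM.span_minimal ZM.subspace_span) (auto intro!: ZM.span_diff z_elt_in_span)

definition perp_gens :: "int list \<Rightarrow> ((int \<Rightarrow> int) \<Rightarrow> rat) set" where
  "perp_gens D = {z_elt D T - z_elt D T' | T T'. T \<in> SBT D \<and> T' \<in> SBT D \<and> sh T = sh T'}"

text \<open>
  Triangularity: modulo \<open>perp_gens\<close> the tableau \<open>Q\<close> may be replaced by the superstandard one of its shape, which differs from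
  an \<open>x_elt D C\<close> by tableaux of smaller total weight.
\<close>

lemma z_elt_in_span_union:
  assumes D: "0 \<notin> set D" and Q: "Q \<in> SBT D"
  shows "z_elt D Q \<in> ZM.span (x_elt D ` sub_comps D \<union> perp_gens D)"
  using Q
proof (induction "total_weight D (sh Q)" arbitrary: Q rule: less_induct)
  case less
  define L where "L = sh Q"
  have L: "L \<in> Bip D" unfolding L_def by (rule sh_in_Bip[OF less.prems])
  define C where "C = superstandard_comp D L"
  define Q0 where "Q0 = superstandard D L"
  let ?M = "ZM.span (x_elt D ` sub_comps D \<union> perp_gens D)"
  let ?A = "{Q \<in> SBT D. compatible D C Q}"
  have C: "C \<in> sub_comps D" unfolding C_def by (rule superstandard_comp_in_sub_comps[OF L D])
  have Q0: "Q0 \<in> SBT D" "sh Q0 = L" "compatible D C Q0"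
    unfolding Q0_def C_def using superstandard_in_SBT[OF L] sh_superstandard[OF L] compatible_superstandard[OF L D] by auto
  have "x_elt D C = (\<Sum>Q'\<in>?A. z_elt D Q')" by (rule x_elt_eq_sum_z_elt[OF sub_compsD[OF C]])
  also have "\<dots> = z_elt D Q0 + (\<Sum>Q'\<in>?A - {Q0}. z_elt D Q')"
    using finite_SBT Q0 by (intro sum.remove) auto
  finally have e: "z_elt D Q0 = x_elt D C - (\<Sum>Q'\<in>?A - {Q0}. z_elt D Q')" by simp
  have "z_elt D Q' \<in> ?M" if "Q' \<in> ?A - {Q0}" for Q'
  proof (rule less.hyps)
    show "Q' \<in> SBT D" using that by blast
    show "total_weight D (sh Q') < total_weight D (sh Q)"
      using compatible_weight[OF L D, of Q'] that unfolding C_def Q0_def L_def by blast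
  qed
  then have "z_elt D Q0 \<in> ?M" unfolding e using C by (intro ZM.span_diff ZM.span_sum) (auto intro: ZM.span_base)
  moreover have "z_elt D Q - z_elt D Q0 \<in> ?M"
  proof (intro ZM.span_base UnI2)
    show "z_elt D Q - z_elt D Q0 \<in> perp_gens D" unfolding perp_gens_def using less.prems Q0(1) Q0(2)[unfolded L_def] by force
  qed
  ultimately have "(z_elt D Q - z_elt D Q0) + z_elt D Q0 \<in> ?M" by (intro ZM.span_add)
  then show ?case by simp
qed

lemma coplactic_decompose:
  assumes D: "0 \<notin> set D" and x: "x \<in> coplactic D"
  shows "\<exists>a\<in>Sigma' D. \<exists>b\<in>coplactic_perp D. x = a + b"
proof -
  have "coplactic D \<subseteq> ZM.span (x_elt D ` sub_comps D \<union> perp_gens D)"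
    unfolding coplactic_def using z_elt_in_span_union[OF D] by (intro ZM.span_minimal ZM.subspace_span) auto
  then show ?thesis using x unfolding ZM.span_Un Sigma'_def coplactic_perp_def perp_gens_def by blast
qed

lemma QSigma'_subset_span_z: "QSigma' D \<subseteq> QM.span (z_elt D ` SBT D)"
  unfolding QSigma'_def
proof (intro QM.span_minimal QM.subspace_span image_subsetI)
  fix C assume C: "C \<in> sub_comps D"
  show "x_elt D C \<in> QM.span (z_elt D ` SBT D)"
    unfolding x_elt_eq_sum_z_elt[OF sub_compsD[OF C]] by (intro QM.span_sum QM.span_base) simp
qed

lemma coplactic_subset_span_z: "coplactic D \<subseteq> QM.span (z_elt D ` SBT D)"
  unfolding coplactic_def by (rule ZM_span_subset_QM_span)

text \<open>The form on \<open>z_elt\<close> depends on shapes only.\<close>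

lemma tau_form_perp:
  assumes b: "b \<in> coplactic_perp D" and y: "y \<in> QM.span (z_elt D ` SBT D)"
  shows "tau_form D b y = 0"
proof -
  obtain m where m: "y = (\<Sum>Q\<in>SBT D. qscale (m Q) (z_elt D Q))"
    using QM.span_image_expand[OF finite_SBT y] by blast
  have "ZM.subspace {b. tau_form D b y = 0}"
    unfolding ZM.subspace_def using tau_form_sum_left[of D "\<lambda>_. of_int _" "\<lambda>x. x" "{_}" y]
    by (auto simp: tau_form_add_left zscale_eq_qscale)
  moreover have "{z_elt D T - z_elt D T' | T T'. T \<in> SBT D \<and> T' \<in> SBT D \<and> sh T = sh T'} \<subseteq> {b. tau_form D b y = 0}"
    by (auto simp: tau_form_diff_left m tau_form_sum_right tau_form_z_elt)
  ultimately show ?thesis using b ZM.span_minimal unfolding coplactic_perp_def by blast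
qed

text \<open>
  Pairing with a tableau of shape \<open>L\<close> gives the sum of the coefficients of \<open>x\<close> over the shape \<open>L\<close>. If all these
  vanish, \<open>x\<close> is a combination of differences to the superstandard tableaux.
\<close>

lemma tau_form_radical:
  assumes x: "x \<in> coplactic D" and r: "\<And>y. y \<in> coplactic D \<Longrightarrow> tau_form D x y = 0"
  shows "x \<in> coplactic_perp D"
proof -
  obtain m where m: "x = (\<Sum>Q\<in>SBT D. zscale (m Q) (z_elt D Q))"
    using ZM.span_image_expand[OF finite_SBT x[unfolded coplactic_def]] by blast
  let ?S = "\<lambda>Q. superstandard D (sh Q)"
  have S: "?S Q \<in> SBT D" "sh (?S Q) = sh Q" if "Q \<in> SBT D" for Q
    using superstandard_in_SBT sh_superstandard sh_in_Bip[OF that] by auto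
  have zero: "(\<Sum>Q | Q \<in> SBT D \<and> sh Q = L. m Q) = 0" if L: "L \<in> Bip D" for L
  proof -
    let ?y = "z_elt D (superstandard D L)"
    have "?y \<in> coplactic D" using z_elt_in_span superstandard_in_SBT[OF L] unfolding coplactic_def by blast
    then have "0 = tau_form D x ?y" using r by simp
    also have "\<dots> = (\<Sum>Q\<in>SBT D. of_int (m Q) * tau_form D (z_elt D Q) ?y)"
      unfolding m zscale_eq_qscale by (rule tau_form_sum_left)
    also have "\<dots> = (\<Sum>Q\<in>SBT D. if sh Q = L then of_int (m Q) else 0)"
      using superstandard_in_SBT[OF L] sh_superstandard[OF L] by (intro sum.cong refl) (simp add: tau_form_z_elt)
    also have "\<dots> = of_int (\<Sum>Q | Q \<in> SBT D \<and> sh Q = L. m Q)"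
      using finite_SBT by (simp flip: sum.inter_filter)
    finally have "of_int (\<Sum>Q | Q \<in> SBT D \<and> sh Q = L. m Q) = (0 :: rat)" by (rule sym)
    then show ?thesis by (simp only: of_int_eq_0_iff)
  qed
  have "(\<Sum>Q\<in>SBT D. zscale (m Q) (z_elt D (?S Q))) = (\<Sum>L\<in>Bip D. \<Sum>Q | Q \<in> SBT D \<and> sh Q = L. zscale (m Q) (z_elt D (?S Q)))"
    using finite_SBT finite_Bip sh_in_Bip by (intro sum.group[symmetric]) auto
  also have "\<dots> = (\<Sum>L\<in>Bip D. zscale (\<Sum>Q | Q \<in> SBT D \<and> sh Q = L. m Q) (z_elt D (superstandard D L)))"
    by (intro sum.cong refl) (simp add: ZM.scale_sum_left)
  also have "\<dots> = 0" using zero by simp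
  finally have "x = (\<Sum>Q\<in>SBT D. zscale (m Q) (z_elt D Q - z_elt D (?S Q)))"
    unfolding m by (simp add: ZM.scale_right_diff_distrib sum_subtractf)
  moreover have "z_elt D Q - z_elt D (?S Q) \<in> coplactic_perp D" if "Q \<in> SBT D" for Q
    unfolding coplactic_perp_def
    by (intro ZM.span_base CollectI exI[of _ Q] exI[of _ "?S Q"] conjI refl that S[OF that] S(2)[OF that, symmetric])
  ultimately show ?thesis unfolding coplactic_perp_def by (simp add: ZM.span_sum ZM.span_scale)
qed

text \<open>
  Two decompositions differ by an element of the descent algebra in the radical, whose image has scalar product \<open>0\<close> with itself.
\<close>

lemma theta_ext_eq:
  assumes a: "a \<in> Sigma' D" and b: "b \<in> coplactic_perp D"
  shows "theta_ext D (a + b) = theta D a"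
  unfolding theta_ext_def
proof (rule the_equality)
  show "\<exists>a'\<in>Sigma' D. \<exists>b'\<in>coplactic_perp D. a + b = a' + b' \<and> theta D a = theta D a'" using a b by blast
  fix \<phi> assume "\<exists>a'\<in>Sigma' D. \<exists>b'\<in>coplactic_perp D. a + b = a' + b' \<and> \<phi> = theta D a'"
  then obtain a' b' where ab: "a' \<in> Sigma' D" "b' \<in> coplactic_perp D" "a + b = a' + b'" "\<phi> = theta D a'" by blast
  have q: "a \<in> QSigma' D" "a' \<in> QSigma' D" using a ab(1) Sigma'_subset_QSigma' by auto
  then have d: "a' - a \<in> QSigma' D" unfolding QSigma'_def by (intro QM.span_diff)
  have "a' - a = b - b'" using ab(3) by (simp add: algebra_simps)
  then have "a' - a \<in> coplactic_perp D" using b ab(2) unfolding coplactic_perp_def by (simp add: ZM.span_diff)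
  then have "tau_form D (a' - a) (a' - a) = 0" using tau_form_perp QSigma'_subset_span_z d by blast
  then have "avg_form (W_group D) (theta D (a' - a)) (theta D (a' - a)) = 0"
    using theta_isometry[OF d d] by simp
  then have "theta D (a' - a) = 0" by (rule avg_form_definite[OF group_W_group finite_W_group theta_in_span[OF d]])
  then show "\<phi> = theta D a" using theta_diff[OF q(2,1)] ab(4) by simp
qed


lemma coplactic_add: "x \<in> coplactic D \<Longrightarrow> y \<in> coplactic D \<Longrightarrow> x + y \<in> coplactic D"
  unfolding coplactic_def by (rule ZM.span_add)

lemma theta_ext_decompose:
  assumes D: "0 \<notin> set D" and x: "x \<in> coplactic D"
  obtains a b where "a \<in> Sigma' D" "b \<in> coplactic_perp D" "x = a + b" "theta_ext D x = theta D a" "a \<in> QSigma' D"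
  using coplactic_decompose[OF assms] theta_ext_eq Sigma'_subset_QSigma' by (metis subsetD)

lemma theta_ext_Sigma':
  assumes "x \<in> Sigma' D" shows "theta_ext D x = theta D x"
  using theta_ext_eq[OF assms, of 0] unfolding coplactic_perp_def by (simp add: ZM.span_zero)

lemma theta_ext_perp:
  assumes "x \<in> coplactic_perp D" shows "theta_ext D x = 0"
proof -
  have z: "(0 :: (int \<Rightarrow> int) \<Rightarrow> rat) \<in> Sigma' D" unfolding Sigma'_def by (rule ZM.span_zero)
  have "theta D (0 - 0) = 0" using z Sigma'_subset_QSigma' theta_diff[of 0 D 0] by auto
  then show ?thesis using theta_ext_eq[OF z assms] by simp
qed

lemma theta_ext_add:
  assumes D: "0 \<notin> set D" and x: "x \<in> coplactic D" and y: "y \<in> coplactic D"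
  shows "theta_ext D (x + y) = theta_ext D x + theta_ext D y"
proof -
  obtain a b where ab: "a \<in> Sigma' D" "b \<in> coplactic_perp D" "x = a + b" "theta_ext D x = theta D a" "a \<in> QSigma' D"
    by (rule theta_ext_decompose[OF D x])
  obtain c d where cd: "c \<in> Sigma' D" "d \<in> coplactic_perp D" "y = c + d" "theta_ext D y = theta D c" "c \<in> QSigma' D"
    by (rule theta_ext_decompose[OF D y])
  have e: "x + y = (a + c) + (b + d)" unfolding ab(3) cd(3) by (simp add: algebra_simps)
  have "a + c \<in> Sigma' D" "b + d \<in> coplactic_perp D"
    using ab(1,2) cd(1,2) unfolding Sigma'_def coplactic_perp_def by (auto intro: ZM.span_add)
  then have "theta_ext D (x + y) = theta D (a + c)" unfolding e by (rule theta_ext_eq)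
  then show ?thesis using theta_add[OF ab(5) cd(5)] ab(4) cd(4) by simp
qed

lemma tau_form_coplactic_QSigma':
  assumes D: "0 \<notin> set D" and x: "x \<in> coplactic D" and y: "y \<in> QSigma' D"
  shows "of_rat (tau_form D x y) = avg_form (W_group D) (theta_ext D x) (theta D y)"
proof -
  obtain a b where ab: "a \<in> Sigma' D" "b \<in> coplactic_perp D" "x = a + b" "theta_ext D x = theta D a" "a \<in> QSigma' D"
    by (rule theta_ext_decompose[OF D x])
  have "tau_form D b y = 0" using tau_form_perp[OF ab(2)] QSigma'_subset_span_z y by blast
  then have "tau_form D x y = tau_form D a y" unfolding ab(3) tau_form_add_left by simp
  then show ?thesis using theta_isometry[OF ab(5) y] ab(4) by simp
qed

lemma tau_form_coplactic:
  assumes D: "0 \<notin> set D" and x: "x \<in> coplactic D" and y: "y \<in> coplactic D"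
  shows "of_rat (tau_form D x y) = avg_form (W_group D) (theta_ext D x) (theta_ext D y)"
proof -
  obtain c d where cd: "c \<in> Sigma' D" "d \<in> coplactic_perp D" "y = c + d" "theta_ext D y = theta D c" "c \<in> QSigma' D"
    by (rule theta_ext_decompose[OF D y])
  have "tau_form D d x = 0" using tau_form_perp[OF cd(2)] coplactic_subset_span_z x by blast
  then have "tau_form D x y = tau_form D x c" unfolding cd(3) tau_form_add_right by (simp add: tau_form_commute[of D x d])
  then show ?thesis using tau_form_coplactic_QSigma'[OF D x cd(5)] cd(4) by simp
qed

lemma theta_ext_in_span:
  assumes D: "0 \<notin> set D" and x: "x \<in> coplactic D"
  shows "theta_ext D x \<in> QM.span (irr_chars (W_group D))"
  by (rule theta_ext_decompose[OF D x]) (simp add: theta_in_span)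

lemma theta_ext_kernel:
  assumes D: "0 \<notin> set D"
  shows "{x \<in> coplactic D. theta_ext D x = 0} = coplactic_perp D"
proof (intro equalityI subsetI)
  fix x assume x: "x \<in> {x \<in> coplactic D. theta_ext D x = 0}"
  show "x \<in> coplactic_perp D"
  proof (rule tau_form_radical)
    show "tau_form D x y = 0" if "y \<in> coplactic D" for y
      using tau_form_coplactic[OF D _ that, of x] x by (simp add: avg_form_def)
  qed (use x in simp)
qed (use coplactic_perp_subset_coplactic theta_ext_perp in auto)

lemma tau_eq_char_inner:
  assumes D: "0 \<notin> set D" and x: "x \<in> coplactic D" and y: "y \<in> coplactic D"
  shows "tau (alg_mult D x y) = char_inner (W_group D) (theta_ext D x) (theta_ext D y)"
proof -
  have "of_rat (tau (alg_mult D x y)) = (of_rat (char_inner (W_group D) (theta_ext D x) (theta_ext D y)) :: complex)"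
    unfolding tau_alg_mult tau_form_coplactic[OF assms]
    by (rule char_inner_eq_avg_form[OF group_W_group finite_W_group theta_ext_in_span[OF D x] theta_ext_in_span[OF D y], symmetric])
  then show ?thesis by simp
qed

text \<open>
  The augmentation is the pairing with the sum of all elements of \<open>W D\<close>, which is the sum of all \<open>z_elt D Q\<close>.
\<close>

lemma aug_perp:
  assumes "b \<in> coplactic_perp D" shows "aug D b = 0"
proof -
  have "aug D b = tau_form D b (\<Sum>Q\<in>SBT D. z_elt D Q)"
    unfolding aug_def tau_form_def
  proof (intro sum.cong refl)
    fix u assume u: "u \<in> W D"
    have "(\<Sum>Q\<in>SBT D. z_elt D Q) (perm_inv u) = (\<Sum>Q\<in>SBT D. if Q = rs_Q D (perm_inv u) then 1 else 0)"
      unfolding sum_fun_apply z_elt_def using W_inv[OF u] by (intro sum.cong refl) (auto simp: indicator_def)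
    also have "\<dots> = 1" using finite_SBT rs_Q_in_SBT[OF W_inv[OF u]] by simp
    finally show "b u = b u * (\<Sum>Q\<in>SBT D. z_elt D Q) (perm_inv u)" by simp
  qed
  also have "\<dots> = 0" by (intro tau_form_perp[OF assms] QM.span_sum QM.span_base) simp
  finally show ?thesis .
qed

lemma char_deg_theta_ext:
  assumes D: "0 \<notin> set D" and x: "x \<in> coplactic D"
  shows "char_deg (W_group D) (theta_ext D x) = of_rat (aug D x)"
proof -
  obtain a b where ab: "a \<in> Sigma' D" "b \<in> coplactic_perp D" "x = a + b" "theta_ext D x = theta D a" "a \<in> QSigma' D"
    by (rule theta_ext_decompose[OF D x])
  have "aug D x = aug D a + aug D b" unfolding ab(3) by (simp add: aug_def sum.distrib)
  then have "aug D x = aug D a" using aug_perp[OF ab(2)] by simp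
  then show ?thesis
    using char_deg_eq_value_at_one[OF group_W_group finite_W_group theta_ext_in_span[OF D x]] theta_id[OF ab(5)] ab(4) by simp
qed

section \<open>Expansion in characteristic functions of classes\<close>

text \<open>The generators are finitely many, so they can be multiplied in some order.\<close>

lemma conj_class_nonempty: "conj_class D L \<noteq> {}"
proof -
  have "finite (S_gens (hat D L))"
  proof -
    have "S_gens (hat D L) \<subseteq> s_gen ` (\<Union>i<length (hat D L). block_pos (hat D L) i)
        \<union> (\<lambda>j. t_gen (Min (block_pos (hat D L) j))) ` {..<length (hat D L)}"
      unfolding S_gens_def by blast
    then show ?thesis by (rule finite_subset) simp
  qed
  then obtain us where "set us = S_gens (hat D L)" "distinct us" using finite_distinct_list by blast
  then have "coxeter_element (hat D L) (word_prod us)" unfolding coxeter_element_def by blast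
  then show ?thesis using W_id unfolding conj_class_def by blast
qed

text \<open>Conjugates of \<open>g\<close> lie in \<open>W C\<close> if and only if their inverses do.\<close>

lemma theta_symmetric:
  assumes x: "x \<in> QSigma' D"
  shows "g \<in> W D \<Longrightarrow> theta D x (perm_inv g) = theta D x g" "g \<notin> W D \<Longrightarrow> theta D x g = 0"
proof -
  obtain a where a: "x = x_comb D a" using QSigma'_expand[OF x] by blast
  have e: "theta D x g = (\<Sum>C\<in>sub_comps D. of_rat (a C) * ind_triv D C g)" for g
    unfolding a theta_x_comb ind_comb_def sum_fun_apply qscale_def ..
  show "theta D x g = 0" if "g \<notin> W D" unfolding e ind_triv_def induced_def using that by simp
  show "theta D x (perm_inv g) = theta D x g" if g: "g \<in> W D"
  proof -
    have "ind_triv D C (perm_inv g) = ind_triv D C g" for C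
    proof -
      have "inv\<^bsub>W_group D\<^esub> y \<circ> perm_inv g \<circ> y = perm_inv (inv\<^bsub>W_group D\<^esub> y \<circ> g \<circ> y)" if y: "y \<in> W D" for y
      proof -
        interpret group "W_group D" by (rule group_W_group)
        have c: "y \<in> carrier (W_group D)" "g \<in> carrier (W_group D)" using y g by auto
        have "inv\<^bsub>W_group D\<^esub> (inv\<^bsub>W_group D\<^esub> y \<otimes>\<^bsub>W_group D\<^esub> g \<otimes>\<^bsub>W_group D\<^esub> y) = inv\<^bsub>W_group D\<^esub> y \<otimes>\<^bsub>W_group D\<^esub> inv\<^bsub>W_group D\<^esub> g \<otimes>\<^bsub>W_group D\<^esub> y"
          using c by (simp only: inv_mult_group inv_closed m_closed inv_inv m_assoc)
        moreover have "inv\<^bsub>W_group D\<^esub> y \<circ> g \<circ> y \<in> W D" using W_comp g y W_group_inv[OF y] W_inv[OF y] by simp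
        ultimately show ?thesis using W_group_inv g by (metis W_group_simps(2))
      qed
      then have "{y \<in> W D. inv\<^bsub>W_group D\<^esub> y \<circ> perm_inv g \<circ> y \<in> W C} = {y \<in> W D. inv\<^bsub>W_group D\<^esub> y \<circ> g \<circ> y \<in> W C}"
      proof (intro Collect_cong conj_cong refl)
        fix y assume y: "y \<in> W D" and h: "\<And>y. y \<in> W D \<Longrightarrow> inv\<^bsub>W_group D\<^esub> y \<circ> perm_inv g \<circ> y = perm_inv (inv\<^bsub>W_group D\<^esub> y \<circ> g \<circ> y)"
        have m: "inv\<^bsub>W_group D\<^esub> y \<circ> g \<circ> y \<in> W D" using W_comp g y W_group_inv[OF y] W_inv[OF y] by simp
        have "perm_inv v \<in> W C \<longleftrightarrow> v \<in> W C" if "v \<in> W D" for v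
          using W_inv[of v C] W_inv[of "perm_inv v" C] hyperoct_inv_simps(5)[OF W_hyperoct[OF that]] by auto
        then show "(inv\<^bsub>W_group D\<^esub> y \<circ> perm_inv g \<circ> y \<in> W C) = (inv\<^bsub>W_group D\<^esub> y \<circ> g \<circ> y \<in> W C)"
          unfolding h[OF y] using m by blast
      qed
      then show ?thesis unfolding ind_triv_def induced_def W_group_simps using g W_inv[OF g] by simp
    qed
    then show ?thesis unfolding e by simp
  qed
qed

text \<open>
  \<open>class_fun D L\<close> takes the same value at \<open>g\<close> and \<open>g\<inverse>\<close>, because it is in the image of \<open>theta\<close>. For the same reason
  it vanishes outside \<open>W D\<close>, so that the class is finite.
\<close>

lemma avg_form_class_fun:
  assumes E: "E \<in> QSigma' D" "theta D E = class_fun D L"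
  shows "avg_form (W_group D) (class_fun D L) (class_fun D L) = of_nat (card (conj_class D L)) / of_nat (card (W D))"
    "card (conj_class D L) \<noteq> 0"
proof -
  note s = theta_symmetric[OF E(1), unfolded E(2)]
  have sub: "conj_class D L \<subseteq> W D"
  proof
    fix g assume "g \<in> conj_class D L"
    then have "class_fun D L g \<noteq> 0" by (simp add: class_fun_def)
    then show "g \<in> W D" using s(2) by blast
  qed
  have "(\<Sum>g\<in>W D. class_fun D L g * class_fun D L (inv\<^bsub>W_group D\<^esub> g)) = (\<Sum>g\<in>W D. indicator (conj_class D L) g)"
  proof (intro sum.cong refl)
    fix g assume g: "g \<in> W D"
    show "class_fun D L g * class_fun D L (inv\<^bsub>W_group D\<^esub> g) = indicator (conj_class D L) g"
      unfolding W_group_inv[OF g] s(1)[OF g] by (simp add: class_fun_def indicator_def)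
  qed
  also have "\<dots> = of_nat (card (W D \<inter> conj_class D L))" by (rule sum_indicator_card[OF finite_W])
  also have "W D \<inter> conj_class D L = conj_class D L" using sub by blast
  finally show "avg_form (W_group D) (class_fun D L) (class_fun D L) = of_nat (card (conj_class D L)) / of_nat (card (W D))"
    unfolding avg_form_def carrier_W_group by simp
  show "card (conj_class D L) \<noteq> 0" using conj_class_nonempty finite_subset[OF sub finite_W] by simp
qed

text \<open>\<open>theta_ext D (z_elt D Q)\<close> depends only on the shape of \<open>Q\<close>.\<close>

lemma theta_ext_image_span:
  assumes D: "0 \<notin> set D" and x: "x \<in> coplactic D"
  shows "theta_ext D x \<in> QM.span ((\<lambda>L. theta_ext D (z_elt D (superstandard D L))) ` Bip D)"
proof -
  let ?V = "QM.span ((\<lambda>L. theta_ext D (z_elt D (superstandard D L))) ` Bip D)"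
  have cop: "z_elt D Q \<in> coplactic D" if "Q \<in> SBT D" for Q using z_elt_in_span[OF that] unfolding coplactic_def .
  have scale: "theta_ext D (zscale c y) = zscale c (theta_ext D y)" if y: "y \<in> coplactic D" for c y
  proof -
    obtain a b where ab: "a \<in> Sigma' D" "b \<in> coplactic_perp D" "y = a + b" "theta_ext D y = theta D a" "a \<in> QSigma' D"
      by (rule theta_ext_decompose[OF D y])
    obtain r where r: "a = x_comb D r" using QSigma'_expand[OF ab(5)] by blast
    have "zscale c a = x_comb D (\<lambda>C. of_int c * r C)"
      unfolding r x_comb_def zscale_eq_qscale QM.scale_sum_right QM.scale_scale ..
    then have "theta D (zscale c a) = zscale c (theta D a)"
      unfolding r theta_x_comb by (simp add: theta_x_comb ind_comb_def zscale_eq_qscale QM.scale_sum_right)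
    moreover have "theta_ext D (zscale c a + zscale c b) = theta D (zscale c a)"
      using ab(1,2) unfolding Sigma'_def coplactic_perp_def
      by (intro theta_ext_eq) (simp_all add: Sigma'_def coplactic_perp_def ZM.span_scale)
    ultimately show ?thesis unfolding ab(3) using ab(3,4) by (simp add: ZM.scale_right_distrib)
  qed
  have "ZM.subspace {y \<in> coplactic D. theta_ext D y \<in> ?V}"
    unfolding ZM.subspace_def
  proof (intro conjI ballI allI)
    show "0 \<in> {y \<in> coplactic D. theta_ext D y \<in> ?V}"
      using theta_ext_perp[of 0 D] by (simp add: coplactic_def coplactic_perp_def ZM.span_zero QM.span_zero)
    fix y assume y: "y \<in> {y \<in> coplactic D. theta_ext D y \<in> ?V}"
    show "y + y' \<in> {y \<in> coplactic D. theta_ext D y \<in> ?V}" if "y' \<in> {y \<in> coplactic D. theta_ext D y \<in> ?V}" for y'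
      using y that by (simp add: theta_ext_add[OF D] coplactic_add QM.span_add)
    show "zscale c y \<in> {y \<in> coplactic D. theta_ext D y \<in> ?V}" for c
      using y scale[of y c] by (simp add: zscale_eq_qscale QM.span_scale)
        (metis ZM.span_scale coplactic_def zscale_eq_qscale)
  qed
  moreover have "z_elt D ` SBT D \<subseteq> {y \<in> coplactic D. theta_ext D y \<in> ?V}"
  proof (intro image_subsetI CollectI conjI cop)
    fix Q assume Q: "Q \<in> SBT D"
    let ?S = "superstandard D (sh Q)"
    have S: "?S \<in> SBT D" "sh ?S = sh Q" using superstandard_in_SBT sh_superstandard sh_in_Bip[OF Q] by auto
    have p: "z_elt D Q - z_elt D ?S \<in> coplactic_perp D" unfolding coplactic_perp_def
      by (intro ZM.span_base CollectI exI[of _ Q] exI[of _ ?S] conjI refl Q S S(2)[symmetric])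
    have "theta_ext D (z_elt D ?S + (z_elt D Q - z_elt D ?S)) = theta_ext D (z_elt D ?S) + theta_ext D (z_elt D Q - z_elt D ?S)"
      using p coplactic_perp_subset_coplactic by (intro theta_ext_add[OF D] cop S(1)) blast
    then have "theta_ext D (z_elt D Q) = theta_ext D (z_elt D ?S)" using theta_ext_perp[OF p] by simp
    then show "theta_ext D (z_elt D Q) \<in> ?V" using sh_in_Bip[OF Q] by (simp add: QM.span_base)
  qed
  ultimately have "ZM.span (z_elt D ` SBT D) \<subseteq> {y \<in> coplactic D. theta_ext D y \<in> ?V}"
    by (rule ZM.span_minimal[rotated])
  then show ?thesis using x[unfolded coplactic_def] by blast
qed


lemma theta_x_elt:
  assumes C: "C \<in> sub_comps D" shows "theta D (x_elt D C) = ind_triv D C"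
proof -
  have d: "(\<Sum>C'\<in>sub_comps D. qscale (if C' = C then 1 else 0) (g C')) = g C" for g :: "int list \<Rightarrow> 'z \<Rightarrow> 'b::field_char_0"
  proof -
    have "(\<Sum>C'\<in>sub_comps D. qscale (if C' = C then 1 else 0) (g C')) = (\<Sum>C'\<in>sub_comps D. if C' = C then g C' else 0)"
      by (intro sum.cong) auto
    then show ?thesis using finite_sub_comps C by simp
  qed
  show ?thesis using theta_x_comb[of D "\<lambda>C'. if C' = C then 1 else 0"] unfolding x_comb_def ind_comb_def d .
qed

text \<open>
  The functions \<open>class_fun D L\<close> are linearly independent by orthogonality. If \<open>theta_ext D x\<close> were not in their span,
  there would be more independent elements than shapes in a space spanned by one element for each shape.
\<close>

lemma class_fun_expansion:
  assumes D: "0 \<notin> set D" and E: "idempotent_family D E" and x: "x \<in> coplactic D"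
  shows "theta_ext D x = (\<lambda>g. of_nat (card (W D)) * (\<Sum>L\<in>Bip D.
    of_rat (tau (alg_mult D x (E L))) / of_nat (card (conj_class D L)) * class_fun D L g))"
proof -
  let ?G = "W_group D" and ?f = "class_fun D" and ?z = "\<lambda>L. theta_ext D (z_elt D (superstandard D L))"
  have EL: "E L \<in> QSigma' D" "theta D (E L) = ?f L" if "L \<in> Bip D" for L
    using E that unfolding idempotent_family_def by blast+
  have orth: "avg_form ?G (?f L) (?f M) = (if L = M then of_nat (card (conj_class D L)) / of_nat (card (W D)) else 0)"
    if L: "L \<in> Bip D" and M: "M \<in> Bip D" for L M
  proof (cases "L = M")
    case False
    have "alg_mult D (E L) (E M) = 0" using E L M False unfolding idempotent_family_def by blast
    then have "tau_form D (E L) (E M) = 0" unfolding tau_alg_mult[symmetric] by (simp add: tau_def)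
    then show ?thesis using theta_isometry[OF EL(1)[OF L] EL(1)[OF M]] False by (simp add: EL(2) L M)
  qed (use avg_form_class_fun(1)[OF EL[OF L]] in simp)
  have cW: "card (W D) \<noteq> 0" using finite_W W_id by (auto simp: card_eq_0_iff)
  have nz: "avg_form ?G (?f L) (?f L) \<noteq> 0" if L: "L \<in> Bip D" for L
    using orth[OF L L] avg_form_class_fun(2)[OF EL[OF L]] cW by simp
  have inj: "inj_on ?f (Bip D)"
  proof (rule inj_onI)
    fix L M assume LM: "L \<in> Bip D" "M \<in> Bip D" "?f L = ?f M"
    show "L = M" using orth[OF LM(1,2)] nz[OF LM(1)] LM(3) by (auto split: if_splits)
  qed
  have indep: "QM.independent (?f ` Bip D)"
  proof (rule QM.independent_if_scalars_zero)
    fix u y assume u: "(\<Sum>v\<in>?f ` Bip D. qscale (u v) v) = 0" and y: "y \<in> ?f ` Bip D"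
    obtain M where M: "M \<in> Bip D" "y = ?f M" using y by blast
    have "0 = avg_form ?G (\<Sum>L\<in>Bip D. qscale (u (?f L)) (?f L)) (?f M)"
      using u unfolding sum.reindex[OF inj] comp_def by (simp add: avg_form_def)
    also have "\<dots> = (\<Sum>L\<in>Bip D. of_rat (u (?f L)) * avg_form ?G (?f L) (?f M))" by (rule avg_form_sum_left)
    also have "\<dots> = (\<Sum>L\<in>Bip D. if L = M then of_rat (u (?f M)) * avg_form ?G (?f M) (?f M) else 0)"
      using orth M(1) by (intro sum.cong refl) auto
    also have "\<dots> = of_rat (u (?f M)) * avg_form ?G (?f M) (?f M)" using finite_Bip M(1) by simp
    finally show "u y = 0" using nz[OF M(1)] M(2) by simp
  qed (use finite_Bip in simp)
  have ind_V: "ind_triv D C \<in> QM.span (?z ` Bip D)" if C: "C \<in> sub_comps D" for C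
  proof -
    have "x_elt D C \<in> Sigma' D" unfolding Sigma'_def using C by (intro ZM.span_base) simp
    then have "theta_ext D (x_elt D C) = ind_triv D C" "x_elt D C \<in> coplactic D"
      using theta_ext_Sigma' theta_x_elt[OF C] Sigma'_subset_coplactic by auto
    then show ?thesis using theta_ext_image_span[OF D] by metis
  qed
  have sub: "?f ` Bip D \<subseteq> QM.span (?z ` Bip D)"
  proof (rule image_subsetI)
    fix L assume L: "L \<in> Bip D"
    obtain a where "E L = x_comb D a" using QSigma'_expand[OF EL(1)[OF L]] by blast
    then have "?f L = ind_comb D a" using EL(2)[OF L] theta_x_comb by metis
    then show "?f L \<in> QM.span (?z ` Bip D)"
      unfolding ind_comb_def using ind_V by (simp add: QM.span_sum QM.span_scale)
  qed
  have "theta_ext D x \<in> QM.span (?f ` Bip D)"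
  proof (rule ccontr)
    assume out: "theta_ext D x \<notin> QM.span (?f ` Bip D)"
    have "QM.independent (insert (theta_ext D x) (?f ` Bip D))" by (rule QM.independent_insertI[OF out indep])
    moreover have "insert (theta_ext D x) (?f ` Bip D) \<subseteq> QM.span (?z ` Bip D)"
      using sub theta_ext_image_span[OF D x] by simp
    ultimately have "card (insert (theta_ext D x) (?f ` Bip D)) \<le> card (?z ` Bip D)"
      using QM.independent_span_bound[OF finite_imageI[OF finite_Bip]] by blast
    moreover have "theta_ext D x \<notin> ?f ` Bip D" using out QM.span_base by blast
    ultimately have "Suc (card (Bip D)) \<le> card (?z ` Bip D)" using finite_Bip by (simp add: card_image[OF inj])
    then show False using card_image_le[OF finite_Bip, of ?z D] by simp
  qed
  then obtain c where c: "theta_ext D x = (\<Sum>L\<in>Bip D. qscale (c L) (?f L))"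
    using QM.span_image_expand[OF finite_Bip] by blast
  have coeff: "of_rat (c M) = (of_nat (card (W D)) * (of_rat (tau (alg_mult D x (E M))) / of_nat (card (conj_class D M))) :: complex)"
    if M: "M \<in> Bip D" for M
  proof -
    have "of_rat (tau (alg_mult D x (E M))) = avg_form ?G (theta_ext D x) (?f M)"
      unfolding tau_alg_mult using tau_form_coplactic_QSigma'[OF D x EL(1)[OF M]] EL(2)[OF M] by simp
    also have "\<dots> = (\<Sum>L\<in>Bip D. of_rat (c L) * avg_form ?G (?f L) (?f M))"
      unfolding c by (rule avg_form_sum_left)
    also have "\<dots> = (\<Sum>L\<in>Bip D. if L = M then of_rat (c M) * avg_form ?G (?f M) (?f M) else 0)"
      using orth M by (intro sum.cong refl) auto
    also have "\<dots> = of_rat (c M) * avg_form ?G (?f M) (?f M)" using finite_Bip M by simp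
    also have "\<dots> = of_rat (c M) * (of_nat (card (conj_class D M)) / of_nat (card (W D)))"
      using orth[OF M M] by simp
    finally show ?thesis using cW avg_form_class_fun(2)[OF EL[OF M]] by (simp add: field_simps)
  qed
  show ?thesis
  proof
    fix g
    have "theta_ext D x g = (\<Sum>L\<in>Bip D. of_rat (c L) * ?f L g)" unfolding c sum_fun_apply qscale_def ..
    also have "\<dots> = (\<Sum>L\<in>Bip D. of_nat (card (W D)) * (of_rat (tau (alg_mult D x (E L))) / of_nat (card (conj_class D L)) * ?f L g))"
      by (intro sum.cong refl) (simp only: coeff mult.assoc)
    also have "\<dots> = of_nat (card (W D)) * (\<Sum>L\<in>Bip D. of_rat (tau (alg_mult D x (E L))) / of_nat (card (conj_class D L)) * ?f L g)"
      by (rule sum_distrib_left[symmetric])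
    finally show "theta_ext D x g = of_nat (card (W D)) * (\<Sum>L\<in>Bip D. of_rat (tau (alg_mult D x (E L))) / of_nat (card (conj_class D L)) * ?f L g)" .
  qed
qed

theorem theorem4p14:
  fixes n :: nat and D :: "int list"
  assumes "signed_composition n D"
  shows
    "(Sigma' D \<subseteq> coplactic D
      \<and> theta_ext D ` coplactic D \<subseteq> virtual_chars (W_group D)
      \<and> (\<forall>x\<in>coplactic D. \<forall>y\<in>coplactic D. theta_ext D (x + y) = theta_ext D x + theta_ext D y)
      \<and> (\<forall>x\<in>Sigma' D. theta_ext D x = theta D x))
   \<and> {x \<in> coplactic D. theta_ext D x = 0} = coplactic_perp D
   \<and> (\<forall>x\<in>coplactic D. \<forall>y\<in>coplactic D.
        tau (alg_mult D x y) = char_inner (W_group D) (theta_ext D x) (theta_ext D y))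
   \<and> (\<forall>x\<in>coplactic D. char_deg (W_group D) (theta_ext D x) = of_rat (aug D x))
   \<and> (\<forall>E. idempotent_family D E \<longrightarrow> (\<forall>x\<in>coplactic D.
        theta_ext D x = (\<lambda>g. of_nat (card (W D)) * (\<Sum>L\<in>Bip D.
          of_rat (tau (alg_mult D x (E L))) / of_nat (card (conj_class D L)) * class_fun D L g))))"
proof -
  have D: "0 \<notin> set D" using assms by (simp add: signed_composition_def)
  have virt: "theta_ext D ` coplactic D \<subseteq> virtual_chars (W_group D)"
  proof (rule image_subsetI)
    fix x assume "x \<in> coplactic D"
    then show "theta_ext D x \<in> virtual_chars (W_group D)"
      by (rule theta_ext_decompose[OF D]) (simp add: theta_virtual)
  qed
  show ?thesis
    by (intro conjI ballI allI impI Sigma'_subset_coplactic virt theta_ext_add[OF D] theta_ext_Sigma' theta_ext_kernel[OF D]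
      tau_eq_char_inner[OF D] char_deg_theta_ext[OF D] class_fun_expansion[OF D])
qed

end
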